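(* Let $\Lambda$ be an artin algebra, $e\in\Lambda$ an idempotent, $P=\Lambda e$, $\Gamma=\mathrm{End}_\Lambda(P)^{op}$, and let $\mathbb{P}_\infty$ be the full subcategory of $\mathrm{mod}\,\Lambda$ of modules having a projective resolution all of whose terms lie in $\mathrm{add}\,P$. For every $\Lambda$-module $Y\in\mathbb{P}_\infty$: (a) for $d\in\mathbb{N}$, there exists a $d$-division of $Y$ (in $\mathrm{mod}\,\Lambda$) if and only if there exists a $d$-division of $\mathrm{Hom}_\Lambda(P,Y)$ (in $\mathrm{mod}\,\Gamma$); (b) $\phi_l^\Lambda(Y)=\phi_l^\Gamma(\mathrm{Hom}_\Lambda(P,Y))$; (c) $\psi_l^\Lambda(Y)=\psi_l^\Gamma(\mathrm{Hom}_\Lambda(P,Y))$.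
   Context: $\mathrm{mod}\,\Lambda$ is the category of finitely generated left $\Lambda$-modules; $\mathrm{add}\,X$ is the full subcategory of summands of finite direct sums of $X$. $d$-division: a pair $(X,Z)$ of objects in $\mathrm{add}\,M$ is a $d$-division of $M\in\mathrm{mod}\,\Lambda$ if $\mathrm{add}(X)\cap\mathrm{add}(Z)=0$, $\mathrm{Ext}^d_\Lambda(X,-)\not\simeq\mathrm{Ext}^d_\Lambda(Z,-)$ as functors on $\mathrm{mod}\,\Lambda$, and $\mathrm{Ext}^{d+1}_\Lambda(X,-)\simeq\mathrm{Ext}^{d+1}_\Lambda(Z,-)$ as functors on $\mathrm{mod}\,\Lambda$. The same definition is used over $\Gamma$. Igusa-Todorov functions: let $K_0$ be the abelian group generated by symbols $[M]$, $M\in\mathrm{mod}\,\Lambda$, modulo $[C]=[A]+[B]$ if $C\simeq A\oplus B$ and $[Q]=0$ if $Q$ is projective; let $\Omega:K_0\to K_0$, $\Omega([M])=[\Omega(M)]$, be induced by the syzygy; let $\langle \mathrm{add}\,M\rangle$ be the subgroup generated by the indecomposable summands of $M$. Then $\phi_l^\Lambda(M)$ is the smallest non-negative integer $n$ such that $\Omega:\Omega^s(\langle\mathrm{add}\,M\rangle)\to\Omega^{s+1}(\langle\mathrm{add}\,M\rangle)$ is an isomorphism for all $s\ge n$, and $\psi_l^\Lambda(M)=\phi_l^\Lambda(M)+\sup\{\mathrm{pd}\,X: X$ a direct summand of $\Omega^{\phi_l^\Lambda(M)}(M)$ with $\mathrm{pd}\,X<\infty\}$ (with $\mathrm{pd}\,0=0$).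 Similarly for $\Gamma$. *)

theory Defs
  imports "HOL-Algebra.Ideal" "HOL-Algebra.Module" "HOL-Algebra.Free_Abelian_Groups"
    "HOL-Library.Extended_Nat"
begin

section \<open>Left modules over a ring\<close>

text \<open>
  The library's \<^locale>\<open>Module.module\<close> requires commutative scalars. The record type is reused;
  its ring multiplication and unit play no role for a module.
\<close>

locale left_module = R?: ring R + M?: abelian_group M
  for R :: "('a, 'r) ring_scheme" (structure) and M :: "('a, 'm, 'x) module_scheme" (structure) +
  assumes smult_closed [simp, intro]:
      "\<lbrakk>a \<in> carrier R; x \<in> carrier M\<rbrakk> \<Longrightarrow> a \<odot>\<^bsub>M\<^esub> x \<in> carrier M"
    and smult_l_distr:
      "\<lbrakk>a \<in> carrier R; b \<in> carrier R; x \<in> carrier M\<rbrakk>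
        \<Longrightarrow> (a \<oplus> b) \<odot>\<^bsub>M\<^esub> x = a \<odot>\<^bsub>M\<^esub> x \<oplus>\<^bsub>M\<^esub> b \<odot>\<^bsub>M\<^esub> x"
    and smult_r_distr:
      "\<lbrakk>a \<in> carrier R; x \<in> carrier M; y \<in> carrier M\<rbrakk>
        \<Longrightarrow> a \<odot>\<^bsub>M\<^esub> (x \<oplus>\<^bsub>M\<^esub> y) = a \<odot>\<^bsub>M\<^esub> x \<oplus>\<^bsub>M\<^esub> a \<odot>\<^bsub>M\<^esub> y"
    and smult_assoc1:
      "\<lbrakk>a \<in> carrier R; b \<in> carrier R; x \<in> carrier M\<rbrakk>
        \<Longrightarrow> (a \<otimes> b) \<odot>\<^bsub>M\<^esub> x = a \<odot>\<^bsub>M\<^esub> (b \<odot>\<^bsub>M\<^esub> x)"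
    and smult_one [simp]: "x \<in> carrier M \<Longrightarrow> \<one> \<odot>\<^bsub>M\<^esub> x = x"

definition mk_module :: "'m set \<Rightarrow> 'm \<Rightarrow> ('m \<Rightarrow> 'm \<Rightarrow> 'm) \<Rightarrow> ('a \<Rightarrow> 'm \<Rightarrow> 'm) \<Rightarrow> ('a, 'm) module"
  where "mk_module C z p s =
    \<lparr>carrier = C, monoid.mult = undefined, monoid.one = undefined, ring.zero = z, ring.add = p, smult = s\<rparr>"

definition submod :: "('a, 'm) module \<Rightarrow> 'm set \<Rightarrow> ('a, 'm) module"
  where "submod M A = M\<lparr>carrier := A\<rparr>"

definition fin_gen :: "('a, 'r) ring_scheme \<Rightarrow> ('a, 'm, 'x) module_scheme \<Rightarrow> bool"
  where "fin_gen R M \<longleftrightarrow>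
    (\<exists>S \<subseteq> carrier M. finite S \<and> (\<forall>N. submodule N R M \<and> S \<subseteq> N \<longrightarrow> N = carrier M))"

text \<open>The objects of mod \<open>R\<close> whose underlying set is a subset of the type \<open>'m\<close>.\<close>

definition fgmod :: "('a, 'r) ring_scheme \<Rightarrow> ('a, 'm) module set"
  where "fgmod R = {M. left_module R M \<and> fin_gen R M}"

text \<open>
  Since types cannot be quantified over, mod \<open>R\<close> is represented by the modules carried by one
  type \<open>'m\<close>, which must be large enough. A finitely generated module is countable or of cardinality
  at most that of \<open>R\<close>, so this condition makes \<open>fgmod R\<close> contain an isomorphic copy of
  every finitely generated \<open>R\<close>-module; see \<open>fgmod_copy\<close> below.
\<close>

definition module_universe :: "('a, 'r) ring_scheme \<Rightarrow> 'm itself \<Rightarrow> bool"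
  where "module_universe R _ \<longleftrightarrow> infinite (UNIV :: 'm set) \<and> carrier R \<lesssim> (UNIV :: 'm set)"

text \<open>Homomorphisms are extensional, so that equality of homomorphisms is equality in HOL.\<close>

definition mod_hom :: "('a, 'r) ring_scheme \<Rightarrow> ('a, 'm) module \<Rightarrow> ('a, 'n) module \<Rightarrow> ('m \<Rightarrow> 'n) set"
  where "mod_hom R M N = {f \<in> carrier M \<rightarrow>\<^sub>E carrier N.
    (\<forall>x\<in>carrier M. \<forall>y\<in>carrier M. f (x \<oplus>\<^bsub>M\<^esub> y) = f x \<oplus>\<^bsub>N\<^esub> f y) \<and>
    (\<forall>a\<in>carrier R. \<forall>x\<in>carrier M. f (a \<odot>\<^bsub>M\<^esub> x) = a \<odot>\<^bsub>N\<^esub> f x)}"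

definition mod_iso :: "('a, 'r) ring_scheme \<Rightarrow> ('a, 'm) module \<Rightarrow> ('a, 'n) module \<Rightarrow> bool"
  where "mod_iso R M N \<longleftrightarrow> (\<exists>f\<in>mod_hom R M N. bij_betw f (carrier M) (carrier N))"

definition zero_module :: "('a, 'm) module \<Rightarrow> bool"
  where "zero_module M \<longleftrightarrow> carrier M = {\<zero>\<^bsub>M\<^esub>}"

definition dsum :: "('a, 'm) module \<Rightarrow> ('a, 'n) module \<Rightarrow> ('a, 'm \<times> 'n) module"
  where "dsum A B = mk_module (carrier A \<times> carrier B) (\<zero>\<^bsub>A\<^esub>, \<zero>\<^bsub>B\<^esub>)
    (\<lambda>x y. (fst x \<oplus>\<^bsub>A\<^esub> fst y, snd x \<oplus>\<^bsub>B\<^esub> snd y))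
    (\<lambda>a x. (a \<odot>\<^bsub>A\<^esub> fst x, a \<odot>\<^bsub>B\<^esub> snd x))"

text \<open>The direct sum of \<open>n\<close> copies of \<open>M\<close>.\<close>

definition copower :: "('a, 'm) module \<Rightarrow> nat \<Rightarrow> ('a, nat \<Rightarrow> 'm) module"
  where "copower M n = mk_module ({..<n} \<rightarrow>\<^sub>E carrier M) (\<lambda>i\<in>{..<n}. \<zero>\<^bsub>M\<^esub>)
    (\<lambda>x y. \<lambda>i\<in>{..<n}. x i \<oplus>\<^bsub>M\<^esub> y i) (\<lambda>a x. \<lambda>i\<in>{..<n}. a \<odot>\<^bsub>M\<^esub> x i)"

definition internal_sum :: "('a, 'r) ring_scheme \<Rightarrow> ('a, 'm) module \<Rightarrow> 'm set \<Rightarrow> 'm set \<Rightarrow> bool"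
  where "internal_sum R M A B \<longleftrightarrow>
    submodule A R M \<and> submodule B R M \<and> A \<inter> B = {\<zero>\<^bsub>M\<^esub>} \<and> A <+>\<^bsub>M\<^esub> B = carrier M"

text \<open>\<open>X\<close> is (isomorphic to) a direct summand of \<open>M\<close>.\<close>

definition summand :: "('a, 'r) ring_scheme \<Rightarrow> ('a, 'm) module \<Rightarrow> ('a, 'n) module \<Rightarrow> bool"
  where "summand R X M \<longleftrightarrow> (\<exists>A B. internal_sum R M A B \<and> mod_iso R X (submod M A))"

definition add_cat :: "('a, 'r) ring_scheme \<Rightarrow> ('a, 'n) module \<Rightarrow> ('a, 'm) module set"
  where "add_cat R M = {X \<in> fgmod R. \<exists>n. summand R X (copower M n)}"

definition indecomposable :: "('a, 'r) ring_scheme \<Rightarrow> ('a, 'm) module \<Rightarrow> bool"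
  where "indecomposable R X \<longleftrightarrow> \<not> zero_module X \<and>
    (\<forall>A B. internal_sum R X A B \<longrightarrow> A = {\<zero>\<^bsub>X\<^esub>} \<or> B = {\<zero>\<^bsub>X\<^esub>})"


section \<open>Projective resolutions, syzygies, projective dimension\<close>

definition projective :: "('a, 'r) ring_scheme \<Rightarrow> ('a, 'm) module \<Rightarrow> bool"
  where "projective R Q \<longleftrightarrow> Q \<in> fgmod R \<and>
    (\<forall>(A :: ('a, 'm) module) \<in> fgmod R. \<forall>(B :: ('a, 'm) module) \<in> fgmod R.
      \<forall>g\<in>mod_hom R A B. \<forall>f\<in>mod_hom R Q B. g ` carrier A = carrier B \<longrightarrow>
        (\<exists>h\<in>mod_hom R Q A. compose (carrier Q) g h = f))"

definition hom_ker :: "('a, 'm) module \<Rightarrow> ('a, 'n) module \<Rightarrow> ('m \<Rightarrow> 'n) \<Rightarrow> 'm set"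
  where "hom_ker M N f = {x \<in> carrier M. f x = \<zero>\<^bsub>N\<^esub>}"

text \<open>\<open>\<dots> \<rightarrow> F 2 \<rightarrow> F 1 \<rightarrow> F 0 \<rightarrow> X \<rightarrow> 0\<close>, with differentials
  \<open>D n : F (n + 1) \<rightarrow> F n\<close> and augmentation \<open>p : F 0 \<rightarrow> X\<close>.\<close>

definition proj_resolution ::
  "('a, 'r) ring_scheme \<Rightarrow> ('a, 'm) module \<Rightarrow> (nat \<Rightarrow> ('a, 'm) module) \<Rightarrow> (nat \<Rightarrow> 'm \<Rightarrow> 'm)
    \<Rightarrow> ('m \<Rightarrow> 'm) \<Rightarrow> bool"
  where "proj_resolution R X F D p \<longleftrightarrow>
    (\<forall>n. projective R (F n)) \<and>
    (\<forall>n. D n \<in> mod_hom R (F (Suc n)) (F n)) \<and>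
    p \<in> mod_hom R (F 0) X \<and>
    p ` carrier (F 0) = carrier X \<and>
    D 0 ` carrier (F 1) = hom_ker (F 0) X p \<and>
    (\<forall>n. D (Suc n) ` carrier (F (Suc (Suc n))) = hom_ker (F (Suc n)) (F n) (D n))"

definition proj_dim :: "('a, 'r) ring_scheme \<Rightarrow> ('a, 'm) module \<Rightarrow> enat"
  where "proj_dim R X =
    Inf {enat n | n. \<exists>F D p. proj_resolution R X F D p \<and> (\<forall>i>n. zero_module (F i))}"

definition proj_cover ::
  "('a, 'r) ring_scheme \<Rightarrow> ('a, 'm) module \<Rightarrow> ('a, 'm) module \<Rightarrow> ('m \<Rightarrow> 'm) \<Rightarrow> bool"
  where "proj_cover R X Q p \<longleftrightarrow> projective R Q \<and> p \<in> mod_hom R Q X \<and> p ` carrier Q = carrier X \<and>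
    (\<forall>L. submodule L R Q \<and> hom_ker Q X p <+>\<^bsub>Q\<^esub> L = carrier Q \<longrightarrow> L = carrier Q)"

definition syzygy :: "('a, 'r) ring_scheme \<Rightarrow> ('a, 'm) module \<Rightarrow> ('a, 'm) module"
  where "syzygy R X = (case SOME (Q, p). proj_cover R X Q p of (Q, p) \<Rightarrow> submod Q (hom_ker Q X p))"


section \<open>The functors Ext and \<open>d\<close>-divisions\<close>

definition hom_group ::
  "('a, 'r) ring_scheme \<Rightarrow> ('a, 'm) module \<Rightarrow> ('a, 'n) module \<Rightarrow> ('m \<Rightarrow> 'n) monoid"
  where "hom_group R M N = \<lparr>carrier = mod_hom R M N,
    monoid.mult = (\<lambda>f g. \<lambda>x\<in>carrier M. f x \<oplus>\<^bsub>N\<^esub> g x), one = (\<lambda>x\<in>carrier M. \<zero>\<^bsub>N\<^esub>)\<rparr>"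

definition some_resolution ::
  "('a, 'r) ring_scheme \<Rightarrow> ('a, 'm) module
    \<Rightarrow> (nat \<Rightarrow> ('a, 'm) module) \<times> (nat \<Rightarrow> 'm \<Rightarrow> 'm) \<times> ('m \<Rightarrow> 'm)"
  where "some_resolution R X = (SOME (F, D, p). proj_resolution R X F D p)"

definition res_term :: "('a, 'r) ring_scheme \<Rightarrow> ('a, 'm) module \<Rightarrow> nat \<Rightarrow> ('a, 'm) module"
  where "res_term R X = fst (some_resolution R X)"

definition res_diff :: "('a, 'r) ring_scheme \<Rightarrow> ('a, 'm) module \<Rightarrow> nat \<Rightarrow> 'm \<Rightarrow> 'm"
  where "res_diff R X = fst (snd (some_resolution R X))"

definition cocycles ::
  "('a, 'r) ring_scheme \<Rightarrow> nat \<Rightarrow> ('a, 'm) module \<Rightarrow> ('a, 'm) module \<Rightarrow> ('m \<Rightarrow> 'm) set"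
  where "cocycles R n X N = {f \<in> mod_hom R (res_term R X n) N.
    compose (carrier (res_term R X (Suc n))) f (res_diff R X n)
      = (\<lambda>x\<in>carrier (res_term R X (Suc n)). \<zero>\<^bsub>N\<^esub>)}"

fun coboundaries ::
  "('a, 'r) ring_scheme \<Rightarrow> nat \<Rightarrow> ('a, 'm) module \<Rightarrow> ('a, 'm) module \<Rightarrow> ('m \<Rightarrow> 'm) set"
  where
    "coboundaries R 0 X N = {\<lambda>x\<in>carrier (res_term R X 0). \<zero>\<^bsub>N\<^esub>}"
  | "coboundaries R (Suc n) X N =
      (\<lambda>g. compose (carrier (res_term R X (Suc n))) g (res_diff R X n)) ` mod_hom R (res_term R X n) N"

text \<open>\<open>Ext R n X N\<close> is the \<open>n\<close>-th cohomology group of \<open>Hom(F, N)\<close> for the chosen resolution \<open>F\<close>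
  of \<open>X\<close>, and \<open>Ext_map R n X N N' h\<close> is \<open>Ext\<^sup>n(X, h)\<close> for \<open>h : N \<rightarrow> N'\<close>.\<close>

definition Ext ::
  "('a, 'r) ring_scheme \<Rightarrow> nat \<Rightarrow> ('a, 'm) module \<Rightarrow> ('a, 'm) module \<Rightarrow> ('m \<Rightarrow> 'm) set monoid"
  where "Ext R n X N =
    (hom_group R (res_term R X n) N)\<lparr>carrier := cocycles R n X N\<rparr> Mod coboundaries R n X N"

definition Ext_map ::
  "('a, 'r) ring_scheme \<Rightarrow> nat \<Rightarrow> ('a, 'm) module \<Rightarrow> ('a, 'm) module \<Rightarrow> ('a, 'm) module
    \<Rightarrow> ('m \<Rightarrow> 'm) \<Rightarrow> ('m \<Rightarrow> 'm) set \<Rightarrow> ('m \<Rightarrow> 'm) set"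
  where "Ext_map R n X N N' h c = the_elem ((\<lambda>f. coboundaries R n X N'
      #>\<^bsub>hom_group R (res_term R X n) N'\<^esub> compose (carrier (res_term R X n)) h f) ` c)"

definition Ext_nat_iso ::
  "('a, 'r) ring_scheme \<Rightarrow> nat \<Rightarrow> ('a, 'm) module \<Rightarrow> ('a, 'm) module \<Rightarrow> bool"
  where "Ext_nat_iso R n X Z \<longleftrightarrow>
    (\<exists>\<eta>. (\<forall>N\<in>fgmod R. \<eta> N \<in> iso (Ext R n X N) (Ext R n Z N)) \<and>
         (\<forall>N\<in>fgmod R. \<forall>N'\<in>fgmod R. \<forall>h\<in>mod_hom R N N'. \<forall>c\<in>carrier (Ext R n X N).
            \<eta> N' (Ext_map R n X N N' h c) = Ext_map R n Z N N' h (\<eta> N c)))"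

definition d_division ::
  "('a, 'r) ring_scheme \<Rightarrow> nat \<Rightarrow> ('a, 'm) module \<Rightarrow> ('a, 'm) module \<Rightarrow> ('a, 'm) module \<Rightarrow> bool"
  where "d_division R d M X Z \<longleftrightarrow>
    X \<in> add_cat R M \<and> Z \<in> add_cat R M \<and>
    (\<forall>(W :: ('a, 'm) module) \<in> add_cat R X \<inter> add_cat R Z. zero_module W) \<and>
    \<not> Ext_nat_iso R d X Z \<and> Ext_nat_iso R (Suc d) X Z"


section \<open>Igusa--Todorov functions\<close>

definition K0_relations :: "('a, 'r) ring_scheme \<Rightarrow> (('a, 'm) module \<Rightarrow>\<^sub>0 int) set"
  where "K0_relations R =
    {frag_of C - (frag_of A + frag_of B) | A B C.
        A \<in> fgmod R \<and> B \<in> fgmod R \<and> C \<in> fgmod R \<and> mod_iso R C (dsum A B)}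
    \<union> {frag_of Q | Q. projective R Q}"

definition K0_kernel :: "('a, 'r) ring_scheme \<Rightarrow> (('a, 'm) module \<Rightarrow>\<^sub>0 int) set"
  where "K0_kernel R = generate (free_Abelian_group (fgmod R)) (K0_relations R)"

definition K0 :: "('a, 'r) ring_scheme \<Rightarrow> (('a, 'm) module \<Rightarrow>\<^sub>0 int) set monoid"
  where "K0 R = free_Abelian_group (fgmod R) Mod K0_kernel R"

definition K0_coset ::
  "('a, 'r) ring_scheme \<Rightarrow> (('a, 'm) module \<Rightarrow>\<^sub>0 int) \<Rightarrow> (('a, 'm) module \<Rightarrow>\<^sub>0 int) set"
  where "K0_coset R x = K0_kernel R #>\<^bsub>free_Abelian_group (fgmod R)\<^esub> x"

definition K0_class :: "('a, 'r) ring_scheme \<Rightarrow> ('a, 'm) module \<Rightarrow> (('a, 'm) module \<Rightarrow>\<^sub>0 int) set"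
  where "K0_class R M = K0_coset R (frag_of M)"

text \<open>The endomorphism of \<open>K0 R\<close> induced by \<open>[M] \<mapsto> [\<Omega> M]\<close>.\<close>

definition K0_syzygy ::
  "('a, 'r) ring_scheme \<Rightarrow> (('a, 'm) module \<Rightarrow>\<^sub>0 int) set \<Rightarrow> (('a, 'm) module \<Rightarrow>\<^sub>0 int) set"
  where "K0_syzygy R c =
    the_elem ((\<lambda>x. K0_coset R (frag_extend (\<lambda>M. frag_of (syzygy R M)) x)) ` c)"

definition add_span ::
  "('a, 'r) ring_scheme \<Rightarrow> ('a, 'm) module \<Rightarrow> (('a, 'm) module \<Rightarrow>\<^sub>0 int) set set"
  where "add_span R M = generate (K0 R)
    {K0_class R X | X. X \<in> fgmod R \<and> indecomposable R X \<and> summand R X M}"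

definition phi :: "('a, 'r) ring_scheme \<Rightarrow> ('a, 'm) module \<Rightarrow> nat"
  where "phi R M = (LEAST n. \<forall>s\<ge>n.
    K0_syzygy R \<in> iso ((K0 R)\<lparr>carrier := (K0_syzygy R ^^ s) ` add_span R M\<rparr>)
                     ((K0 R)\<lparr>carrier := (K0_syzygy R ^^ Suc s) ` add_span R M\<rparr>))"

definition psi :: "('a, 'r) ring_scheme \<Rightarrow> ('a, 'm) module \<Rightarrow> enat"
  where "psi R M = enat (phi R M) +
    Sup {proj_dim R X | X :: ('a, 'm) module.
      X \<in> fgmod R \<and> summand R X ((syzygy R ^^ phi R M) M) \<and> proj_dim R X < \<infinity>}"


section \<open>Artin algebras and the functor \<open>Hom(P, -)\<close>\<close>

definition artinian :: "('k, 'x) ring_scheme \<Rightarrow> bool"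
  where "artinian k \<longleftrightarrow>
    (\<forall>I. (\<forall>n::nat. ideal (I n) k \<and> I (Suc n) \<subseteq> I n) \<longrightarrow> (\<exists>n. \<forall>m\<ge>n. I m = I n))"

text \<open>The \<open>k\<close>-algebra structure is the scalar multiplication of the record \<open>L\<close>.\<close>

locale artin_algebra = Module.module k L + ring L
  for k :: "('k, 'x) ring_scheme" and L :: "('k, 'a, 'y) module_scheme" (structure) +
  assumes smult_mult_left:
      "\<lbrakk>c \<in> carrier k; x \<in> carrier L; y \<in> carrier L\<rbrakk> \<Longrightarrow> (c \<odot> x) \<otimes> y = c \<odot> (x \<otimes> y)"
    and smult_mult_right:
      "\<lbrakk>c \<in> carrier k; x \<in> carrier L; y \<in> carrier L\<rbrakk> \<Longrightarrow> x \<otimes> (c \<odot> y) = c \<odot> (x \<otimes> y)"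
    and artinian_base: "artinian k"
    and finitely_generated: "fin_gen k L"

text \<open>The left ideal \<open>L e\<close> as a left \<open>L\<close>-module.\<close>

definition left_ideal_module :: "('a, 'r) ring_scheme \<Rightarrow> 'a \<Rightarrow> ('a, 'a) module"
  where "left_ideal_module L e =
    mk_module {x \<otimes>\<^bsub>L\<^esub> e | x. x \<in> carrier L} \<zero>\<^bsub>L\<^esub> (\<lambda>x y. x \<oplus>\<^bsub>L\<^esub> y) (\<lambda>a x. a \<otimes>\<^bsub>L\<^esub> x)"

definition End_ring :: "('a, 'r) ring_scheme \<Rightarrow> ('a, 'm) module \<Rightarrow> ('m \<Rightarrow> 'm) ring"
  where "End_ring R M = \<lparr>carrier = mod_hom R M M,
    monoid.mult = (\<lambda>f g. compose (carrier M) f g), one = (\<lambda>x\<in>carrier M. x),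
    ring.zero = (\<lambda>x\<in>carrier M. \<zero>\<^bsub>M\<^esub>), ring.add = (\<lambda>f g. \<lambda>x\<in>carrier M. f x \<oplus>\<^bsub>M\<^esub> g x)\<rparr>"

definition opposite_ring :: "('a, 'r) ring_scheme \<Rightarrow> ('a, 'r) ring_scheme"
  where "opposite_ring R = R\<lparr>monoid.mult := (\<lambda>x y. y \<otimes>\<^bsub>R\<^esub> x)\<rparr>"

text \<open>\<open>Hom(P, Y)\<close> as a left module over the opposite of the endomorphism ring of \<open>P\<close>:
  \<open>\<gamma>\<close> acts by \<open>f \<mapsto> f \<circ> \<gamma>\<close>.\<close>

definition hom_module ::
  "('a, 'r) ring_scheme \<Rightarrow> ('a, 'p) module \<Rightarrow> ('a, 'm) module \<Rightarrow> ('p \<Rightarrow> 'p, 'p \<Rightarrow> 'm) module"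
  where "hom_module R P Y = mk_module (mod_hom R P Y) (\<lambda>x\<in>carrier P. \<zero>\<^bsub>Y\<^esub>)
    (\<lambda>f g. \<lambda>x\<in>carrier P. f x \<oplus>\<^bsub>Y\<^esub> g x) (\<lambda>\<gamma> f. compose (carrier P) f \<gamma>)"

text \<open>The modules with a projective resolution all of whose terms lie in add \<open>P\<close>.\<close>

definition P_inf :: "('a, 'r) ring_scheme \<Rightarrow> ('a, 'p) module \<Rightarrow> ('a, 'm) module set"
  where "P_inf R P =
    {Y \<in> fgmod R. \<exists>F D p. proj_resolution R Y F D p \<and> (\<forall>n. F n \<in> add_cat R P)}"


section \<open>Adequacy of the universes\<close>

lemma module_universe_End:
  fixes L :: "('a, 'r) ring_scheme"
  assumes "ring L" "e \<in> carrier L" "e \<otimes>\<^bsub>L\<^esub> e = e" "module_universe L TYPE('m)"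
  shows "module_universe (opposite_ring (End_ring L (left_ideal_module L e))) TYPE('a \<Rightarrow> 'm)"
proof -
  interpret ring L by fact
  let ?P = "left_ideal_module L e"
  let ?E = "mod_hom L ?P ?P"
  have eP: "e \<in> carrier ?P"
    using assms by (force simp: left_ideal_module_def mk_module_def)
  have val: "f x = x \<otimes>\<^bsub>L\<^esub> f e" if f: "f \<in> ?E" and x': "x \<in> carrier ?P" for f x
  proof -
    obtain y where y: "y \<in> carrier L" "x = y \<otimes>\<^bsub>L\<^esub> e"
      using x' by (auto simp: left_ideal_module_def mk_module_def)
    have x: "x \<in> carrier L" "x = x \<otimes>\<^bsub>L\<^esub> e"
      using y assms by (auto simp: m_assoc)
    have "f (x \<odot>\<^bsub>?P\<^esub> e) = x \<odot>\<^bsub>?P\<^esub> f e"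
      using f eP x(1) unfolding mod_hom_def by blast
    then show ?thesis using x(2) by (simp add: left_ideal_module_def mk_module_def)
  qed
  have inj: "inj_on (\<lambda>f. f e) ?E"
  proof (rule inj_onI)
    fix f g assume fg: "f \<in> ?E" "g \<in> ?E" "f e = g e"
    then have "f \<in> extensional (carrier ?P)" "g \<in> extensional (carrier ?P)"
      by (auto simp: mod_hom_def PiE_def)
    then show "f = g"
      by (rule extensionalityI) (simp only: val[OF fg(1)] val[OF fg(2)] fg(3))
  qed
  have "(\<lambda>f. f e) ` ?E \<subseteq> carrier ?P"
    using eP by (auto simp: mod_hom_def PiE_def Pi_def)
  also have "\<dots> \<subseteq> carrier L"
    using assms by (auto simp: left_ideal_module_def mk_module_def)
  finally have "?E \<lesssim> carrier L"
    using inj unfolding lepoll_def by blast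
  also have "\<dots> \<lesssim> (UNIV :: 'm set)"
    using assms unfolding module_universe_def by blast
  finally have 1: "?E \<lesssim> (UNIV :: 'm set)" .
  have 2: "(UNIV :: 'm set) \<lesssim> (UNIV :: ('a \<Rightarrow> 'm) set)"
    unfolding lepoll_def by (intro exI[of _ "\<lambda>y _. y"]) (auto simp: inj_on_def fun_eq_iff)
  have 3: "infinite (UNIV :: 'm set)"
    using assms unfolding module_universe_def by blast
  show ?thesis
    unfolding module_universe_def
    using lepoll_trans[OF 1 2] lepoll_trans[OF _ 2] 3
    by (simp add: opposite_ring_def End_ring_def infinite_le_lepoll)
qed

lemma fgmod_card:
  fixes R :: "('a, 'r) ring_scheme" and N :: "('a, 'n) module"
  assumes "N \<in> fgmod R" "module_universe R TYPE('m)"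
  shows "carrier N \<lesssim> (UNIV :: 'm set)"
proof -
  interpret left_module R N using assms by (simp add: fgmod_def)
  obtain S where S: "S \<subseteq> carrier N" "finite S"
    and gen: "\<And>H. submodule H R N \<Longrightarrow> S \<subseteq> H \<Longrightarrow> H = carrier N"
    using assms unfolding fgmod_def fin_gen_def by blast
  define ev where "ev = (\<lambda>l. foldr (\<lambda>(a, s) t. a \<odot>\<^bsub>N\<^esub> s \<oplus>\<^bsub>N\<^esub> t) l \<zero>\<^bsub>N\<^esub>)"
  have ev_simps [simp]: "ev [] = \<zero>\<^bsub>N\<^esub>" "ev ((a, s) # l) = a \<odot>\<^bsub>N\<^esub> s \<oplus>\<^bsub>N\<^esub> ev l" for a s l
    by (auto simp: ev_def)
  define T where "T = lists (carrier R \<times> S)"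
  have ev_closed [simp]: "ev l \<in> carrier N" if "l \<in> T" for l
    using that S unfolding T_def by (induction l) (auto simp: subset_iff)
  have ev_app: "ev (l @ l') = ev l \<oplus>\<^bsub>N\<^esub> ev l'" if "l \<in> T" "l' \<in> T" for l l'
    using that
  proof (induction l)
    case (Cons a l)
    obtain r s where a: "a = (r, s)" by force
    have "r \<in> carrier R" "s \<in> carrier N" "l \<in> T"
      using Cons.prems S a by (auto simp: T_def)
    then show ?case using Cons a by (simp add: M.a_assoc)
  qed simp
  have ev_sm: "ev (map (\<lambda>(r, s). (b \<otimes>\<^bsub>R\<^esub> r, s)) l) = b \<odot>\<^bsub>N\<^esub> ev l" if "l \<in> T" "b \<in> carrier R" for b l
    using that
  proof (induction l)
    case Nil
    have "b \<odot>\<^bsub>N\<^esub> \<zero>\<^bsub>N\<^esub> \<oplus>\<^bsub>N\<^esub> b \<odot>\<^bsub>N\<^esub> \<zero>\<^bsub>N\<^esub> = b \<odot>\<^bsub>N\<^esub> \<zero>\<^bsub>N\<^esub>"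
      using Nil smult_r_distr[of b "\<zero>\<^bsub>N\<^esub>" "\<zero>\<^bsub>N\<^esub>"] by simp
    then show ?case using Nil M.add.l_cancel_one[of "b \<odot>\<^bsub>N\<^esub> \<zero>\<^bsub>N\<^esub>" "b \<odot>\<^bsub>N\<^esub> \<zero>\<^bsub>N\<^esub>"] by simp
  next
    case (Cons a l)
    obtain r s where a: "a = (r, s)" by force
    have "r \<in> carrier R" "s \<in> carrier N" "l \<in> T"
      using Cons.prems S a by (auto simp: T_def)
    then show ?case using Cons a by (simp add: smult_r_distr smult_assoc1)
  qed
  have map_T: "map (\<lambda>(r, s). (b \<otimes>\<^bsub>R\<^esub> r, s)) l \<in> T" if "l \<in> T" "b \<in> carrier R" for b l
    using that by (auto simp: T_def lists_eq_set)
  have sm0: "\<zero>\<^bsub>R\<^esub> \<odot>\<^bsub>N\<^esub> x = \<zero>\<^bsub>N\<^esub>" if "x \<in> carrier N" for x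
  proof -
    have "\<zero>\<^bsub>R\<^esub> \<odot>\<^bsub>N\<^esub> x \<oplus>\<^bsub>N\<^esub> \<zero>\<^bsub>R\<^esub> \<odot>\<^bsub>N\<^esub> x = \<zero>\<^bsub>R\<^esub> \<odot>\<^bsub>N\<^esub> x"
      using that smult_l_distr[of "\<zero>\<^bsub>R\<^esub>" "\<zero>\<^bsub>R\<^esub>" x] by simp
    then show ?thesis using that M.add.l_cancel_one[of "\<zero>\<^bsub>R\<^esub> \<odot>\<^bsub>N\<^esub> x" "\<zero>\<^bsub>R\<^esub> \<odot>\<^bsub>N\<^esub> x"] by simp
  qed
  have neg: "(\<ominus>\<^bsub>R\<^esub> \<one>\<^bsub>R\<^esub>) \<odot>\<^bsub>N\<^esub> x = \<ominus>\<^bsub>N\<^esub> x" if "x \<in> carrier N" for x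
  proof -
    have "(\<ominus>\<^bsub>R\<^esub> \<one>\<^bsub>R\<^esub>) \<odot>\<^bsub>N\<^esub> x \<oplus>\<^bsub>N\<^esub> x = (\<ominus>\<^bsub>R\<^esub> \<one>\<^bsub>R\<^esub> \<oplus>\<^bsub>R\<^esub> \<one>\<^bsub>R\<^esub>) \<odot>\<^bsub>N\<^esub> x"
      using that by (simp add: smult_l_distr)
    also have "\<dots> = \<zero>\<^bsub>N\<^esub>" using that by (simp add: R.l_neg sm0)
    finally show ?thesis using that by (simp add: M.minus_equality)
  qed
  have "submodule (ev ` T) R N"
  proof (intro submodule.intro subgroup.intro submodule_axioms.intro)
    show "ev ` T \<subseteq> carrier (add_monoid N)" by auto
    show "x \<otimes>\<^bsub>add_monoid N\<^esub> y \<in> ev ` T" if xy: "x \<in> ev ` T" "y \<in> ev ` T" for x y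
    proof -
      obtain l l' where l: "l \<in> T" "l' \<in> T" "x = ev l" "y = ev l'" using xy by blast
      then have "l @ l' \<in> T" by (simp add: T_def)
      then have "ev (l @ l') \<in> ev ` T" by (rule imageI)
      then show ?thesis using l ev_app by simp
    qed
    have "[] \<in> T" by (simp add: T_def)
    then show "\<one>\<^bsub>add_monoid N\<^esub> \<in> ev ` T" using image_eqI[of "\<zero>\<^bsub>N\<^esub>" ev "[]" T] by simp
    show sm: "a \<odot>\<^bsub>N\<^esub> x \<in> ev ` T" if "a \<in> carrier R" "x \<in> ev ` T" for a x
      using that ev_sm map_T by (metis (no_types, lifting) imageE imageI)
    show "inv\<^bsub>add_monoid N\<^esub> x \<in> ev ` T" if "x \<in> ev ` T" for x
    proof -
      have "x \<in> carrier N" using that by auto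
      then show ?thesis using sm[OF _ that, of "\<ominus>\<^bsub>R\<^esub> \<one>\<^bsub>R\<^esub>"] neg by (simp add: a_inv_def)
    qed
  qed
  moreover have "S \<subseteq> ev ` T"
  proof
    fix s assume "s \<in> S"
    then have "[(\<one>\<^bsub>R\<^esub>, s)] \<in> T" "ev [(\<one>\<^bsub>R\<^esub>, s)] = s" using S by (auto simp: T_def)
    then show "s \<in> ev ` T" by (metis imageI)
  qed
  ultimately have "carrier N = ev ` T" using gen by blast
  then have "carrier N \<lesssim> T" by (simp add: image_lepoll)
  also have "T \<lesssim> (UNIV :: 'm set)"
  proof -
    have inf: "infinite (UNIV :: 'm set)" and cR: "carrier R \<lesssim> (UNIV :: 'm set)"
      using assms unfolding module_universe_def by auto
    have "S \<lesssim> (UNIV :: 'm set)"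
      using S inf finite_lepoll_infinite by blast
    with cR have "carrier R \<times> S \<lesssim> (UNIV :: 'm set) \<times> (UNIV :: 'm set)"
      by (rule times_lepoll_mono)
    also have "\<dots> \<lesssim> (UNIV :: 'm set)"
      using card_of_Times_same_infinite[OF inf] eqpoll_iff_card_of_ordIso eqpoll_imp_lepoll by blast
    finally have "T \<lesssim> lists (UNIV :: 'm set)"
      unfolding T_def by (rule lists_lepoll_mono)
    also have "\<dots> \<lesssim> (UNIV :: 'm set)"
      using card_of_lists_infinite[OF inf] eqpoll_iff_card_of_ordIso eqpoll_imp_lepoll by blast
    finally show ?thesis .
  qed
  finally show ?thesis .
qed

lemma fgmod_copy:
  fixes R :: "('a, 'r) ring_scheme" and N :: "('a, 'n) module"
  assumes N: "N \<in> fgmod R" and "module_universe R TYPE('m)"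
  shows "\<exists>M :: ('a, 'm) module. M \<in> fgmod R \<and> mod_iso R N M"
proof -
  interpret left_module R N using assms by (simp add: fgmod_def)
  obtain f :: "'n \<Rightarrow> 'm" where f: "inj_on f (carrier N)"
    using fgmod_card[OF assms] unfolding lepoll_def by blast
  define g where "g = inv_into (carrier N) f"
  have g [simp]: "g (f x) = x" if "x \<in> carrier N" for x
    using f that by (simp add: g_def)
  define M :: "('a, 'm) module" where
    "M = mk_module (f ` carrier N) (f \<zero>\<^bsub>N\<^esub>) (\<lambda>x y. f (g x \<oplus>\<^bsub>N\<^esub> g y)) (\<lambda>a x. f (a \<odot>\<^bsub>N\<^esub> g x))"
  have M [simp]: "carrier M = f ` carrier N" "\<zero>\<^bsub>M\<^esub> = f \<zero>\<^bsub>N\<^esub>"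
      "x \<oplus>\<^bsub>M\<^esub> y = f (g x \<oplus>\<^bsub>N\<^esub> g y)" "a \<odot>\<^bsub>M\<^esub> x = f (a \<odot>\<^bsub>N\<^esub> g x)" for x y a
    by (simp_all add: M_def mk_module_def)
  have M_group: "abelian_group M"
  proof (rule abelian_groupI)
    fix x assume "x \<in> carrier M"
    then obtain u where "u \<in> carrier N" "x = f u" by auto
    then show "\<exists>y\<in>carrier M. y \<oplus>\<^bsub>M\<^esub> x = \<zero>\<^bsub>M\<^esub>"
      by (intro bexI[of _ "f (\<ominus>\<^bsub>N\<^esub> u)"]) (auto simp: M.l_neg)
  qed (auto simp: M.a_ac)
  interpret M': abelian_group M by (rule M_group)
  have LM: "left_module R M"
    by unfold_locales (auto simp: smult_l_distr smult_r_distr smult_assoc1)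
  obtain S where S: "S \<subseteq> carrier N" "finite S"
    and gen: "\<And>H. submodule H R N \<Longrightarrow> S \<subseteq> H \<Longrightarrow> H = carrier N"
    using assms unfolding fgmod_def fin_gen_def by blast
  have "H = carrier M" if H: "submodule H R M" "f ` S \<subseteq> H" for H
  proof -
    interpret H: submodule H R M by fact
    have Hsub: "H \<subseteq> f ` carrier N" using H.subset by simp
    let ?K = "{x \<in> carrier N. f x \<in> H}"
    have inv: "inv\<^bsub>add_monoid M\<^esub> (f x) = f (\<ominus>\<^bsub>N\<^esub> x)" if "x \<in> carrier N" for x
      using that M'.minus_equality[of "f (\<ominus>\<^bsub>N\<^esub> x)" "f x"] by (simp add: M.l_neg a_inv_def)
    have "submodule ?K R N"
    proof (intro submodule.intro subgroup.intro submodule_axioms.intro)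
      show "x \<otimes>\<^bsub>add_monoid N\<^esub> y \<in> ?K" if "x \<in> ?K" "y \<in> ?K" for x y
        using that H.m_closed[of "f x" "f y"] by simp
      show "\<one>\<^bsub>add_monoid N\<^esub> \<in> ?K" using H.one_closed by simp
      show "inv\<^bsub>add_monoid N\<^esub> x \<in> ?K" if "x \<in> ?K" for x
      proof -
        have "f (\<ominus>\<^bsub>N\<^esub> x) \<in> H" using that H.m_inv_closed[of "f x"] inv[of x] by simp
        then show ?thesis using that by (simp add: a_inv_def[symmetric])
      qed
      show "a \<odot>\<^bsub>N\<^esub> x \<in> ?K" if "a \<in> carrier R" "x \<in> ?K" for a x
        using that H.smult_closed[of a "f x"] by simp
    qed auto
    moreover have "S \<subseteq> ?K" using S H by auto
    ultimately have "?K = carrier N" by (rule gen)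
    then show ?thesis using Hsub by auto
  qed
  then have "fin_gen R M"
    unfolding fin_gen_def using S by (intro exI[of _ "f ` S"]) auto
  moreover have "restrict f (carrier N) \<in> mod_hom R N M"
    by (auto simp: mod_hom_def)
  moreover have "bij_betw (restrict f (carrier N)) (carrier N) (carrier M)"
    using f by (auto simp: bij_betw_def)
  ultimately show ?thesis using LM unfolding fgmod_def mod_iso_def by blast
qed

end

theory Submission
  imports Defs
begin

text \<open>
  The functor \<open>Hom(P, -)\<close> is fully faithful on \<open>P_inf\<close>, since every module there is the
  cokernel of a map in \<open>add P\<close> and the functor is an equivalence from \<open>add P\<close> onto the projective
  \<open>\<Gamma>\<close>-modules. It sends projective covers with terms in \<open>add P\<close> to projective covers, hence commutes
  with syzygies; and \<open>P_inf\<close> is closed under syzygies and contains \<open>add Y\<close> for each of its objects \<open>Y\<close>, so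
  that \<open>add Y\<close> and \<open>add Hom(P, Y)\<close> correspond to each other.

  It remains to express everything through isomorphism and stable equivalence, that is, isomorphism
  modulo maps that factor through projectives. \<open>Ext\<^sup>0(X, -) \<simeq> Ext\<^sup>0(Z, -)\<close> means \<open>X \<simeq> Z\<close>, while for
  \<open>d \<ge> 1\<close>, \<open>Ext\<^sup>d(X, -) \<simeq> Ext\<^sup>d(Z, -)\<close> means that \<open>\<Omega>\<^bsup>d-1\<^esup> X\<close> and \<open>\<Omega>\<^bsup>d-1\<^esup> Z\<close> are stably equivalent. In
  \<open>K\<^sub>0\<close>, \<open>[A] = [B]\<close> holds if and only if \<open>A\<close> and \<open>B\<close> are stably equivalent, by cancellation. The projective
  dimension of \<open>X\<close> is the least \<open>n\<close> with \<open>\<Omega>\<^sup>n X\<close> projective.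
\<close>

section \<open>Linear maps\<close>

text \<open>Membership in add \<open>M\<close> is handled through one condition,
  \<open>thru\<close>: the identity of \<open>X\<close> is a finite sum of composites
  \<open>X -> M -> X\<close>. It mentions neither an exponent nor a complement, every additive
  functor carries it along, and fully faithful ones reflect it; summands of copowers are left behind
  at \<open>add_cat_iff\<close>.

  The obstacle in \<open>K0\<close> is that its elements are formal differences, whereas Hom(P, -)
  acts on modules only. The property that defines \<open>phi\<close> is therefore rewritten as a
  statement on pairs \<open>A\<close>, \<open>B\<close> in add \<open>M\<close>: if the syzygies of
  order \<open>s + 1\<close> are stably equivalent, so are those of order \<open>s\<close>
  (\<open>phi_stab\<close>). This rests on the local endomorphism rings of indecomposable modules.

  Carrier types shape many statements. Sums live on product types and Hom modules on function types,
  so a construction that must stay in a fixed \<open>fgmod\<close> is replaced by an isomorphic copy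
  (\<open>fg_copy\<close>). Finite length is the source of projective covers and of Fitting's lemma;
  over \<Gamma> it is inherited through evaluation at \<open>e\<close>.\<close>

lemma left_moduleI:
  fixes R (structure) and M (structure)
  assumes "ring R" "abelian_group M"
    and "\<And>a x. \<lbrakk>a \<in> carrier R; x \<in> carrier M\<rbrakk> \<Longrightarrow> a \<odot>\<^bsub>M\<^esub> x \<in> carrier M"
    and "\<And>a b x. \<lbrakk>a \<in> carrier R; b \<in> carrier R; x \<in> carrier M\<rbrakk>
      \<Longrightarrow> (a \<oplus> b) \<odot>\<^bsub>M\<^esub> x = a \<odot>\<^bsub>M\<^esub> x \<oplus>\<^bsub>M\<^esub> b \<odot>\<^bsub>M\<^esub> x"
    and "\<And>a x y. \<lbrakk>a \<in> carrier R; x \<in> carrier M; y \<in> carrier M\<rbrakk>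
      \<Longrightarrow> a \<odot>\<^bsub>M\<^esub> (x \<oplus>\<^bsub>M\<^esub> y) = a \<odot>\<^bsub>M\<^esub> x \<oplus>\<^bsub>M\<^esub> a \<odot>\<^bsub>M\<^esub> y"
    and "\<And>a b x. \<lbrakk>a \<in> carrier R; b \<in> carrier R; x \<in> carrier M\<rbrakk>
      \<Longrightarrow> (a \<otimes> b) \<odot>\<^bsub>M\<^esub> x = a \<odot>\<^bsub>M\<^esub> (b \<odot>\<^bsub>M\<^esub> x)"
    and "\<And>x. x \<in> carrier M \<Longrightarrow> \<one> \<odot>\<^bsub>M\<^esub> x = x"
  shows "left_module R M"
  using assms by (intro left_module.intro left_module_axioms.intro) auto

context left_module
begin

lemma smult_r_null [simp]: "a \<in> carrier R \<Longrightarrow> a \<odot>\<^bsub>M\<^esub> \<zero>\<^bsub>M\<^esub> = \<zero>\<^bsub>M\<^esub>"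
  using smult_r_distr[of a "\<zero>\<^bsub>M\<^esub>" "\<zero>\<^bsub>M\<^esub>"]
    M.add.l_cancel_one[of "a \<odot>\<^bsub>M\<^esub> \<zero>\<^bsub>M\<^esub>" "a \<odot>\<^bsub>M\<^esub> \<zero>\<^bsub>M\<^esub>"] by simp

lemma smult_l_null [simp]: "x \<in> carrier M \<Longrightarrow> \<zero> \<odot>\<^bsub>M\<^esub> x = \<zero>\<^bsub>M\<^esub>"
  using smult_l_distr[of "\<zero>" "\<zero>" x] M.add.l_cancel_one[of "\<zero> \<odot>\<^bsub>M\<^esub> x" "\<zero> \<odot>\<^bsub>M\<^esub> x"] by simp

lemma smult_l_minus: "\<lbrakk>a \<in> carrier R; x \<in> carrier M\<rbrakk> \<Longrightarrow> (\<ominus> a) \<odot>\<^bsub>M\<^esub> x = \<ominus>\<^bsub>M\<^esub> (a \<odot>\<^bsub>M\<^esub> x)"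
  using smult_l_distr[of "\<ominus> a" a x] M.minus_equality[of "(\<ominus> a) \<odot>\<^bsub>M\<^esub> x" "a \<odot>\<^bsub>M\<^esub> x"]
  by (simp add: R.l_neg)

lemma smult_r_minus: "\<lbrakk>a \<in> carrier R; x \<in> carrier M\<rbrakk> \<Longrightarrow> a \<odot>\<^bsub>M\<^esub> (\<ominus>\<^bsub>M\<^esub> x) = \<ominus>\<^bsub>M\<^esub> (a \<odot>\<^bsub>M\<^esub> x)"
  using smult_r_distr[of a "\<ominus>\<^bsub>M\<^esub> x" x] M.minus_equality[of "a \<odot>\<^bsub>M\<^esub> (\<ominus>\<^bsub>M\<^esub> x)" "a \<odot>\<^bsub>M\<^esub> x"]
  by (simp add: M.l_neg)

lemma minus_eq_smult: "x \<in> carrier M \<Longrightarrow> \<ominus>\<^bsub>M\<^esub> x = (\<ominus> \<one>) \<odot>\<^bsub>M\<^esub> x"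
  by (simp add: smult_l_minus)

text \<open>Closure under negation comes from the scalars, since \<open>-x\<close> is
  \<open>(-1) x\<close>.\<close>

lemma submoduleI:
  assumes "H \<subseteq> carrier M" "\<zero>\<^bsub>M\<^esub> \<in> H"
    and "\<And>x y. \<lbrakk>x \<in> H; y \<in> H\<rbrakk> \<Longrightarrow> x \<oplus>\<^bsub>M\<^esub> y \<in> H"
    and "\<And>a x. \<lbrakk>a \<in> carrier R; x \<in> H\<rbrakk> \<Longrightarrow> a \<odot>\<^bsub>M\<^esub> x \<in> H"
  shows "submodule H R M"
proof (intro submodule.intro subgroup.intro submodule_axioms.intro)
  show "inv\<^bsub>add_monoid M\<^esub> x \<in> H" if "x \<in> H" for x
    using assms(4)[of "\<ominus> \<one>" x] that assms(1) minus_eq_smult[of x] by (auto simp: a_inv_def)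
qed (use assms in auto)

lemma submoduleD:
  assumes "submodule H R M"
  shows "H \<subseteq> carrier M" "\<zero>\<^bsub>M\<^esub> \<in> H"
    "\<lbrakk>x \<in> H; y \<in> H\<rbrakk> \<Longrightarrow> x \<oplus>\<^bsub>M\<^esub> y \<in> H"
    "\<lbrakk>a \<in> carrier R; x \<in> H\<rbrakk> \<Longrightarrow> a \<odot>\<^bsub>M\<^esub> x \<in> H"
    "x \<in> H \<Longrightarrow> \<ominus>\<^bsub>M\<^esub> x \<in> H" "\<lbrakk>x \<in> H; y \<in> H\<rbrakk> \<Longrightarrow> x \<ominus>\<^bsub>M\<^esub> y \<in> H" "x \<in> H \<Longrightarrow> x \<in> carrier M"
proof -
  interpret H: submodule H R M by fact
  show sub: "H \<subseteq> carrier M" using H.subset by simp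
  show "\<zero>\<^bsub>M\<^esub> \<in> H" using H.one_closed by simp
  show add: "\<lbrakk>x \<in> H; y \<in> H\<rbrakk> \<Longrightarrow> x \<oplus>\<^bsub>M\<^esub> y \<in> H" for x y using H.m_closed by simp
  show sm: "\<lbrakk>a \<in> carrier R; x \<in> H\<rbrakk> \<Longrightarrow> a \<odot>\<^bsub>M\<^esub> x \<in> H" for a x by simp
  show neg: "x \<in> H \<Longrightarrow> \<ominus>\<^bsub>M\<^esub> x \<in> H" for x
    using sm[of "\<ominus> \<one>" x] sub minus_eq_smult[of x] by auto
  show "\<lbrakk>x \<in> H; y \<in> H\<rbrakk> \<Longrightarrow> x \<ominus>\<^bsub>M\<^esub> y \<in> H" using add neg by (simp add: a_minus_def)
  show "x \<in> H \<Longrightarrow> x \<in> carrier M" using sub by auto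
qed

lemma submodule_carrier: "submodule (carrier M) R M"
  by (rule submoduleI) auto

lemma submodule_zero: "submodule {\<zero>\<^bsub>M\<^esub>} R M"
  by (rule submoduleI) auto

lemma minus_add_cancel: "\<lbrakk>x \<in> carrier M; y \<in> carrier M\<rbrakk> \<Longrightarrow> (x \<ominus>\<^bsub>M\<^esub> y) \<oplus>\<^bsub>M\<^esub> y = x"
  by (simp add: a_minus_def M.a_assoc M.l_neg)

lemma add_minus_cancel: "\<lbrakk>x \<in> carrier M; y \<in> carrier M\<rbrakk> \<Longrightarrow> y \<oplus>\<^bsub>M\<^esub> (x \<ominus>\<^bsub>M\<^esub> y) = x"
  by (simp add: a_minus_def M.a_comm[of x] M.r_neg2 M.r_neg1)

lemma minus_self: "x \<in> carrier M \<Longrightarrow> x \<ominus>\<^bsub>M\<^esub> x = \<zero>\<^bsub>M\<^esub>"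
  by (simp add: a_minus_def M.r_neg)

lemma minus_eq_zero: "\<lbrakk>x \<in> carrier M; y \<in> carrier M\<rbrakk> \<Longrightarrow> x \<ominus>\<^bsub>M\<^esub> y = \<zero>\<^bsub>M\<^esub> \<longleftrightarrow> x = y"
  using minus_add_cancel[of x y] minus_self by force

lemma add_minus_self: "\<lbrakk>x \<in> carrier M; y \<in> carrier M\<rbrakk> \<Longrightarrow> (x \<oplus>\<^bsub>M\<^esub> y) \<ominus>\<^bsub>M\<^esub> y = x"
  by (simp add: a_minus_def M.a_assoc M.r_neg)

lemma add_minus_self2: "\<lbrakk>x \<in> carrier M; y \<in> carrier M\<rbrakk> \<Longrightarrow> (x \<oplus>\<^bsub>M\<^esub> y) \<ominus>\<^bsub>M\<^esub> x = y"
  using add_minus_self[of y x] by (simp add: M.a_comm)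

end

section \<open>Submodules as modules in their own right\<close>

lemma submod_simps [simp]:
  "carrier (submod M A) = A" "\<zero>\<^bsub>submod M A\<^esub> = \<zero>\<^bsub>M\<^esub>" "x \<oplus>\<^bsub>submod M A\<^esub> y = x \<oplus>\<^bsub>M\<^esub> y"
  "a \<odot>\<^bsub>submod M A\<^esub> x = a \<odot>\<^bsub>M\<^esub> x"
  by (simp_all add: submod_def)

lemma submod_submod [simp]: "submod (submod M A) B = submod M B"
  by (simp add: submod_def)

lemma submod_carrier [simp]: "submod M (carrier M) = M"
  by (simp add: submod_def)

lemma left_module_submod:
  assumes "left_module R M" "submodule A R M"
  shows "left_module R (submod M A)"
proof -
  interpret left_module R M by fact
  note A = submoduleD[OF assms(2)]
  have "abelian_group (submod M A)"
  proof (rule abelian_groupI)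
    show "\<exists>y\<in>carrier (submod M A). y \<oplus>\<^bsub>submod M A\<^esub> x = \<zero>\<^bsub>submod M A\<^esub>" if "x \<in> carrier (submod M A)" for x
      using that A(5)[of x] A(7)[of x] by (intro bexI[of _ "\<ominus>\<^bsub>M\<^esub> x"]) (auto simp: M.l_neg)
  qed (auto simp: A M.a_assoc intro: M.a_comm)
  then show ?thesis
    by (intro left_moduleI) (auto simp: A smult_l_distr smult_r_distr smult_assoc1 R.ring_axioms)
qed

lemma submodule_submod:
  assumes "left_module R M" "submodule A R M"
  shows "submodule B R (submod M A) \<longleftrightarrow> submodule B R M \<and> B \<subseteq> A"
proof -
  interpret left_module R M by fact
  interpret A: left_module R "submod M A" by (rule left_module_submod) fact+
  show ?thesis
  proof
    assume B: "submodule B R (submod M A)"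
    note B' = A.submoduleD[OF B]
    show "submodule B R M \<and> B \<subseteq> A"
      using B' submoduleD(1)[OF assms(2)] by (auto intro!: submoduleI)
  next
    assume B: "submodule B R M \<and> B \<subseteq> A"
    note B' = submoduleD[of B]
    show "submodule B R (submod M A)"
      using B' B by (auto intro!: A.submoduleI)
  qed
qed

definition lhom :: "('a, 'r) ring_scheme \<Rightarrow> ('a, 'm) module \<Rightarrow> ('a, 'n) module \<Rightarrow> ('m \<Rightarrow> 'n) \<Rightarrow> bool"
  where "lhom R A B f \<longleftrightarrow> f \<in> carrier A \<rightarrow> carrier B \<and>
    (\<forall>x\<in>carrier A. \<forall>y\<in>carrier A. f (x \<oplus>\<^bsub>A\<^esub> y) = f x \<oplus>\<^bsub>B\<^esub> f y) \<and>
    (\<forall>a\<in>carrier R. \<forall>x\<in>carrier A. f (a \<odot>\<^bsub>A\<^esub> x) = a \<odot>\<^bsub>B\<^esub> f x)"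

text \<open>Equations between linear maps are stated pointwise on the carrier; this spares the
  restrictions that the extensional maps of \<^const>\<open>mod_hom\<close> need.\<close>

lemma mod_hom_iff: "f \<in> mod_hom R A B \<longleftrightarrow> lhom R A B f \<and> f \<in> extensional (carrier A)"
  by (auto simp: mod_hom_def lhom_def PiE_def)

lemma lhomI:
  assumes "\<And>x. x \<in> carrier A \<Longrightarrow> f x \<in> carrier B"
    "\<And>x y. \<lbrakk>x \<in> carrier A; y \<in> carrier A\<rbrakk> \<Longrightarrow> f (x \<oplus>\<^bsub>A\<^esub> y) = f x \<oplus>\<^bsub>B\<^esub> f y"
    "\<And>a x. \<lbrakk>a \<in> carrier R; x \<in> carrier A\<rbrakk> \<Longrightarrow> f (a \<odot>\<^bsub>A\<^esub> x) = a \<odot>\<^bsub>B\<^esub> f x"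
  shows "lhom R A B f"
  using assms by (auto simp: lhom_def)

lemma lhomD:
  assumes "lhom R A B f"
  shows "x \<in> carrier A \<Longrightarrow> f x \<in> carrier B"
    "\<lbrakk>x \<in> carrier A; y \<in> carrier A\<rbrakk> \<Longrightarrow> f (x \<oplus>\<^bsub>A\<^esub> y) = f x \<oplus>\<^bsub>B\<^esub> f y"
    "\<lbrakk>a \<in> carrier R; x \<in> carrier A\<rbrakk> \<Longrightarrow> f (a \<odot>\<^bsub>A\<^esub> x) = a \<odot>\<^bsub>B\<^esub> f x"
  using assms by (auto simp: lhom_def)

lemma lhomZ:
  assumes "lhom R A B f" "left_module R A" "left_module R B"
  shows "f \<zero>\<^bsub>A\<^esub> = \<zero>\<^bsub>B\<^esub>" "x \<in> carrier A \<Longrightarrow> f (\<ominus>\<^bsub>A\<^esub> x) = \<ominus>\<^bsub>B\<^esub> f x"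
    "\<lbrakk>x \<in> carrier A; y \<in> carrier A\<rbrakk> \<Longrightarrow> f (x \<ominus>\<^bsub>A\<^esub> y) = f x \<ominus>\<^bsub>B\<^esub> f y"
proof -
  interpret A: left_module R A by fact
  interpret B: left_module R B by fact
  note f = lhomD[OF assms(1)]
  show z: "f \<zero>\<^bsub>A\<^esub> = \<zero>\<^bsub>B\<^esub>"
    using f(3)[of "\<zero>\<^bsub>R\<^esub>" "\<zero>\<^bsub>A\<^esub>"] f(1)[of "\<zero>\<^bsub>A\<^esub>"] by simp
  show n: "f (\<ominus>\<^bsub>A\<^esub> x) = \<ominus>\<^bsub>B\<^esub> f x" if "x \<in> carrier A" for x
    using f(3)[of "\<ominus>\<^bsub>R\<^esub> \<one>\<^bsub>R\<^esub>" x] f(1)[of x] that by (simp add: A.minus_eq_smult B.minus_eq_smult)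
  show "f (x \<ominus>\<^bsub>A\<^esub> y) = f x \<ominus>\<^bsub>B\<^esub> f y" if "x \<in> carrier A" "y \<in> carrier A"
    using that f n by (simp add: a_minus_def)
qed

lemma lhom_cong:
  assumes "left_module R A" "\<And>x. x \<in> carrier A \<Longrightarrow> f x = g x"
  shows "lhom R A B f \<longleftrightarrow> lhom R A B g"
proof -
  interpret left_module R A by fact
  have "lhom R A B g" if "lhom R A B f" "\<And>x. x \<in> carrier A \<Longrightarrow> f x = g x" for f g
    using that(1) unfolding lhom_def by (auto simp flip: that(2))
  then show ?thesis using assms by metis
qed

lemma lhom_restrict_iff:
  "left_module R A \<Longrightarrow> lhom R A B (restrict f (carrier A)) \<longleftrightarrow> lhom R A B f"
  by (rule lhom_cong) auto

lemma restrict_mod_hom: "left_module R A \<Longrightarrow> restrict f (carrier A) \<in> mod_hom R A B \<longleftrightarrow> lhom R A B f"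
  by (simp add: mod_hom_iff lhom_restrict_iff)

lemma lhom_comp: "\<lbrakk>lhom R A B f; lhom R B C g\<rbrakk> \<Longrightarrow> lhom R A C (\<lambda>x. g (f x))"
  by (rule lhomI) (simp_all add: lhomD)

lemma lhom_id: "lhom R A A (\<lambda>x. x)"
  by (auto simp: lhom_def)

lemma lhom_zero: "left_module R B \<Longrightarrow> lhom R A B (\<lambda>x. \<zero>\<^bsub>B\<^esub>)"
proof -
  assume "left_module R B"
  then interpret left_module R B .
  show ?thesis by (auto simp: lhom_def)
qed

lemma lhom_add:
  assumes "left_module R B" "lhom R A B f" "lhom R A B g"
  shows "lhom R A B (\<lambda>x. f x \<oplus>\<^bsub>B\<^esub> g x)"
proof -
  interpret left_module R B by fact
  show ?thesis using lhomD[OF assms(2)] lhomD[OF assms(3)]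
    by (intro lhomI) (auto simp: M.a_ac smult_r_distr)
qed

lemma lhom_neg:
  assumes "left_module R B" "lhom R A B f"
  shows "lhom R A B (\<lambda>x. \<ominus>\<^bsub>B\<^esub> f x)"
proof -
  interpret left_module R B by fact
  show ?thesis using lhomD[OF assms(2)]
    by (intro lhomI) (auto simp: M.minus_add smult_r_minus)
qed

lemma lhom_diff:
  assumes "left_module R B" "lhom R A B f" "lhom R A B g"
  shows "lhom R A B (\<lambda>x. f x \<ominus>\<^bsub>B\<^esub> g x)"
  using lhom_add[OF assms(1,2) lhom_neg[OF assms(1,3)]] by (simp add: a_minus_def)

lemma lhom_incl:
  assumes "left_module R M" "submodule A R M"
  shows "lhom R (submod M A) M (\<lambda>x. x)"
proof -
  interpret left_module R M by fact
  show ?thesis using submoduleD(1)[OF assms(2)] by (auto simp: lhom_def)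
qed

lemma lhom_submodI: "\<lbrakk>lhom R X M f; \<And>x. x \<in> carrier X \<Longrightarrow> f x \<in> A\<rbrakk> \<Longrightarrow> lhom R X (submod M A) f"
  by (auto simp: lhom_def)

lemma lhom_submodD: "\<lbrakk>lhom R X (submod M A) f; A \<subseteq> carrier M\<rbrakk> \<Longrightarrow> lhom R X M f"
  by (auto simp: lhom_def)

lemma lhom_from_submod: "\<lbrakk>lhom R M X f; A \<subseteq> carrier M\<rbrakk> \<Longrightarrow> lhom R (submod M A) X f"
  by (rule lhomI) (auto simp: lhomD subset_iff)

section \<open>Images, preimages and sums of submodules\<close>

lemma submodule_image:
  assumes "left_module R M" "left_module R N" "lhom R M N f" "submodule A R M"
  shows "submodule (f ` A) R N"
proof -
  interpret M: left_module R M by fact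
  interpret N: left_module R N by fact
  note A = M.submoduleD[OF assms(4)] and f = lhomD[OF assms(3)] lhomZ[OF assms(3,1,2)]
  show ?thesis
  proof (rule N.submoduleI)
    show "f ` A \<subseteq> carrier N" using A f by auto
    show "\<zero>\<^bsub>N\<^esub> \<in> f ` A" using A f by (metis imageI)
    show "x \<oplus>\<^bsub>N\<^esub> y \<in> f ` A" if "x \<in> f ` A" "y \<in> f ` A" for x y
      using that A f(2) by (smt (verit) imageE imageI)
    show "a \<odot>\<^bsub>N\<^esub> x \<in> f ` A" if "a \<in> carrier R" "x \<in> f ` A" for a x
      using that A f(3) by (smt (verit) imageE imageI)
  qed
qed

lemma submodule_vimage:
  assumes "left_module R M" "left_module R N" "lhom R M N f" "submodule B R N"
  shows "submodule {x \<in> carrier M. f x \<in> B} R M"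
proof -
  interpret M: left_module R M by fact
  interpret N: left_module R N by fact
  show ?thesis
    using N.submoduleD[OF assms(4)] lhomD[OF assms(3)] lhomZ[OF assms(3,1,2)] by (intro M.submoduleI) auto
qed

lemma submodule_ker:
  assumes "left_module R M" "left_module R N" "lhom R M N f"
  shows "submodule (hom_ker M N f) R M"
  using submodule_vimage[OF assms left_module.submodule_zero[OF assms(2)]] by (simp add: hom_ker_def)

lemma submodule_inter:
  assumes "left_module R M" "submodule A R M" "submodule B R M"
  shows "submodule (A \<inter> B) R M"
proof -
  interpret M: left_module R M by fact
  show ?thesis
    using M.submoduleD[OF assms(2)] M.submoduleD[OF assms(3)] by (intro M.submoduleI) auto
qed

lemma set_add_iff: "x \<in> A <+>\<^bsub>M\<^esub> B \<longleftrightarrow> (\<exists>a\<in>A. \<exists>b\<in>B. x = a \<oplus>\<^bsub>M\<^esub> b)"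
  by (auto simp: set_add_def set_mult_def)

lemma submodule_sum:
  assumes "left_module R M" "submodule A R M" "submodule B R M"
  shows "submodule (A <+>\<^bsub>M\<^esub> B) R M" "A \<subseteq> A <+>\<^bsub>M\<^esub> B" "B \<subseteq> A <+>\<^bsub>M\<^esub> B"
proof -
  interpret M: left_module R M by fact
  note A = M.submoduleD[OF assms(2)] and B = M.submoduleD[OF assms(3)]
  show "submodule (A <+>\<^bsub>M\<^esub> B) R M"
  proof (rule M.submoduleI)
    show "A <+>\<^bsub>M\<^esub> B \<subseteq> carrier M" using A B by (auto simp: set_add_iff)
    show "\<zero>\<^bsub>M\<^esub> \<in> A <+>\<^bsub>M\<^esub> B" using A(2) B(2) by (force simp: set_add_iff)
    show "x \<oplus>\<^bsub>M\<^esub> y \<in> A <+>\<^bsub>M\<^esub> B" if xy: "x \<in> A <+>\<^bsub>M\<^esub> B" "y \<in> A <+>\<^bsub>M\<^esub> B" for x y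
    proof -
      obtain a b a' b' where h: "a \<in> A" "b \<in> B" "x = a \<oplus>\<^bsub>M\<^esub> b" "a' \<in> A" "b' \<in> B" "y = a' \<oplus>\<^bsub>M\<^esub> b'"
        using xy by (auto simp: set_add_iff)
      then have "x \<oplus>\<^bsub>M\<^esub> y = (a \<oplus>\<^bsub>M\<^esub> a') \<oplus>\<^bsub>M\<^esub> (b \<oplus>\<^bsub>M\<^esub> b')"
        using A(7) B(7) by (simp add: M.a_ac)
      then show ?thesis using h A(3)[of a a'] B(3)[of b b'] unfolding set_add_iff by blast
    qed
    show "r \<odot>\<^bsub>M\<^esub> x \<in> A <+>\<^bsub>M\<^esub> B" if "r \<in> carrier R" "x \<in> A <+>\<^bsub>M\<^esub> B" for r x
      using that A(4,7) B(4,7) by (force simp: set_add_iff M.smult_r_distr)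
  qed
  show "A \<subseteq> A <+>\<^bsub>M\<^esub> B"
  proof
    fix x assume "x \<in> A"
    then have "x = x \<oplus>\<^bsub>M\<^esub> \<zero>\<^bsub>M\<^esub>" using A(7) by simp
    then show "x \<in> A <+>\<^bsub>M\<^esub> B" using \<open>x \<in> A\<close> B(2) by (metis set_add_iff)
  qed
  show "B \<subseteq> A <+>\<^bsub>M\<^esub> B"
  proof
    fix x assume "x \<in> B"
    then have "x = \<zero>\<^bsub>M\<^esub> \<oplus>\<^bsub>M\<^esub> x" using B(7) by simp
    then show "x \<in> A <+>\<^bsub>M\<^esub> B" using \<open>x \<in> B\<close> A(2) by (metis set_add_iff)
  qed
qed

text \<open>Mutually inverse linear maps replace bijectivity from here on: they compose, restrict to
  submodules and pass through functors.\<close>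

lemma mod_iso_iff:
  assumes "left_module R A" "left_module R B"
  shows "mod_iso R A B \<longleftrightarrow> (\<exists>f g. lhom R A B f \<and> lhom R B A g \<and>
    (\<forall>x\<in>carrier A. g (f x) = x) \<and> (\<forall>y\<in>carrier B. f (g y) = y))"
proof
  assume "mod_iso R A B"
  then obtain f where f: "lhom R A B f" "bij_betw f (carrier A) (carrier B)"
    by (auto simp: mod_iso_def mod_hom_iff)
  interpret A: left_module R A by fact
  define g where "g = inv_into (carrier A) f"
  have g: "g y \<in> carrier A" "f (g y) = y" if "y \<in> carrier B" for y
    using f(2) that by (auto simp: g_def bij_betw_def inv_into_into f_inv_into_f)
  have gf: "g (f x) = x" if "x \<in> carrier A" for x
    using f(2) that by (auto simp: g_def bij_betw_def)
  have "lhom R B A g"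
  proof (rule lhomI)
    show "g (x \<oplus>\<^bsub>B\<^esub> y) = g x \<oplus>\<^bsub>A\<^esub> g y" if "x \<in> carrier B" "y \<in> carrier B" for x y
      using gf[of "g x \<oplus>\<^bsub>A\<^esub> g y"] g that lhomD[OF f(1)] by simp
    show "g (a \<odot>\<^bsub>B\<^esub> x) = a \<odot>\<^bsub>A\<^esub> g x" if "a \<in> carrier R" "x \<in> carrier B" for a x
      using gf[of "a \<odot>\<^bsub>A\<^esub> g x"] g that lhomD[OF f(1)] by simp
  qed (use g in auto)
  then show "\<exists>f g. lhom R A B f \<and> lhom R B A g \<and>
    (\<forall>x\<in>carrier A. g (f x) = x) \<and> (\<forall>y\<in>carrier B. f (g y) = y)"
    using f g gf by blast
next
  assume "\<exists>f g. lhom R A B f \<and> lhom R B A g \<and>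
    (\<forall>x\<in>carrier A. g (f x) = x) \<and> (\<forall>y\<in>carrier B. f (g y) = y)"
  then obtain f g where fg: "lhom R A B f" "lhom R B A g"
    "\<forall>x\<in>carrier A. g (f x) = x" "\<forall>y\<in>carrier B. f (g y) = y" by blast
  have "bij_betw f (carrier A) (carrier B)"
    using fg by (intro bij_betw_byWitness[of _ g]) (auto simp: lhom_def)
  then have "bij_betw (restrict f (carrier A)) (carrier A) (carrier B)"
    by (simp cong: bij_betw_cong)
  then show "mod_iso R A B"
    unfolding mod_iso_def using fg(1) restrict_mod_hom[OF assms(1)] by blast
qed

lemma mod_isoI:
  assumes "left_module R A" "left_module R B" "lhom R A B f" "lhom R B A g"
    "\<And>x. x \<in> carrier A \<Longrightarrow> g (f x) = x" "\<And>y. y \<in> carrier B \<Longrightarrow> f (g y) = y"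
  shows "mod_iso R A B"
  unfolding mod_iso_iff[OF assms(1,2)] using assms(3-6) by blast

lemma mod_isoE:
  assumes "mod_iso R A B" "left_module R A" "left_module R B"
  obtains f g where "lhom R A B f" "lhom R B A g"
    "\<And>x. x \<in> carrier A \<Longrightarrow> g (f x) = x" "\<And>y. y \<in> carrier B \<Longrightarrow> f (g y) = y"
  using assms(1) that unfolding mod_iso_iff[OF assms(2,3)] by blast

lemma mod_iso_refl: "left_module R A \<Longrightarrow> mod_iso R A A"
  by (rule mod_isoI[where f = "\<lambda>x. x" and g = "\<lambda>x. x"]) (auto intro: lhom_id)

lemma mod_iso_sym: "\<lbrakk>mod_iso R A B; left_module R A; left_module R B\<rbrakk> \<Longrightarrow> mod_iso R B A"
  by (erule mod_isoE) (auto intro: mod_isoI)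

lemma mod_iso_trans:
  assumes "mod_iso R A B" "mod_iso R B C" "left_module R A" "left_module R B" "left_module R C"
  shows "mod_iso R A C"
proof -
  obtain f g where fg: "lhom R A B f" "lhom R B A g"
    "\<And>x. x \<in> carrier A \<Longrightarrow> g (f x) = x" "\<And>y. y \<in> carrier B \<Longrightarrow> f (g y) = y"
    using assms mod_isoE by metis
  obtain f' g' where fg': "lhom R B C f'" "lhom R C B g'"
    "\<And>x. x \<in> carrier B \<Longrightarrow> g' (f' x) = x" "\<And>y. y \<in> carrier C \<Longrightarrow> f' (g' y) = y"
    using assms mod_isoE by metis
  show ?thesis
    by (rule mod_isoI[where f = "\<lambda>x. f' (f x)" and g = "\<lambda>x. g (g' x)"])
      (use assms fg fg' lhomD(1)[OF fg(1)] lhomD(1)[OF fg'(2)] in \<open>auto intro: lhom_comp\<close>)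
qed

lemma zero_module_iso:
  assumes "mod_iso R A B" "left_module R A" "left_module R B" "zero_module A"
  shows "zero_module B"
proof -
  obtain f g where f: "lhom R A B f" and g: "lhom R B A g"
    and fg: "\<And>y. y \<in> carrier B \<Longrightarrow> f (g y) = y"
    using assms(1-3) mod_isoE by metis
  have "y = \<zero>\<^bsub>B\<^esub>" if "y \<in> carrier B" for y
    using fg[OF that] lhomD(1)[OF g that] assms(4) lhomZ(1)[OF f assms(2,3)] by (simp add: zero_module_def)
  moreover have "\<zero>\<^bsub>B\<^esub> \<in> carrier B"
    using left_module.submoduleD(2)[OF assms(3) left_module.submodule_carrier[OF assms(3)]] .
  ultimately show ?thesis unfolding zero_module_def by blast
qed

section \<open>Finitely generated modules\<close>

lemma fgmodD: "M \<in> fgmod R \<Longrightarrow> left_module R M"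
  by (simp add: fgmod_def)

lemma fgmodE:
  assumes "M \<in> fgmod R"
  obtains S where "S \<subseteq> carrier M" "finite S"
    "\<And>H. submodule H R M \<Longrightarrow> S \<subseteq> H \<Longrightarrow> H = carrier M"
  using assms unfolding fgmod_def fin_gen_def by blast

lemma fgmodI:
  assumes "left_module R M" "S \<subseteq> carrier M" "finite S"
    "\<And>H. submodule H R M \<Longrightarrow> S \<subseteq> H \<Longrightarrow> H = carrier M"
  shows "M \<in> fgmod R"
  unfolding fgmod_def fin_gen_def using assms(1) by (auto intro!: exI[of _ S] assms)

text \<open>The preimage of a submodule that contains the images of the generators contains the
  generators.\<close>

lemma fgmod_image:
  fixes M :: "('a, 'm) module" and N :: "('a, 'n) module"
  assumes "M \<in> fgmod R" "left_module R N" "lhom R M N f" "f ` carrier M = carrier N"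
  shows "N \<in> fgmod R"
proof -
  have M: "left_module R M" using assms by (simp add: fgmod_def)
  obtain S where S: "S \<subseteq> carrier M" "finite S"
    and gen: "\<And>H. submodule H R M \<Longrightarrow> S \<subseteq> H \<Longrightarrow> H = carrier M"
    using fgmodE[OF assms(1)] by blast
  have "H = carrier N" if H: "submodule H R N" "f ` S \<subseteq> H" for H
  proof -
    have "{x \<in> carrier M. f x \<in> H} = carrier M"
      using H S by (intro gen submodule_vimage[OF M assms(2,3)]) auto
    then have "carrier N \<subseteq> H" unfolding assms(4)[symmetric] by blast
    then show ?thesis using left_module.submoduleD(1)[OF assms(2) H(1)] by auto
  qed
  then show ?thesis
    using S assms(4) by (intro fgmodI[OF assms(2), of "f ` S"]) auto
qed

lemma fgmod_iso:
  assumes "mod_iso R A B" "A \<in> fgmod R" "left_module R B"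
  shows "B \<in> fgmod R"
proof -
  obtain f g where fg: "lhom R A B f" "lhom R B A g"
    "\<And>x. x \<in> carrier A \<Longrightarrow> g (f x) = x" "\<And>y. y \<in> carrier B \<Longrightarrow> f (g y) = y"
    using mod_isoE[OF assms(1) fgmodD[OF assms(2)] assms(3)] by metis
  have "f ` carrier A = carrier B"
    using lhomD(1)[OF fg(1)] lhomD(1)[OF fg(2)] fg(4) image_eqI[of _ f "g _" "carrier A"]
    by (metis image_subsetI subsetI subset_antisym)
  then show ?thesis using fgmod_image[OF assms(2,3) fg(1)] by blast
qed

lemma fgmod_submod_image:
  assumes "M \<in> fgmod R" "left_module R N" "lhom R M N f"
  shows "submod N (f ` carrier M) \<in> fgmod R"
proof -
  have M: "left_module R M" using assms by (simp add: fgmod_def)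
  have "submodule (f ` carrier M) R N"
    using submodule_image M left_module.submodule_carrier assms by blast
  then show ?thesis
    using assms by (intro fgmod_image[of M R _ f] left_module_submod lhom_submodI) auto
qed

definition reg :: "('a, 'r) ring_scheme \<Rightarrow> ('a, 'a) module"
  where "reg R = mk_module (carrier R) \<zero>\<^bsub>R\<^esub> (\<lambda>x y. x \<oplus>\<^bsub>R\<^esub> y) (\<lambda>a x. a \<otimes>\<^bsub>R\<^esub> x)"

lemma mk_module_simps [simp]:
  "carrier (mk_module C z p s) = C" "\<zero>\<^bsub>mk_module C z p s\<^esub> = z"
  "x \<oplus>\<^bsub>mk_module C z p s\<^esub> y = p x y" "a \<odot>\<^bsub>mk_module C z p s\<^esub> x = s a x"
  by (simp_all add: mk_module_def)

lemma reg_simps [simp]: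
  "carrier (reg R) = carrier R" "\<zero>\<^bsub>reg R\<^esub> = \<zero>\<^bsub>R\<^esub>" "x \<oplus>\<^bsub>reg R\<^esub> y = x \<oplus>\<^bsub>R\<^esub> y" "a \<odot>\<^bsub>reg R\<^esub> x = a \<otimes>\<^bsub>R\<^esub> x"
  by (simp_all add: reg_def)

lemma left_module_reg: "ring R \<Longrightarrow> left_module R (reg R)"
proof -
  assume "ring R"
  then interpret ring R .
  have "abelian_group (reg R)"
    by (rule abelian_groupI) (auto simp: a_ac intro: l_neg)
  then show ?thesis
    by (intro left_moduleI) (auto simp: m_assoc l_distr r_distr ring_axioms)
qed

lemma lhom_smult:
  assumes "left_module R M" "x \<in> carrier M"
  shows "lhom R (reg R) M (\<lambda>a. a \<odot>\<^bsub>M\<^esub> x)"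
proof -
  interpret left_module R M by fact
  show ?thesis using assms by (intro lhomI) (auto simp: smult_l_distr smult_assoc1)
qed

lemma fgmod_reg: "ring R \<Longrightarrow> reg R \<in> fgmod R"
proof -
  assume R: "ring R"
  then interpret ring R .
  interpret M: left_module R "reg R" using R by (rule left_module_reg)
  have "H = carrier (reg R)" if "submodule H R (reg R)" "{\<one>\<^bsub>R\<^esub>} \<subseteq> H" for H
    using M.submoduleD(1,4)[OF that(1)] that(2) by force
  then have "fin_gen R (reg R)" unfolding fin_gen_def by (intro exI[of _ "{\<one>\<^bsub>R\<^esub>}"]) auto
  then show ?thesis by (simp add: fgmod_def M.left_module_axioms)
qed

section \<open>Direct sums\<close>

lemma dsum_simps [simp]:
  "carrier (dsum A B) = carrier A \<times> carrier B" "\<zero>\<^bsub>dsum A B\<^esub> = (\<zero>\<^bsub>A\<^esub>, \<zero>\<^bsub>B\<^esub>)"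
  "x \<oplus>\<^bsub>dsum A B\<^esub> y = (fst x \<oplus>\<^bsub>A\<^esub> fst y, snd x \<oplus>\<^bsub>B\<^esub> snd y)"
  "a \<odot>\<^bsub>dsum A B\<^esub> x = (a \<odot>\<^bsub>A\<^esub> fst x, a \<odot>\<^bsub>B\<^esub> snd x)"
  by (simp_all add: dsum_def)

lemma left_module_dsum:
  assumes "left_module R A" "left_module R B"
  shows "left_module R (dsum A B)"
proof -
  interpret A: left_module R A by fact
  interpret B: left_module R B by fact
  have "abelian_group (dsum A B)"
  proof (rule abelian_groupI)
    show "\<exists>y\<in>carrier (dsum A B). y \<oplus>\<^bsub>dsum A B\<^esub> x = \<zero>\<^bsub>dsum A B\<^esub>" if "x \<in> carrier (dsum A B)" for x
      using that by (intro bexI[of _ "(\<ominus>\<^bsub>A\<^esub> fst x, \<ominus>\<^bsub>B\<^esub> snd x)"]) (auto simp: A.M.l_neg B.M.l_neg)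
  qed (auto simp: A.M.a_assoc B.M.a_assoc intro: A.M.a_comm B.M.a_comm)
  then show ?thesis
    by (intro left_moduleI) (auto simp: A.smult_l_distr A.smult_r_distr A.smult_assoc1
        B.smult_l_distr B.smult_r_distr B.smult_assoc1 A.R.ring_axioms)
qed

lemma dsum_maps:
  assumes "left_module R A" "left_module R B"
  shows "lhom R A (dsum A B) (\<lambda>x. (x, \<zero>\<^bsub>B\<^esub>))" "lhom R B (dsum A B) (\<lambda>y. (\<zero>\<^bsub>A\<^esub>, y))"
    "lhom R (dsum A B) A fst" "lhom R (dsum A B) B snd"
proof -
  interpret A: left_module R A by fact
  interpret B: left_module R B by fact
  show "lhom R A (dsum A B) (\<lambda>x. (x, \<zero>\<^bsub>B\<^esub>))" "lhom R B (dsum A B) (\<lambda>y. (\<zero>\<^bsub>A\<^esub>, y))"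
    "lhom R (dsum A B) A fst" "lhom R (dsum A B) B snd"
    by (auto simp: lhom_def)
qed

lemma lhom_pair: "\<lbrakk>lhom R X A f; lhom R X B g\<rbrakk> \<Longrightarrow> lhom R X (dsum A B) (\<lambda>x. (f x, g x))"
  by (auto simp: lhom_def)

lemma lhom_copair:
  assumes "left_module R X" "lhom R A X f" "lhom R B X g"
  shows "lhom R (dsum A B) X (\<lambda>z. f (fst z) \<oplus>\<^bsub>X\<^esub> g (snd z))"
proof -
  interpret left_module R X by fact
  show ?thesis using lhomD[OF assms(2)] lhomD[OF assms(3)]
    by (intro lhomI) (auto simp: M.a_ac smult_r_distr)
qed

lemma fgmod_dsum:
  assumes "A \<in> fgmod R" "B \<in> fgmod R"
  shows "dsum A B \<in> fgmod R"
proof -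
  interpret A: left_module R A using assms fgmodD by blast
  interpret B: left_module R B using assms fgmodD by blast
  note AB = A.left_module_axioms B.left_module_axioms
  interpret D: left_module R "dsum A B" using AB by (rule left_module_dsum)
  obtain S where S: "S \<subseteq> carrier A" "finite S"
    and genS: "\<And>H. submodule H R A \<Longrightarrow> S \<subseteq> H \<Longrightarrow> H = carrier A"
    using fgmodE[OF assms(1)] by blast
  obtain T where T: "T \<subseteq> carrier B" "finite T"
    and genT: "\<And>H. submodule H R B \<Longrightarrow> T \<subseteq> H \<Longrightarrow> H = carrier B"
    using fgmodE[OF assms(2)] by blast
  let ?U = "(\<lambda>x. (x, \<zero>\<^bsub>B\<^esub>)) ` S \<union> (\<lambda>y. (\<zero>\<^bsub>A\<^esub>, y)) ` T"
  have "H = carrier (dsum A B)" if H: "submodule H R (dsum A B)" "?U \<subseteq> H" for H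
  proof -
    have 1: "{x \<in> carrier A. (x, \<zero>\<^bsub>B\<^esub>) \<in> H} = carrier A"
      using H S by (intro genS submodule_vimage[OF AB(1) D.left_module_axioms dsum_maps(1)[OF AB]]) auto
    have 2: "{y \<in> carrier B. (\<zero>\<^bsub>A\<^esub>, y) \<in> H} = carrier B"
      using H T by (intro genT submodule_vimage[OF AB(2) D.left_module_axioms dsum_maps(2)[OF AB]]) auto
    have "(x, y) \<in> H" if "x \<in> carrier A" "y \<in> carrier B" for x y
      using D.submoduleD(3)[OF H(1), of "(x, \<zero>\<^bsub>B\<^esub>)" "(\<zero>\<^bsub>A\<^esub>, y)"] 1 2 that by auto
    then show ?thesis using D.submoduleD(1)[OF H(1)] by auto
  qed
  then show ?thesis
    using S T by (intro fgmodI[OF D.left_module_axioms, of ?U]) auto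
qed

lemma dsum_cong:
  assumes "mod_iso R A A'" "mod_iso R B B'"
    "left_module R A" "left_module R A'" "left_module R B" "left_module R B'"
  shows "mod_iso R (dsum A B) (dsum A' B')"
proof -
  obtain f g where fg: "lhom R A A' f" "lhom R A' A g"
    "\<And>x. x \<in> carrier A \<Longrightarrow> g (f x) = x" "\<And>y. y \<in> carrier A' \<Longrightarrow> f (g y) = y"
    using assms mod_isoE by metis
  obtain f' g' where fg': "lhom R B B' f'" "lhom R B' B g'"
    "\<And>x. x \<in> carrier B \<Longrightarrow> g' (f' x) = x" "\<And>y. y \<in> carrier B' \<Longrightarrow> f' (g' y) = y"
    using assms mod_isoE by metis
  show ?thesis
    by (rule mod_isoI[where f = "\<lambda>z. (f (fst z), f' (snd z))" and g = "\<lambda>z. (g (fst z), g' (snd z))"])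
      (use assms fg fg' in \<open>auto intro!: left_module_dsum lhomI simp: lhomD[OF fg(1)] lhomD[OF fg(2)]
        lhomD[OF fg'(1)] lhomD[OF fg'(2)]\<close>)
qed

lemma dsum_comm:
  assumes "left_module R A" "left_module R B"
  shows "mod_iso R (dsum A B) (dsum B A)"
  by (rule mod_isoI[where f = "\<lambda>z. (snd z, fst z)" and g = "\<lambda>z. (snd z, fst z)"])
    (use assms in \<open>auto intro!: left_module_dsum lhomI\<close>)

lemma dsum_assoc:
  assumes "left_module R A" "left_module R B" "left_module R C"
  shows "mod_iso R (dsum (dsum A B) C) (dsum A (dsum B C))"
  by (rule mod_isoI[where f = "\<lambda>z. (fst (fst z), snd (fst z), snd z)" and g = "\<lambda>z. ((fst z, fst (snd z)), snd (snd z))"])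
    (use assms in \<open>auto intro!: left_module_dsum lhomI\<close>)

text \<open>Regrouping for \<open>stab_dsum\<close>, where two isomorphisms that involve projective
  summands are added.\<close>

lemma dsum_swap4:
  assumes "left_module R A" "left_module R B" "left_module R C" "left_module R D"
  shows "mod_iso R (dsum (dsum A B) (dsum C D)) (dsum (dsum A C) (dsum B D))"
  by (rule mod_isoI[where f = "\<lambda>z. ((fst (fst z), fst (snd z)), snd (fst z), snd (snd z))"
        and g = "\<lambda>z. ((fst (fst z), fst (snd z)), snd (fst z), snd (snd z))"])
    (use assms in \<open>auto intro!: left_module_dsum lhomI\<close>)

lemma dsum_zero:
  assumes "left_module R A" "left_module R Z" "zero_module Z"
  shows "mod_iso R (dsum A Z) A"
proof -
  interpret A: left_module R A by fact
  interpret Z: left_module R Z by fact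
  have "z = \<zero>\<^bsub>Z\<^esub>" if "z \<in> carrier Z" for z using that assms(3) by (simp add: zero_module_def)
  then show ?thesis
    by (intro mod_isoI[where f = fst and g = "\<lambda>x. (x, \<zero>\<^bsub>Z\<^esub>)"] dsum_maps left_module_dsum)
      (use assms in auto)
qed

section \<open>Retracts and additive closures\<close>

text \<open>Splittings are recorded by both maps, which makes them composable and lets a functor act
  on them; \<open>summand_iff_retract\<close> is the link to internal decompositions.\<close>

definition retract :: "('a, 'r) ring_scheme \<Rightarrow> ('a, 'm) module \<Rightarrow> ('a, 'n) module \<Rightarrow> ('m \<Rightarrow> 'n) \<Rightarrow> ('n \<Rightarrow> 'm) \<Rightarrow> bool"
  where "retract R X M i r \<longleftrightarrow> lhom R X M i \<and> lhom R M X r \<and> (\<forall>x\<in>carrier X. r (i x) = x)"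

lemma internal_sum_retract:
  assumes "left_module R M" "internal_sum R M A B"
  obtains r where "lhom R M (submod M A) r" "\<And>x. x \<in> A \<Longrightarrow> r x = x" "\<And>x. x \<in> B \<Longrightarrow> r x = \<zero>\<^bsub>M\<^esub>"
proof -
  interpret M: left_module R M by fact
  have A: "submodule A R M" and B: "submodule B R M" and AB: "A \<inter> B = {\<zero>\<^bsub>M\<^esub>}" "A <+>\<^bsub>M\<^esub> B = carrier M"
    using assms(2) by (auto simp: internal_sum_def)
  note A' = M.submoduleD[OF A] and B' = M.submoduleD[OF B]
  have uniq: "a = a'" if "a \<in> A" "a' \<in> A" "b \<in> B" "b' \<in> B" "a \<oplus>\<^bsub>M\<^esub> b = a' \<oplus>\<^bsub>M\<^esub> b'" for a a' b b'
  proof -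
    have c: "a \<in> carrier M" "a' \<in> carrier M" "b \<in> carrier M" "b' \<in> carrier M" using that A' B' by auto
    have "a \<ominus>\<^bsub>M\<^esub> a' = b' \<ominus>\<^bsub>M\<^esub> b"
    proof -
      have "a = (a' \<oplus>\<^bsub>M\<^esub> b') \<ominus>\<^bsub>M\<^esub> b" using M.add_minus_self[of a b] that(5) c by simp
      then have "a = a' \<oplus>\<^bsub>M\<^esub> (b' \<ominus>\<^bsub>M\<^esub> b)" using c by (simp add: a_minus_def M.a_assoc)
      then show ?thesis using M.add_minus_self2[of a' "b' \<ominus>\<^bsub>M\<^esub> b"] c by simp
    qed
    then have "a \<ominus>\<^bsub>M\<^esub> a' \<in> A \<inter> B"
      using A'(6)[OF that(1,2)] B'(6)[OF that(4,3)] by simp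
    then show ?thesis using AB(1) c M.minus_eq_zero by auto
  qed
  define r where "r x = (THE a. a \<in> A \<and> (\<exists>b\<in>B. x = a \<oplus>\<^bsub>M\<^esub> b))" for x
  have r: "r (a \<oplus>\<^bsub>M\<^esub> b) = a" if "a \<in> A" "b \<in> B" for a b
    unfolding r_def
  proof (rule the_equality)
    show "a \<in> A \<and> (\<exists>b'\<in>B. a \<oplus>\<^bsub>M\<^esub> b = a \<oplus>\<^bsub>M\<^esub> b')" using that by blast
    show "a' = a" if "a' \<in> A \<and> (\<exists>b'\<in>B. a \<oplus>\<^bsub>M\<^esub> b = a' \<oplus>\<^bsub>M\<^esub> b')" for a'
      using uniq[of a' a _ b] that \<open>a \<in> A\<close> \<open>b \<in> B\<close> by metis
  qed
  have ex: "\<exists>a\<in>A. \<exists>b\<in>B. x = a \<oplus>\<^bsub>M\<^esub> b" if "x \<in> carrier M" for x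
    using that set_add_iff[of x M A B] AB(2) by simp
  have "lhom R M (submod M A) r"
  proof (rule lhomI)
    show "r x \<in> carrier (submod M A)" if "x \<in> carrier M" for x
      using ex[OF that] r by auto
    show "r (x \<oplus>\<^bsub>M\<^esub> y) = r x \<oplus>\<^bsub>submod M A\<^esub> r y" if xy: "x \<in> carrier M" "y \<in> carrier M" for x y
    proof -
      obtain a b a' b' where h: "a \<in> A" "b \<in> B" "x = a \<oplus>\<^bsub>M\<^esub> b" "a' \<in> A" "b' \<in> B" "y = a' \<oplus>\<^bsub>M\<^esub> b'"
        using ex[OF xy(1)] ex[OF xy(2)] by blast
      then have "x \<oplus>\<^bsub>M\<^esub> y = (a \<oplus>\<^bsub>M\<^esub> a') \<oplus>\<^bsub>M\<^esub> (b \<oplus>\<^bsub>M\<^esub> b')"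
        using A'(7) B'(7) by (simp add: M.a_ac)
      then show ?thesis using h r A'(3) B'(3) by simp
    qed
    show "r (c \<odot>\<^bsub>M\<^esub> x) = c \<odot>\<^bsub>submod M A\<^esub> r x" if cx: "c \<in> carrier R" "x \<in> carrier M" for c x
    proof -
      obtain a b where h: "a \<in> A" "b \<in> B" "x = a \<oplus>\<^bsub>M\<^esub> b" using ex[OF cx(2)] by blast
      then have "c \<odot>\<^bsub>M\<^esub> x = c \<odot>\<^bsub>M\<^esub> a \<oplus>\<^bsub>M\<^esub> c \<odot>\<^bsub>M\<^esub> b"
        using A'(7) B'(7) cx by (simp add: M.smult_r_distr)
      then show ?thesis using h r A'(4) B'(4) cx by simp
    qed
  qed
  moreover have "r x = x" if "x \<in> A" for x using r[of x "\<zero>\<^bsub>M\<^esub>"] that A'(7) B'(2) by simp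
  moreover have "r x = \<zero>\<^bsub>M\<^esub>" if "x \<in> B" for x using r[of "\<zero>\<^bsub>M\<^esub>" x] that B'(7) A'(2) by simp
  ultimately show ?thesis using that by blast
qed

text \<open>The complement is the kernel of \<open>r\<close>: an element \<open>m\<close> is the sum
  of \<open>i (r m)\<close> and \<open>m - i (r m)\<close>, and \<open>r\<close> kills the
  latter.\<close>

lemma retract_internal_sum:
  assumes X: "left_module R X" and M: "left_module R M" and ir: "retract R X M i r"
  shows "internal_sum R M (i ` carrier X) (hom_ker M X r)" "mod_iso R X (submod M (i ` carrier X))"
proof -
  interpret X: left_module R X by fact
  interpret M: left_module R M by fact
  have i: "lhom R X M i" and r: "lhom R M X r" and ri: "\<And>x. x \<in> carrier X \<Longrightarrow> r (i x) = x"
    using ir by (auto simp: retract_def)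
  note i' = lhomD[OF i] lhomZ[OF i X M] and r' = lhomD[OF r] lhomZ[OF r M X]
  have A: "submodule (i ` carrier X) R M"
    using submodule_image[OF X M i X.submodule_carrier] .
  have B: "submodule (hom_ker M X r) R M" using submodule_ker[OF M X r] .
  have "i ` carrier X \<inter> hom_ker M X r = {\<zero>\<^bsub>M\<^esub>}"
  proof
    show "i ` carrier X \<inter> hom_ker M X r \<subseteq> {\<zero>\<^bsub>M\<^esub>}" using ri i' by (auto simp: hom_ker_def)
    show "{\<zero>\<^bsub>M\<^esub>} \<subseteq> i ` carrier X \<inter> hom_ker M X r"
      using i'(4) r'(4) X.M.zero_closed by (force simp: hom_ker_def)
  qed
  moreover have "i ` carrier X <+>\<^bsub>M\<^esub> hom_ker M X r = carrier M"
  proof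
    show "i ` carrier X <+>\<^bsub>M\<^esub> hom_ker M X r \<subseteq> carrier M"
      using i' by (auto simp: set_add_iff hom_ker_def)
    show "carrier M \<subseteq> i ` carrier X <+>\<^bsub>M\<^esub> hom_ker M X r"
    proof
      fix m assume m: "m \<in> carrier M"
      have "m = i (r m) \<oplus>\<^bsub>M\<^esub> (m \<ominus>\<^bsub>M\<^esub> i (r m))" using m i' r' by (simp add: M.add_minus_cancel)
      moreover have "m \<ominus>\<^bsub>M\<^esub> i (r m) \<in> hom_ker M X r"
        using m i' r' ri by (simp add: hom_ker_def X.minus_self)
      ultimately show "m \<in> i ` carrier X <+>\<^bsub>M\<^esub> hom_ker M X r"
        using m r'(1) unfolding set_add_iff by blast
    qed
  qed
  ultimately show "internal_sum R M (i ` carrier X) (hom_ker M X r)"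
    unfolding internal_sum_def using A B by blast
  have "lhom R (submod M (i ` carrier X)) X r"
    using r i' by (intro lhom_from_submod) auto
  then show "mod_iso R X (submod M (i ` carrier X))"
    using A ri by (intro mod_isoI[where f = i and g = r] X left_module_submod[OF M] lhom_submodI[OF i]) auto
qed

lemma summand_iff_retract:
  assumes "left_module R X" "left_module R M"
  shows "summand R X M \<longleftrightarrow> (\<exists>i r. retract R X M i r)"
proof
  assume "summand R X M"
  then obtain A B where AB: "internal_sum R M A B" "mod_iso R X (submod M A)"
    unfolding summand_def by blast
  have A: "submodule A R M" using AB by (simp add: internal_sum_def)
  have A': "left_module R (submod M A)" using left_module_submod assms A by blast
  obtain f g where fg: "lhom R X (submod M A) f" "lhom R (submod M A) X g"
    "\<And>x. x \<in> carrier X \<Longrightarrow> g (f x) = x" "\<And>y. y \<in> carrier (submod M A) \<Longrightarrow> f (g y) = y"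
    using mod_isoE[OF AB(2) assms(1) A'] by blast
  obtain r where r: "lhom R M (submod M A) r" "\<And>x. x \<in> A \<Longrightarrow> r x = x"
    using internal_sum_retract[OF assms(2) AB(1)] by blast
  have "retract R X M f (\<lambda>x. g (r x))"
    unfolding retract_def
    using lhom_submodD[OF fg(1)] left_module.submoduleD(1)[OF assms(2) A] lhom_comp[OF r(1) fg(2)]
      r(2) fg(3) lhomD(1)[OF fg(1)] by auto
  then show "\<exists>i r. retract R X M i r" by blast
next
  assume "\<exists>i r. retract R X M i r"
  then show "summand R X M"
    unfolding summand_def using retract_internal_sum[OF assms] by blast
qed

lemma retract_trans:
  "\<lbrakk>retract R X Y i r; retract R Y Z j q\<rbrakk> \<Longrightarrow> retract R X Z (\<lambda>x. j (i x)) (\<lambda>x. r (q x))"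
  unfolding retract_def by (auto intro: lhom_comp simp: lhomD(1))

lemma iso_retract:
  assumes "mod_iso R X Y" "left_module R X" "left_module R Y"
  obtains i r where "retract R X Y i r" "retract R Y X r i"
  using mod_isoE[OF assms] unfolding retract_def by metis

lemma retract_dsum:
  assumes "left_module R A" "left_module R B"
  shows "retract R A (dsum A B) (\<lambda>x. (x, \<zero>\<^bsub>B\<^esub>)) fst" "retract R B (dsum A B) (\<lambda>x. (\<zero>\<^bsub>A\<^esub>, x)) snd"
  unfolding retract_def using dsum_maps[OF assms] by auto

lemma fgmod_retract:
  assumes "retract R X M i r" "M \<in> fgmod R" "left_module R X"
  shows "X \<in> fgmod R"
proof -
  have "r ` carrier M = carrier X"
  proof
    show "carrier X \<subseteq> r ` carrier M"
      using assms(1) by (force simp: retract_def lhom_def intro: rev_image_eqI)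
  qed (use assms in \<open>auto simp: retract_def lhom_def\<close>)
  then show ?thesis using fgmod_image[OF assms(2,3)] assms(1) unfolding retract_def by blast
qed

text \<open>The maps that are finite sums of composites \<open>X \<rightarrow> M \<rightarrow> Y\<close>.\<close>

inductive thru :: "('a, 'r) ring_scheme \<Rightarrow> ('a, 'n) module \<Rightarrow> ('a, 'm) module \<Rightarrow> ('a, 'p) module \<Rightarrow> ('m \<Rightarrow> 'p) \<Rightarrow> bool"
  for R M X Y where
  zero: "(\<And>x. x \<in> carrier X \<Longrightarrow> h x = \<zero>\<^bsub>Y\<^esub>) \<Longrightarrow> thru R M X Y h"
| step: "\<lbrakk>thru R M X Y h; lhom R X M g; lhom R M Y f; \<And>x. x \<in> carrier X \<Longrightarrow> k x = h x \<oplus>\<^bsub>Y\<^esub> f (g x)\<rbrakk>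
    \<Longrightarrow> thru R M X Y k"

lemma thru_cong:
  assumes "thru R M X Y h" "\<And>x. x \<in> carrier X \<Longrightarrow> k x = h x"
  shows "thru R M X Y k"
  using assms
proof (induction arbitrary: k rule: thru.induct)
  case (zero h)
  have "k x = \<zero>\<^bsub>Y\<^esub>" if "x \<in> carrier X" for x using zero(1)[OF that] zero(2)[OF that] by simp
  then show ?case by (rule thru.zero)
next
  case (step h g f k k')
  have "k' x = h x \<oplus>\<^bsub>Y\<^esub> f (g x)" if "x \<in> carrier X" for x
    using step.hyps(4)[OF that] step.prems[OF that] by simp
  then show ?case by (rule thru.step[OF step.hyps(1-3)])
qed

lemma thru_lhom:
  assumes "thru R M X Y h" "left_module R X" "left_module R Y"
  shows "lhom R X Y h"
  using assms(1)
proof (induction rule: thru.induct)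
  case (zero h)
  then show ?case using lhom_cong[OF assms(2), of h "\<lambda>x. \<zero>\<^bsub>Y\<^esub>" Y] lhom_zero[OF assms(3)] by simp
next
  case (step h g f k)
  have "lhom R X Y (\<lambda>x. h x \<oplus>\<^bsub>Y\<^esub> f (g x))"
    by (rule lhom_add[OF assms(3) step.IH lhom_comp[OF step.hyps(2,3)]])
  then show ?case
    using lhom_cong[OF assms(2), of k "\<lambda>x. h x \<oplus>\<^bsub>Y\<^esub> f (g x)" Y] step.hyps(4) by simp
qed

lemma thru_add:
  assumes "thru R M X Y k" "thru R M X Y h" "left_module R X" "left_module R Y"
  shows "thru R M X Y (\<lambda>x. h x \<oplus>\<^bsub>Y\<^esub> k x)"
  using assms(1)
proof -
  interpret Y: left_module R Y by fact
  note h = lhomD(1)[OF thru_lhom[OF assms(2-4)]]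
  show ?thesis using assms(1)
  proof (induction rule: thru.induct)
    case (zero k)
    have "h x \<oplus>\<^bsub>Y\<^esub> k x = h x" if "x \<in> carrier X" for x using h[OF that] zero[OF that] by simp
    then show ?case by (rule thru_cong[OF assms(2)])
  next
    case (step k g f l)
    have "h x \<oplus>\<^bsub>Y\<^esub> l x = (h x \<oplus>\<^bsub>Y\<^esub> k x) \<oplus>\<^bsub>Y\<^esub> f (g x)" if "x \<in> carrier X" for x
      using h[OF that] step.hyps(4)[OF that] lhomD(1)[OF thru_lhom[OF step.hyps(1) assms(3,4)] that]
        lhomD(1)[OF step.hyps(3) lhomD(1)[OF step.hyps(2) that]] by (simp add: Y.M.a_assoc)
    then show ?case by (rule thru.step[OF step.IH step.hyps(2,3)])
  qed
qed

text \<open>With \<open>thru_add\<close> this makes the maps through \<open>M\<close> a two-sided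
  ideal, so that membership of an object in add \<open>M\<close> can be tested on its
  identity.\<close>

lemma thru_comp:
  assumes "thru R M X Y h" "lhom R Y Z f" "lhom R W X g" "left_module R Y" "left_module R Z"
    "left_module R X"
  shows "thru R M W Z (\<lambda>x. f (h (g x)))"
  using assms(1)
proof (induction rule: thru.induct)
  case (zero h)
  have "f (h (g x)) = \<zero>\<^bsub>Z\<^esub>" if "x \<in> carrier W" for x
    using zero lhomD(1)[OF assms(3) that] lhomZ(1)[OF assms(2,4,5)] by simp
  then show ?case by (rule thru.zero)
next
  case (step h g' f' k)
  have h: "lhom R X Y h" by (rule thru_lhom[OF step.hyps(1) assms(6,4)])
  have "f (k (g x)) = f (h (g x)) \<oplus>\<^bsub>Z\<^esub> f (f' (g' (g x)))" if "x \<in> carrier W" for x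
  proof -
    have x: "g x \<in> carrier X" using lhomD(1)[OF assms(3) that] .
    show ?thesis
      using lhomD(2)[OF assms(2) lhomD(1)[OF h x] lhomD(1)[OF step.hyps(3) lhomD(1)[OF step.hyps(2) x]]]
        step.hyps(4)[OF x] by simp
  qed
  then show ?case
    by (rule thru.step[OF step.IH lhom_comp[OF assms(3) step.hyps(2)] lhom_comp[OF step.hyps(3) assms(2)]])
qed

lemma thru_comp1:
  assumes "lhom R X M g" "lhom R M Y f" "left_module R Y"
  shows "thru R M X Y (\<lambda>x. f (g x))"
proof -
  interpret left_module R Y by fact
  have z: "thru R M X Y (\<lambda>x. \<zero>\<^bsub>Y\<^esub>)" by (rule thru.zero) (rule refl)
  have "f (g x) = \<zero>\<^bsub>Y\<^esub> \<oplus>\<^bsub>Y\<^esub> f (g x)" if "x \<in> carrier X" for x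
    using lhomD(1)[OF assms(2) lhomD(1)[OF assms(1) that]] by simp
  then show ?thesis by (rule thru.step[OF z assms(1,2)])
qed

text \<open>Inserting the identity of \<open>M\<close>, a sum of composites through
  \<open>N\<close>, into each \<open>f g\<close> writes it as a map through \<open>N\<close>. For
  identities this is transitivity of the additive closure.\<close>

lemma thru_trans:
  assumes "thru R M X Y h" "thru R N M M (\<lambda>x. x)" "left_module R X" "left_module R Y" "left_module R M"
  shows "thru R N X Y h"
  using assms
proof (induction rule: thru.induct)
  case (zero h) then show ?case by (intro thru.zero)
next
  case (step h g f k)
  have "thru R N X Y (\<lambda>x. f (g x))"
    by (rule thru_comp[OF step.prems(1) step.hyps(3,2) step.prems(4,3,4)])
  then show ?case
    by (rule thru_cong[OF thru_add[OF _ step.IH[OF step.prems] step.prems(2,3)]]) (rule step.hyps(4))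
qed

section \<open>Finite copowers and the additive closure\<close>

lemma copower_simps [simp]:
  "carrier (copower M n) = {..<n} \<rightarrow>\<^sub>E carrier M" "\<zero>\<^bsub>copower M n\<^esub> = (\<lambda>i\<in>{..<n}. \<zero>\<^bsub>M\<^esub>)"
  "x \<oplus>\<^bsub>copower M n\<^esub> y = (\<lambda>i\<in>{..<n}. x i \<oplus>\<^bsub>M\<^esub> y i)" "a \<odot>\<^bsub>copower M n\<^esub> x = (\<lambda>i\<in>{..<n}. a \<odot>\<^bsub>M\<^esub> x i)"
  by (simp_all add: copower_def)

lemma left_module_copower:
  assumes "left_module R M"
  shows "left_module R (copower M n)"
proof -
  interpret M: left_module R M by fact
  have "abelian_group (copower M n)"
  proof (rule abelian_groupI)
    show "\<exists>y\<in>carrier (copower M n). y \<oplus>\<^bsub>copower M n\<^esub> x = \<zero>\<^bsub>copower M n\<^esub>" if "x \<in> carrier (copower M n)" for x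
      using that by (intro bexI[of _ "\<lambda>i\<in>{..<n}. \<ominus>\<^bsub>M\<^esub> x i"]) (auto simp: M.l_neg PiE_iff)
  qed (auto simp: M.M.a_assoc M.M.l_zero PiE_iff extensional_def fun_eq_iff intro: M.M.a_comm)
  then show ?thesis
    by (intro left_moduleI) (auto simp: M.smult_l_distr M.smult_r_distr M.smult_assoc1 M.R.ring_axioms
        PiE_iff extensional_def fun_eq_iff)
qed

text \<open>A sum of \<open>n\<close> composites is a single composite through the
  \<open>n\<close>-th copower, with the inner maps as coordinates and the outer ones added
  up.\<close>

lemma retract_copower:
  assumes "left_module R M" "left_module R X" "left_module R Y" "thru R M X Y h"
  shows "\<exists>n a b. lhom R X (copower M n) a \<and> lhom R (copower M n) Y b \<and> (\<forall>x\<in>carrier X. h x = b (a x))"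
  using assms(4)
proof (induction rule: thru.induct)
  case (zero h)
  interpret X: left_module R X by fact
  interpret Y: left_module R Y by fact
  show ?case
    by (rule exI[of _ 0], rule exI[of _ "\<lambda>x. \<zero>\<^bsub>copower M 0\<^esub>"], rule exI[of _ "\<lambda>x. \<zero>\<^bsub>Y\<^esub>"])
      (use zero left_module_copower[OF assms(1), of 0] in \<open>auto simp: lhom_def\<close>)
next
  case (step h g f k)
  then obtain n a b where ab: "lhom R X (copower M n) a" "lhom R (copower M n) Y b" "\<forall>x\<in>carrier X. h x = b (a x)"
    by blast
  interpret X: left_module R X by fact
  interpret Y: left_module R Y by fact
  interpret M: left_module R M by fact
  note a = lhomD[OF ab(1)] and b = lhomD[OF ab(2)] and g = lhomD[OF step.hyps(2)] and f = lhomD[OF step.hyps(3)]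
  \<comment> \<open>The new composite takes coordinate \<open>n\<close>; restriction to
    \<open>{..<n}\<close> recovers the old vector.\<close>
  define a' where "a' x = (\<lambda>i\<in>{..<Suc n}. if i < n then a x i else g x)" for x
  define b' where "b' v = b (restrict v {..<n}) \<oplus>\<^bsub>Y\<^esub> f (v n)" for v
  have "lhom R X (copower M (Suc n)) a'"
  proof (rule lhomI)
    show "a' x \<in> carrier (copower M (Suc n))" if "x \<in> carrier X" for x
      using that a(1)[OF that] g(1) by (auto simp: a'_def PiE_iff)
  qed (auto simp: a'_def a g fun_eq_iff)
  moreover have "lhom R (copower M (Suc n)) Y b'"
  proof (rule lhomI)
    have r: "restrict v {..<n} \<in> carrier (copower M n)" "v n \<in> carrier M" if "v \<in> carrier (copower M (Suc n))" for v
      using that by (auto simp: PiE_iff)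
    show "b' v \<in> carrier Y" if "v \<in> carrier (copower M (Suc n))" for v
      using r[OF that] b(1) f(1) by (simp add: b'_def)
    have e1: "restrict (v \<oplus>\<^bsub>copower M (Suc n)\<^esub> w) {..<n} = restrict v {..<n} \<oplus>\<^bsub>copower M n\<^esub> restrict w {..<n}"
      for v w by (auto simp: fun_eq_iff)
    show "b' (v \<oplus>\<^bsub>copower M (Suc n)\<^esub> w) = b' v \<oplus>\<^bsub>Y\<^esub> b' w"
      if "v \<in> carrier (copower M (Suc n))" "w \<in> carrier (copower M (Suc n))" for v w
      unfolding b'_def e1 using r[OF that(1)] r[OF that(2)] b(1,2) f by (simp add: Y.M.a_ac del: copower_simps(3))
        (simp add: f Y.M.a_ac b)
    have e2: "restrict (c \<odot>\<^bsub>copower M (Suc n)\<^esub> v) {..<n} = c \<odot>\<^bsub>copower M n\<^esub> restrict v {..<n}"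
      for c v by (auto simp: fun_eq_iff)
    show "b' (c \<odot>\<^bsub>copower M (Suc n)\<^esub> v) = c \<odot>\<^bsub>Y\<^esub> b' v"
      if "c \<in> carrier R" "v \<in> carrier (copower M (Suc n))" for v c
      unfolding b'_def e2 using r[OF that(2)] that(1) b(1,3) f
      by (simp add: Y.smult_r_distr del: copower_simps(4)) (simp add: f Y.smult_r_distr)
  qed
  moreover have "k x = b' (a' x)" if x: "x \<in> carrier X" for x
  proof -
    have "restrict (a' x) {..<n} = a x"
      using a(1)[OF x] by (auto simp: a'_def fun_eq_iff PiE_iff extensional_def)
    then show ?thesis using ab(3) step.hyps(4)[OF x] x by (simp add: b'_def) (simp add: a'_def)
  qed
  ultimately show ?case by blast
qed

text \<open>The identity is the sum of the coordinate projections followed by the coordinate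
  inclusions. The induction truncates a vector after its first \<open>m\<close> coordinates.\<close>

lemma thru_copower:
  assumes M: "left_module R M"
  shows "thru R M (copower M n) (copower M n) (\<lambda>x. x)"
proof -
  interpret M: left_module R M by fact
  have "thru R M (copower M n) (copower M n) (\<lambda>x. \<lambda>i\<in>{..<n}. if i < m then x i else \<zero>\<^bsub>M\<^esub>)" if "m \<le> n" for m
    using that
  proof (induction m)
    case 0 show ?case by (rule thru.zero) (simp add: fun_eq_iff)
  next
    case (Suc m)
    show ?case
    proof (rule thru.step[OF Suc.IH])
      show "lhom R (copower M n) M (\<lambda>x. x m)" using Suc.prems by (auto simp: lhom_def PiE_iff)
      show "lhom R M (copower M n) (\<lambda>y. \<lambda>i\<in>{..<n}. if i = m then y else \<zero>\<^bsub>M\<^esub>)"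
        by (auto simp: lhom_def fun_eq_iff)
    qed (use Suc.prems in \<open>auto simp: fun_eq_iff PiE_iff less_Suc_eq\<close>)
  qed
  from this[of n] show ?thesis
    by (rule thru_cong) (auto simp: PiE_iff extensional_def fun_eq_iff)
qed

text \<open>\<open>retract_copower\<close> collects composites in a copower, and
  \<open>thru_copower\<close> spreads a copower out into composites. The carrier types of
  \<open>X\<close> and \<open>M\<close> are independent, so that \<open>M\<close> can later be
  \<open>P\<close> with its own type.\<close>

lemma add_cat_iff:
  assumes M: "left_module R M"
  shows "X \<in> add_cat R M \<longleftrightarrow> X \<in> fgmod R \<and> thru R M X X (\<lambda>x. x)"
proof
  assume X: "X \<in> add_cat R M"
  then obtain n where n: "X \<in> fgmod R" "summand R X (copower M n)" by (auto simp: add_cat_def)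
  have X': "left_module R X" using n fgmodD by blast
  have C: "left_module R (copower M n)" by (rule left_module_copower[OF M])
  obtain i r where "retract R X (copower M n) i r"
    using n summand_iff_retract[OF X' C] by blast
  then have ir: "lhom R X (copower M n) i" "lhom R (copower M n) X r" "\<And>x. x \<in> carrier X \<Longrightarrow> r (i x) = x"
    by (auto simp: retract_def)
  have "thru R M X X (\<lambda>x. r (i x))"
    by (rule thru_comp[OF thru_copower[OF M] ir(2,1) C X' C])
  then show "X \<in> fgmod R \<and> thru R M X X (\<lambda>x. x)" using n(1) ir(3) thru_cong by fastforce
next
  assume X: "X \<in> fgmod R \<and> thru R M X X (\<lambda>x. x)"
  then have X': "left_module R X" using fgmodD by blast
  obtain n a b where "lhom R X (copower M n) a" "lhom R (copower M n) X b" "\<forall>x\<in>carrier X. x = b (a x)"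
    using retract_copower[OF M X' X'] X by blast
  then have "retract R X (copower M n) a b" by (simp add: retract_def)
  then have "summand R X (copower M n)"
    using summand_iff_retract[OF X' left_module_copower[OF M]] by blast
  then show "X \<in> add_cat R M" using X by (auto simp: add_cat_def)
qed

lemma thru_retract:
  assumes "thru R M X X (\<lambda>x. x)" "retract R W X i r" "left_module R W" "left_module R X"
  shows "thru R M W W (\<lambda>x. x)"
proof -
  have "thru R M W W (\<lambda>x. r (i x))"
    using thru_comp[OF assms(1) _ _ assms(4,3,4)] assms(2) unfolding retract_def by blast
  then show ?thesis by (rule thru_cong) (use assms(2) in \<open>simp add: retract_def\<close>)
qed

lemma thru_retract_base:
  assumes "retract R M N i r" "left_module R M"
  shows "thru R N M M (\<lambda>x. x)"
proof -
  have "thru R N M M (\<lambda>x. r (i x))"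
    using thru_comp1[OF _ _ assms(2)] assms(1) unfolding retract_def by blast
  then show ?thesis by (rule thru_cong) (use assms(1) in \<open>simp add: retract_def\<close>)
qed

lemma thru_dsum:
  assumes "thru R M X X (\<lambda>x. x)" "thru R M Y Y (\<lambda>x. x)" "left_module R X" "left_module R Y"
  shows "thru R M (dsum X Y) (dsum X Y) (\<lambda>x. x)"
proof -
  interpret X: left_module R X by fact
  interpret Y: left_module R Y by fact
  note D = left_module_dsum[OF assms(3,4)] and m = dsum_maps[OF assms(3,4)]
  have "thru R M (dsum X Y) (dsum X Y) (\<lambda>z. (fst z, \<zero>\<^bsub>Y\<^esub>))"
    by (rule thru_comp[OF assms(1) m(1,3) assms(3) D assms(3)])
  moreover have "thru R M (dsum X Y) (dsum X Y) (\<lambda>z. (\<zero>\<^bsub>X\<^esub>, snd z))"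
    by (rule thru_comp[OF assms(2) m(2,4) assms(4) D assms(4)])
  ultimately show ?thesis by (rule thru_cong[OF thru_add[OF _ _ D D]]) auto
qed

text \<open>The element is a parameter, so that a zero module exists on every carrier type.\<close>

definition zero_mod :: "'m \<Rightarrow> ('a, 'm) module"
  where "zero_mod z = mk_module {z} z (\<lambda>x y. z) (\<lambda>a x. z)"

lemma zero_mod:
  assumes "ring R"
  shows "zero_mod z \<in> fgmod R" "zero_module (zero_mod z)"
proof -
  interpret ring R by fact
  have "abelian_group (zero_mod z)"
    by (rule abelian_groupI) (auto simp: zero_mod_def)
  then interpret Z: left_module R "zero_mod z"
    by (intro left_moduleI) (auto simp: zero_mod_def ring_axioms)
  have "H = carrier (zero_mod z)" if "submodule H R (zero_mod z)" for H
    using Z.submoduleD(1,2)[OF that] by (auto simp: zero_mod_def)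
  then have "fin_gen R (zero_mod z)" unfolding fin_gen_def by blast
  then show "zero_mod z \<in> fgmod R" by (simp add: fgmod_def Z.left_module_axioms)
  show "zero_module (zero_mod z)" by (simp add: zero_module_def zero_mod_def)
qed

section \<open>Chain conditions\<close>

text \<open>The minimum condition is well-foundedness of this relation, the maximum condition that
  of its converse. Induction over submodules and extremal choices then come from
  \<open>wf\<close>.\<close>

definition sub_rel :: "('a, 'r) ring_scheme \<Rightarrow> ('a, 'm) module \<Rightarrow> ('m set \<times> 'm set) set"
  where "sub_rel R M = {(A, B). submodule A R M \<and> submodule B R M \<and> A \<subset> B}"

definition art :: "('a, 'r) ring_scheme \<Rightarrow> ('a, 'm) module \<Rightarrow> bool"
  where "art R M \<longleftrightarrow> wf (sub_rel R M)"

definition noe :: "('a, 'r) ring_scheme \<Rightarrow> ('a, 'm) module \<Rightarrow> bool"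
  where "noe R M \<longleftrightarrow> wf ((sub_rel R M)\<inverse>)"

definition flen :: "('a, 'r) ring_scheme \<Rightarrow> ('a, 'm) module \<Rightarrow> bool"
  where "flen R M \<longleftrightarrow> art R M \<and> noe R M"

text \<open>The device for extensions, used in place of quotient modules: a submodule is measured
  first by \<open>f\<close>, and where \<open>f\<close> stands still by \<open>g\<close>.\<close>

lemma wf_lex_via:
  assumes "wf r1" "wf r2" "\<And>A B. (A, B) \<in> r \<Longrightarrow> (f A, f B) \<in> r1 \<or> f A = f B \<and> (g A, g B) \<in> r2"
  shows "wf r"
proof (rule wf_subset)
  show "wf (inv_image (r1 <*lex*> r2) (\<lambda>A. (f A, g A)))"
    by (intro wf_inv_image wf_lex_prod assms(1,2))
  show "r \<subseteq> inv_image (r1 <*lex*> r2) (\<lambda>A. (f A, g A))"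
    using assms(3) by (auto simp: inv_image_def)
qed

lemma flen_lex:
  assumes "flen R1 M1" "flen R2 M2"
    "\<And>A B. (A, B) \<in> sub_rel R M \<Longrightarrow> (f A, f B) \<in> sub_rel R1 M1 \<or> f A = f B \<and> (g A, g B) \<in> sub_rel R2 M2"
  shows "flen R M"
proof -
  have "wf (sub_rel R M)"
    using assms(1,2) by (intro wf_lex_via[of "sub_rel R1 M1" "sub_rel R2 M2" _ f g] assms(3))
      (auto simp: flen_def art_def)
  moreover have "wf ((sub_rel R M)\<inverse>)"
  proof (rule wf_lex_via[of "(sub_rel R1 M1)\<inverse>" "(sub_rel R2 M2)\<inverse>" _ f g])
    show "wf ((sub_rel R1 M1)\<inverse>)" "wf ((sub_rel R2 M2)\<inverse>)"
      using assms(1,2) by (simp_all add: flen_def noe_def)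
    show "(f A, f B) \<in> (sub_rel R1 M1)\<inverse> \<or> f A = f B \<and> (g A, g B) \<in> (sub_rel R2 M2)\<inverse>"
      if "(A, B) \<in> (sub_rel R M)\<inverse>" for A B
      using assms(3)[of B A] that by auto
  qed
  ultimately show ?thesis by (simp add: flen_def art_def noe_def)
qed

text \<open>Strict chains go to strict chains under \<open>f\<close>, ascending ones as well as
  descending ones.\<close>

lemma flen_transport:
  assumes "flen R' M'" "\<And>A B. (A, B) \<in> sub_rel R M \<Longrightarrow> (f A, f B) \<in> sub_rel R' M'"
  shows "flen R M"
  by (rule flen_lex[OF assms(1,1), where f = f and g = f]) (use assms(2) in blast)

lemma flen_submod:
  assumes "left_module R M" "submodule A R M" "flen R M"
  shows "flen R (submod M A)"
  by (rule flen_transport[OF assms(3), of _ _ "\<lambda>B. B"])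
    (auto simp: sub_rel_def submodule_submod[OF assms(1,2)])

lemma set_add_subset:
  assumes "left_module R M" "submodule C R M" "A \<subseteq> C" "B \<subseteq> C"
  shows "A <+>\<^bsub>M\<^esub> B \<subseteq> C"
proof
  fix x assume "x \<in> A <+>\<^bsub>M\<^esub> B"
  then obtain a b where "a \<in> A" "b \<in> B" "x = a \<oplus>\<^bsub>M\<^esub> b" by (auto simp: set_add_iff)
  then show "x \<in> C" using left_module.submoduleD(3)[OF assms(1,2)] assms(3,4) by (simp add: subset_iff)
qed

text \<open>The quotient of \<open>M\<close> by \<open>N\<close> is cyclic, hence an image of
  \<open>reg R\<close>. In its place the left ideal \<open>?I L\<close> of all \<open>r\<close> with
  \<open>r x\<close> in \<open>L + N\<close> records how \<open>L\<close> sits above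
  \<open>N\<close>.\<close>

lemma flen_cyclic_ext:
  assumes M: "left_module R M" and N: "submodule N R M" "flen R (submod M N)"
    and R: "flen R (reg R)" and x: "x \<in> carrier M"
    and gen: "\<And>m. m \<in> carrier M \<Longrightarrow> \<exists>n\<in>N. \<exists>r\<in>carrier R. m = n \<oplus>\<^bsub>M\<^esub> r \<odot>\<^bsub>M\<^esub> x"
  shows "flen R M"
proof -
  interpret M: left_module R M by fact
  let ?I = "\<lambda>L. {r \<in> carrier R. r \<odot>\<^bsub>M\<^esub> x \<in> L <+>\<^bsub>M\<^esub> N}"
  have reg: "left_module R (reg R)" using left_module_reg[OF M.R.ring_axioms] .
  have I: "submodule (?I L) R (reg R)" if "submodule L R M" for L
    using submodule_vimage[OF reg M lhom_smult[OF M x] submodule_sum(1)[OF M that N(1)]] by simp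
  note N' = M.submoduleD[OF N(1)]
  show ?thesis
  proof (rule flen_lex[OF N(2) R, of R M "\<lambda>L. L \<inter> N" ?I])
    fix L L' assume "(L, L') \<in> sub_rel R M"
    then have L: "submodule L R M" "submodule L' R M" "L \<subset> L'" by (auto simp: sub_rel_def)
    note D = M.submoduleD[OF L(1)] and D' = M.submoduleD[OF L(2)]
    have LN: "submodule (L \<inter> N) R (submod M N)" "submodule (L' \<inter> N) R (submod M N)"
      using submodule_inter[OF M L(1) N(1)] submodule_inter[OF M L(2) N(1)]
      by (simp_all add: submodule_submod[OF M N(1)])
    have mono: "L \<inter> N \<subseteq> L' \<inter> N" "?I L \<subseteq> ?I L'" using L(3) by (auto simp: set_add_iff)
    \<comment> \<open>Modular law. Write \<open>y = n + r x\<close> with \<open>n\<close> in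
      \<open>N\<close>; then \<open>r x\<close> lies in \<open>L' + N\<close>, so by equality of the
      left ideals in \<open>L + N\<close>. This leaves \<open>y\<close> in \<open>L\<close> up to an
      element of \<open>L' \<inter> N = L \<inter> N\<close>.\<close>
    have "L' \<subseteq> L" if eq: "L \<inter> N = L' \<inter> N" "?I L = ?I L'"
    proof
      fix y assume y: "y \<in> L'"
      then have yM: "y \<in> carrier M" using D'(7) by blast
      obtain n r where nr: "n \<in> N" "r \<in> carrier R" "y = n \<oplus>\<^bsub>M\<^esub> r \<odot>\<^bsub>M\<^esub> x" using gen[OF yM] by blast
      have c: "n \<in> carrier M" "r \<odot>\<^bsub>M\<^esub> x \<in> carrier M" using nr N'(7) x by auto
      have "r \<odot>\<^bsub>M\<^esub> x = y \<oplus>\<^bsub>M\<^esub> (\<ominus>\<^bsub>M\<^esub> n)"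
        unfolding nr(3) using c by (simp add: M.M.a_ac M.M.r_neg2)
      then have "r \<odot>\<^bsub>M\<^esub> x \<in> L' <+>\<^bsub>M\<^esub> N" using y N'(5)[OF nr(1)] unfolding set_add_iff by blast
      then have "r \<in> ?I L" using nr(2) eq(2) by simp
      then obtain l n' where l: "l \<in> L" "n' \<in> N" "r \<odot>\<^bsub>M\<^esub> x = l \<oplus>\<^bsub>M\<^esub> n'" by (auto simp: set_add_iff)
      have c': "l \<in> carrier M" "n' \<in> carrier M" using l D(7) N'(7) by auto
      have "y = (n \<oplus>\<^bsub>M\<^esub> n') \<oplus>\<^bsub>M\<^esub> l" using nr(3) l(3) c c' by (simp add: M.M.a_ac)
      then have "y \<ominus>\<^bsub>M\<^esub> l = n \<oplus>\<^bsub>M\<^esub> n'" using c c' by (simp add: M.add_minus_self)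
      then have "y \<ominus>\<^bsub>M\<^esub> l \<in> L' \<inter> N"
        using D'(6)[OF y, of l] l(1) L(3) N'(3)[OF nr(1) l(2)] by (metis IntI psubsetD)
      then have "y \<ominus>\<^bsub>M\<^esub> l \<in> L" using eq(1) by blast
      then have "(y \<ominus>\<^bsub>M\<^esub> l) \<oplus>\<^bsub>M\<^esub> l \<in> L" using l(1) D(3) by blast
      then show "y \<in> L" using M.minus_add_cancel[OF yM c'(1)] by simp
    qed
    then have "\<not> (L \<inter> N = L' \<inter> N \<and> ?I L = ?I L')" using L(3) by blast
    then show "(L \<inter> N, L' \<inter> N) \<in> sub_rel R (submod M N) \<or>
        L \<inter> N = L' \<inter> N \<and> (?I L, ?I L') \<in> sub_rel R (reg R)"
      using mono LN I[OF L(1)] I[OF L(2)] unfolding sub_rel_def by blast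
  qed
qed

lemma submodule_cyclic:
  fixes M :: "('a, 'm) module"
  assumes "left_module R M" "x \<in> carrier M"
  shows "submodule ((\<lambda>r. r \<odot>\<^bsub>M\<^esub> x) ` carrier R) R M" "x \<in> (\<lambda>r. r \<odot>\<^bsub>M\<^esub> x) ` carrier R"
proof -
  interpret left_module R M by fact
  have reg: "left_module R (reg R)" using left_module_reg[OF R.ring_axioms] .
  show "submodule ((\<lambda>r. r \<odot>\<^bsub>M\<^esub> x) ` carrier R) R M"
    using submodule_image[OF reg assms(1) lhom_smult[OF assms] left_module.submodule_carrier[OF reg]] by simp
  show "x \<in> (\<lambda>r. r \<odot>\<^bsub>M\<^esub> x) ` carrier R"
    using smult_one[OF assms(2)] R.one_closed by force
qed

lemma sub_rel_zero:
  assumes M: "left_module R M"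
  shows "sub_rel R (submod M {\<zero>\<^bsub>M\<^esub>}) = {}"
proof -
  interpret M: left_module R M by fact
  have "A = {\<zero>\<^bsub>M\<^esub>}" if "submodule A R M" "A \<subseteq> {\<zero>\<^bsub>M\<^esub>}" for A
    using that(2) M.submoduleD(2)[OF that(1)] by blast
  then show ?thesis
    by (auto simp: sub_rel_def submodule_submod[OF M M.submodule_zero])
qed

text \<open>Generators are adjoined one at a time, each step being an extension by a cyclic
  module.\<close>

lemma flen_fgmod:
  assumes "M \<in> fgmod R" "flen R (reg R)"
  shows "flen R M"
proof -
  have M: "left_module R M" using assms fgmodD by blast
  interpret M: left_module R M by fact
  obtain S where S: "S \<subseteq> carrier M" "finite S" and gen: "\<And>H. submodule H R M \<Longrightarrow> S \<subseteq> H \<Longrightarrow> H = carrier M"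
    using fgmodE[OF assms(1)] by blast
  have "\<exists>N. submodule N R M \<and> T \<subseteq> N \<and> flen R (submod M N)" if "finite T" "T \<subseteq> carrier M" for T
    using that
  proof (induction T)
    case empty
    have "flen R (submod M {\<zero>\<^bsub>M\<^esub>})"
      by (simp add: flen_def art_def noe_def sub_rel_zero[OF M])
    then show ?case using M.submodule_zero by blast
  next
    case (insert x T)
    then obtain N where N: "submodule N R M" "T \<subseteq> N" "flen R (submod M N)" by blast
    have x: "x \<in> carrier M" using insert by simp
    let ?C = "(\<lambda>r. r \<odot>\<^bsub>M\<^esub> x) ` carrier R"
    let ?N = "N <+>\<^bsub>M\<^esub> ?C"
    note C = submodule_cyclic[OF M x]
    note s = submodule_sum[OF M N(1) C(1)]
    have "flen R (submod M ?N)"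
    proof (rule flen_cyclic_ext[OF left_module_submod[OF M s(1)] _ _ assms(2)])
      show "submodule N R (submod M ?N)" using N(1) s by (simp add: submodule_submod[OF M s(1)])
      show "flen R (submod (submod M ?N) N)" using N(3) by simp
      show "x \<in> carrier (submod M ?N)" using C(2) s(3) by auto
    qed (auto simp: set_add_iff)
    moreover have "insert x T \<subseteq> ?N" using C(2) s(2,3) N(2) by blast
    ultimately show ?case using s(1) by blast
  qed
  from this[OF S(2,1)] obtain N where N: "submodule N R M" "S \<subseteq> N" "flen R (submod M N)" by blast
  then show ?thesis using gen[OF N(1,2)] by simp
qed

text \<open>A maximal finitely generated submodule contains every element, since it could otherwise
  be enlarged by a cyclic one.\<close>

lemma noe_fgmod:
  assumes M: "left_module R M" and "noe R M"
  shows "M \<in> fgmod R"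
proof -
  interpret M: left_module R M by fact
  let ?Q = "{N. submodule N R M \<and> (\<exists>S\<subseteq>N. finite S \<and> (\<forall>H. submodule H R M \<and> S \<subseteq> H \<longrightarrow> N \<subseteq> H))}"
  have "{\<zero>\<^bsub>M\<^esub>} \<in> ?Q" using M.submodule_zero M.submoduleD(2) by auto
  then obtain N where N: "N \<in> ?Q" and max: "\<And>N'. (N', N) \<in> (sub_rel R M)\<inverse> \<Longrightarrow> N' \<notin> ?Q"
    by (rule wfE_min[OF assms(2)[unfolded noe_def]]) blast
  from N have "submodule N R M" "\<exists>S\<subseteq>N. finite S \<and> (\<forall>H. submodule H R M \<and> S \<subseteq> H \<longrightarrow> N \<subseteq> H)"
    by simp_all
  then obtain S where S: "submodule N R M" "S \<subseteq> N" "finite S"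
    and gen': "\<forall>H. submodule H R M \<and> S \<subseteq> H \<longrightarrow> N \<subseteq> H" by metis
  have gen: "N \<subseteq> H" if "submodule H R M" "S \<subseteq> H" for H using gen' that by simp
  have "carrier M \<subseteq> N"
  proof
    fix x assume x: "x \<in> carrier M"
    let ?C = "(\<lambda>r. r \<odot>\<^bsub>M\<^esub> x) ` carrier R"
    let ?N = "N <+>\<^bsub>M\<^esub> ?C"
    note C = submodule_cyclic[OF M x]
    note s = submodule_sum[OF M S(1) C(1)]
    have "?N \<subseteq> H" if H: "submodule H R M" "insert x S \<subseteq> H" for H
    proof
      fix y assume "y \<in> ?N"
      then obtain n r where "n \<in> N" "r \<in> carrier R" "y = n \<oplus>\<^bsub>M\<^esub> r \<odot>\<^bsub>M\<^esub> x" by (auto simp: set_add_iff)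
      then show "y \<in> H" using M.submoduleD(3)[OF H(1), of n] M.submoduleD(4)[OF H(1), of r x] H(2) gen[OF H(1)] by auto
    qed
    moreover have "insert x S \<subseteq> ?N" "finite (insert x S)" using S C(2) s(2,3) by auto
    ultimately have "?N \<in> ?Q" using s(1) unfolding mem_Collect_eq by (intro conjI exI[of _ "insert x S"]) auto
    then have "(?N, N) \<notin> (sub_rel R M)\<inverse>" using max by blast
    then have "?N = N" using s(1,2) S(1) unfolding sub_rel_def by blast
    then show "x \<in> N" using C(2) s(3) by blast
  qed
  then have "N = carrier M" using M.submoduleD(1)[OF S(1)] by blast
  then show ?thesis
    using S gen M.submoduleD(1) by (intro fgmodI[OF M, of S]) (auto intro: subset_antisym)
qed

lemma flen_submod_fgmod:
  assumes "left_module R M" "flen R M" "submodule A R M"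
  shows "submod M A \<in> fgmod R"
  using noe_fgmod[OF left_module_submod[OF assms(1,3)]] flen_submod[OF assms(1,3,2)] by (simp add: flen_def)

text \<open>For commutative rings the descending chain condition implies the ascending one. Let \<open>I\<close> be an ideal
  all of whose proper subideals are Noetherian. If some \<open>a\<close> has \<open>0 \<noteq> a I \<noteq> I\<close>, then \<open>I\<close> is an
  extension of \<open>a I\<close> by the kernel of multiplication by \<open>a\<close>. Otherwise every \<open>a\<close> acts on \<open>I\<close> as zero or
  invertibly, so that \<open>I\<close> is an extension of a simple module by a maximal proper subideal.\<close>

lemma art_imp_noe:
  fixes k (structure)
  assumes k: "cring k" and art: "art k (reg k)"
  shows "noe k (reg k)"
proof -
  interpret cring k by fact
  let ?K = "reg k"
  have K: "left_module k ?K" using left_module_reg[OF ring_axioms] .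
  interpret K: left_module k ?K by fact
  have mult: "lhom k ?K ?K (\<lambda>x. a \<otimes> x)" if "a \<in> carrier k" for a
    using that by (intro lhomI) (auto simp: r_distr m_lcomm)
  have sub: "submodule ((\<lambda>x. a \<otimes> x) ` I) k ?K" if "a \<in> carrier k" "submodule I k ?K" for a I
    using submodule_image[OF K K mult[OF that(1)] that(2)] .
  have "submodule I k ?K \<longrightarrow> noe k (submod ?K I)" for I
  proof (induction I rule: wf_induct_rule[OF art[unfolded art_def]])
    case (1 I)
    show ?case
    proof
      assume I: "submodule I k ?K"
      note I' = K.submoduleD[OF I]
      have IH: "noe k (submod ?K J)" if "submodule J k ?K" "J \<subset> I" for J
        using 1[of J] that I by (auto simp: sub_rel_def)
      show "noe k (submod ?K I)"
      proof (cases "\<exists>a\<in>carrier k. (\<lambda>x. a \<otimes> x) ` I \<noteq> {\<zero>} \<and> (\<lambda>x. a \<otimes> x) ` I \<noteq> I")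
        case True
        then obtain a where a: "a \<in> carrier k" "(\<lambda>x. a \<otimes> x) ` I \<noteq> {\<zero>}" "(\<lambda>x. a \<otimes> x) ` I \<noteq> I"
          by blast
        let ?a = "\<lambda>x. a \<otimes> x"
        let ?Z = "{x \<in> I. ?a x = \<zero>}"
        have "?Z = hom_ker ?K ?K ?a \<inter> I" using I'(1) by (auto simp: hom_ker_def)
        then have Z: "submodule ?Z k ?K"
          using submodule_inter[OF K submodule_ker[OF K K mult[OF a(1)]] I] by simp
        have aI: "?a ` I \<subset> I" using I'(4)[OF a(1)] a(3) by auto
        have "?Z \<noteq> I"
        proof
          assume "?Z = I"
          then have "?a x = \<zero>" if "x \<in> I" for x using that by blast
          then have "?a ` I \<subseteq> {\<zero>}" by blast
          moreover have "\<zero> \<in> ?a ` I" using I'(2) a(1) by force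
          ultimately show False using a(2) by blast
        qed
        then have ZI: "?Z \<subset> I" by blast
        \<comment> \<open>Extension argument for multiplication by \<open>a\<close>: nested ideals
          inside \<open>I\<close> with the same trace on the kernel \<open>?Z\<close> and the same
          image in \<open>a I\<close> coincide. Both \<open>?Z\<close> and \<open>a I\<close> are
          proper in \<open>I\<close>, so the induction hypothesis covers them.\<close>
        show ?thesis unfolding noe_def
        proof (rule wf_lex_via[OF IH[OF Z ZI, unfolded noe_def] IH[OF sub[OF a(1) I] aI, unfolded noe_def],
              of _ "\<lambda>A. A \<inter> ?Z" "\<lambda>A. ?a ` A"])
          fix A B assume "(A, B) \<in> (sub_rel k (submod ?K I))\<inverse>"
          then have AB: "submodule A k ?K" "submodule B k ?K" "B \<subset> A" "A \<subseteq> I"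
            by (auto simp: sub_rel_def submodule_submod[OF K I])
          note A' = K.submoduleD[OF AB(1)] and B' = K.submoduleD[OF AB(2)]
          have "A \<subseteq> B" if eq: "A \<inter> ?Z = B \<inter> ?Z" "?a ` A = ?a ` B"
          proof
            fix x assume x: "x \<in> A"
            then obtain y where y: "y \<in> B" "?a x = ?a y" using eq(2) by blast
            have c: "x \<in> carrier k" "y \<in> carrier k" using A'(7) B'(7) x y by auto
            have d: "x \<ominus>\<^bsub>?K\<^esub> y \<in> A" using A'(6)[OF x] y AB(3) by blast
            have "?a (x \<ominus>\<^bsub>?K\<^esub> y) = \<zero>"
              using lhomZ(3)[OF mult[OF a(1)] K K, of x y] c y(2) a(1) K.minus_self[of "?a y"] by simp
            then have "x \<ominus>\<^bsub>?K\<^esub> y \<in> A \<inter> ?Z" using d AB(4) by blast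
            then have "x \<ominus>\<^bsub>?K\<^esub> y \<in> B" using eq(1) by blast
            then show "x \<in> B" using B'(3)[OF _ y(1)] K.minus_add_cancel[of x y] c by fastforce
          qed
          then have "\<not> (A \<inter> ?Z = B \<inter> ?Z \<and> ?a ` A = ?a ` B)" using AB(3) by blast
          moreover have "B \<inter> ?Z \<subseteq> A \<inter> ?Z" "?a ` B \<subseteq> ?a ` A" "?a ` A \<subseteq> ?a ` I" using AB by blast+
          moreover have "submodule (A \<inter> ?Z) k (submod ?K ?Z)" "submodule (B \<inter> ?Z) k (submod ?K ?Z)"
            using submodule_inter[OF K AB(1) Z] submodule_inter[OF K AB(2) Z]
            by (simp_all add: submodule_submod[OF K Z])
          moreover have "submodule (?a ` A) k (submod ?K (?a ` I))" "submodule (?a ` B) k (submod ?K (?a ` I))"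
            unfolding submodule_submod[OF K sub[OF a(1) I]] using sub[OF a(1)] AB by blast+
          ultimately show "(A \<inter> ?Z, B \<inter> ?Z) \<in> (sub_rel k (submod ?K ?Z))\<inverse> \<or>
              A \<inter> ?Z = B \<inter> ?Z \<and> (?a ` A, ?a ` B) \<in> (sub_rel k (submod ?K (?a ` I)))\<inverse>"
            unfolding sub_rel_def by blast
        qed
      next
        case False
        then have dich: "(\<lambda>x. a \<otimes> x) ` I = {\<zero>} \<or> (\<lambda>x. a \<otimes> x) ` I = I" if "a \<in> carrier k" for a
          using that by blast
        show ?thesis
        proof (cases "I = {\<zero>}")
          case True
          then have "sub_rel k (submod ?K I) = {}" using sub_rel_zero[OF K] by simp
          then show ?thesis by (simp add: noe_def)
        next
          case False
          then obtain x where x: "x \<in> I" "x \<noteq> \<zero>" using I'(2) by auto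
          have xk: "x \<in> carrier k" using I'(7)[OF x(1)] by simp
          \<comment> \<open>The ideals \<open>k a^n\<close> descend and become stationary, which
            gives \<open>a^n = b a^(n+1)\<close>. As \<open>a\<close>, and with it
            \<open>a^n\<close>, maps \<open>I\<close> onto \<open>I\<close>, this \<open>b\<close>
            inverts \<open>a\<close> on \<open>I\<close>.\<close>
          have inv: "\<exists>b\<in>carrier k. \<forall>z\<in>I. b \<otimes> (a \<otimes> z) = z"
            if a: "a \<in> carrier k" "(\<lambda>x. a \<otimes> x) ` I = I" for a
          proof -
            let ?p = "\<lambda>n. (\<lambda>r. r \<otimes> (a [^] (n::nat))) ` carrier k"
            have p: "submodule (?p n) k ?K" for n
              using submodule_cyclic(1)[OF K, of "a [^] n"] a(1) by simp
            obtain N where N: "N \<in> range ?p" and min: "\<And>N'. (N', N) \<in> sub_rel k ?K \<Longrightarrow> N' \<notin> range ?p"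
              by (rule wfE_min[OF art[unfolded art_def], of "?p 0" "range ?p"]) blast+
            then obtain n where n: "N = ?p n" by blast
            have "?p (Suc n) \<subseteq> ?p n"
            proof
              fix y assume "y \<in> ?p (Suc n)"
              then obtain r where "r \<in> carrier k" "y = r \<otimes> (a [^] Suc n)" by blast
              then have "y = (r \<otimes> a) \<otimes> (a [^] n)" "r \<otimes> a \<in> carrier k"
                using a(1) by (simp_all add: m_ac)
              then show "y \<in> ?p n" by blast
            qed
            then have "?p (Suc n) = ?p n" using min[of "?p (Suc n)"] p n unfolding sub_rel_def by blast
            moreover have "a [^] n \<in> ?p n" using submodule_cyclic(2)[OF K, of "a [^] n"] a(1) by simp
            ultimately obtain b where b: "b \<in> carrier k" "a [^] n = b \<otimes> (a [^] Suc n)" by blast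
            have surj: "\<exists>w\<in>I. z = (a [^] m) \<otimes> w" if "z \<in> I" for z and m :: nat
              using that
            proof (induction m arbitrary: z)
              case 0
              then show ?case using I'(7)[of z] by (intro bexI[of _ z]) auto
            next
              case (Suc m)
              then obtain w where w: "w \<in> I" "z = (a [^] m) \<otimes> w" by blast
              obtain v where v: "v \<in> I" "w = a \<otimes> v" using a(2) w(1) by blast
              have "z = (a [^] Suc m) \<otimes> v" using w(2) v I'(7)[OF v(1)] a(1) by (simp add: m_assoc)
              then show ?case using v(1) by blast
            qed
            have "b \<otimes> (a \<otimes> z) = z" if z: "z \<in> I" for z
            proof -
              obtain w where w: "w \<in> I" "z = (a [^] n) \<otimes> w" using surj[OF z] by blast
              have wk: "w \<in> carrier k" using I'(7)[OF w(1)] by simp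
              have "b \<otimes> (a \<otimes> z) = (b \<otimes> (a [^] Suc n)) \<otimes> w"
                using w(2) wk a(1) b(1) by (simp add: m_ac)
              then show ?thesis unfolding b(2)[symmetric] w(2)[symmetric] .
            qed
            then show ?thesis using b(1) by blast
          qed
          let ?J = "{J. submodule J k ?K \<and> J \<subseteq> I \<and> x \<notin> J}"
          \<comment> \<open>Avoiding a fixed nonzero \<open>x\<close> keeps unions of chains proper,
            so Zorn's lemma yields \<open>J\<close>; every strictly larger ideal inside
            \<open>I\<close> contains \<open>x\<close>.\<close>
          have "\<exists>J\<in>?J. \<forall>L\<in>?J. J \<subseteq> L \<longrightarrow> L = J"
          proof (rule subset_Zorn_nonempty)
            have "{\<zero>} \<in> ?J" using K.submodule_zero I'(2) x(2) by auto
            then show "?J \<noteq> {}" by blast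
            fix \<C> assume C: "\<C> \<noteq> {}" "subset.chain ?J \<C>"
            have Cs: "submodule J k ?K" "J \<subseteq> I" "x \<notin> J" if "J \<in> \<C>" for J
              using C(2) that unfolding subset.chain_def by blast+
            have lin: "J \<subseteq> J' \<or> J' \<subseteq> J" if "J \<in> \<C>" "J' \<in> \<C>" for J J'
              using C(2) that unfolding subset.chain_def by blast
            have "submodule (\<Union>\<C>) k ?K"
            proof (rule K.submoduleI)
              show "\<Union>\<C> \<subseteq> carrier ?K" using Cs(2) I'(1) by blast
              show "\<zero>\<^bsub>?K\<^esub> \<in> \<Union>\<C>" using C(1) K.submoduleD(2)[OF Cs(1)] by blast
              show "u \<oplus>\<^bsub>?K\<^esub> v \<in> \<Union>\<C>" if uv: "u \<in> \<Union>\<C>" "v \<in> \<Union>\<C>" for u v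
              proof -
                obtain J J' where J: "J \<in> \<C>" "J' \<in> \<C>" "u \<in> J" "v \<in> J'" using uv by blast
                then obtain L where "L \<in> \<C>" "u \<in> L" "v \<in> L" using lin[OF J(1,2)] by blast
                then show ?thesis using K.submoduleD(3)[OF Cs(1)[of L]] by blast
              qed
              show "c \<odot>\<^bsub>?K\<^esub> u \<in> \<Union>\<C>" if "c \<in> carrier k" "u \<in> \<Union>\<C>" for c u
                using that K.submoduleD(4)[OF Cs(1)] by blast
            qed
            then show "\<Union>\<C> \<in> ?J" using Cs by blast
          qed
          then obtain J where J0: "J \<in> ?J" and max0: "\<forall>L\<in>?J. J \<subseteq> L \<longrightarrow> L = J" by (rule bexE)
          have J: "submodule J k ?K" "J \<subseteq> I" "x \<notin> J" using J0 by simp_all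
          have max: "L = J" if "submodule L k ?K" "L \<subseteq> I" "x \<notin> L" "J \<subseteq> L" for L
            using max0 that by simp
          note J' = K.submoduleD[OF J(1)]
          \<comment> \<open>For \<open>y\<close> outside \<open>J\<close>, maximality puts
            \<open>x\<close> in \<open>J + k y\<close>, say \<open>x = j + a y\<close>. Here
            \<open>a y\<close> is nonzero because \<open>x\<close> is not in \<open>J\<close>, so
            \<open>a\<close> is invertible on \<open>I\<close> and \<open>y\<close> is a multiple of
            \<open>x - j\<close>, which lies in \<open>L\<close>.\<close>
          have simple: "I \<subseteq> L" if L: "submodule L k ?K" "J \<subseteq> L" "L \<subseteq> I" "L \<noteq> J" for L
          proof
            note L' = K.submoduleD[OF L(1)]
            have xL: "x \<in> L" using max[OF L(1,3) _ L(2)] L(4) by blast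
            fix y assume y: "y \<in> I"
            show "y \<in> L"
            proof (cases "y \<in> J")
              case False
              have yk: "y \<in> carrier k" using I'(7)[OF y] by simp
              then have yK: "y \<in> carrier ?K" by simp
              let ?C = "(\<lambda>r. r \<odot>\<^bsub>?K\<^esub> y) ` carrier k"
              note C = submodule_cyclic[OF K yK]
              note s = submodule_sum[OF K J(1) C(1)]
              have "J <+>\<^bsub>?K\<^esub> ?C \<subseteq> I" 
                using J(2) I'(4)[OF _ y] by (intro set_add_subset[OF K I]) auto
              moreover have "J <+>\<^bsub>?K\<^esub> ?C \<noteq> J" using C(2) s(3) False by blast
              ultimately have "x \<in> J <+>\<^bsub>?K\<^esub> ?C" using max[OF s(1) _ _ s(2)] by blast
              then obtain j a where ja: "j \<in> J" "a \<in> carrier k" "x = j \<oplus>\<^bsub>?K\<^esub> (a \<otimes> y)"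
                unfolding set_add_iff by auto
              have jk: "j \<in> carrier k" using J'(7)[OF ja(1)] by simp
              have "a \<otimes> y \<noteq> \<zero>" using ja J(3) jk by auto
              then have "(\<lambda>x. a \<otimes> x) ` I = I" using dich[OF ja(2)] y by blast
              then obtain b where b: "b \<in> carrier k" "b \<otimes> (a \<otimes> y) = y"
                using inv[OF ja(2)] y by blast
              have "x \<ominus>\<^bsub>?K\<^esub> j = a \<otimes> y"
                using K.add_minus_self2[of j "a \<otimes> y"] ja jk yk by simp
              then have "b \<odot>\<^bsub>?K\<^esub> (x \<ominus>\<^bsub>?K\<^esub> j) = y" using b(2) by simp
              moreover have "x \<ominus>\<^bsub>?K\<^esub> j \<in> L" using L'(6)[OF xL] ja(1) L(2) by blast
              ultimately show ?thesis using L'(4)[OF b(1)] by metis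
            qed (use L(2) in blast)
          qed
          have JI: "J \<subset> I" using J x(1) by blast
          \<comment> \<open>Modulo the simple quotient of \<open>I\<close> by \<open>J\<close> an
            ideal is zero or everything, so two values suffice as second measure; ideals inside
            \<open>J\<close> get the larger one because the relation is converse inclusion.\<close>
          show ?thesis unfolding noe_def
          proof (rule wf_lex_via[OF IH[OF J(1) JI, unfolded noe_def] wf_less_than,
                of _ "\<lambda>A. A \<inter> J" "\<lambda>A. if A \<subseteq> J then 1 else 0"])
            fix A B assume "(A, B) \<in> (sub_rel k (submod ?K I))\<inverse>"
            then have AB: "submodule A k ?K" "submodule B k ?K" "B \<subset> A" "A \<subseteq> I"
              by (auto simp: sub_rel_def submodule_submod[OF K I])
            note A' = K.submoduleD[OF AB(1)] and B' = K.submoduleD[OF AB(2)]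
            have "\<not> A \<subseteq> J \<and> B \<subseteq> J" if eq: "A \<inter> J = B \<inter> J"
            proof
              show "\<not> A \<subseteq> J" using eq AB(3) by blast
              show "B \<subseteq> J"
              proof (rule ccontr)
                assume nB: "\<not> B \<subseteq> J"
                note s = submodule_sum[OF K AB(2) J(1)]
                have "B <+>\<^bsub>?K\<^esub> J \<subseteq> I"
                  using AB(3,4) J(2) by (intro set_add_subset[OF K I]) auto
                then have I_sub: "I \<subseteq> B <+>\<^bsub>?K\<^esub> J" using simple[OF s(1,3)] nB s(2) by blast
                have "A \<subseteq> B"
                proof
                  fix a assume a: "a \<in> A"
                  then have "a \<in> B <+>\<^bsub>?K\<^esub> J" using I_sub AB(4) by blast
                  then obtain b j where bj: "b \<in> B" "j \<in> J" "a = b \<oplus>\<^bsub>?K\<^esub> j" unfolding set_add_iff by blast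
                  then have "a \<ominus>\<^bsub>?K\<^esub> b = j" using K.add_minus_self2 B'(7) J'(7) by simp
                  moreover have "a \<ominus>\<^bsub>?K\<^esub> b \<in> A" using A'(6)[OF a] bj(1) AB(3) by blast
                  ultimately have "j \<in> B" using eq bj(2) by blast
                  then show "a \<in> B" using bj B'(3) by blast
                qed
                then show False using AB(3) by blast
              qed
            qed
            then show "(A \<inter> J, B \<inter> J) \<in> (sub_rel k (submod ?K J))\<inverse> \<or>
              A \<inter> J = B \<inter> J \<and> (if A \<subseteq> J then 1 else 0, if B \<subseteq> J then 1 else 0) \<in> less_than"
              using AB(3) submodule_inter[OF K AB(1) J(1)] submodule_inter[OF K AB(2) J(1)]
              unfolding sub_rel_def by (cases "A \<inter> J = B \<inter> J") (auto simp: submodule_submod[OF K J(1)])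
          qed
        qed
      qed
    qed
  qed
  then show ?thesis using K.submodule_carrier by (metis submod_carrier)
qed

text \<open>For a commutative ring the submodules of \<open>reg k\<close> are ideals, and a strictly
  descending sequence of them contradicts \<open>artinian\<close>.\<close>

lemma artinian_art:
  assumes "cring k" "artinian k"
  shows "art k (reg k)"
  unfolding art_def wf_iff_no_infinite_down_chain
proof
  interpret cring k by fact
  have K: "left_module k (reg k)" using left_module_reg[OF ring_axioms] .
  interpret K: left_module k "reg k" by fact
  assume "\<exists>f. \<forall>i. (f (Suc i), f i) \<in> sub_rel k (reg k)"
  then obtain f where f: "\<And>i. (f (Suc i), f i) \<in> sub_rel k (reg k)" by blast
  have "ideal (f n) k" for n
  proof -
    have s: "submodule (f n) k (reg k)" using f[of n] by (simp add: sub_rel_def)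
    note D = K.submoduleD[OF s]
    have "subgroup (f n) (add_monoid k)"
    proof (rule group.subgroupI)
      show "group (add_monoid k)" by (rule add.is_group)
      show "f n \<subseteq> carrier (add_monoid k)" using D(1) by simp
      show "f n \<noteq> {}" using D(2) by blast
      show "inv\<^bsub>add_monoid k\<^esub> x \<in> f n" if "x \<in> f n" for x
        using D(4)[of "\<ominus>\<^bsub>k\<^esub> \<one>\<^bsub>k\<^esub>" x] D(7)[OF that] that l_minus[of "\<one>\<^bsub>k\<^esub>" x] by (simp add: a_inv_def)
      show "x \<otimes>\<^bsub>add_monoid k\<^esub> y \<in> f n" if "x \<in> f n" "y \<in> f n" for x y
        using D(3)[OF that] by simp
    qed
    then show ?thesis
    proof (rule idealI[OF ring_axioms])
      show "x \<otimes>\<^bsub>k\<^esub> a \<in> f n" if "a \<in> f n" "x \<in> carrier k" for a x using D(4)[OF that(2,1)] by simp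
      then show "a \<otimes>\<^bsub>k\<^esub> x \<in> f n" if "a \<in> f n" "x \<in> carrier k" for a x
        using that D(7)[OF that(1)] m_comm[of a x] by simp
    qed
  qed
  moreover have "f (Suc n) \<subset> f n" for n using f[of n] by (simp add: sub_rel_def)
  ultimately have "\<exists>n. \<forall>m\<ge>n. f m = f n" using assms(2) unfolding artinian_def by blast
  then obtain n where "f (Suc n) = f n" by (metis le_SucI order_refl)
  then show False using \<open>\<And>n. f (Suc n) \<subset> f n\<close> by blast
qed

text \<open>Left ideals are \<open>k\<close>-submodules because \<open>c x = (c 1) x\<close>, and
  \<open>L\<close> has finite length over \<open>k\<close>, being finitely generated over a ring
  that is Artinian and, by \<open>art_imp_noe\<close>, Noetherian.\<close>

lemma artin_algebra_flen:
  fixes L :: "('k, 'a) module"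
  assumes "artin_algebra k L"
  shows "flen L (reg L)" "ring L"
proof -
  interpret artin_algebra k L by fact
  have k: "cring k" by (rule R.is_cring)
  have L: "left_module k L"
    by (intro left_moduleI) (auto simp: smult_l_distr smult_r_distr smult_assoc1 R.ring_axioms M.abelian_group_axioms)
  show R: "ring L" by (rule ring_axioms)
  have reg: "left_module L (reg L)" using left_module_reg[OF R] .
  interpret reg: left_module L "reg L" by fact
  interpret L': left_module k L by fact
  have "L \<in> fgmod k" using L finitely_generated by (simp add: fgmod_def)
  then have flen: "flen k L"
    using flen_fgmod art_imp_noe[OF k] artinian_art[OF k artinian_base] by (auto simp: flen_def)
  have "submodule I k L" if "submodule I L (reg L)" for I
  proof (rule L'.submoduleI)
    note D = reg.submoduleD[OF that]
    show "I \<subseteq> carrier L" "\<zero>\<^bsub>L\<^esub> \<in> I" using D(1,2) by auto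
    show "x \<oplus>\<^bsub>L\<^esub> y \<in> I" if "x \<in> I" "y \<in> I" for x y using D(3)[OF that] by simp
    show "a \<odot>\<^bsub>L\<^esub> x \<in> I" if "a \<in> carrier k" "x \<in> I" for a x
    proof -
      have x: "x \<in> carrier L" using D(7)[OF that(2)] by simp
      have "a \<odot>\<^bsub>L\<^esub> x = (a \<odot>\<^bsub>L\<^esub> \<one>\<^bsub>L\<^esub>) \<otimes>\<^bsub>L\<^esub> x"
        using smult_mult_left[OF that(1) one_closed x] x by simp
      then show ?thesis using D(4)[of "a \<odot>\<^bsub>L\<^esub> \<one>\<^bsub>L\<^esub>" x] that one_closed by simp
    qed
  qed
  then show "flen L (reg L)"
    by (intro flen_transport[OF flen, of _ _ "\<lambda>I. I"]) (simp add: sub_rel_def)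
qed

section \<open>Projective modules and projective covers\<close>

lemma projectiveI:
  fixes Q :: "('a, 'm) module"
  assumes "Q \<in> fgmod R"
    "\<And>(A :: ('a, 'm) module) (B :: ('a, 'm) module) g f. \<lbrakk>A \<in> fgmod R; B \<in> fgmod R; lhom R A B g; lhom R Q B f; g ` carrier A = carrier B\<rbrakk>
      \<Longrightarrow> \<exists>h. lhom R Q A h \<and> (\<forall>x\<in>carrier Q. g (h x) = f x)"
  shows "projective R Q"
  unfolding projective_def
proof (intro conjI ballI impI)
  fix A B :: "('a, 'm) module" and g f
  assume AB: "A \<in> fgmod R" "B \<in> fgmod R" and gf: "g \<in> mod_hom R A B" "f \<in> mod_hom R Q B"
    and s: "g ` carrier A = carrier B"
  obtain h where h: "lhom R Q A h" "\<forall>x\<in>carrier Q. g (h x) = f x"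
    using assms(2)[OF AB _ _ s, of f] gf by (auto simp: mod_hom_iff)
  show "\<exists>h\<in>mod_hom R Q A. compose (carrier Q) g h = f"
  proof (rule bexI)
    show "restrict h (carrier Q) \<in> mod_hom R Q A"
      using h(1) restrict_mod_hom[OF fgmodD[OF assms(1)]] by blast
    show "compose (carrier Q) g (restrict h (carrier Q)) = f"
      using gf(2) h(2) by (auto simp: compose_def mod_hom_iff extensional_def fun_eq_iff)
  qed
qed (rule assms(1))

lemma projective_fgmod: "projective R Q \<Longrightarrow> Q \<in> fgmod R"
  by (simp add: projective_def)

lemma projective_lift:
  fixes Q A B :: "('a, 'm) module"
  assumes Q: "projective R Q" and AB: "A \<in> fgmod R" "B \<in> fgmod R" "lhom R A B g" "lhom R Q B f"
    and s: "g ` carrier A = carrier B"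
  obtains h where "lhom R Q A h" "\<And>x. x \<in> carrier Q \<Longrightarrow> g (h x) = f x"
proof -
  let ?g = "restrict g (carrier A)" and ?f = "restrict f (carrier Q)"
  have g: "?g \<in> mod_hom R A B" using AB restrict_mod_hom[OF fgmodD[OF AB(1)]] by blast
  have f: "?f \<in> mod_hom R Q B" using AB restrict_mod_hom[OF fgmodD[OF projective_fgmod[OF Q]]] by blast
  have "?g ` carrier A = carrier B" using s by simp
  then obtain h where h: "h \<in> mod_hom R Q A" "compose (carrier Q) ?g h = ?f"
    using Q AB(1,2) g f unfolding projective_def by blast
  have l: "lhom R Q A h" using h(1) by (simp add: mod_hom_iff)
  have "g (h x) = f x" if "x \<in> carrier Q" for x
    using fun_cong[OF h(2), of x] that lhomD(1)[OF l that] by (simp add: compose_def)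
  then show ?thesis using that l by blast
qed

text \<open>Lifts along the two composites add up to a lift along the identity. This covers
  retracts, where one composite is zero, as well as sums of two projectives.\<close>

lemma projective_thruI:
  fixes C Q1 Q2 :: "('a, 'm) module"
  assumes C: "C \<in> fgmod R" and Q: "projective R Q1" "projective R Q2"
    and ab: "lhom R C Q1 a1" "lhom R Q1 C b1" "lhom R C Q2 a2" "lhom R Q2 C b2"
    and id: "\<And>x. x \<in> carrier C \<Longrightarrow> x = b1 (a1 x) \<oplus>\<^bsub>C\<^esub> b2 (a2 x)"
  shows "projective R C"
proof (rule projectiveI[OF C])
  fix A B :: "('a, 'm) module" and g f
  assume AB: "A \<in> fgmod R" "B \<in> fgmod R" "lhom R A B g" "lhom R C B f" "g ` carrier A = carrier B"
  obtain h1 where h1: "lhom R Q1 A h1" "\<And>x. x \<in> carrier Q1 \<Longrightarrow> g (h1 x) = f (b1 x)"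
    using projective_lift[OF Q(1) AB(1,2,3) lhom_comp[OF ab(2) AB(4)] AB(5)] by blast
  obtain h2 where h2: "lhom R Q2 A h2" "\<And>x. x \<in> carrier Q2 \<Longrightarrow> g (h2 x) = f (b2 x)"
    using projective_lift[OF Q(2) AB(1,2,3) lhom_comp[OF ab(4) AB(4)] AB(5)] by blast
  have "lhom R C A (\<lambda>x. h1 (a1 x) \<oplus>\<^bsub>A\<^esub> h2 (a2 x))"
    by (rule lhom_add[OF fgmodD[OF AB(1)] lhom_comp[OF ab(1) h1(1)] lhom_comp[OF ab(3) h2(1)]])
  moreover have "g (h1 (a1 x) \<oplus>\<^bsub>A\<^esub> h2 (a2 x)) = f x" if x: "x \<in> carrier C" for x
  proof -
    note a = lhomD(1)[OF ab(1) x] lhomD(1)[OF ab(3) x]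
    have "g (h1 (a1 x) \<oplus>\<^bsub>A\<^esub> h2 (a2 x)) = f (b1 (a1 x)) \<oplus>\<^bsub>B\<^esub> f (b2 (a2 x))"
      using lhomD(2)[OF AB(3) lhomD(1)[OF h1(1) a(1)] lhomD(1)[OF h2(1) a(2)]] h1(2)[OF a(1)] h2(2)[OF a(2)]
      by simp
    also have "\<dots> = f (b1 (a1 x) \<oplus>\<^bsub>C\<^esub> b2 (a2 x))"
      using lhomD(2)[OF AB(4) lhomD(1)[OF ab(2) a(1)] lhomD(1)[OF ab(4) a(2)]] by simp
    finally show ?thesis using id[OF x] by simp
  qed
  ultimately show "\<exists>h. lhom R C A h \<and> (\<forall>x\<in>carrier C. g (h x) = f x)" by blast
qed

lemma projective_retract:
  fixes C Q :: "('a, 'm) module"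
  assumes C: "left_module R C" and Q: "projective R Q" and ir: "retract R C Q i r"
  shows "projective R C"
proof -
  interpret C: left_module R C by fact
  have fg: "C \<in> fgmod R" by (rule fgmod_retract[OF ir projective_fgmod[OF Q] C])
  have i: "lhom R C Q i" and r: "lhom R Q C r" and ri: "\<And>x. x \<in> carrier C \<Longrightarrow> r (i x) = x"
    using ir by (auto simp: retract_def)
  show ?thesis
    by (rule projective_thruI[OF fg Q Q i r i lhom_zero[OF C]]) (use ri in simp)
qed

lemma projective_zero:
  fixes Z :: "('a, 'm) module"
  assumes Z: "Z \<in> fgmod R" "zero_module Z"
  shows "projective R Z"
proof (rule projectiveI[OF Z(1)])
  fix A B :: "('a, 'm) module" and g f
  assume AB: "A \<in> fgmod R" "B \<in> fgmod R" "lhom R A B g" "lhom R Z B f"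
  have "g \<zero>\<^bsub>A\<^esub> = f x" if "x \<in> carrier Z" for x
    using that Z(2) lhomZ(1)[OF AB(3) fgmodD fgmodD] lhomZ(1)[OF AB(4) fgmodD fgmodD] AB Z
    by (simp add: zero_module_def)
  then show "\<exists>h. lhom R Z A h \<and> (\<forall>x\<in>carrier Z. g (h x) = f x)"
    using lhom_zero[OF fgmodD[OF AB(1)], of Z] by blast
qed

text \<open>The kernels of the powers of \<open>f\<close> become stationary at some
  \<open>n\<close>. Surjectivity writes \<open>x\<close> as \<open>f^n w\<close>; then
  \<open>w\<close> is killed by \<open>f^(n+1)\<close>, hence already by \<open>f^n\<close>.\<close>

lemma surj_endo_inj:
  assumes M: "left_module R M" and noe: "noe R M" and f: "lhom R M M f" "f ` carrier M = carrier M"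
    and x: "x \<in> carrier M" "f x = \<zero>\<^bsub>M\<^esub>"
  shows "x = \<zero>\<^bsub>M\<^esub>"
proof -
  interpret M: left_module R M by fact
  have p: "lhom R M M (f ^^ n)" for n
    by (induction n) (simp_all add: lhom_id[unfolded id_def[symmetric]] lhom_comp[OF _ f(1)] comp_def id_def lhom_id)
  let ?K = "\<lambda>n. hom_ker M M (f ^^ n)"
  have K: "submodule (?K n) R M" for n by (rule submodule_ker[OF M M p])
  obtain N where N: "N \<in> range ?K" and max: "\<And>N'. (N', N) \<in> (sub_rel R M)\<inverse> \<Longrightarrow> N' \<notin> range ?K"
    by (rule wfE_min[OF noe[unfolded noe_def], of "?K 0" "range ?K"]) blast+
  then obtain n where n: "N = ?K n" by blast
  have "?K n \<subseteq> ?K (Suc n)" using lhomZ(1)[OF f(1) M M] by (auto simp: hom_ker_def)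
  then have eq: "?K (Suc n) = ?K n" using max[of "?K (Suc n)"] K n unfolding sub_rel_def by blast
  have "\<exists>w\<in>carrier M. z = (f ^^ m) w" if "z \<in> carrier M" for z m
    using that
  proof (induction m arbitrary: z)
    case (Suc m)
    obtain v where v: "v \<in> carrier M" "z = f v" using Suc.prems f(2) by (metis imageE)
    then show ?case using Suc.IH[OF v(1)] by auto
  qed auto
  then obtain w where w: "w \<in> carrier M" "x = (f ^^ n) w" using x(1) by blast
  then have "w \<in> ?K (Suc n)" using x(2) by (simp add: hom_ker_def)
  then have "w \<in> ?K n" unfolding eq .
  then show ?thesis using w by (simp add: hom_ker_def)
qed

lemma lhom_inj_iso:
  assumes M: "left_module R M" "left_module R N" and f: "lhom R M N f" "f ` carrier M = carrier N"
    and inj: "\<And>x. \<lbrakk>x \<in> carrier M; f x = \<zero>\<^bsub>N\<^esub>\<rbrakk> \<Longrightarrow> x = \<zero>\<^bsub>M\<^esub>"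
  obtains g where "lhom R N M g" "\<And>x. x \<in> carrier M \<Longrightarrow> g (f x) = x" "\<And>y. y \<in> carrier N \<Longrightarrow> f (g y) = y"
proof -
  interpret M: left_module R M by fact
  interpret N: left_module R N by fact
  have "inj_on f (carrier M)"
  proof (rule inj_onI)
    fix x y assume xy: "x \<in> carrier M" "y \<in> carrier M" "f x = f y"
    then have "f (x \<ominus>\<^bsub>M\<^esub> y) = \<zero>\<^bsub>N\<^esub>"
      using lhomZ(3)[OF f(1) M, of x y] N.minus_self[of "f y"] lhomD(1)[OF f(1)] by simp
    then have "x \<ominus>\<^bsub>M\<^esub> y = \<zero>\<^bsub>M\<^esub>" using xy by (intro inj) auto
    then show "x = y" using M.minus_eq_zero xy by blast
  qed
  then have b: "bij_betw f (carrier M) (carrier N)" using f(2) by (simp add: bij_betw_def)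
  define g where "g = inv_into (carrier M) f"
  have gf: "g (f x) = x" if "x \<in> carrier M" for x using bij_betw_inv_into_left[OF b that] by (simp add: g_def)
  have fg: "f (g y) = y" if "y \<in> carrier N" for y using bij_betw_inv_into_right[OF b that] by (simp add: g_def)
  have gc: "g y \<in> carrier M" if "y \<in> carrier N" for y
    using bij_betwE[OF bij_betw_inv_into[OF b]] that by (simp add: g_def)
  have "lhom R N M g"
  proof (rule lhomI)
    show "g (x \<oplus>\<^bsub>N\<^esub> y) = g x \<oplus>\<^bsub>M\<^esub> g y" if "x \<in> carrier N" "y \<in> carrier N" for x y
      using gf[of "g x \<oplus>\<^bsub>M\<^esub> g y"] gc fg that lhomD[OF f(1)] by simp
    show "g (a \<odot>\<^bsub>N\<^esub> x) = a \<odot>\<^bsub>M\<^esub> g x" if "a \<in> carrier R" "x \<in> carrier N" for a x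
      using gf[of "a \<odot>\<^bsub>M\<^esub> g x"] gc fg that lhomD[OF f(1)] by simp
  qed (rule gc)
  then show ?thesis using that gf fg by blast
qed

lemma proj_coverD:
  assumes "proj_cover R X Q p"
  shows "projective R Q" "Q \<in> fgmod R" "left_module R Q" "lhom R Q X p" "p ` carrier Q = carrier X"
    "\<lbrakk>submodule L R Q; hom_ker Q X p <+>\<^bsub>Q\<^esub> L = carrier Q\<rbrakk> \<Longrightarrow> L = carrier Q"
  using assms projective_fgmod[of R Q] fgmodD[of Q R] by (auto simp: proj_cover_def mod_hom_iff)

text \<open>Together with \<open>image_of_ker_add\<close>, supplements of the kernel are exactly the
  submodules with full image, which turns superfluity of a kernel into a statement on
  surjections.\<close>

lemma ker_add_image:
  assumes Q: "left_module R Q" and X: "left_module R X" and p: "lhom R Q X p"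
    and L: "submodule L R Q" and s: "p ` L = p ` carrier Q"
  shows "hom_ker Q X p <+>\<^bsub>Q\<^esub> L = carrier Q"
proof
  interpret Q: left_module R Q by fact
  interpret X: left_module R X by fact
  note L' = Q.submoduleD[OF L]
  show "hom_ker Q X p <+>\<^bsub>Q\<^esub> L \<subseteq> carrier Q"
    using L'(1) by (intro set_add_subset[OF Q Q.submodule_carrier]) (auto simp: hom_ker_def)
  show "carrier Q \<subseteq> hom_ker Q X p <+>\<^bsub>Q\<^esub> L"
  proof
    fix x assume x: "x \<in> carrier Q"
    then have "p x \<in> p ` L" using s by simp
    then obtain l where l: "l \<in> L" "p x = p l" by blast
    have lc: "l \<in> carrier Q" using L'(7)[OF l(1)] .
    have "x \<ominus>\<^bsub>Q\<^esub> l \<in> hom_ker Q X p"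
      using x lc l(2) lhomZ(3)[OF p Q X, of x l] X.minus_self[of "p l"] lhomD(1)[OF p] by (simp add: hom_ker_def)
    moreover have "x = (x \<ominus>\<^bsub>Q\<^esub> l) \<oplus>\<^bsub>Q\<^esub> l" using Q.minus_add_cancel[OF x lc] by simp
    ultimately show "x \<in> hom_ker Q X p <+>\<^bsub>Q\<^esub> L" using l(1) unfolding set_add_iff by blast
  qed
qed

lemma image_of_ker_add:
  assumes Q: "left_module R Q" and X: "left_module R X" and p: "lhom R Q X p"
    and L: "submodule L R Q" and s: "hom_ker Q X p <+>\<^bsub>Q\<^esub> L = carrier Q"
  shows "p ` L = p ` carrier Q"
proof
  interpret Q: left_module R Q by fact
  interpret X: left_module R X by fact
  note L' = Q.submoduleD[OF L]
  show "p ` L \<subseteq> p ` carrier Q" using L'(1) by blast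
  show "p ` carrier Q \<subseteq> p ` L"
  proof
    fix y assume "y \<in> p ` carrier Q"
    then obtain x where x: "x \<in> carrier Q" "y = p x" by blast
    then obtain z l where "z \<in> hom_ker Q X p" "l \<in> L" "x = z \<oplus>\<^bsub>Q\<^esub> l" unfolding s[symmetric] set_add_iff by blast
    then have "y = p l" using x(2) L'(7)[of l] lhomD[OF p] by (simp add: hom_ker_def)
    then show "y \<in> p ` L" using \<open>l \<in> L\<close> by blast
  qed
qed

lemma cover_surj:
  assumes c: "proj_cover R X Q p" and X: "left_module R X" and A: "left_module R A" and g: "lhom R A Q g"
    and s: "(\<lambda>a. p (g a)) ` carrier A = carrier X"
  shows "g ` carrier A = carrier Q"
proof -
  note c' = proj_coverD[OF c]
  have L: "submodule (g ` carrier A) R Q"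
    using submodule_image[OF A c'(3) g left_module.submodule_carrier[OF A]] .
  have "p ` g ` carrier A = p ` carrier Q" using s c'(5) by (simp add: image_image)
  then show ?thesis using c'(6)[OF L ker_add_image[OF c'(3) X c'(4) L]] by simp
qed

text \<open>The common ground of \<Lambda> and \<Gamma>: an artin algebra satisfies it for a large
  enough carrier type \<open>'m\<close>, and \<open>good_Gm\<close> provides it for the endomorphism
  ring with carrier type \<open>'a => 'm\<close>. Every result proved here is thereby available on
  both sides.\<close>

locale good_ring =
  fixes R :: "('a, 'r) ring_scheme" and U :: "'m itself"
  assumes ring_R: "ring R" and universe: "module_universe R TYPE('m)" and flen_reg: "flen R (reg R)"
begin

lemma fg_noe: assumes "M \<in> fgmod R" shows "noe R M"
  using flen_fgmod[OF assms flen_reg] by (simp add: flen_def)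

lemma fg_art: assumes "M \<in> fgmod R" shows "art R M"
  using flen_fgmod[OF assms flen_reg] by (simp add: flen_def)

lemma fg_submod: assumes "M \<in> fgmod R" "submodule A R M" shows "submod M A \<in> fgmod R"
  by (rule flen_submod_fgmod[OF fgmodD[OF assms(1)] flen_fgmod[OF assms(1) flen_reg] assms(2)])

text \<open>Brings sums and other constructions on product or function types back to the type
  \<open>'m\<close>, over which \<open>fgmod\<close>, \<open>projective\<close> and
  \<open>K0\<close> are formed.\<close>

lemma fg_copy:
  assumes "N \<in> fgmod R"
  obtains M :: "('a, 'm) module" where "M \<in> fgmod R" "mod_iso R N M"
  using fgmod_copy[OF assms universe] by blast

lemma projective_dsum:
  fixes S Q1 Q2 :: "('a, 'm) module"
  assumes S: "S \<in> fgmod R" "mod_iso R S (dsum Q1 Q2)" and Q: "projective R Q1" "projective R Q2"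
  shows "projective R S"
proof -
  note fg = projective_fgmod[OF Q(1)] projective_fgmod[OF Q(2)]
  note lm = fgmodD[OF S(1)] fgmodD[OF fg(1)] fgmodD[OF fg(2)]
  interpret Q1: left_module R Q1 by (rule lm)
  interpret Q2: left_module R Q2 by (rule lm)
  obtain u v where uv: "lhom R S (dsum Q1 Q2) u" "lhom R (dsum Q1 Q2) S v" "\<And>x. x \<in> carrier S \<Longrightarrow> v (u x) = x"
    using mod_isoE[OF S(2) lm(1) left_module_dsum[OF lm(2,3)]] by metis
  note m = dsum_maps[OF lm(2,3)]
  show ?thesis
  proof (rule projective_thruI[OF S(1) Q lhom_comp[OF uv(1) m(3)] lhom_comp[OF m(1) uv(2)]
        lhom_comp[OF uv(1) m(4)] lhom_comp[OF m(2) uv(2)]])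
    fix x assume x: "x \<in> carrier S"
    have u: "fst (u x) \<in> carrier Q1" "snd (u x) \<in> carrier Q2" using lhomD(1)[OF uv(1) x] by auto
    have "v (fst (u x), \<zero>\<^bsub>Q2\<^esub>) \<oplus>\<^bsub>S\<^esub> v (\<zero>\<^bsub>Q1\<^esub>, snd (u x))
        = v ((fst (u x), \<zero>\<^bsub>Q2\<^esub>) \<oplus>\<^bsub>dsum Q1 Q2\<^esub> (\<zero>\<^bsub>Q1\<^esub>, snd (u x)))"
      using u by (subst lhomD(2)[OF uv(2)]) auto
    also have "\<dots> = x" using u uv(3)[OF x] by simp
    finally show "x = v (fst (u x), \<zero>\<^bsub>Q2\<^esub>) \<oplus>\<^bsub>S\<^esub> v (\<zero>\<^bsub>Q1\<^esub>, snd (u x))" by simp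
  qed
qed

text \<open>A map out of the free module of rank one is prescribed by the image of
  \<open>u 1\<close>, so a lift amounts to a preimage of one element.\<close>

lemma free_copy:
  obtains F :: "('a, 'm) module" and v where "projective R F" "lhom R F (reg R) v" "v ` carrier F = carrier R"
proof -
  interpret ring R by (rule ring_R)
  have reg: "left_module R (reg R)" using left_module_reg[OF ring_R] .
  obtain F :: "('a, 'm) module" where F: "F \<in> fgmod R" "mod_iso R (reg R) F"
    using fg_copy[OF fgmod_reg[OF ring_R]] by blast
  obtain u v where uv: "lhom R (reg R) F u" "lhom R F (reg R) v" "\<And>x. x \<in> carrier (reg R) \<Longrightarrow> v (u x) = x"
    "\<And>y. y \<in> carrier F \<Longrightarrow> u (v y) = y"
    using mod_isoE[OF F(2) reg fgmodD[OF F(1)]] by metis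
  have "projective R F"
  proof (rule projectiveI[OF F(1)])
    fix A B :: "('a, 'm) module" and g f
    assume AB: "A \<in> fgmod R" "B \<in> fgmod R" "lhom R A B g" "lhom R F B f" "g ` carrier A = carrier B"
    have u1: "u \<one>\<^bsub>R\<^esub> \<in> carrier F" using lhomD(1)[OF uv(1)] by simp
    then have "f (u \<one>\<^bsub>R\<^esub>) \<in> g ` carrier A" unfolding AB(5) by (rule lhomD(1)[OF AB(4)])
    then obtain a where a: "a \<in> carrier A" "f (u \<one>\<^bsub>R\<^esub>) = g a" by blast
    have "g (v x \<odot>\<^bsub>A\<^esub> a) = f x" if x: "x \<in> carrier F" for x
    proof -
      have vx: "v x \<in> carrier R" using lhomD(1)[OF uv(2) x] by simp
      have "g (v x \<odot>\<^bsub>A\<^esub> a) = f (v x \<odot>\<^bsub>F\<^esub> u \<one>\<^bsub>R\<^esub>)"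
        using lhomD(3)[OF AB(3) vx a(1)] lhomD(3)[OF AB(4) vx u1] a(2) by simp
      also have "v x \<odot>\<^bsub>F\<^esub> u \<one>\<^bsub>R\<^esub> = u (v x)"
        using lhomD(3)[OF uv(1) vx, of "\<one>\<^bsub>R\<^esub>"] vx by simp
      finally show ?thesis using uv(4)[OF x] by simp
    qed
    then show "\<exists>h. lhom R F A h \<and> (\<forall>x\<in>carrier F. g (h x) = f x)"
      using lhom_comp[OF uv(2) lhom_smult[OF fgmodD[OF AB(1)] a(1)]] by blast
  qed
  moreover have "v ` carrier F = carrier R"
  proof
    show "v ` carrier F \<subseteq> carrier R" using lhomD(1)[OF uv(2)] by auto
    show "carrier R \<subseteq> v ` carrier F"
    proof
      fix r assume "r \<in> carrier R"
      then have "u r \<in> carrier F" "r = v (u r)" using lhomD(1)[OF uv(1)] uv(3) by simp_all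
      then show "r \<in> v ` carrier F" by blast
    qed
  qed
  ultimately show ?thesis using that uv(2) by blast
qed

text \<open>One free summand is added for each generator, and its basis element is sent to that
  generator.\<close>

lemma projective_surj:
  fixes M :: "('a, 'm) module"
  assumes M: "M \<in> fgmod R"
  obtains Q :: "('a, 'm) module" and p
  where "projective R Q" "lhom R Q M p" "p ` carrier Q = carrier M" "Q \<in> fgmod R" "left_module R Q"
proof -
  have lM: "left_module R M" using fgmodD[OF M] .
  interpret M: left_module R M by (rule lM)
  obtain F :: "('a, 'm) module" and v where F: "projective R F" "lhom R F (reg R) v" "v ` carrier F = carrier R"
    by (rule free_copy)
  obtain S where S: "S \<subseteq> carrier M" "finite S" and gen: "\<And>H. submodule H R M \<Longrightarrow> S \<subseteq> H \<Longrightarrow> H = carrier M"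
    by (rule fgmodE[OF M]) blast
  have "\<exists>(Q :: ('a, 'm) module) h. projective R Q \<and> lhom R Q M h \<and> T \<subseteq> h ` carrier Q"
    if "finite T" "T \<subseteq> carrier M" for T
    using that
  proof (induction T)
    case empty
    then show ?case using F(1) lhom_zero[OF lM, of F] by blast
  next
    case (insert x T)
    then obtain Q :: "('a, 'm) module" and h where Q: "projective R Q" "lhom R Q M h" "T \<subseteq> h ` carrier Q" by auto
    have x: "x \<in> carrier M" using insert by simp
    note fg = projective_fgmod[OF Q(1)] projective_fgmod[OF F(1)]
    note lm = fgmodD[OF fg(1)] fgmodD[OF fg(2)]
    interpret Q: left_module R Q by (rule lm)
    interpret F: left_module R F by (rule lm)
    obtain D :: "('a, 'm) module" where D: "D \<in> fgmod R" "mod_iso R (dsum Q F) D"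
      using fg_copy[OF fgmod_dsum[OF fg]] by blast
    note lD = fgmodD[OF D(1)] left_module_dsum[OF lm]
    have pD: "projective R D" by (rule projective_dsum[OF D(1) mod_iso_sym[OF D(2) lD(2,1)] Q(1) F(1)])
    obtain u w where uw: "lhom R (dsum Q F) D u" "lhom R D (dsum Q F) w" "\<And>x. x \<in> carrier (dsum Q F) \<Longrightarrow> w (u x) = x"
      using mod_isoE[OF D(2) lD(2,1)] by metis
    let ?c = "\<lambda>z. h (fst z) \<oplus>\<^bsub>M\<^esub> v (snd z) \<odot>\<^bsub>M\<^esub> x"
    have "lhom R (dsum Q F) M ?c"
      using lhom_copair[OF lM Q(2) lhom_comp[OF F(2) lhom_smult[OF lM x]]] .
    then have 1: "lhom R D M (\<lambda>d. ?c (w d))" by (rule lhom_comp[OF uw(2)])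
    have im: "?c z \<in> (\<lambda>d. ?c (w d)) ` carrier D" if "z \<in> carrier (dsum Q F)" for z
    proof -
      have "?c (w (u z)) = ?c z" using uw(3)[OF that] by simp
      then show ?thesis using lhomD(1)[OF uw(1) that] by (metis (no_types, lifting) imageI)
    qed
    have "T \<subseteq> (\<lambda>d. ?c (w d)) ` carrier D"
    proof
      fix t assume "t \<in> T"
      then obtain q where q: "q \<in> carrier Q" "t = h q" using Q(3) by blast
      then have "?c (q, \<zero>\<^bsub>F\<^esub>) = t"
        using lhomZ(1)[OF F(2) lm(2) left_module_reg[OF ring_R]] x lhomD(1)[OF Q(2)] by simp
      then show "t \<in> (\<lambda>d. ?c (w d)) ` carrier D" using im[of "(q, \<zero>\<^bsub>F\<^esub>)"] q(1) by simp
    qed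
    moreover have "x \<in> (\<lambda>d. ?c (w d)) ` carrier D"
    proof -
      obtain y where y: "y \<in> carrier F" "v y = \<one>\<^bsub>R\<^esub>" using F(3) M.R.one_closed by (metis imageE)
      then have "?c (\<zero>\<^bsub>Q\<^esub>, y) = x" using lhomZ(1)[OF Q(2) lm(1) lM] x by simp
      then show ?thesis using im[of "(\<zero>\<^bsub>Q\<^esub>, y)"] y(1) by simp
    qed
    ultimately show ?case using pD 1 by blast
  qed
  from this[OF S(2,1)] obtain Q :: "('a, 'm) module" and h where Q: "projective R Q" "lhom R Q M h" "S \<subseteq> h ` carrier Q"
    by blast
  have fg: "Q \<in> fgmod R" by (rule projective_fgmod[OF Q(1)])
  have "h ` carrier Q = carrier M"
    using gen[OF submodule_image[OF fgmodD[OF fg] lM Q(2) left_module.submodule_carrier[OF fgmodD[OF fg]]] Q(3)] .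
  then show ?thesis using that Q fg fgmodD by blast
qed

text \<open>A minimal supplement \<open>L\<close> of the kernel of a surjection from a projective module is a projective cover:
  a lift of the surjection to \<open>L\<close> restricts to a surjective, hence bijective, endomorphism of \<open>L\<close>.\<close>

lemma proj_cover_exists:
  fixes X :: "('a, 'm) module"
  assumes X: "X \<in> fgmod R"
  obtains Q p where "proj_cover R X Q p"
proof -
  have lX: "left_module R X" using fgmodD[OF X] .
  obtain Q :: "('a, 'm) module" and p where Q: "projective R Q" "lhom R Q X p" "p ` carrier Q = carrier X" "Q \<in> fgmod R" "left_module R Q"
    by (rule projective_surj[OF X]) (rule that)
  interpret Q: left_module R Q by (rule Q(5))
  let ?S = "{L. submodule L R Q \<and> p ` L = carrier X}"
  obtain L where L0: "L \<in> ?S" and min: "\<And>N. (N, L) \<in> sub_rel R Q \<Longrightarrow> N \<notin> ?S"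
    by (rule wfE_min[OF fg_art[OF Q(4), unfolded art_def], of "carrier Q" ?S]) (use Q(3) Q.submodule_carrier in auto)
  then have L: "submodule L R Q" "p ` L = carrier X" by simp_all
  have minL: "N = L" if "submodule N R Q" "N \<subseteq> L" "p ` N = carrier X" for N
    using min[of N] that L(1) unfolding sub_rel_def by blast
  let ?L = "submod Q L"
  have lL: "left_module R ?L" by (rule left_module_submod[OF Q(5) L(1)])
  interpret L: left_module R ?L by (rule lL)
  have fL: "?L \<in> fgmod R" by (rule fg_submod[OF Q(4) L(1)])
  have LQ: "L \<subseteq> carrier Q" using Q.submoduleD(1)[OF L(1)] .
  have pL: "lhom R ?L X p" using lhom_from_submod[OF Q(2) LQ] .
  obtain h where h: "lhom R Q ?L h" "\<And>x. x \<in> carrier Q \<Longrightarrow> p (h x) = p x"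
    by (rule projective_lift[OF Q(1) fL X pL Q(2)]) (simp_all add: L(2))
  have hL: "lhom R ?L ?L h" using lhom_from_submod[OF h(1) LQ] .
  have "h ` L = L"
  proof (rule minL)
    show "submodule (h ` L) R Q"
      using submodule_image[OF lL lL hL L.submodule_carrier] submodule_submod[OF Q(5) L(1)] by simp
    show "h ` L \<subseteq> L" using lhomD(1)[OF hL] by auto
    have "p ` h ` L = p ` L" unfolding image_image using h(2) LQ by (intro image_cong) auto
    then show "p ` h ` L = carrier X" using L(2) by simp
  qed
  then have hs: "h ` carrier ?L = carrier ?L" by simp
  obtain g where g: "lhom R ?L ?L g" "\<And>x. x \<in> carrier ?L \<Longrightarrow> g (h x) = x"
    using lhom_inj_iso[OF lL lL hL hs] surj_endo_inj[OF lL fg_noe[OF fL] hL hs] by metis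
  have "retract R ?L Q (\<lambda>x. x) (\<lambda>x. g (h x))"
    unfolding retract_def using lhom_incl[OF Q(5) L(1)] lhom_comp[OF h(1) g(1)] g(2) by blast
  then have proj: "projective R ?L" by (rule projective_retract[OF lL Q(1)])
  have "N = carrier ?L" if N: "submodule N R ?L" "hom_ker ?L X p <+>\<^bsub>?L\<^esub> N = carrier ?L" for N
  proof -
    have "p ` N = carrier X" using image_of_ker_add[OF lL lX pL N] L(2) by simp
    then show ?thesis using minL[of N] N(1) submodule_submod[OF Q(5) L(1)] by simp
  qed
  moreover have "hom_ker ?L X (restrict p L) = hom_ker ?L X p" by (auto simp: hom_ker_def)
  ultimately have "proj_cover R X ?L (restrict p L)"
    unfolding proj_cover_def using proj restrict_mod_hom[OF lL, of p X] pL L(2) by simp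
  then show ?thesis using that by blast
qed

text \<open>Lifting \<open>p\<close> along \<open>q\<close> and \<open>q\<close> along
  \<open>p\<close> gives \<open>i\<close> and \<open>r\<close>. The composite \<open>r i\<close>
  lies over the identity of \<open>X\<close>, so it is surjective by \<open>cover_surj\<close> and
  bijective by finite length; its inverse \<open>t\<close> corrects \<open>i\<close> to a
  section.\<close>

lemma cover_retract:
  fixes X Q F :: "('a, 'm) module"
  assumes X: "X \<in> fgmod R" and c: "proj_cover R X Q p" and F: "projective R F" "lhom R F X q" "q ` carrier F = carrier X"
  obtains i r where "retract R Q F i r" "\<And>x. x \<in> carrier Q \<Longrightarrow> q (i x) = p x" "\<And>y. y \<in> carrier F \<Longrightarrow> p (r y) = q y"
proof -
  note c' = proj_coverD[OF c] and fF = projective_fgmod[OF F(1)]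
  have lX: "left_module R X" using fgmodD[OF X] .
  obtain r where r: "lhom R F Q r" "\<And>y. y \<in> carrier F \<Longrightarrow> p (r y) = q y"
    by (rule projective_lift[OF F(1) c'(2) X c'(4) F(2) c'(5)]) (rule that)
  obtain i where i: "lhom R Q F i" "\<And>x. x \<in> carrier Q \<Longrightarrow> q (i x) = p x"
    by (rule projective_lift[OF c'(1) fF X F(2) c'(4) F(3)]) (rule that)
  have ri: "lhom R Q Q (\<lambda>x. r (i x))" using lhom_comp[OF i(1) r(1)] .
  have pri: "p (r (i x)) = p x" if "x \<in> carrier Q" for x using r(2)[OF lhomD(1)[OF i(1) that]] i(2)[OF that] by simp
  have "(\<lambda>x. p (r (i x))) ` carrier Q = carrier X" using pri c'(5) by simp
  then have s: "(\<lambda>x. r (i x)) ` carrier Q = carrier Q" by (rule cover_surj[OF c lX c'(3) ri])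
  obtain t where t: "lhom R Q Q t" "\<And>x. x \<in> carrier Q \<Longrightarrow> t (r (i x)) = x" "\<And>x. x \<in> carrier Q \<Longrightarrow> r (i (t x)) = x"
    using lhom_inj_iso[OF c'(3,3) ri s] surj_endo_inj[OF c'(3) fg_noe[OF c'(2)] ri s] by metis
  have tc: "t x \<in> carrier Q" if "x \<in> carrier Q" for x using lhomD(1)[OF t(1) that] .
  have "retract R Q F (\<lambda>x. i (t x)) r"
    unfolding retract_def using lhom_comp[OF t(1) i(1)] r(1) t(3) by blast
  moreover have "q (i (t x)) = p x" if x: "x \<in> carrier Q" for x
    using i(2)[OF tc[OF x]] pri[OF tc[OF x]] t(3)[OF x] by simp
  ultimately show ?thesis using that r(2) by blast
qed

text \<open>Projective covers are unique: the retraction from \<open>cover_retract\<close> is an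
  isomorphism, because minimality of \<open>Q\<close> makes \<open>i\<close> surjective as well.
  Hence the choice made in \<open>syzygy\<close> matters only up to isomorphism.\<close>

lemma cover_kernel_iso:
  fixes X X' Q Q' :: "('a, 'm) module"
  assumes X: "X \<in> fgmod R" "X' \<in> fgmod R" "mod_iso R X X'" and c: "proj_cover R X Q p" "proj_cover R X' Q' p'"
  shows "mod_iso R (submod Q (hom_ker Q X p)) (submod Q' (hom_ker Q' X' p'))"
proof -
  note lX = fgmodD[OF X(1)] fgmodD[OF X(2)] and c1 = proj_coverD[OF c(1)] and c2 = proj_coverD[OF c(2)]
  obtain f g where fg: "lhom R X X' f" "lhom R X' X g" "\<And>x. x \<in> carrier X \<Longrightarrow> g (f x) = x"
    "\<And>y. y \<in> carrier X' \<Longrightarrow> f (g y) = y"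
    using mod_isoE[OF X(3) lX] by metis
  have q: "lhom R Q X' (\<lambda>x. f (p x))" using lhom_comp[OF c1(4) fg(1)] .
  have fX: "f ` carrier X = carrier X'"
    using lhomD(1)[OF fg(1)] lhomD(1)[OF fg(2)] fg(4) by (metis image_eqI image_subsetI subsetI subset_antisym)
  have "(\<lambda>x. f (p x)) ` carrier Q = f ` p ` carrier Q" by (simp add: image_image)
  then have qs: "(\<lambda>x. f (p x)) ` carrier Q = carrier X'" using c1(5) fX by simp
  obtain i r where ir: "retract R Q' Q i r" "\<And>x. x \<in> carrier Q' \<Longrightarrow> f (p (i x)) = p' x"
      "\<And>y. y \<in> carrier Q \<Longrightarrow> p' (r y) = f (p y)"
    by (rule cover_retract[OF X(2) c(2) c1(1) q qs]) (rule that)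
  have i: "lhom R Q' Q i" and r: "lhom R Q Q' r" and ri: "\<And>x. x \<in> carrier Q' \<Longrightarrow> r (i x) = x"
    using ir(1) by (auto simp: retract_def)
  have "(\<lambda>x. p (i x)) ` carrier Q' = carrier X"
  proof
    show "(\<lambda>x. p (i x)) ` carrier Q' \<subseteq> carrier X" using lhomD(1)[OF lhom_comp[OF i c1(4)]] by blast
    show "carrier X \<subseteq> (\<lambda>x. p (i x)) ` carrier Q'"
    proof
      fix x assume x: "x \<in> carrier X"
      then have "f x \<in> p' ` carrier Q'" using c2(5) lhomD(1)[OF fg(1)] by simp
      then obtain z where z: "z \<in> carrier Q'" "f x = p' z" by blast
      then have "f (p (i z)) = f x" using ir(2) by simp
      then have "p (i z) = x" using fg(3)[OF x] fg(3)[OF lhomD(1)[OF lhom_comp[OF i c1(4)] z(1)]] by simp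
      then show "x \<in> (\<lambda>x. p (i x)) ` carrier Q'" using z(1) by blast
    qed
  qed
  then have isj: "i ` carrier Q' = carrier Q" by (rule cover_surj[OF c(1) lX(1) c2(3) i])
  have ir': "i (r y) = y" if "y \<in> carrier Q" for y
  proof -
    have "y \<in> i ` carrier Q'" using that isj by simp
    then show ?thesis
    proof
      fix x assume x: "y = i x" "x \<in> carrier Q'"
      then show ?thesis using ri[OF x(2)] by simp
    qed
  qed
  let ?K = "hom_ker Q X p" and ?K' = "hom_ker Q' X' p'"
  have K: "submodule ?K R Q" "submodule ?K' R Q'" using submodule_ker[OF c1(3) lX(1) c1(4)] submodule_ker[OF c2(3) lX(2) c2(4)] .
  have sub: "?K \<subseteq> carrier Q" "?K' \<subseteq> carrier Q'" by (auto simp: hom_ker_def)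
  have rK: "r y \<in> ?K'" if "y \<in> ?K" for y
    using that ir(3)[of y] lhomD(1)[OF r, of y] lhomZ(1)[OF fg(1) lX] by (simp add: hom_ker_def)
  have iK: "i x \<in> ?K" if "x \<in> ?K'" for x
  proof -
    have x: "x \<in> carrier Q'" "p' x = \<zero>\<^bsub>X'\<^esub>" using that by (simp_all add: hom_ker_def)
    have "g (f (p (i x))) = \<zero>\<^bsub>X\<^esub>" using ir(2)[OF x(1)] x(2) lhomZ(1)[OF fg(2) lX(2,1)] by simp
    then have "p (i x) = \<zero>\<^bsub>X\<^esub>" using fg(3)[OF lhomD(1)[OF lhom_comp[OF i c1(4)] x(1)]] by simp
    then show ?thesis using lhomD(1)[OF i x(1)] by (simp add: hom_ker_def)
  qed
  show ?thesis
  proof (rule mod_isoI[where f = r and g = i])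
    show "left_module R (submod Q ?K)" "left_module R (submod Q' ?K')"
      by (rule left_module_submod[OF c1(3) K(1)], rule left_module_submod[OF c2(3) K(2)])
    show "lhom R (submod Q ?K) (submod Q' ?K') r"
      using lhom_submodI[OF lhom_from_submod[OF r sub(1)]] rK by simp
    show "lhom R (submod Q' ?K') (submod Q ?K) i"
      using lhom_submodI[OF lhom_from_submod[OF i sub(2)]] iK by simp
  qed (use ri ir' sub in auto)
qed

section \<open>Syzygies\<close>

lemma syzygyE:
  fixes X :: "('a, 'm) module"
  assumes X: "X \<in> fgmod R"
  obtains Q p where "proj_cover R X Q p" "syzygy R X = submod Q (hom_ker Q X p)"
    "submodule (hom_ker Q X p) R Q"
proof -
  obtain Q0 p0 where "proj_cover R X Q0 p0" by (rule proj_cover_exists[OF X]) (rule that)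
  then have "\<exists>z. case z of (Q, p) \<Rightarrow> proj_cover R X Q p" by (intro exI[of _ "(Q0, p0)"]) simp
  from someI_ex[OF this] obtain Q p where Qp: "(SOME (Q, p). proj_cover R X Q p) = (Q, p)" "proj_cover R X Q p"
    by (metis (no_types, lifting) case_prodE)
  then have "syzygy R X = submod Q (hom_ker Q X p)" by (simp add: syzygy_def)
  then show ?thesis using that Qp(2) submodule_ker[OF proj_coverD(3) fgmodD[OF X] proj_coverD(4)] by blast
qed

lemma syzygy_fgmod:
  fixes X :: "('a, 'm) module"
  assumes X: "X \<in> fgmod R"
  shows "syzygy R X \<in> fgmod R"
  using syzygyE[OF X] fg_submod proj_coverD(2) by metis

lemma syzygy_iso:
  fixes X X' :: "('a, 'm) module"
  assumes X: "X \<in> fgmod R" "X' \<in> fgmod R" "mod_iso R X X'"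
  shows "mod_iso R (syzygy R X) (syzygy R X')"
  using syzygyE[OF X(1)] syzygyE[OF X(2)] cover_kernel_iso[OF X] by metis

lemma syzygy_pow_fgmod:
  fixes X :: "('a, 'm) module"
  assumes X: "X \<in> fgmod R"
  shows "(syzygy R ^^ n) X \<in> fgmod R"
  using X by (induction n) (simp_all add: syzygy_fgmod)

lemma syzygy_pow_iso:
  fixes X X' :: "('a, 'm) module"
  assumes X: "X \<in> fgmod R" "X' \<in> fgmod R" "mod_iso R X X'"
  shows "mod_iso R ((syzygy R ^^ n) X) ((syzygy R ^^ n) X')"
  using X by (induction n) (simp_all add: syzygy_iso syzygy_pow_fgmod)

end

section \<open>Stable equivalence\<close>

lemma (in left_module) minus_null: "x \<in> carrier M \<Longrightarrow> x \<ominus>\<^bsub>M\<^esub> \<zero>\<^bsub>M\<^esub> = x"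
  using minus_add_cancel[of x "\<zero>\<^bsub>M\<^esub>"] by simp

lemma retract_dsum_iso:
  assumes X: "left_module R X" and M: "left_module R M" and ir: "retract R X M i r"
  shows "mod_iso R M (dsum X (submod M (hom_ker M X r)))"
proof -
  interpret X: left_module R X by fact
  interpret M: left_module R M by fact
  have i: "lhom R X M i" and r: "lhom R M X r" and ri: "\<And>x. x \<in> carrier X \<Longrightarrow> r (i x) = x"
    using ir by (auto simp: retract_def)
  let ?K = "hom_ker M X r"
  have K: "submodule ?K R M" by (rule submodule_ker[OF M X r])
  have KM: "?K \<subseteq> carrier M" by (auto simp: hom_ker_def)
  have lK: "left_module R (submod M ?K)" by (rule left_module_submod[OF M K])
  have ir': "lhom R M M (\<lambda>m. i (r m))" by (rule lhom_comp[OF r i])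
  have d: "m \<ominus>\<^bsub>M\<^esub> i (r m) \<in> ?K" if "m \<in> carrier M" for m
    using that lhomZ(3)[OF r M X that lhomD(1)[OF ir' that]] ri[OF lhomD(1)[OF r that]]
      lhomD(1)[OF ir' that] lhomD(1)[OF r that] X.minus_self[of "r m"] by (simp add: hom_ker_def)
  show ?thesis
  proof (rule mod_isoI[OF M left_module_dsum[OF X lK], where f = "\<lambda>m. (r m, m \<ominus>\<^bsub>M\<^esub> i (r m))" and g = "\<lambda>z. i (fst z) \<oplus>\<^bsub>M\<^esub> snd z"])
    show "lhom R M (dsum X (submod M ?K)) (\<lambda>m. (r m, m \<ominus>\<^bsub>M\<^esub> i (r m)))"
      using d by (intro lhom_pair[OF r] lhom_submodI lhom_diff[OF M lhom_id ir'])
    show "lhom R (dsum X (submod M ?K)) M (\<lambda>z. i (fst z) \<oplus>\<^bsub>M\<^esub> snd z)"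
      by (rule lhom_copair[OF M i lhom_incl[OF M K]])
    show "i (fst (r m, m \<ominus>\<^bsub>M\<^esub> i (r m))) \<oplus>\<^bsub>M\<^esub> snd (r m, m \<ominus>\<^bsub>M\<^esub> i (r m)) = m" if "m \<in> carrier M" for m
      using M.add_minus_cancel[OF that lhomD(1)[OF ir' that]] by simp
    fix z assume "z \<in> carrier (dsum X (submod M ?K))"
    then obtain x k where z: "z = (x, k)" "x \<in> carrier X" "k \<in> carrier M" "r k = \<zero>\<^bsub>X\<^esub>" by (auto simp: hom_ker_def)
    have ix: "i x \<in> carrier M" using lhomD(1)[OF i z(2)] .
    have "r (i x \<oplus>\<^bsub>M\<^esub> k) = x" using lhomD(2)[OF r ix z(3)] ri[OF z(2)] z by simp
    then show "(r (i (fst z) \<oplus>\<^bsub>M\<^esub> snd z), (i (fst z) \<oplus>\<^bsub>M\<^esub> snd z) \<ominus>\<^bsub>M\<^esub> i (r (i (fst z) \<oplus>\<^bsub>M\<^esub> snd z))) = z"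
      using z(1) M.add_minus_self2[OF ix z(3)] by simp
  qed
qed

lemma internal_sum_iso:
  assumes M: "left_module R M" and s: "internal_sum R M A B"
  shows "mod_iso R M (dsum (submod M A) (submod M B))"
proof -
  interpret M: left_module R M by fact
  have A: "submodule A R M" and B: "submodule B R M" and AB: "A \<inter> B = {\<zero>\<^bsub>M\<^esub>}" "A <+>\<^bsub>M\<^esub> B = carrier M"
    using s by (auto simp: internal_sum_def)
  note A' = M.submoduleD[OF A] and B' = M.submoduleD[OF B]
  obtain r where r: "lhom R M (submod M A) r" "\<And>x. x \<in> A \<Longrightarrow> r x = x" "\<And>x. x \<in> B \<Longrightarrow> r x = \<zero>\<^bsub>M\<^esub>"
    using internal_sum_retract[OF M s] by metis
  have ir: "retract R (submod M A) M (\<lambda>x. x) r"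
    unfolding retract_def using lhom_incl[OF M A] r by simp
  have "hom_ker M (submod M A) r = B"
  proof
    show "B \<subseteq> hom_ker M (submod M A) r" using r(3) B'(7) by (auto simp: hom_ker_def)
    show "hom_ker M (submod M A) r \<subseteq> B"
    proof
      fix x assume "x \<in> hom_ker M (submod M A) r"
      then have x: "x \<in> carrier M" "r x = \<zero>\<^bsub>M\<^esub>" by (auto simp: hom_ker_def)
      then obtain a b where ab: "a \<in> A" "b \<in> B" "x = a \<oplus>\<^bsub>M\<^esub> b" using AB(2) set_add_iff[of x M A B] by auto
      have "r x = a"
        using lhomD(2)[OF r(1) A'(7)[OF ab(1)] B'(7)[OF ab(2)]] r(2)[OF ab(1)] r(3)[OF ab(2)] ab(3) A'(7)[OF ab(1)] by simp
      then show "x \<in> B" using ab x(2) B'(7)[OF ab(2)] by simp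
    qed
  qed
  then show ?thesis using retract_dsum_iso[OF left_module_submod[OF M A] M ir] by simp
qed

section \<open>The stable category\<close>

definition pnull :: "('a, 'r) ring_scheme \<Rightarrow> ('a, 'm) module \<Rightarrow> ('a, 'm) module \<Rightarrow> ('m \<Rightarrow> 'm) \<Rightarrow> bool"
  where "pnull R A B h \<longleftrightarrow> (\<exists>(Q :: ('a, 'm) module) s t. projective R Q \<and> lhom R A Q s \<and> lhom R Q B t \<and>
    (\<forall>x\<in>carrier A. h x = t (s x)))"

text \<open>Isomorphism in the stable category, where the maps that satisfy \<open>pnull\<close> are
  zero; \<open>h\<close> and \<open>k\<close> are the defects \<open>1 - g f\<close> and
  \<open>1 - f g\<close>, written additively.\<close>

definition stab :: "('a, 'r) ring_scheme \<Rightarrow> ('a, 'm) module \<Rightarrow> ('a, 'm) module \<Rightarrow> bool"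
  where "stab R A B \<longleftrightarrow> (\<exists>f g h k. lhom R A B f \<and> lhom R B A g \<and> pnull R A A h \<and> pnull R B B k \<and>
    (\<forall>x\<in>carrier A. x = g (f x) \<oplus>\<^bsub>A\<^esub> h x) \<and> (\<forall>y\<in>carrier B. y = f (g y) \<oplus>\<^bsub>B\<^esub> k y))"

text \<open>The pairs \<open>\<iota> : K \<rightarrow> G\<close> and \<open>\<iota>' : K' \<rightarrow> G'\<close> define isomorphic functors
  \<open>N \<mapsto> Hom(K, N) / Hom(G, N) \<circ> \<iota>\<close>; see \<open>ext_iff_pair_eq\<close>.\<close>

definition pair_eq :: "('a, 'r) ring_scheme \<Rightarrow> ('a, 'm) module \<Rightarrow> ('a, 'm) module \<Rightarrow> ('m \<Rightarrow> 'm)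
    \<Rightarrow> ('a, 'm) module \<Rightarrow> ('a, 'm) module \<Rightarrow> ('m \<Rightarrow> 'm) \<Rightarrow> bool"
  where "pair_eq R K G \<iota> K' G' \<iota>' \<longleftrightarrow> (\<exists>u u' g g' c c'.
    lhom R K' K u \<and> lhom R K K' u' \<and> lhom R G' G g \<and> lhom R G G' g' \<and> lhom R G K c \<and> lhom R G' K' c' \<and>
    (\<forall>y\<in>carrier K'. \<iota> (u y) = g (\<iota>' y)) \<and> (\<forall>x\<in>carrier K. \<iota>' (u' x) = g' (\<iota> x)) \<and>
    (\<forall>x\<in>carrier K. x = u (u' x) \<oplus>\<^bsub>K\<^esub> c (\<iota> x)) \<and> (\<forall>y\<in>carrier K'. y = u' (u y) \<oplus>\<^bsub>K'\<^esub> c' (\<iota>' y)))"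

lemma pnullI:
  fixes Q A B :: "('a, 'm) module"
  shows "\<lbrakk>projective R Q; lhom R A Q s; lhom R Q B t; \<And>x. x \<in> carrier A \<Longrightarrow> h x = t (s x)\<rbrakk> \<Longrightarrow> pnull R A B h"
  unfolding pnull_def by blast

lemma pnullE:
  fixes A B :: "('a, 'm) module"
  assumes "pnull R A B h"
  obtains Q :: "('a, 'm) module" and s t
  where "projective R Q" "lhom R A Q s" "lhom R Q B t" "\<forall>x\<in>carrier A. h x = t (s x)"
  using assms unfolding pnull_def by blast

lemma pnull_lhom:
  fixes A B :: "('a, 'm) module"
  assumes "pnull R A B h" "left_module R A"
  shows "lhom R A B h"
proof -
  obtain Q :: "('a, 'm) module" and s t where "projective R Q" "lhom R A Q s" "lhom R Q B t" "\<forall>x\<in>carrier A. h x = t (s x)"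
    by (rule pnullE[OF assms(1)]) (rule that)
  then show ?thesis using lhom_comp[of R A Q s B t] lhom_cong[OF assms(2), of h "\<lambda>x. t (s x)" B] by simp
qed

lemma pnull_comp:
  fixes A B C D :: "('a, 'm) module"
  assumes "pnull R A B h" "lhom R B C f" "lhom R D A g"
  shows "pnull R D C (\<lambda>x. f (h (g x)))"
proof -
  obtain Q :: "('a, 'm) module" and s t where Q: "projective R Q" "lhom R A Q s" "lhom R Q B t" "\<forall>x\<in>carrier A. h x = t (s x)"
    by (rule pnullE[OF assms(1)]) (rule that)
  show ?thesis
    by (rule pnullI[OF Q(1) lhom_comp[OF assms(3) Q(2)] lhom_comp[OF Q(3) assms(2)]])
      (use Q(4) lhomD(1)[OF assms(3)] in simp)
qed

text \<open>The projective in the middle lifts along any surjection onto \<open>B\<close>. Two null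
  maps can thus be routed through the same module, and through one in add \<open>P\<close> where
  that is required.\<close>

lemma pnull_cover:
  fixes A B P :: "('a, 'm) module"
  assumes "pnull R A B h" "B \<in> fgmod R" "P \<in> fgmod R" "lhom R P B q" "q ` carrier P = carrier B"
  obtains s where "lhom R A P s" "\<And>x. x \<in> carrier A \<Longrightarrow> h x = q (s x)"
proof -
  obtain Q :: "('a, 'm) module" and s t where Q: "projective R Q" "lhom R A Q s" "lhom R Q B t" "\<forall>x\<in>carrier A. h x = t (s x)"
    by (rule pnullE[OF assms(1)]) (rule that)
  obtain t' where t': "lhom R Q P t'" "\<And>x. x \<in> carrier Q \<Longrightarrow> q (t' x) = t x"
    by (rule projective_lift[OF Q(1) assms(3,2,4) Q(3) assms(5)]) (rule that)
  have "h x = q (t' (s x))" if "x \<in> carrier A" for x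
    using Q(4) t'(2)[OF lhomD(1)[OF Q(2) that]] that by simp
  then show ?thesis using that lhom_comp[OF Q(2) t'(1)] by blast
qed

lemma stab_sym: "stab R A B \<Longrightarrow> stab R B A"
  unfolding stab_def by blast

text \<open>With \<open>h = q s\<close>, the map \<open>G F + s q\<close> lies over the identity of
  \<open>A\<close>, so \<open>c = 1 - G F - s q\<close> takes values in the kernel. On the kernel
  \<open>s q\<close> vanishes, which leaves \<open>1 = G F + c\<close> with \<open>c\<close> defined
  on all of \<open>Q\<close>.\<close>

lemma stab_kernel_half:
  fixes A B Q Q' :: "('a, 'm) module"
  assumes AB: "A \<in> fgmod R" "B \<in> fgmod R" "lhom R A B f" "lhom R B A g" "pnull R A A h"
    and id: "\<And>x. x \<in> carrier A \<Longrightarrow> x = g (f x) \<oplus>\<^bsub>A\<^esub> h x"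
    and Q: "projective R Q" "lhom R Q A q" "q ` carrier Q = carrier A"
    and Q': "left_module R Q'" "lhom R Q' B q'"
    and F: "lhom R Q Q' F" "\<And>x. x \<in> carrier Q \<Longrightarrow> q' (F x) = f (q x)"
    and G: "lhom R Q' Q G" "\<And>x. x \<in> carrier Q' \<Longrightarrow> q (G x) = g (q' x)"
  obtains c where "lhom R Q (submod Q (hom_ker Q A q)) c"
    "\<And>x. x \<in> hom_ker Q A q \<Longrightarrow> x = G (F x) \<oplus>\<^bsub>Q\<^esub> c x"
proof -
  have fQ: "Q \<in> fgmod R" by (rule projective_fgmod[OF Q(1)])
  have lQ: "left_module R Q" and lA: "left_module R A" using fgmodD fQ AB(1) by blast+
  interpret Q: left_module R Q by (rule lQ)
  interpret A: left_module R A by (rule lA)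
  obtain s where s: "lhom R A Q s" "\<And>x. x \<in> carrier A \<Longrightarrow> h x = q (s x)"
    by (rule pnull_cover[OF AB(5,1) fQ Q(2,3)]) (rule that)
  have GF: "lhom R Q Q (\<lambda>x. G (F x))" by (rule lhom_comp[OF F(1) G(1)])
  have sq: "lhom R Q Q (\<lambda>x. s (q x))" by (rule lhom_comp[OF Q(2) s(1)])
  have e: "lhom R Q Q (\<lambda>x. G (F x) \<oplus>\<^bsub>Q\<^esub> s (q x))" by (rule lhom_add[OF lQ GF sq])
  define c where "c x = x \<ominus>\<^bsub>Q\<^esub> (G (F x) \<oplus>\<^bsub>Q\<^esub> s (q x))" for x
  have c: "lhom R Q Q c" unfolding c_def by (rule lhom_diff[OF lQ lhom_id e])
  have "q (c x) = \<zero>\<^bsub>A\<^esub>" if x: "x \<in> carrier Q" for x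
  proof -
    have qx: "q x \<in> carrier A" using lhomD(1)[OF Q(2) x] .
    have "q (G (F x) \<oplus>\<^bsub>Q\<^esub> s (q x)) = g (f (q x)) \<oplus>\<^bsub>A\<^esub> h (q x)"
      using lhomD(2)[OF Q(2) lhomD(1)[OF GF x] lhomD(1)[OF sq x]] G(2)[OF lhomD(1)[OF F(1) x]] F(2)[OF x] s(2)[OF qx]
      by simp
    also have "\<dots> = q x" using id[OF qx] by simp
    finally show ?thesis
      unfolding c_def using lhomZ(3)[OF Q(2) lQ lA x lhomD(1)[OF e x]] A.minus_self[OF qx] by simp
  qed
  then have c': "lhom R Q (submod Q (hom_ker Q A q)) c"
    using lhomD(1)[OF c] by (intro lhom_submodI[OF c]) (simp add: hom_ker_def)
  have "x = G (F x) \<oplus>\<^bsub>Q\<^esub> c x" if "x \<in> hom_ker Q A q" for x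
  proof -
    have x: "x \<in> carrier Q" "q x = \<zero>\<^bsub>A\<^esub>" using that by (auto simp: hom_ker_def)
    then have "c x = x \<ominus>\<^bsub>Q\<^esub> G (F x)"
      using lhomZ(1)[OF s(1) lA lQ] lhomD(1)[OF GF x(1)] by (simp add: c_def)
    then show ?thesis using Q.add_minus_cancel[OF x(1) lhomD(1)[OF GF x(1)]] by simp
  qed
  then show ?thesis using that c' by blast
qed

lemma lhom_ker_restrict:
  assumes "lhom R Q Q' F" "\<And>x. x \<in> carrier Q \<Longrightarrow> q' (F x) = f (q x)" "f \<zero>\<^bsub>A\<^esub> = \<zero>\<^bsub>B\<^esub>"
  shows "lhom R (submod Q (hom_ker Q A q)) (submod Q' (hom_ker Q' B q')) F"
proof (rule lhom_submodI)
  show "lhom R (submod Q (hom_ker Q A q)) Q' F"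
    by (rule lhom_from_submod[OF assms(1)]) (auto simp: hom_ker_def)
  show "F x \<in> hom_ker Q' B q'" if "x \<in> carrier (submod Q (hom_ker Q A q))" for x
    using that assms(2,3) lhomD(1)[OF assms(1)] by (auto simp: hom_ker_def)
qed

lemma stab_pair_eq:
  fixes A B Q Q' :: "('a, 'm) module"
  assumes AB: "A \<in> fgmod R" "B \<in> fgmod R" "stab R A B"
    and Q: "projective R Q" "lhom R Q A q" "q ` carrier Q = carrier A"
    and Q': "projective R Q'" "lhom R Q' B q'" "q' ` carrier Q' = carrier B"
  shows "pair_eq R (submod Q (hom_ker Q A q)) Q (\<lambda>x. x) (submod Q' (hom_ker Q' B q')) Q' (\<lambda>x. x)"
proof -
  obtain f g h k where fg: "lhom R A B f" "lhom R B A g" "pnull R A A h" "pnull R B B k"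
    "\<forall>x\<in>carrier A. x = g (f x) \<oplus>\<^bsub>A\<^esub> h x" "\<forall>y\<in>carrier B. y = f (g y) \<oplus>\<^bsub>B\<^esub> k y"
    using AB(3) unfolding stab_def by blast
  note fQ = projective_fgmod[OF Q(1)] projective_fgmod[OF Q'(1)]
  note lQ = fgmodD[OF fQ(1)] fgmodD[OF fQ(2)] and lA = fgmodD[OF AB(1)] fgmodD[OF AB(2)]
  obtain F where F: "lhom R Q Q' F" "\<And>x. x \<in> carrier Q \<Longrightarrow> q' (F x) = f (q x)"
    by (rule projective_lift[OF Q(1) fQ(2) AB(2) Q'(2) lhom_comp[OF Q(2) fg(1)] Q'(3)]) (rule that)
  obtain G where G: "lhom R Q' Q G" "\<And>x. x \<in> carrier Q' \<Longrightarrow> q (G x) = g (q' x)"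
    by (rule projective_lift[OF Q'(1) fQ(1) AB(1) Q(2) lhom_comp[OF Q'(2) fg(2)] Q(3)]) (rule that)
  let ?K = "submod Q (hom_ker Q A q)" and ?K' = "submod Q' (hom_ker Q' B q')"
  obtain c where c: "lhom R Q ?K c" "\<And>x. x \<in> hom_ker Q A q \<Longrightarrow> x = G (F x) \<oplus>\<^bsub>Q\<^esub> c x"
    by (rule stab_kernel_half[OF AB(1,2) fg(1,2,3) fg(5)[rule_format] Q lQ(2) Q'(2) F G]) (assumption | rule that)+
  obtain c' where c': "lhom R Q' ?K' c'" "\<And>x. x \<in> hom_ker Q' B q' \<Longrightarrow> x = F (G x) \<oplus>\<^bsub>Q'\<^esub> c' x"
    by (rule stab_kernel_half[OF AB(2,1) fg(2,1,4) fg(6)[rule_format] Q' lQ(1) Q(2) G F]) (assumption | rule that)+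
  have FK: "lhom R ?K ?K' F" by (rule lhom_ker_restrict[where f = f and q = q and q' = q', OF F lhomZ(1)[OF fg(1) lA]])
  have GK: "lhom R ?K' ?K G" by (rule lhom_ker_restrict[where f = g and q = q' and q' = q, OF G lhomZ(1)[OF fg(2) lA(2,1)]])
  show ?thesis
    unfolding pair_eq_def using c(2) c'(2) FK GK F(1) G(1) c(1) c'(1)
    by (intro exI[of _ G] exI[of _ F] exI[of _ G] exI[of _ F] exI[of _ c] exI[of _ c']) simp
qed

text \<open>A stable form of Schanuel's lemma: the homotopies \<open>c\<close>, \<open>c'\<close> on
  the kernels extend to the projective modules \<open>Q\<close>, \<open>Q'\<close>, so they are
  null.\<close>

lemma stab_kernel:
  fixes A B Q Q' :: "('a, 'm) module"
  assumes AB: "A \<in> fgmod R" "B \<in> fgmod R" "stab R A B"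
    and Q: "projective R Q" "lhom R Q A q" "q ` carrier Q = carrier A"
    and Q': "projective R Q'" "lhom R Q' B q'" "q' ` carrier Q' = carrier B"
  shows "stab R (submod Q (hom_ker Q A q)) (submod Q' (hom_ker Q' B q'))"
proof -
  let ?K = "submod Q (hom_ker Q A q)" and ?K' = "submod Q' (hom_ker Q' B q')"
  obtain u u' g g' c c' where *: "lhom R ?K' ?K u" "lhom R ?K ?K' u'" "lhom R Q ?K c" "lhom R Q' ?K' c'"
    "\<forall>x\<in>carrier ?K. x = u (u' x) \<oplus>\<^bsub>?K\<^esub> c x" "\<forall>y\<in>carrier ?K'. y = u' (u y) \<oplus>\<^bsub>?K'\<^esub> c' y"
    using stab_pair_eq[OF assms] unfolding pair_eq_def by (elim exE conjE) (rule that)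
  note lQ = fgmodD[OF projective_fgmod[OF Q(1)]] fgmodD[OF projective_fgmod[OF Q'(1)]]
  have K: "submodule (hom_ker Q A q) R Q" "submodule (hom_ker Q' B q') R Q'"
    using submodule_ker[OF lQ(1) fgmodD[OF AB(1)] Q(2)] submodule_ker[OF lQ(2) fgmodD[OF AB(2)] Q'(2)] .
  have "pnull R ?K ?K c" by (rule pnullI[OF Q(1) lhom_incl[OF lQ(1) K(1)] *(3)]) simp
  moreover have "pnull R ?K' ?K' c'" by (rule pnullI[OF Q'(1) lhom_incl[OF lQ(2) K(2)] *(4)]) simp
  ultimately show ?thesis
    unfolding stab_def using *(1,2,5,6)
    by (intro exI[of _ u'] exI[of _ u] exI[of _ c] exI[of _ c']) simp
qed

text \<open>The entries \<open>A -> B\<close> and \<open>B -> A\<close> of the isomorphism and its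
  inverse are stably inverse, since the rest of the matrix product passes through \<open>P\<close>
  or \<open>C\<close>.\<close>

lemma dsum_iso_stab:
  fixes A B C P :: "('a, 'm) module"
  assumes AB: "left_module R A" "left_module R B" and CP: "projective R C" "projective R P"
    and iso: "mod_iso R (dsum A C) (dsum B P)"
  shows "stab R A B"
proof -
  \<comment> \<open>The maps \<open>f\<close> and \<open>g\<close> are pinned down by equations, so
    that the two applications of this statement yield the same pair.\<close>
  have half: "\<exists>f g h. f = (\<lambda>x. fst (u (x, \<zero>\<^bsub>C\<^esub>))) \<and> g = (\<lambda>y. fst (v (y, \<zero>\<^bsub>P\<^esub>))) \<and> lhom R A B f \<and> pnull R A A h \<and>
      (\<forall>x\<in>carrier A. x = g (f x) \<oplus>\<^bsub>A\<^esub> h x)"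
    if AB: "left_module R A" "left_module R B" and CP: "projective R C" "projective R P"
      and uv: "lhom R (dsum A C) (dsum B P) u" "lhom R (dsum B P) (dsum A C) v" "\<And>x. x \<in> carrier (dsum A C) \<Longrightarrow> v (u x) = x"
    for A B C P :: "('a, 'm) module" and u v
  proof -
    note l = fgmodD[OF projective_fgmod[OF CP(1)]] fgmodD[OF projective_fgmod[OF CP(2)]]
    interpret A: left_module R A by fact
    interpret B: left_module R B by fact
    interpret C: left_module R C by (rule l)
    interpret P: left_module R P by (rule l)
    note m = dsum_maps[OF AB(1) l(1)] and m' = dsum_maps[OF AB(2) l(2)]
    let ?f = "\<lambda>x. fst (u (x, \<zero>\<^bsub>C\<^esub>))" and ?g = "\<lambda>y. fst (v (y, \<zero>\<^bsub>P\<^esub>))"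
    let ?s = "\<lambda>x. snd (u (x, \<zero>\<^bsub>C\<^esub>))" and ?t = "\<lambda>w. fst (v (\<zero>\<^bsub>B\<^esub>, w))"
    have f: "lhom R A B ?f" using lhom_comp[OF lhom_comp[OF m(1) uv(1)] m'(3)] .
    have s: "lhom R A P ?s" using lhom_comp[OF lhom_comp[OF m(1) uv(1)] m'(4)] .
    have t: "lhom R P A ?t" using lhom_comp[OF lhom_comp[OF m'(2) uv(2)] m(3)] .
    have eq: "x = ?g (?f x) \<oplus>\<^bsub>A\<^esub> ?t (?s x)" if x: "x \<in> carrier A" for x
    proof -
      have c: "?f x \<in> carrier B" "?s x \<in> carrier P" using lhomD(1)[OF f x] lhomD(1)[OF s x] .
      have "u (x, \<zero>\<^bsub>C\<^esub>) = (?f x, \<zero>\<^bsub>P\<^esub>) \<oplus>\<^bsub>dsum B P\<^esub> (\<zero>\<^bsub>B\<^esub>, ?s x)" using c by simp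
      then have "v (u (x, \<zero>\<^bsub>C\<^esub>)) = v (?f x, \<zero>\<^bsub>P\<^esub>) \<oplus>\<^bsub>dsum A C\<^esub> v (\<zero>\<^bsub>B\<^esub>, ?s x)"
        using lhomD(2)[OF uv(2), of "(?f x, \<zero>\<^bsub>P\<^esub>)" "(\<zero>\<^bsub>B\<^esub>, ?s x)"] c by simp
      then show ?thesis using uv(3)[of "(x, \<zero>\<^bsub>C\<^esub>)"] x by (metis C.M.zero_closed dsum_simps(1,3) fst_conv mem_Sigma_iff)
    qed
    have pn: "pnull R A A (\<lambda>x. ?t (?s x))" by (rule pnullI[OF CP(2) s t]) (rule refl)
    show ?thesis
      by (rule exI[of _ ?f], rule exI[of _ ?g], rule exI[of _ "\<lambda>x. ?t (?s x)"])
        (use f pn eq in blast)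
  qed
  note l = fgmodD[OF projective_fgmod[OF CP(1)]] fgmodD[OF projective_fgmod[OF CP(2)]]
  obtain u v where uv: "lhom R (dsum A C) (dsum B P) u" "lhom R (dsum B P) (dsum A C) v"
    "\<And>x. x \<in> carrier (dsum A C) \<Longrightarrow> v (u x) = x" "\<And>x. x \<in> carrier (dsum B P) \<Longrightarrow> u (v x) = x"
    using mod_isoE[OF iso left_module_dsum[OF AB(1) l(1)] left_module_dsum[OF AB(2) l(2)]] by metis
  from half[OF AB CP uv(1,2,3)] half[OF AB(2,1) CP(2,1) uv(2,1,4)]
  show ?thesis unfolding stab_def by blast
qed

context good_ring
begin

lemma pnull_zero:
  fixes A B :: "('a, 'm) module"
  assumes "left_module R B"
  shows "pnull R A B (\<lambda>x. \<zero>\<^bsub>B\<^esub>)"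
proof -
  obtain F :: "('a, 'm) module" and v where F: "projective R F" "lhom R F (reg R) v" "v ` carrier F = carrier R"
    by (rule free_copy)
  show ?thesis
    by (rule pnullI[OF F(1) lhom_zero[OF fgmodD[OF projective_fgmod[OF F(1)]]] lhom_zero[OF assms]]) simp
qed

text \<open>Both maps are routed through one projective \<open>Q\<close> onto \<open>B\<close>,
  where their first factors can be added.\<close>

lemma pnull_add:
  fixes A B :: "('a, 'm) module"
  assumes "pnull R A B h" "pnull R A B k" "B \<in> fgmod R"
  shows "pnull R A B (\<lambda>x. h x \<oplus>\<^bsub>B\<^esub> k x)"
proof -
  obtain Q :: "('a, 'm) module" and p
    where Q: "projective R Q" "lhom R Q B p" "p ` carrier Q = carrier B" "Q \<in> fgmod R" "left_module R Q"
    by (rule projective_surj[OF assms(3)]) (rule that)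
  obtain s where s: "lhom R A Q s" "\<And>x. x \<in> carrier A \<Longrightarrow> h x = p (s x)"
    by (rule pnull_cover[OF assms(1,3) Q(4,2,3)]) (rule that)
  obtain t where t: "lhom R A Q t" "\<And>x. x \<in> carrier A \<Longrightarrow> k x = p (t x)"
    by (rule pnull_cover[OF assms(2,3) Q(4,2,3)]) (rule that)
  show ?thesis
  proof (rule pnullI[OF Q(1) lhom_add[OF Q(5) s(1) t(1)] Q(2)])
    fix x assume x: "x \<in> carrier A"
    show "h x \<oplus>\<^bsub>B\<^esub> k x = p (s x \<oplus>\<^bsub>Q\<^esub> t x)"
      using lhomD(2)[OF Q(2) lhomD(1)[OF s(1) x] lhomD(1)[OF t(1) x]] s(2)[OF x] t(2)[OF x] by simp
  qed
qed

lemma iso_stab: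
  fixes A B :: "('a, 'm) module"
  assumes "mod_iso R A B" "left_module R A" "left_module R B"
  shows "stab R A B"
proof -
  interpret A: left_module R A by fact
  interpret B: left_module R B by fact
  obtain f g where fg: "lhom R A B f" "lhom R B A g" "\<And>x. x \<in> carrier A \<Longrightarrow> g (f x) = x"
    "\<And>y. y \<in> carrier B \<Longrightarrow> f (g y) = y"
    using mod_isoE[OF assms] by metis
  show ?thesis
    unfolding stab_def
    using fg pnull_zero[OF assms(2), of A] pnull_zero[OF assms(3), of B]
    by (intro exI[of _ f] exI[of _ g] exI[of _ "\<lambda>x. \<zero>\<^bsub>A\<^esub>"] exI[of _ "\<lambda>x. \<zero>\<^bsub>B\<^esub>"]) simp
qed

text \<open>The defect of the composite is \<open>g h' f + h\<close>, a sum of null maps.\<close>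

lemma stab_trans:
  fixes A B C :: "('a, 'm) module"
  assumes AB: "stab R A B" and BC: "stab R B C" and fg: "A \<in> fgmod R" "B \<in> fgmod R" "C \<in> fgmod R"
  shows "stab R A C"
proof -
  note l = fgmodD[OF fg(1)] fgmodD[OF fg(2)] fgmodD[OF fg(3)]
  have half: "pnull R A A (\<lambda>x. g (h' (f x)) \<oplus>\<^bsub>A\<^esub> h x) \<and>
      (\<forall>x\<in>carrier A. x = g (g' (f' (f x))) \<oplus>\<^bsub>A\<^esub> (g (h' (f x)) \<oplus>\<^bsub>A\<^esub> h x))"
    if fgm: "A \<in> fgmod R" "B \<in> fgmod R" and f: "lhom R A B f" "lhom R B A g" "pnull R A A h" "\<forall>x\<in>carrier A. x = g (f x) \<oplus>\<^bsub>A\<^esub> h x"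
      and f': "lhom R B C f'" "lhom R C B g'" "pnull R B B h'" "\<forall>x\<in>carrier B. x = g' (f' x) \<oplus>\<^bsub>B\<^esub> h' x"
    for A B C :: "('a, 'm) module" and f g h f' g' h'
  proof
    interpret A: left_module R A by (rule fgmodD[OF fgm(1)])
    show "pnull R A A (\<lambda>x. g (h' (f x)) \<oplus>\<^bsub>A\<^esub> h x)"
      by (rule pnull_add[OF pnull_comp[OF f'(3) f(2,1)] f(3) fgm(1)])
    show "\<forall>x\<in>carrier A. x = g (g' (f' (f x))) \<oplus>\<^bsub>A\<^esub> (g (h' (f x)) \<oplus>\<^bsub>A\<^esub> h x)"
    proof
      fix x assume x: "x \<in> carrier A"
      have fx: "f x \<in> carrier B" using lhomD(1)[OF f(1) x] .
      have y: "g' (f' (f x)) \<in> carrier B" using lhomD(1)[OF f'(2) lhomD(1)[OF f'(1) fx]] .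
      have z: "h' (f x) \<in> carrier B" using lhomD(1)[OF pnull_lhom[OF f'(3) fgmodD[OF fgm(2)]] fx] .
      have w: "h x \<in> carrier A" using lhomD(1)[OF pnull_lhom[OF f(3) fgmodD[OF fgm(1)]] x] .
      have "g (f x) = g (g' (f' (f x))) \<oplus>\<^bsub>A\<^esub> g (h' (f x))"
        using lhomD(2)[OF f(2) y z] f'(4)[rule_format, OF fx] by simp
      then show "x = g (g' (f' (f x))) \<oplus>\<^bsub>A\<^esub> (g (h' (f x)) \<oplus>\<^bsub>A\<^esub> h x)"
        using f(4)[rule_format, OF x] lhomD(1)[OF f(2) y] lhomD(1)[OF f(2) z] w by (simp add: A.M.a_assoc)
    qed
  qed
  obtain f g h k where f: "lhom R A B f" "lhom R B A g" "pnull R A A h" "pnull R B B k"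
    "\<forall>x\<in>carrier A. x = g (f x) \<oplus>\<^bsub>A\<^esub> h x" "\<forall>y\<in>carrier B. y = f (g y) \<oplus>\<^bsub>B\<^esub> k y"
    using AB unfolding stab_def by blast
  obtain f' g' h' k' where f': "lhom R B C f'" "lhom R C B g'" "pnull R B B h'" "pnull R C C k'"
    "\<forall>x\<in>carrier B. x = g' (f' x) \<oplus>\<^bsub>B\<^esub> h' x" "\<forall>y\<in>carrier C. y = f' (g' y) \<oplus>\<^bsub>C\<^esub> k' y"
    using BC unfolding stab_def by blast
  from half[OF fg(1,2) f(1,2,3,5) f'(1,2,3,5)] half[OF fg(3,2) f'(2,1,4,6) f(2,1,4,6)]
  show ?thesis
    unfolding stab_def using lhom_comp[OF f(1) f'(1)] lhom_comp[OF f'(2) f(2)]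
    by (intro exI[of _ "\<lambda>x. f' (f x)"] exI[of _ "\<lambda>x. g (g' x)"] exI[of _ "\<lambda>x. g (h' (f x)) \<oplus>\<^bsub>A\<^esub> h x"]
        exI[of _ "\<lambda>x. f' (k (g' x)) \<oplus>\<^bsub>C\<^esub> k' x"]) simp
qed

text \<open>If \<open>f\<close>, \<open>g\<close> are stably inverse and \<open>1 - g f = p s\<close> with \<open>p : P \<rightarrow> A\<close> a projective presentation, then
  \<open>(f, s) : A \<rightarrow> B \<oplus> P\<close> is split by \<open>(g, p)\<close>, whose kernel is projective.\<close>

lemma stab_dsum_iso:
  fixes A B :: "('a, 'm) module"
  assumes AB: "A \<in> fgmod R" "B \<in> fgmod R" "stab R A B"
  obtains C P :: "('a, 'm) module" where "projective R C" "projective R P" "mod_iso R (dsum A C) (dsum B P)"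
proof -
  obtain f g h k where fg: "lhom R A B f" "lhom R B A g" "pnull R A A h" "pnull R B B k"
    "\<forall>x\<in>carrier A. x = g (f x) \<oplus>\<^bsub>A\<^esub> h x" "\<forall>y\<in>carrier B. y = f (g y) \<oplus>\<^bsub>B\<^esub> k y"
    using AB(3) unfolding stab_def by blast
  have lA: "left_module R A" and lB: "left_module R B" using fgmodD AB(1,2) by blast+
  obtain P :: "('a, 'm) module" and p
    where P: "projective R P" "lhom R P A p" "p ` carrier P = carrier A" "P \<in> fgmod R" "left_module R P"
    by (rule projective_surj[OF AB(1)]) (rule that)
  interpret A: left_module R A by (rule lA)
  interpret B: left_module R B by (rule lB)
  interpret P: left_module R P by (rule P(5))
  obtain s where s: "lhom R A P s" "\<And>x. x \<in> carrier A \<Longrightarrow> h x = p (s x)"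
    by (rule pnull_cover[OF fg(3) AB(1) P(4,2,3)]) (rule that)
  obtain Q' :: "('a, 'm) module" and s' t' where Q': "projective R Q'" "lhom R B Q' s'" "lhom R Q' B t'" "\<forall>y\<in>carrier B. k y = t' (s' y)"
    by (rule pnullE[OF fg(4)]) (rule that)
  let ?D = "dsum B P"
  have lD: "left_module R ?D" by (rule left_module_dsum[OF lB P(5)])
  have fD: "?D \<in> fgmod R" by (rule fgmod_dsum[OF AB(2) P(4)])
  note m = dsum_maps[OF lB P(5)]
  let ?i = "\<lambda>x. (f x, s x)" and ?r = "\<lambda>z. g (fst z) \<oplus>\<^bsub>A\<^esub> p (snd z)"
  have i: "lhom R A ?D ?i" by (rule lhom_pair[OF fg(1) s(1)])
  have r: "lhom R ?D A ?r" by (rule lhom_copair[OF lA fg(2) P(2)])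
  have ri: "?r (?i x) = x" if "x \<in> carrier A" for x using fg(5) s(2) that by simp
  have ret: "retract R A ?D ?i ?r" unfolding retract_def using i r ri by simp
  let ?K = "hom_ker ?D A ?r"
  let ?C0 = "submod ?D ?K"
  have K: "submodule ?K R ?D" by (rule submodule_ker[OF lD lA r])
  have lC0: "left_module R ?C0" by (rule left_module_submod[OF lD K])
  have fC0: "?C0 \<in> fgmod R" by (rule fg_submod[OF fD K])
  obtain C :: "('a, 'm) module" where C: "C \<in> fgmod R" "mod_iso R ?C0 C" using fg_copy[OF fC0] by blast
  have lC: "left_module R C" by (rule fgmodD[OF C(1)])
  obtain v u where uv: "lhom R ?C0 C v" "lhom R C ?C0 u" "\<And>y. y \<in> carrier C \<Longrightarrow> v (u y) = y"
    by (rule mod_isoE[OF C(2) lC0 lC]) (rule that)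
  interpret D: left_module R ?D by (rule lD)
  interpret C: left_module R C by (rule lC)
  interpret C0: left_module R ?C0 by (rule lC0)
  \<comment> \<open>The projection \<open>1 - i r\<close> onto the kernel \<open>?K\<close> of
    \<open>?r\<close>.\<close>
  define e where "e z = z \<ominus>\<^bsub>?D\<^esub> ?i (?r z)" for z
  have ir: "lhom R ?D ?D (\<lambda>z. ?i (?r z))" by (rule lhom_comp[OF r i])
  have e0: "lhom R ?D ?D e" unfolding e_def by (rule lhom_diff[OF lD lhom_id ir])
  have "?r (e z) = \<zero>\<^bsub>A\<^esub>" if z: "z \<in> carrier ?D" for z
    unfolding e_def using lhomZ(3)[OF r lD lA z lhomD(1)[OF ir z]] ri[OF lhomD(1)[OF r z]] A.minus_self[OF lhomD(1)[OF r z]]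
    by simp
  then have e: "lhom R ?D ?C0 e" using lhomD(1)[OF e0] by (intro lhom_submodI[OF e0]) (simp add: hom_ker_def)
  have eK: "e z = z" if "z \<in> ?K" for z
  proof -
    have z: "z \<in> carrier ?D" "?r z = \<zero>\<^bsub>A\<^esub>" using that unfolding hom_ker_def by blast+
    show ?thesis unfolding e_def z(2) lhomZ(1)[OF i lA lD] using D.minus_null[OF z(1)] .
  qed
  have KD: "?K \<subseteq> carrier ?D" by (auto simp: hom_ker_def)
  have uD: "lhom R C ?D u" by (rule lhom_submodD[OF uv(2) KD])
  \<comment> \<open>For \<open>(y, w)\<close> in the kernel, \<open>g y = - p w\<close>, so
    \<open>y = f (g y) + k y\<close> becomes \<open>y = - f (p w) + t' (s' y)\<close>. Thus
    \<open>(y, w)\<close> is the sum of a term that depends on \<open>w\<close> in \<open>P\<close>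
    and one that depends on \<open>s' y\<close> in \<open>Q'\<close>, and the identity of
    \<open>C\<close> passes through these two projectives.\<close>
  let ?a1 = "\<lambda>c. snd (u c)" and ?b1 = "\<lambda>y. v (e (\<ominus>\<^bsub>B\<^esub> f (p y), y))"
  let ?a2 = "\<lambda>c. s' (fst (u c))" and ?b2 = "\<lambda>w. v (e (t' w, \<zero>\<^bsub>P\<^esub>))"
  have b1': "lhom R P ?D (\<lambda>y. (\<ominus>\<^bsub>B\<^esub> f (p y), y))" by (rule lhom_pair[OF lhom_neg[OF lB lhom_comp[OF P(2) fg(1)]] lhom_id])
  have b2': "lhom R Q' ?D (\<lambda>w. (t' w, \<zero>\<^bsub>P\<^esub>))" by (rule lhom_comp[OF Q'(3) m(1)])
  have a: "lhom R C P ?a1" "lhom R C Q' ?a2"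
    by (rule lhom_comp[OF uD m(4)], rule lhom_comp[OF lhom_comp[OF uD m(3)] Q'(2)])
  have b: "lhom R P C ?b1" "lhom R Q' C ?b2"
    by (rule lhom_comp[OF lhom_comp[OF b1' e] uv(1)], rule lhom_comp[OF lhom_comp[OF b2' e] uv(1)])
  have "projective R C"
  proof (rule projective_thruI[OF C(1) P(1) Q'(1) a(1) b(1) a(2) b(2)])
    fix c assume c: "c \<in> carrier C"
    obtain y w where yw: "u c = (y, w)" by force
    have "(y, w) \<in> ?K" using lhomD(1)[OF uv(2) c] yw by simp
    then have yw': "y \<in> carrier B" "w \<in> carrier P" "g y \<oplus>\<^bsub>A\<^esub> p w = \<zero>\<^bsub>A\<^esub>" by (auto simp: hom_ker_def)
    have pw: "p w \<in> carrier A" using lhomD(1)[OF P(2) yw'(2)] .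
    have gy: "g y = \<ominus>\<^bsub>A\<^esub> p w" using A.M.minus_equality[OF yw'(3) pw lhomD(1)[OF fg(2) yw'(1)]] by simp
    have ty: "t' (s' y) \<in> carrier B" using lhomD(1)[OF lhom_comp[OF Q'(2,3)] yw'(1)] .
    have "y = \<ominus>\<^bsub>B\<^esub> f (p w) \<oplus>\<^bsub>B\<^esub> t' (s' y)"
      using fg(6)[rule_format, OF yw'(1)] gy lhomZ(2)[OF fg(1) lA lB pw] Q'(4) yw'(1) by simp
    then have yw2: "(y, w) = (\<ominus>\<^bsub>B\<^esub> f (p w), w) \<oplus>\<^bsub>?D\<^esub> (t' (s' y), \<zero>\<^bsub>P\<^esub>)" using yw'(2) by simp
    have d: "(\<ominus>\<^bsub>B\<^esub> f (p w), w) \<in> carrier ?D" "(t' (s' y), \<zero>\<^bsub>P\<^esub>) \<in> carrier ?D"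
      using lhomD(1)[OF b1' yw'(2)] ty by auto
    have "c = v (e (u c))" using eK[of "u c"] lhomD(1)[OF uv(2) c] uv(3)[OF c] by simp
    also have "e (u c) = e (\<ominus>\<^bsub>B\<^esub> f (p w), w) \<oplus>\<^bsub>?C0\<^esub> e (t' (s' y), \<zero>\<^bsub>P\<^esub>)"
      unfolding yw using lhomD(2)[OF e d] yw2 by simp
    also have "v \<dots> = v (e (\<ominus>\<^bsub>B\<^esub> f (p w), w)) \<oplus>\<^bsub>C\<^esub> v (e (t' (s' y), \<zero>\<^bsub>P\<^esub>))"
      using lhomD(2)[OF uv(1) lhomD(1)[OF e d(1)] lhomD(1)[OF e d(2)]] .
    finally show "c = ?b1 (?a1 c) \<oplus>\<^bsub>C\<^esub> ?b2 (?a2 c)" unfolding yw fst_conv snd_conv .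
  qed
  moreover have "mod_iso R (dsum A C) (dsum B P)"
  proof (rule mod_iso_sym[OF mod_iso_trans[OF retract_dsum_iso[OF lA lD ret] dsum_cong[OF mod_iso_refl[OF lA] C(2)]]])
  qed (use lA lC lC0 lD in \<open>simp_all add: left_module_dsum\<close>)
  ultimately show ?thesis using that P(1) by blast
qed

text \<open>Stable equivalences are replaced by isomorphisms after adding projectives, since those
  can be added and regrouped.\<close>

lemma stab_dsum:
  fixes A A' B B' S S' :: "('a, 'm) module"
  assumes fg: "A \<in> fgmod R" "A' \<in> fgmod R" "B \<in> fgmod R" "B' \<in> fgmod R" "S \<in> fgmod R" "S' \<in> fgmod R"
    and S: "mod_iso R S (dsum A B)" "mod_iso R S' (dsum A' B')" and st: "stab R A A'" "stab R B B'"
  shows "stab R S S'"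
proof -
  obtain C P :: "('a, 'm) module" where 1: "projective R C" "projective R P" "mod_iso R (dsum A C) (dsum A' P)"
    by (rule stab_dsum_iso[OF fg(1,2) st(1)]) (rule that)
  obtain C' P' :: "('a, 'm) module" where 2: "projective R C'" "projective R P'" "mod_iso R (dsum B C') (dsum B' P')"
    by (rule stab_dsum_iso[OF fg(3,4) st(2)]) (rule that)
  note f1 = projective_fgmod[OF 1(1)] projective_fgmod[OF 1(2)] projective_fgmod[OF 2(1)] projective_fgmod[OF 2(2)]
  note l = fgmodD[OF fg(1)] fgmodD[OF fg(2)] fgmodD[OF fg(3)] fgmodD[OF fg(4)] fgmodD[OF fg(5)] fgmodD[OF fg(6)]
    fgmodD[OF f1(1)] fgmodD[OF f1(2)] fgmodD[OF f1(3)] fgmodD[OF f1(4)]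
  obtain D :: "('a, 'm) module" where D: "D \<in> fgmod R" "mod_iso R (dsum C C') D" using fg_copy[OF fgmod_dsum[OF f1(1,3)]] by blast
  obtain E :: "('a, 'm) module" where E: "E \<in> fgmod R" "mod_iso R (dsum P P') E" using fg_copy[OF fgmod_dsum[OF f1(2,4)]] by blast
  note l' = l fgmodD[OF D(1)] fgmodD[OF E(1)]
  have pD: "projective R D" by (rule projective_dsum[OF D(1) mod_iso_sym[OF D(2)] 1(1) 2(1)]) (simp_all add: l' left_module_dsum)
  have pE: "projective R E" by (rule projective_dsum[OF E(1) mod_iso_sym[OF E(2)] 1(2) 2(2)]) (simp_all add: l' left_module_dsum)
  have i1: "mod_iso R (dsum S D) (dsum (dsum A B) (dsum C C'))"
    by (rule dsum_cong[OF S(1) mod_iso_sym[OF D(2)]]) (simp_all add: l' left_module_dsum)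
  have i2: "mod_iso R (dsum (dsum A B) (dsum C C')) (dsum (dsum A C) (dsum B C'))"
    by (rule dsum_swap4) (simp_all add: l')
  have i3: "mod_iso R (dsum (dsum A C) (dsum B C')) (dsum (dsum A' P) (dsum B' P'))"
    by (rule dsum_cong[OF 1(3) 2(3)]) (simp_all add: l' left_module_dsum)
  have i4: "mod_iso R (dsum (dsum A' P) (dsum B' P')) (dsum (dsum A' B') (dsum P P'))"
    by (rule dsum_swap4) (simp_all add: l')
  have i5: "mod_iso R (dsum (dsum A' B') (dsum P P')) (dsum S' E)"
    by (rule dsum_cong[OF mod_iso_sym[OF S(2)] E(2)]) (simp_all add: l' left_module_dsum)
  have "mod_iso R (dsum S D) (dsum S' E)"
    by (rule mod_iso_trans[OF i1 mod_iso_trans[OF i2 mod_iso_trans[OF i3 mod_iso_trans[OF i4 i5]]]])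
      (simp_all add: l' left_module_dsum)
  then show ?thesis by (rule dsum_iso_stab[OF l(5,6) pD pE])
qed

end

section \<open>Cancellation\<close>

lemma lhom_funpow: "lhom R M M f \<Longrightarrow> lhom R M M (f ^^ n)"
proof (induction n)
  case 0 then show ?case using lhom_id[of R M] by (simp add: id_def)
next
  case (Suc n) then show ?case using lhom_comp[of R M M "f ^^ n" M f] by (simp add: comp_def)
qed

text \<open>Fitting's lemma: for large \<open>n\<close> the module is the direct sum of the image
  and the kernel of \<open>f^n\<close>, and indecomposability removes one of them.\<close>

lemma fitting:
  fixes M :: "('a, 'm) module"
  assumes M: "left_module R M" and ch: "art R M" "noe R M" and f: "lhom R M M f"
    and ind: "indecomposable R M"
  shows "(f ` carrier M = carrier M \<and> (\<forall>x\<in>carrier M. f x = \<zero>\<^bsub>M\<^esub> \<longrightarrow> x = \<zero>\<^bsub>M\<^esub>)) \<or>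
    (\<exists>n. \<forall>x\<in>carrier M. (f ^^ n) x = \<zero>\<^bsub>M\<^esub>)"
proof -
  interpret M: left_module R M by fact
  note p = lhom_funpow[OF f]
  let ?I = "\<lambda>n. (f ^^ n) ` carrier M" and ?K = "\<lambda>n. hom_ker M M (f ^^ n)"
  have sI: "submodule (?I n) R M" for n by (rule submodule_image[OF M M p M.submodule_carrier])
  have sK: "submodule (?K n) R M" for n by (rule submodule_ker[OF M M p])
  obtain N where N: "N \<in> range ?I" and min: "\<And>N'. (N', N) \<in> sub_rel R M \<Longrightarrow> N' \<notin> range ?I"
    by (rule wfE_min[OF ch(1)[unfolded art_def], of "?I 0" "range ?I"]) blast+
  then obtain a where a: "N = ?I a" by blast
  obtain L where L: "L \<in> range ?K" and max: "\<And>L'. (L', L) \<in> (sub_rel R M)\<inverse> \<Longrightarrow> L' \<notin> range ?K"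
    by (rule wfE_min[OF ch(2)[unfolded noe_def], of "?K 0" "range ?K"]) blast+
  then obtain b where b: "L = ?K b" by blast
  have Imono: "?I (m + j) \<subseteq> ?I m" for m j
  proof
    fix y assume "y \<in> ?I (m + j)"
    then obtain x where x: "x \<in> carrier M" "y = (f ^^ m) ((f ^^ j) x)" by (auto simp: funpow_add)
    then show "y \<in> ?I m" using lhomD(1)[OF p x(1), of j] by blast
  qed
  have Kmono: "?K m \<subseteq> ?K (j + m)" for m j
    using lhomZ(1)[OF p M M, of j] by (auto simp: hom_ker_def funpow_add)
  have Ia: "?I (a + j) = ?I a" for j
    using min[of "?I (a + j)"] Imono[of a j] sI a unfolding sub_rel_def by blast
  have Kb: "?K (j + b) = ?K b" for j
    using max[of "?K (j + b)"] Kmono[of b j] sK b unfolding sub_rel_def by blast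
  \<comment> \<open>Both chains are stationary at \<open>n\<close>; the successor guarantees a
    factor \<open>f\<close> in \<open>f^n\<close>, from which injectivity and surjectivity of
    \<open>f\<close> itself are read off.\<close>
  define n where "n = Suc (a + b)"
  have In: "?I (n + n) = ?I n"
    using Ia[of "Suc b"] Ia[of "Suc b + n"] by (simp add: n_def add.assoc add.commute add.left_commute)
  have Kn: "?K (n + n) = ?K n"
    using Kb[of "Suc a"] Kb[of "Suc a + n"] by (simp add: n_def add.assoc add.commute add.left_commute)
  have "?I n \<inter> ?K n = {\<zero>\<^bsub>M\<^esub>}"
  proof
    show "?I n \<inter> ?K n \<subseteq> {\<zero>\<^bsub>M\<^esub>}"
    proof
      fix y assume y: "y \<in> ?I n \<inter> ?K n"
      then obtain x where x: "x \<in> carrier M" "y = (f ^^ n) x" by blast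
      then have "x \<in> ?K (n + n)" using y by (simp add: hom_ker_def funpow_add)
      then show "y \<in> {\<zero>\<^bsub>M\<^esub>}" unfolding Kn using x(2) by (simp add: hom_ker_def)
    qed
    show "{\<zero>\<^bsub>M\<^esub>} \<subseteq> ?I n \<inter> ?K n" using M.submoduleD(2)[OF sI] M.submoduleD(2)[OF sK] by blast
  qed
  moreover have "?I n <+>\<^bsub>M\<^esub> ?K n = carrier M"
  proof
    show "?I n <+>\<^bsub>M\<^esub> ?K n \<subseteq> carrier M"
      by (rule set_add_subset[OF M M.submodule_carrier M.submoduleD(1)[OF sI] M.submoduleD(1)[OF sK]])
    show "carrier M \<subseteq> ?I n <+>\<^bsub>M\<^esub> ?K n"
    proof
      fix x assume x: "x \<in> carrier M"
      have "(f ^^ n) x \<in> ?I (n + n)" unfolding In using x by blast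
      then obtain w where w: "w \<in> carrier M" "(f ^^ n) x = (f ^^ n) ((f ^^ n) w)" by (auto simp: funpow_add)
      let ?y = "(f ^^ n) w"
      have y: "?y \<in> carrier M" using lhomD(1)[OF p w(1)] .
      have "x \<ominus>\<^bsub>M\<^esub> ?y \<in> ?K n"
        using lhomZ(3)[OF p M M x y, of n] w(2) M.minus_self[OF lhomD(1)[OF p y, of n]] x y by (simp add: hom_ker_def)
      moreover have "x = ?y \<oplus>\<^bsub>M\<^esub> (x \<ominus>\<^bsub>M\<^esub> ?y)" using M.add_minus_cancel[OF x y] by simp
      ultimately show "x \<in> ?I n <+>\<^bsub>M\<^esub> ?K n" unfolding set_add_iff using w(1) by blast
    qed
  qed
  ultimately have isum: "internal_sum R M (?I n) (?K n)" unfolding internal_sum_def using sI sK by blast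
  then have "?I n = {\<zero>\<^bsub>M\<^esub>} \<or> ?K n = {\<zero>\<^bsub>M\<^esub>}" using ind unfolding indecomposable_def by blast
  then show ?thesis
  proof
    assume "?I n = {\<zero>\<^bsub>M\<^esub>}"
    then have "\<forall>x\<in>carrier M. (f ^^ n) x = \<zero>\<^bsub>M\<^esub>" by blast
    then show ?thesis by blast
  next
    assume K0: "?K n = {\<zero>\<^bsub>M\<^esub>}"
    have inj: "x = \<zero>\<^bsub>M\<^esub>" if "x \<in> carrier M" "f x = \<zero>\<^bsub>M\<^esub>" for x
    proof -
      have "(f ^^ n) x = (f ^^ (a + b)) (f x)" by (simp add: n_def funpow_swap1)
      then have "x \<in> ?K n" using that lhomZ(1)[OF p M M, of "a + b"] by (simp add: hom_ker_def)
      then show ?thesis using K0 by blast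
    qed
    have "carrier M \<subseteq> f ` carrier M"
    proof
      fix x assume x: "x \<in> carrier M"
      then obtain y z where yz: "y \<in> ?I n" "z \<in> ?K n" "x = y \<oplus>\<^bsub>M\<^esub> z"
        using \<open>?I n <+>\<^bsub>M\<^esub> ?K n = carrier M\<close> set_add_iff[of x M "?I n" "?K n"] by auto
      then have "x = y" using K0 M.submoduleD(7)[OF sI yz(1)] by simp
      then obtain w where w: "w \<in> carrier M" "x = f ((f ^^ (a + b)) w)" using yz(1) by (auto simp: n_def)
      then show "x \<in> f ` carrier M" using lhomD(1)[OF p w(1), of "a + b"] by blast
    qed
    then show ?thesis using inj lhomD(1)[OF f] by blast
  qed
qed

text \<open>A nonzero module is not killed by a power of an injective map, which excludes the
  nilpotent case of \<open>fitting\<close>.\<close>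

lemma inj_endo_surj:
  fixes M :: "('a, 'm) module"
  assumes M: "left_module R M" and ch: "art R M" "noe R M" and f: "lhom R M M f"
    and ind: "indecomposable R M" and inj: "\<And>x. \<lbrakk>x \<in> carrier M; f x = \<zero>\<^bsub>M\<^esub>\<rbrakk> \<Longrightarrow> x = \<zero>\<^bsub>M\<^esub>"
  shows "f ` carrier M = carrier M"
proof -
  interpret M: left_module R M by fact
  have nz: "\<exists>x\<in>carrier M. x \<noteq> \<zero>\<^bsub>M\<^esub>" using ind M.M.zero_closed unfolding indecomposable_def zero_module_def by blast
  have "\<not> (\<forall>x\<in>carrier M. (f ^^ k) x = \<zero>\<^bsub>M\<^esub>)" for k
  proof (induction k)
    case 0 then show ?case using nz by auto
  next
    case (Suc k)
    then obtain x where "x \<in> carrier M" "(f ^^ k) x \<noteq> \<zero>\<^bsub>M\<^esub>" by blast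
    then show ?case using inj[of "(f ^^ k) x"] lhomD(1)[OF lhom_funpow[OF f], of x k] by auto
  qed
  then show ?thesis using fitting[OF M ch f ind] by blast
qed

text \<open>The endomorphism ring is local: if \<open>f\<close> is nilpotent, then
  \<open>g x = 0\<close> forces \<open>f x = x\<close>, hence \<open>x = 0\<close>, so
  \<open>g\<close> is injective and therefore bijective.\<close>

lemma local_endo:
  fixes M :: "('a, 'm) module"
  assumes M: "left_module R M" and ch: "art R M" "noe R M"
    and f: "lhom R M M f" and g: "lhom R M M g" and fg: "\<And>x. x \<in> carrier M \<Longrightarrow> f x \<oplus>\<^bsub>M\<^esub> g x = x"
    and ind: "indecomposable R M"
  shows "(f ` carrier M = carrier M \<and> (\<forall>x\<in>carrier M. f x = \<zero>\<^bsub>M\<^esub> \<longrightarrow> x = \<zero>\<^bsub>M\<^esub>)) \<or>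
    (g ` carrier M = carrier M \<and> (\<forall>x\<in>carrier M. g x = \<zero>\<^bsub>M\<^esub> \<longrightarrow> x = \<zero>\<^bsub>M\<^esub>))"
proof -
  interpret M: left_module R M by fact
  consider (1) "f ` carrier M = carrier M \<and> (\<forall>x\<in>carrier M. f x = \<zero>\<^bsub>M\<^esub> \<longrightarrow> x = \<zero>\<^bsub>M\<^esub>)"
    | (2) n where "\<forall>x\<in>carrier M. (f ^^ n) x = \<zero>\<^bsub>M\<^esub>"
    using fitting[OF M ch f ind] by blast
  then show ?thesis
  proof cases
    case 2
    have inj: "x = \<zero>\<^bsub>M\<^esub>" if x: "x \<in> carrier M" "g x = \<zero>\<^bsub>M\<^esub>" for x
    proof -
      have "f x = x" using fg[OF x(1)] x lhomD(1)[OF f x(1)] by simp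
      then have "(f ^^ k) x = x" for k by (induction k) simp_all
      then show ?thesis using 2 x(1) by metis
    qed
    then show ?thesis using inj_endo_surj[OF M ch g ind inj] by blast
  qed blast
qed

text \<open>Gaussian elimination with an invertible corner. The choice
  \<open>s y = - w (b y)\<close> makes the first coordinate of \<open>u (s y, y)\<close> vanish, so
  its second coordinate identifies \<open>A\<close> with \<open>B\<close>.\<close>

lemma cancel_invertible:
  fixes X :: "('a, 'm) module" and A :: "('a, 'n) module" and B :: "('a, 'p) module"
  assumes lm: "left_module R X" "left_module R A" "left_module R B"
    and u: "lhom R (dsum X A) (dsum X B) u" and v: "lhom R (dsum X B) (dsum X A) v"
    and vu: "\<And>z. z \<in> carrier (dsum X A) \<Longrightarrow> v (u z) = z" and uv: "\<And>z. z \<in> carrier (dsum X B) \<Longrightarrow> u (v z) = z"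
    and w: "lhom R X X w" "\<And>x. x \<in> carrier X \<Longrightarrow> w (fst (u (x, \<zero>\<^bsub>A\<^esub>))) = x"
      "\<And>x. x \<in> carrier X \<Longrightarrow> fst (u (w x, \<zero>\<^bsub>A\<^esub>)) = x"
  shows "mod_iso R A B"
proof -
  interpret X: left_module R X by fact
  interpret A: left_module R A by fact
  interpret B: left_module R B by fact
  note m = dsum_maps[OF lm(1,2)] and m' = dsum_maps[OF lm(1,3)]
  let ?a = "\<lambda>x. fst (u (x, \<zero>\<^bsub>A\<^esub>))" and ?b = "\<lambda>y. fst (u (\<zero>\<^bsub>X\<^esub>, y))"
  have a: "lhom R X X ?a" by (rule lhom_comp[OF lhom_comp[OF m(1) u] m'(3)])
  have b: "lhom R A X ?b" by (rule lhom_comp[OF lhom_comp[OF m(2) u] m'(3)])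
  define s where "s y = \<ominus>\<^bsub>X\<^esub> w (?b y)" for y
  have s: "lhom R A X s" unfolding s_def by (rule lhom_neg[OF lm(1) lhom_comp[OF b w(1)]])
  have us: "lhom R A (dsum X B) (\<lambda>y. u (s y, y))" by (rule lhom_comp[OF lhom_pair[OF s lhom_id] u])
  have split: "u (x, y) = u (x, \<zero>\<^bsub>A\<^esub>) \<oplus>\<^bsub>dsum X B\<^esub> u (\<zero>\<^bsub>X\<^esub>, y)" if "x \<in> carrier X" "y \<in> carrier A" for x y
    using lhomD(2)[OF u, of "(x, \<zero>\<^bsub>A\<^esub>)" "(\<zero>\<^bsub>X\<^esub>, y)"] that by simp
  have fst_u: "fst (u (x, y)) = ?a x \<oplus>\<^bsub>X\<^esub> ?b y" if "x \<in> carrier X" "y \<in> carrier A" for x y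
    using split[OF that] by simp
  have zero: "fst (u (s y, y)) = \<zero>\<^bsub>X\<^esub>" if y: "y \<in> carrier A" for y
  proof -
    have bY: "?b y \<in> carrier X" using lhomD(1)[OF b y] .
    have wb: "w (?b y) \<in> carrier X" using lhomD(1)[OF w(1) bY] .
    have "?a (s y) = \<ominus>\<^bsub>X\<^esub> ?b y" unfolding s_def using lhomZ(2)[OF a lm(1,1) wb] w(3)[OF bY] by simp
    then show ?thesis using fst_u[OF lhomD(1)[OF s y] y] bY X.M.l_neg by simp
  qed
  have vB: "lhom R B (dsum X A) (\<lambda>c. v (\<zero>\<^bsub>X\<^esub>, c))" by (rule lhom_comp[OF m'(2) v])
  show ?thesis
  proof (rule mod_isoI[OF lm(2,3), where f = "\<lambda>y. snd (u (s y, y))" and g = "\<lambda>c. snd (v (\<zero>\<^bsub>X\<^esub>, c))"])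
    show "lhom R A B (\<lambda>y. snd (u (s y, y)))" by (rule lhom_comp[OF us m'(4)])
    show "lhom R B A (\<lambda>c. snd (v (\<zero>\<^bsub>X\<^esub>, c)))" by (rule lhom_comp[OF vB m(4)])
    show "snd (v (\<zero>\<^bsub>X\<^esub>, snd (u (s y, y)))) = y" if y: "y \<in> carrier A" for y
    proof -
      have "(\<zero>\<^bsub>X\<^esub>, snd (u (s y, y))) = u (s y, y)" using zero[OF y] by (metis prod.collapse)
      then show ?thesis using vu[of "(s y, y)"] lhomD(1)[OF s y] y by simp
    qed
    fix c assume c: "c \<in> carrier B"
    obtain x y where xy: "v (\<zero>\<^bsub>X\<^esub>, c) = (x, y)" by force
    have xyc: "x \<in> carrier X" "y \<in> carrier A" using lhomD(1)[OF vB c] xy by auto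
    have uxy: "u (x, y) = (\<zero>\<^bsub>X\<^esub>, c)" using uv[of "(\<zero>\<^bsub>X\<^esub>, c)"] c xy by simp
    have bY: "?b y \<in> carrier X" using lhomD(1)[OF b xyc(2)] .
    have ax: "?a x \<in> carrier X" using lhomD(1)[OF a xyc(1)] .
    have "?a x \<oplus>\<^bsub>X\<^esub> ?b y = \<zero>\<^bsub>X\<^esub>" using fst_u[OF xyc] uxy by simp
    then have "?a x = \<ominus>\<^bsub>X\<^esub> ?b y" using X.M.minus_equality ax bY by simp
    then have "x = w (\<ominus>\<^bsub>X\<^esub> ?b y)" using w(2)[OF xyc(1)] by simp
    then have "x = s y" unfolding s_def using lhomZ(2)[OF w(1) lm(1,1) bY] by simp
    then show "snd (u (s (snd (v (\<zero>\<^bsub>X\<^esub>, c))), snd (v (\<zero>\<^bsub>X\<^esub>, c)))) = c"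
      using xy uxy by simp
  qed
qed

text \<open>The corner of \<open>v u = 1\<close> reads \<open>al a + be c = 1\<close> on
  \<open>X\<close>, so one of the two terms is invertible. In the first case \<open>a\<close> is
  invertible; in the second, a row operation makes the corner equal to the identity.\<close>

lemma cancel_indecomposable:
  fixes X :: "('a, 'm) module" and A :: "('a, 'n) module" and B :: "('a, 'p) module"
  assumes lm: "left_module R X" "left_module R A" "left_module R B"
    and ch: "art R X" "noe R X" and ind: "indecomposable R X"
    and iso: "mod_iso R (dsum X A) (dsum X B)"
  shows "mod_iso R A B"
proof -
  interpret X: left_module R X by fact
  interpret A: left_module R A by fact
  interpret B: left_module R B by fact
  obtain u v where u: "lhom R (dsum X A) (dsum X B) u" and v: "lhom R (dsum X B) (dsum X A) v"
    and vu: "\<And>z. z \<in> carrier (dsum X A) \<Longrightarrow> v (u z) = z" and uv: "\<And>z. z \<in> carrier (dsum X B) \<Longrightarrow> u (v z) = z"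
    by (rule mod_isoE[OF iso left_module_dsum[OF lm(1,2)] left_module_dsum[OF lm(1,3)]]) (rule that)
  note m = dsum_maps[OF lm(1,2)] and m' = dsum_maps[OF lm(1,3)]
  let ?a = "\<lambda>x. fst (u (x, \<zero>\<^bsub>A\<^esub>))" and ?c = "\<lambda>x. snd (u (x, \<zero>\<^bsub>A\<^esub>))"
  let ?al = "\<lambda>x. fst (v (x, \<zero>\<^bsub>B\<^esub>))" and ?be = "\<lambda>y. fst (v (\<zero>\<^bsub>X\<^esub>, y))"
  have a: "lhom R X X ?a" by (rule lhom_comp[OF lhom_comp[OF m(1) u] m'(3)])
  have c: "lhom R X B ?c" by (rule lhom_comp[OF lhom_comp[OF m(1) u] m'(4)])
  have al: "lhom R X X ?al" by (rule lhom_comp[OF lhom_comp[OF m'(1) v] m(3)])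
  have be: "lhom R B X ?be" by (rule lhom_comp[OF lhom_comp[OF m'(2) v] m(3)])
  have sum: "?al (?a x) \<oplus>\<^bsub>X\<^esub> ?be (?c x) = x" if x: "x \<in> carrier X" for x
  proof -
    have k: "?a x \<in> carrier X" "?c x \<in> carrier B" using lhomD(1)[OF a x] lhomD(1)[OF c x] .
    have "u (x, \<zero>\<^bsub>A\<^esub>) = (?a x, \<zero>\<^bsub>B\<^esub>) \<oplus>\<^bsub>dsum X B\<^esub> (\<zero>\<^bsub>X\<^esub>, ?c x)" using k by simp
    then have "v (u (x, \<zero>\<^bsub>A\<^esub>)) = v (?a x, \<zero>\<^bsub>B\<^esub>) \<oplus>\<^bsub>dsum X A\<^esub> v (\<zero>\<^bsub>X\<^esub>, ?c x)"
      using lhomD(2)[OF v, of "(?a x, \<zero>\<^bsub>B\<^esub>)" "(\<zero>\<^bsub>X\<^esub>, ?c x)"] k by simp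
    moreover have "v (u (x, \<zero>\<^bsub>A\<^esub>)) = (x, \<zero>\<^bsub>A\<^esub>)" using vu[of "(x, \<zero>\<^bsub>A\<^esub>)"] x by simp
    ultimately have "(x, \<zero>\<^bsub>A\<^esub>) = (?al (?a x) \<oplus>\<^bsub>X\<^esub> ?be (?c x), snd (v (?a x, \<zero>\<^bsub>B\<^esub>)) \<oplus>\<^bsub>A\<^esub> snd (v (\<zero>\<^bsub>X\<^esub>, ?c x)))"
      by (simp only: dsum_simps)
    then show ?thesis by (metis prod.inject)
  qed
  have aa: "lhom R X X (\<lambda>x. ?al (?a x))" by (rule lhom_comp[OF a al])
  have bc: "lhom R X X (\<lambda>x. ?be (?c x))" by (rule lhom_comp[OF c be])
  consider (1) "\<forall>x\<in>carrier X. ?al (?a x) = \<zero>\<^bsub>X\<^esub> \<longrightarrow> x = \<zero>\<^bsub>X\<^esub>"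
    | (2) "(\<lambda>x. ?be (?c x)) ` carrier X = carrier X" "\<forall>x\<in>carrier X. ?be (?c x) = \<zero>\<^bsub>X\<^esub> \<longrightarrow> x = \<zero>\<^bsub>X\<^esub>"
    using local_endo[OF lm(1) ch aa bc sum ind] by blast
  then show ?thesis
  proof cases
    case 1
    have inj: "x = \<zero>\<^bsub>X\<^esub>" if "x \<in> carrier X" "?a x = \<zero>\<^bsub>X\<^esub>" for x
      using 1 that lhomZ(1)[OF al lm(1,1)] by simp
    have s: "?a ` carrier X = carrier X" by (rule inj_endo_surj[OF lm(1) ch a ind inj])
    obtain w where w: "lhom R X X w" "\<And>x. x \<in> carrier X \<Longrightarrow> w (?a x) = x" "\<And>x. x \<in> carrier X \<Longrightarrow> ?a (w x) = x"
      by (rule lhom_inj_iso[OF lm(1,1) a s inj]) (assumption | rule that)+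
    show ?thesis by (rule cancel_invertible[OF lm u v vu uv w])
  next
    case 2
    obtain w where w: "lhom R X X w" "\<And>x. x \<in> carrier X \<Longrightarrow> w (?be (?c x)) = x"
      by (rule lhom_inj_iso[OF lm(1,1) bc 2(1) 2(2)[rule_format]]) (assumption | rule that)+
    \<comment> \<open>\<open>d = (1 - a) w be\<close>, so that \<open>d c = 1 - a\<close> because
      \<open>w\<close> inverts \<open>be c\<close>. Adding \<open>d\<close> times the second row to
      the first changes the corner from \<open>a\<close> to \<open>1\<close>.\<close>
    define d where "d y = w (?be y) \<ominus>\<^bsub>X\<^esub> ?a (w (?be y))" for y
    have d: "lhom R B X d"
      unfolding d_def by (rule lhom_diff[OF lm(1) lhom_comp[OF be w(1)] lhom_comp[OF lhom_comp[OF be w(1)] a]])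
    have dc: "?a x \<oplus>\<^bsub>X\<^esub> d (?c x) = x" if x: "x \<in> carrier X" for x
      unfolding d_def w(2)[OF x] using X.add_minus_cancel[OF x lhomD(1)[OF a x]] .
    let ?u = "\<lambda>z. (fst (u z) \<oplus>\<^bsub>X\<^esub> d (snd (u z)), snd (u z))"
    let ?v = "\<lambda>z. v (fst z \<ominus>\<^bsub>X\<^esub> d (snd z), snd z)"
    have u': "lhom R (dsum X A) (dsum X B) ?u"
      by (rule lhom_pair[OF lhom_add[OF lm(1) lhom_comp[OF u m'(3)] lhom_comp[OF lhom_comp[OF u m'(4)] d]] lhom_comp[OF u m'(4)]])
    have v': "lhom R (dsum X B) (dsum X A) ?v"
      by (rule lhom_comp[OF lhom_pair[OF lhom_diff[OF lm(1) m'(3) lhom_comp[OF m'(4) d]] m'(4)] v])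
    show ?thesis
    proof (rule cancel_invertible[OF lm u' v', where w = "\<lambda>x. x"])
      show "?v (?u z) = z" if z: "z \<in> carrier (dsum X A)" for z
      proof -
        obtain x y where xy: "u z = (x, y)" by force
        have k: "x \<in> carrier X" "y \<in> carrier B" using lhomD(1)[OF u z] xy by auto
        have "(x \<oplus>\<^bsub>X\<^esub> d y) \<ominus>\<^bsub>X\<^esub> d y = x" using X.add_minus_self[OF k(1) lhomD(1)[OF d k(2)]] .
        then show ?thesis using vu[OF z] by (simp add: xy)
      qed
      show "?u (?v z) = z" if z: "z \<in> carrier (dsum X B)" for z
      proof -
        obtain x y where xy: "z = (x, y)" "x \<in> carrier X" "y \<in> carrier B" using z by auto
        have dy: "d y \<in> carrier X" using lhomD(1)[OF d xy(3)] .
        have "u (v (x \<ominus>\<^bsub>X\<^esub> d y, y)) = (x \<ominus>\<^bsub>X\<^esub> d y, y)" using uv[of "(x \<ominus>\<^bsub>X\<^esub> d y, y)"] xy dy by simp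
        then show ?thesis using X.minus_add_cancel[OF xy(2) dy] by (simp add: xy(1))
      qed
      show "lhom R X X (\<lambda>x. x)" by (rule lhom_id)
      show "fst (?u (x, \<zero>\<^bsub>A\<^esub>)) = x" if "x \<in> carrier X" for x using dc[OF that] by simp
      then show "fst (?u (x, \<zero>\<^bsub>A\<^esub>)) = x" if "x \<in> carrier X" for x using that by blast
    qed
  qed
qed

context good_ring
begin

text \<open>Descent over the submodules of \<open>C\<close>: a decomposable one is cancelled in two
  smaller pieces, an indecomposable one by \<open>cancel_indecomposable\<close>. The induction
  statement quantifies over \<open>A\<close> and \<open>B\<close> because the first piece is
  cancelled from enlarged modules.\<close>

lemma cancellation:
  fixes A B C :: "('a, 'm) module"
  assumes fg: "A \<in> fgmod R" "B \<in> fgmod R" "C \<in> fgmod R" and iso: "mod_iso R (dsum C A) (dsum C B)"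
  shows "mod_iso R A B"
proof -
  have lC: "left_module R C" by (rule fgmodD[OF fg(3)])
  interpret C: left_module R C by (rule lC)
  have "submodule N R C \<longrightarrow> (\<forall>(A :: ('a, 'm) module) (B :: ('a, 'm) module). A \<in> fgmod R \<longrightarrow> B \<in> fgmod R \<longrightarrow>
      mod_iso R (dsum (submod C N) A) (dsum (submod C N) B) \<longrightarrow> mod_iso R A B)" for N
  proof (induction N rule: wf_induct_rule[OF fg_art[OF fg(3), unfolded art_def]])
    case (1 N)
    show ?case
    proof (intro impI allI)
      fix A B :: "('a, 'm) module"
      assume N: "submodule N R C" and AB: "A \<in> fgmod R" "B \<in> fgmod R"
        and iso: "mod_iso R (dsum (submod C N) A) (dsum (submod C N) B)"
      have IH: "mod_iso R A B" if "submodule L R C" "L \<subset> N" "A \<in> fgmod R" "B \<in> fgmod R"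
          "mod_iso R (dsum (submod C L) A) (dsum (submod C L) B)" for L and A B :: "('a, 'm) module"
        using 1[of L] that N unfolding sub_rel_def by blast
      let ?N = "submod C N"
      have fN: "?N \<in> fgmod R" by (rule fg_submod[OF fg(3) N])
      note l = fgmodD[OF AB(1)] fgmodD[OF AB(2)] fgmodD[OF fN]
      show "mod_iso R A B"
      proof (cases "zero_module ?N")
        case True
        have zA: "mod_iso R (dsum ?N A) A"
          by (rule mod_iso_trans[OF dsum_comm[OF l(3,1)] dsum_zero[OF l(1,3) True]]) (simp_all add: l left_module_dsum)
        have zB: "mod_iso R (dsum ?N B) B"
          by (rule mod_iso_trans[OF dsum_comm[OF l(3,2)] dsum_zero[OF l(2,3) True]]) (simp_all add: l left_module_dsum)
        show ?thesis
          by (rule mod_iso_trans[OF mod_iso_sym[OF zA] mod_iso_trans[OF iso zB]]) (simp_all add: l left_module_dsum)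
      next
        case False
        show ?thesis
        proof (cases "indecomposable R ?N")
          case True
          then show ?thesis using cancel_indecomposable[OF l(3,1,2) fg_art[OF fN] fg_noe[OF fN] _ iso] by blast
        next
          case ni: False
          then obtain N1 N2 where NN: "internal_sum R ?N N1 N2" "N1 \<noteq> {\<zero>\<^bsub>C\<^esub>}" "N2 \<noteq> {\<zero>\<^bsub>C\<^esub>}"
            using False unfolding indecomposable_def by auto
          have s: "submodule N1 R C" "submodule N2 R C" "N1 \<subseteq> N" "N2 \<subseteq> N" "N1 \<inter> N2 = {\<zero>\<^bsub>C\<^esub>}"
            using NN(1) unfolding internal_sum_def submodule_submod[OF lC N] by auto
          have p: "N1 \<subset> N" "N2 \<subset> N" using s NN(2,3) by blast+
          let ?N1 = "submod C N1" and ?N2 = "submod C N2"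
          have f12: "?N1 \<in> fgmod R" "?N2 \<in> fgmod R" using fg_submod[OF fg(3)] s by blast+
          note l' = l fgmodD[OF f12(1)] fgmodD[OF f12(2)]
          have dec: "mod_iso R ?N (dsum ?N1 ?N2)" using internal_sum_iso[OF l(3) NN(1)] by simp
          \<comment> \<open>\<open>A'\<close> is a copy of \<open>N2 + A\<close> on the carrier type
            \<open>'m\<close>: first \<open>N1\<close> is cancelled from \<open>N1 + A'\<close>,
            then \<open>N2\<close> from \<open>N2 + A\<close>.\<close>
          have shift: "\<exists>A' :: ('a, 'm) module. A' \<in> fgmod R \<and> mod_iso R (dsum ?N2 A) A' \<and> mod_iso R (dsum ?N A) (dsum ?N1 A')"
            if A: "A \<in> fgmod R" for A :: "('a, 'm) module"
          proof -
            obtain A' :: "('a, 'm) module" where A': "A' \<in> fgmod R" "mod_iso R (dsum ?N2 A) A'"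
              using fg_copy[OF fgmod_dsum[OF f12(2) A]] by blast
            note l'' = l' fgmodD[OF A] fgmodD[OF A'(1)]
            have i1: "mod_iso R (dsum ?N A) (dsum (dsum ?N1 ?N2) A)"
              by (rule dsum_cong[OF dec mod_iso_refl]) (simp_all add: l'' left_module_dsum)
            have i2: "mod_iso R (dsum (dsum ?N1 ?N2) A) (dsum ?N1 (dsum ?N2 A))"
              by (rule dsum_assoc) (simp_all add: l'')
            have i3: "mod_iso R (dsum ?N1 (dsum ?N2 A)) (dsum ?N1 A')"
              by (rule dsum_cong[OF mod_iso_refl A'(2)]) (simp_all add: l'' left_module_dsum)
            have "mod_iso R (dsum ?N A) (dsum ?N1 A')"
              by (rule mod_iso_trans[OF i1 mod_iso_trans[OF i2 i3]]) (simp_all add: l'' left_module_dsum)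
            then show ?thesis using A' by blast
          qed
          obtain A' :: "('a, 'm) module" where A': "A' \<in> fgmod R" "mod_iso R (dsum ?N2 A) A'" "mod_iso R (dsum ?N A) (dsum ?N1 A')"
            using shift[OF AB(1)] by blast
          obtain B' :: "('a, 'm) module" where B': "B' \<in> fgmod R" "mod_iso R (dsum ?N2 B) B'" "mod_iso R (dsum ?N B) (dsum ?N1 B')"
            using shift[OF AB(2)] by blast
          note l'' = l' fgmodD[OF A'(1)] fgmodD[OF B'(1)]
          have "mod_iso R (dsum ?N1 A') (dsum ?N1 B')"
            by (rule mod_iso_trans[OF mod_iso_sym[OF A'(3)] mod_iso_trans[OF iso B'(3)]]) (simp_all add: l'' left_module_dsum)
          then have AB': "mod_iso R A' B'" by (rule IH[OF s(1) p(1) A'(1) B'(1)])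
          have "mod_iso R (dsum ?N2 A) (dsum ?N2 B)"
            by (rule mod_iso_trans[OF A'(2) mod_iso_trans[OF AB' mod_iso_sym[OF B'(2)]]]) (simp_all add: l'' left_module_dsum)
          then show ?thesis by (rule IH[OF s(2) p(2) AB])
        qed
      qed
    qed
  qed
  from this[of "carrier C"] show ?thesis using C.submodule_carrier fg(1,2) iso by simp
qed

text \<open>The projective summands are absorbed into \<open>A\<close> and \<open>B\<close> before
  \<open>C\<close> is cancelled.\<close>

lemma stab_cancel:
  fixes A B C S T :: "('a, 'm) module"
  assumes fg: "A \<in> fgmod R" "B \<in> fgmod R" "C \<in> fgmod R" "S \<in> fgmod R" "T \<in> fgmod R"
    and S: "mod_iso R S (dsum C A)" "mod_iso R T (dsum C B)" and st: "stab R S T"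
  shows "stab R A B"
proof -
  obtain Q P :: "('a, 'm) module" where QP: "projective R Q" "projective R P" "mod_iso R (dsum S Q) (dsum T P)"
    by (rule stab_dsum_iso[OF fg(4,5) st]) (rule that)
  note f1 = projective_fgmod[OF QP(1)] projective_fgmod[OF QP(2)]
  obtain A' :: "('a, 'm) module" where A': "A' \<in> fgmod R" "mod_iso R (dsum A Q) A'" using fg_copy[OF fgmod_dsum[OF fg(1) f1(1)]] by blast
  obtain B' :: "('a, 'm) module" where B': "B' \<in> fgmod R" "mod_iso R (dsum B P) B'" using fg_copy[OF fgmod_dsum[OF fg(2) f1(2)]] by blast
  note l = fgmodD[OF fg(1)] fgmodD[OF fg(2)] fgmodD[OF fg(3)] fgmodD[OF fg(4)] fgmodD[OF fg(5)]
    fgmodD[OF f1(1)] fgmodD[OF f1(2)] fgmodD[OF A'(1)] fgmodD[OF B'(1)]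
  have a1: "mod_iso R (dsum C A') (dsum C (dsum A Q))"
    by (rule dsum_cong[OF mod_iso_refl mod_iso_sym[OF A'(2)]]) (simp_all add: l left_module_dsum)
  have a2: "mod_iso R (dsum C (dsum A Q)) (dsum (dsum C A) Q)"
    by (rule mod_iso_sym[OF dsum_assoc]) (simp_all add: l left_module_dsum)
  have a3: "mod_iso R (dsum (dsum C A) Q) (dsum S Q)"
    by (rule dsum_cong[OF mod_iso_sym[OF S(1)] mod_iso_refl]) (simp_all add: l left_module_dsum)
  have a4: "mod_iso R (dsum T P) (dsum (dsum C B) P)"
    by (rule dsum_cong[OF S(2) mod_iso_refl]) (simp_all add: l left_module_dsum)
  have a5: "mod_iso R (dsum (dsum C B) P) (dsum C (dsum B P))"
    by (rule dsum_assoc) (simp_all add: l)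
  have a6: "mod_iso R (dsum C (dsum B P)) (dsum C B')"
    by (rule dsum_cong[OF mod_iso_refl B'(2)]) (simp_all add: l left_module_dsum)
  have "mod_iso R (dsum C A') (dsum C B')"
    by (rule mod_iso_trans[OF a1 mod_iso_trans[OF a2 mod_iso_trans[OF a3 mod_iso_trans[OF QP(3) mod_iso_trans[OF a4 mod_iso_trans[OF a5 a6]]]]]])
      (simp_all add: l left_module_dsum)
  then have AB': "mod_iso R A' B'" by (rule cancellation[OF A'(1) B'(1) fg(3)])
  have "mod_iso R (dsum A Q) (dsum B P)"
    by (rule mod_iso_trans[OF A'(2) mod_iso_trans[OF AB' mod_iso_sym[OF B'(2)]]]) (simp_all add: l left_module_dsum)
  then show ?thesis by (rule dsum_iso_stab[OF l(1,2) QP(1,2)])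
qed

end

section \<open>The group \<open>K0\<close>\<close>

text \<open>\<open>eff R x A\<close> says that \<open>x\<close> is an effective combination of modules with direct sum \<open>A\<close>.\<close>

inductive eff :: "('a, 'r) ring_scheme \<Rightarrow> (('a, 'm) module \<Rightarrow>\<^sub>0 int) \<Rightarrow> ('a, 'm) module \<Rightarrow> bool"
  for R where
  zero: "\<lbrakk>Z \<in> fgmod R; zero_module Z\<rbrakk> \<Longrightarrow> eff R 0 Z"
| add: "\<lbrakk>eff R x A; M \<in> fgmod R; S \<in> fgmod R; mod_iso R S (dsum M A)\<rbrakk> \<Longrightarrow> eff R (frag_of M + x) S"

lemma eff_fgmod: "eff R x A \<Longrightarrow> A \<in> fgmod R"
  by (induction rule: eff.induct)

lemma eff_nonneg: "eff R x A \<Longrightarrow> Poly_Mapping.lookup x M \<ge> 0"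
  by (induction rule: eff.induct) (simp_all add: lookup_add)

lemma eff_frag_of:
  fixes M :: "('a, 'm) module"
  assumes M: "M \<in> fgmod R"
  shows "eff R (frag_of M) M"
proof -
  have lM: "left_module R M" by (rule fgmodD[OF M])
  interpret left_module R M by (rule lM)
  let ?Z = "zero_mod undefined :: ('a, 'm) module"
  have Z: "?Z \<in> fgmod R" "zero_module ?Z" 
    by (rule zero_mod(1)[OF R.ring_axioms], rule zero_mod(2)[OF R.ring_axioms])
  have "mod_iso R M (dsum M ?Z)"
    by (rule mod_iso_sym[OF dsum_zero[OF lM fgmodD[OF Z(1)] Z(2)]]) (simp_all add: lM fgmodD[OF Z(1)] left_module_dsum)
  then have "eff R (frag_of M + 0) M" by (rule eff.add[OF eff.zero[OF Z] M M])
  then show ?thesis by simp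
qed

lemma eff_iso:
  assumes "eff R x A" "mod_iso R A A'" "A' \<in> fgmod R"
  shows "eff R x A'"
  using assms(1)
proof cases
  case zero
  then show ?thesis
    using eff.zero[OF assms(3)] zero_module_iso[OF assms(2) fgmodD[OF eff_fgmod[OF assms(1)]] fgmodD[OF assms(3)]]
    by simp
next
  case (add y B M)
  note l = fgmodD[OF assms(3)] fgmodD[OF add(4)] fgmodD[OF add(3)] fgmodD[OF eff_fgmod[OF add(2)]]
  have "mod_iso R A' (dsum M B)"
    by (rule mod_iso_trans[OF mod_iso_sym[OF assms(2)] add(5)]) (simp_all add: l left_module_dsum)
  then show ?thesis unfolding add(1) by (rule eff.add[OF add(2,3) assms(3)])
qed

text \<open>Coefficients of effective combinations are nonnegative, so nothing cancels and a
  combination with at least one term is nonzero.\<close>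

lemma eff_zero: 
  assumes "eff R 0 A"
  shows "zero_module A"
  using assms
proof cases
  case (add x B M)
  have "Poly_Mapping.lookup (frag_of M + x) M > 0" using eff_nonneg[OF add(2), of M] by (simp add: lookup_add)
  then show ?thesis using add(1) by (metis less_irrefl lookup_zero)
qed

section \<open>The kernel and the cosets of \<open>K0\<close>\<close>

lemma generate_subgroup_K0:
  fixes R :: "('a, 'r) ring_scheme"
  shows "subgroup (K0_kernel R :: (('a, 'm) module \<Rightarrow>\<^sub>0 int) set) (free_Abelian_group (fgmod R))"
  unfolding K0_kernel_def
proof (rule group.generate_is_subgroup[OF group_free_Abelian_group])
  have "Poly_Mapping.keys (frag_of C - (frag_of A + frag_of B)) \<subseteq> fgmod R"
    if "A \<in> fgmod R" "B \<in> fgmod R" "C \<in> fgmod R" for A B C :: "('a, 'm) module"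
    using keys_diff[of "frag_of C" "frag_of A + frag_of B"] keys_add[of "frag_of A" "frag_of B"] that
    by (auto simp: keys_frag_of)
  then show "(K0_relations R :: (('a, 'm) module \<Rightarrow>\<^sub>0 int) set) \<subseteq> carrier (free_Abelian_group (fgmod R))"
    unfolding K0_relations_def by (auto dest: projective_fgmod)
qed

lemma K0_kernel_carrier: "x \<in> K0_kernel R \<Longrightarrow> Poly_Mapping.keys x \<subseteq> fgmod R"
  using subgroup.mem_carrier[OF generate_subgroup_K0, of x R] by simp

lemma K0_kernel_zero: "0 \<in> K0_kernel R"
  using subgroup.one_closed[OF generate_subgroup_K0] by simp

lemma K0_kernel_add: "\<lbrakk>x \<in> K0_kernel R; y \<in> K0_kernel R\<rbrakk> \<Longrightarrow> x + y \<in> K0_kernel R"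
  using subgroup.m_closed[OF generate_subgroup_K0, of x R y] by simp

lemma K0_kernel_minus: "x \<in> K0_kernel R \<Longrightarrow> - x \<in> K0_kernel R"
  using subgroup.m_inv_closed[OF generate_subgroup_K0, of x R] K0_kernel_carrier[of x R] by simp

lemma K0_kernel_diff: "\<lbrakk>x \<in> K0_kernel R; y \<in> K0_kernel R\<rbrakk> \<Longrightarrow> x - y \<in> K0_kernel R"
  using K0_kernel_add[of x R "- y"] K0_kernel_minus[of y R] by simp

lemma K0_kernel_sum:
  "\<lbrakk>A \<in> fgmod R; B \<in> fgmod R; C \<in> fgmod R; mod_iso R C (dsum A B)\<rbrakk>
    \<Longrightarrow> frag_of C - (frag_of A + frag_of B) \<in> K0_kernel R"
  unfolding K0_kernel_def K0_relations_def by (intro generate.incl) blast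

lemma K0_kernel_projective: "projective R Q \<Longrightarrow> frag_of Q \<in> K0_kernel R"
  unfolding K0_kernel_def K0_relations_def by (intro generate.incl) blast

lemma K0_coset_eq: "K0_coset R x = (\<lambda>h. h + x) ` K0_kernel R"
  by (auto simp: K0_coset_def r_coset_def)

lemma K0_coset_eq_iff:
  fixes x y :: "('a, 'm) module \<Rightarrow>\<^sub>0 int"
  shows "K0_coset R x = K0_coset R y \<longleftrightarrow> x - y \<in> K0_kernel R"
proof
  assume "K0_coset R x = K0_coset R y"
  moreover have "0 + x \<in> K0_coset R x" unfolding K0_coset_eq using K0_kernel_zero by blast
  ultimately obtain h where "h \<in> K0_kernel R" "0 + x = h + y" unfolding K0_coset_eq by blast
  then show "x - y \<in> K0_kernel R" by (simp add: algebra_simps)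
next
  have sub: "K0_coset R x \<subseteq> K0_coset R y" if "x - y \<in> K0_kernel R" for x y :: "('a, 'm) module \<Rightarrow>\<^sub>0 int"
  proof
    fix z assume "z \<in> K0_coset R x"
    then obtain h where h: "h \<in> K0_kernel R" "z = h + x" unfolding K0_coset_eq by blast
    then have "z = (h + (x - y)) + y" by simp
    then show "z \<in> K0_coset R y" unfolding K0_coset_eq using K0_kernel_add[OF h(1) that] by blast
  qed
  assume a: "x - y \<in> K0_kernel R"
  then have "y - x \<in> K0_kernel R" using K0_kernel_minus[of "x - y" R] by simp
  then show "K0_coset R x = K0_coset R y" using sub a by blast
qed

text \<open>The lift of \<open>K0_syzygy\<close> to the free group, where it is additive by
  construction; statements on \<open>K0\<close> become statements modulo
  \<open>K0_kernel\<close>.\<close>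

definition Om :: "('a, 'r) ring_scheme \<Rightarrow> (('a, 'm) module \<Rightarrow>\<^sub>0 int) \<Rightarrow> (('a, 'm) module \<Rightarrow>\<^sub>0 int)"
  where "Om R = frag_extend (\<lambda>M. frag_of (syzygy R M))"

lemma Om_simps: "Om R 0 = 0" "Om R (frag_of M) = frag_of (syzygy R M)" "Om R (x + y) = Om R x + Om R y"
  "Om R (x - y) = Om R x - Om R y" "Om R (- x) = - Om R x"
  by (simp_all add: Om_def frag_extend_add frag_extend_diff frag_extend_minus)

lemma Om_pow_diff: "(Om R ^^ s) (x - y) = (Om R ^^ s) x - (Om R ^^ s) y"
  by (induction s) (simp_all add: Om_simps)

definition ind_summands :: "('a, 'r) ring_scheme \<Rightarrow> ('a, 'm) module \<Rightarrow> ('a, 'm) module set"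
  where "ind_summands R M = {X. X \<in> fgmod R \<and> indecomposable R X \<and> summand R X M}"

lemma K0_mult:
  assumes "Poly_Mapping.keys x \<subseteq> fgmod R" "Poly_Mapping.keys y \<subseteq> fgmod R"
  shows "K0_coset R x \<otimes>\<^bsub>K0 R\<^esub> K0_coset R y = K0_coset R (x + y)"
proof -
  have "K0_kernel R \<lhd> free_Abelian_group (fgmod R)"
    by (rule comm_group.normal_iff_subgroup[THEN iffD2, OF abelian_free_Abelian_group generate_subgroup_K0])
  then show ?thesis
    using normal.rcos_sum[of "K0_kernel R" "free_Abelian_group (fgmod R)" x y] assms
    by (simp add: K0_def K0_coset_def)
qed

lemma K0_group: "group (K0 R)"
  unfolding K0_def
  by (rule normal.factorgroup_is_group[OF comm_group.normal_iff_subgroup[THEN iffD2, OF abelian_free_Abelian_group generate_subgroup_K0]])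

lemma K0_carrier: "carrier (K0 R) = K0_coset R ` {x. Poly_Mapping.keys x \<subseteq> fgmod R}"
  unfolding K0_def carrier_FactGroup K0_coset_def by auto

lemma K0_one: "\<one>\<^bsub>K0 R\<^esub> = K0_coset R 0"
  by (simp add: K0_def K0_coset_eq)

lemma K0_inv:
  assumes "Poly_Mapping.keys x \<subseteq> fgmod R"
  shows "inv\<^bsub>K0 R\<^esub> (K0_coset R x) = K0_coset R (- x)"
proof (rule group.inv_equality[OF K0_group])
  show "K0_coset R (- x) \<otimes>\<^bsub>K0 R\<^esub> K0_coset R x = \<one>\<^bsub>K0 R\<^esub>"
    using K0_mult[of "- x" R x] assms by (simp add: K0_one)
qed (use assms in \<open>auto simp: K0_carrier\<close>)

text \<open>Cosets are compatible with the group operations, so the subgroup generated in the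
  quotient is the image of the formal combinations.\<close>

lemma add_span_eq:
  fixes M :: "('a, 'm) module"
  shows "add_span R M = K0_coset R ` {x. Poly_Mapping.keys x \<subseteq> ind_summands R M}"
proof -
  let ?S = "{K0_class R X | X :: ('a, 'm) module. X \<in> fgmod R \<and> indecomposable R X \<and> summand R X M}"
  have sub: "ind_summands R M \<subseteq> fgmod R" by (auto simp: ind_summands_def)
  have S: "?S = K0_coset R ` frag_of ` ind_summands R M" by (auto simp: K0_class_def ind_summands_def)
  have Sc: "?S \<subseteq> carrier (K0 R)" unfolding S K0_carrier using sub by auto
  have "generate (K0 R) ?S \<subseteq> K0_coset R ` {x. Poly_Mapping.keys x \<subseteq> ind_summands R M}"
  proof
    fix c assume "c \<in> generate (K0 R) ?S"
    then show "c \<in> K0_coset R ` {x. Poly_Mapping.keys x \<subseteq> ind_summands R M}"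
    proof (induction rule: generate.induct)
      case one then show ?case unfolding K0_one by (intro imageI) simp
    next
      case (incl h) then show ?case unfolding S by (auto simp: keys_frag_of)
    next
      case (inv h)
      then obtain X where X: "X \<in> ind_summands R M" "h = K0_coset R (frag_of X)" unfolding S by blast
      then have "inv\<^bsub>K0 R\<^esub> h = K0_coset R (- frag_of X)" using K0_inv[of "frag_of X" R] sub by auto
      then show ?case using X(1) by (auto simp: keys_frag_of)
    next
      case (eng h1 h2)
      then obtain x y where xy: "h1 = K0_coset R x" "Poly_Mapping.keys x \<subseteq> ind_summands R M"
        "h2 = K0_coset R y" "Poly_Mapping.keys y \<subseteq> ind_summands R M" by blast
      then have "h1 \<otimes>\<^bsub>K0 R\<^esub> h2 = K0_coset R (x + y)" using K0_mult[of x R y] sub by auto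
      then show ?case using xy(2,4) keys_add[of x y] by blast
    qed
  qed
  moreover have "K0_coset R x \<in> generate (K0 R) ?S" if "Poly_Mapping.keys x \<subseteq> ind_summands R M" for x
    using that
  proof (induction rule: free_Abelian_group_induct[consumes 1, case_names 1 2 3])
    case 1 then show ?case using generate.one[of "K0 R" ?S] by (simp add: K0_one)
  next
    case (2 x y)
    have "inv\<^bsub>K0 R\<^esub> (K0_coset R y) \<in> generate (K0 R) ?S"
      by (rule group.generate_m_inv_closed[OF K0_group Sc 2(4)])
    then have "K0_coset R x \<otimes>\<^bsub>K0 R\<^esub> K0_coset R (- y) \<in> generate (K0 R) ?S"
      using generate.eng[OF 2(3)] K0_inv[of y R] 2(2) sub by auto
    then show ?case using K0_mult[of x R "- y"] 2(1,2) sub by auto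
  next
    case (3 a)
    then show ?case unfolding S by (intro generate.incl imageI)
  qed
  ultimately show ?thesis unfolding add_span_def by blast
qed

section \<open>Effective combinations and equality in \<open>K0\<close>\<close>

context good_ring
begin

text \<open>The term \<open>M\<close> may sit below the last one, \<open>M'\<close>; regrouping
  \<open>M' + (M + T)\<close> as \<open>M + (M' + T)\<close> brings it to the front.\<close>

lemma eff_extract:
  fixes S :: "('a, 'm) module"
  assumes "eff R y S" "Poly_Mapping.lookup y M > 0"
  shows "\<exists>T. eff R (y - frag_of M) T \<and> mod_iso R S (dsum M T)"
  using assms
proof (induction rule: eff.induct)
  case (add x A M' S)
  note fA = eff_fgmod[OF add(1)]
  show ?case
  proof (cases "M' = M")
    case True
    then show ?thesis using add by (intro exI[of _ A]) simp
  next
    case False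
    then have "Poly_Mapping.lookup x M > 0" using add.prems by (simp add: lookup_add)
    then obtain T where T: "eff R (x - frag_of M) T" "mod_iso R A (dsum M T)" using add.IH by blast
    note fT = eff_fgmod[OF T(1)]
    have fM: "M \<in> fgmod R"
    proof -
      have "M \<in> Poly_Mapping.keys x" using \<open>Poly_Mapping.lookup x M > 0\<close> by (simp add: in_keys_iff)
      moreover have "Poly_Mapping.keys x \<subseteq> fgmod R" using add(1)
      proof (induction rule: eff.induct)
        case (add x A M S)
        then show ?case using keys_add[of "frag_of M" x] by (auto simp: keys_frag_of)
      qed simp
      ultimately show ?thesis by blast
    qed
    obtain U :: "('a, 'm) module" where U: "U \<in> fgmod R" "mod_iso R (dsum M' T) U"
      using fg_copy[OF fgmod_dsum[OF add(2) fT]] by blast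
    note l = fgmodD[OF fA] fgmodD[OF add(2)] fgmodD[OF add(3)] fgmodD[OF fT] fgmodD[OF U(1)] fgmodD[OF fM]
    have "eff R (frag_of M' + (x - frag_of M)) U"
      by (rule eff.add[OF T(1) add(2) U(1) mod_iso_sym[OF U(2)]]) (simp_all add: l left_module_dsum)
    moreover have "mod_iso R S (dsum M U)"
    proof -
      have i1: "mod_iso R (dsum M' A) (dsum M' (dsum M T))"
        by (rule dsum_cong[OF mod_iso_refl T(2)]) (simp_all add: l left_module_dsum)
      have i2: "mod_iso R (dsum M' (dsum M T)) (dsum (dsum M' M) T)"
        by (rule mod_iso_sym[OF dsum_assoc]) (simp_all add: l left_module_dsum)
      have i3: "mod_iso R (dsum (dsum M' M) T) (dsum (dsum M M') T)"
        by (rule dsum_cong[OF dsum_comm mod_iso_refl]) (simp_all add: l left_module_dsum)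
      have i4: "mod_iso R (dsum (dsum M M') T) (dsum M (dsum M' T))"
        by (rule dsum_assoc) (simp_all add: l)
      have i5: "mod_iso R (dsum M (dsum M' T)) (dsum M U)"
        by (rule dsum_cong[OF mod_iso_refl U(2)]) (simp_all add: l left_module_dsum)
      show ?thesis
        by (rule mod_iso_trans[OF add(4) mod_iso_trans[OF i1 mod_iso_trans[OF i2 mod_iso_trans[OF i3 mod_iso_trans[OF i4 i5]]]]])
          (simp_all add: l left_module_dsum)
    qed
    ultimately show ?thesis by (intro exI[of _ U]) (simp add: algebra_simps)
  qed
qed simp

lemma zero_modules_iso:
  fixes A B :: "('a, 'm) module"
  assumes "left_module R A" "left_module R B" "zero_module A" "zero_module B"
  shows "mod_iso R A B"
proof (rule mod_isoI[OF assms(1,2) lhom_zero[OF assms(2)] lhom_zero[OF assms(1)]])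
qed (use assms(3,4) in \<open>auto simp: zero_module_def\<close>)

text \<open>Independence of the order of summation: the last term of one sum is extracted from the
  other by \<open>eff_extract\<close>.\<close>

lemma eff_unique:
  fixes A A' :: "('a, 'm) module"
  assumes "eff R x A" "eff R x A'"
  shows "mod_iso R A A'"
  using assms
proof (induction arbitrary: A' rule: eff.induct)
  case (zero Z)
  then show ?case
    by (intro zero_modules_iso fgmodD[OF zero(1)] fgmodD[OF eff_fgmod[OF zero(3)]] zero(2) eff_zero[OF zero(3)])
next
  case (add x A M S)
  have "Poly_Mapping.lookup (frag_of M + x) M > 0" using eff_nonneg[OF add(1), of M] by (simp add: lookup_add)
  then obtain T where T: "eff R (frag_of M + x - frag_of M) T" "mod_iso R A' (dsum M T)"
    using eff_extract[OF add.prems] by blast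
  then have T': "eff R x T" by simp
  note l = fgmodD[OF eff_fgmod[OF T']] fgmodD[OF eff_fgmod[OF add(1)]] fgmodD[OF add(2)] fgmodD[OF add(3)]
    fgmodD[OF eff_fgmod[OF add.prems]]
  have i: "mod_iso R (dsum M A) (dsum M T)"
    by (rule dsum_cong[OF mod_iso_refl add.IH[OF T']]) (simp_all add: l)
  show ?case
    by (rule mod_iso_trans[OF add(4) mod_iso_trans[OF i mod_iso_sym[OF T(2)]]]) (simp_all add: l left_module_dsum)
qed

lemma eff_add:
  fixes A B S :: "('a, 'm) module"
  assumes "eff R x A" "eff R y B" "S \<in> fgmod R" "mod_iso R S (dsum A B)"
  shows "eff R (x + y) S"
  using assms(1,3,4)
proof (induction arbitrary: S rule: eff.induct)
  case (zero Z)
  note l = fgmodD[OF zero(1)] fgmodD[OF eff_fgmod[OF assms(2)]] fgmodD[OF zero(3)]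
  have i: "mod_iso R (dsum B Z) B" by (rule dsum_zero[OF l(2,1) zero(2)])
  have "mod_iso R S B"
    by (rule mod_iso_trans[OF zero(4) mod_iso_trans[OF dsum_comm i]]) (simp_all add: l left_module_dsum)
  then show ?case using eff_iso[OF assms(2) mod_iso_sym[OF _ l(3,2)] zero(3)] by simp
next
  case (add x A M S S')
  note fB = eff_fgmod[OF assms(2)] and fA = eff_fgmod[OF add(1)]
  obtain T :: "('a, 'm) module" where T: "T \<in> fgmod R" "mod_iso R (dsum A B) T"
    using fg_copy[OF fgmod_dsum[OF fA fB]] by blast
  note l = fgmodD[OF fA] fgmodD[OF fB] fgmodD[OF add(2)] fgmodD[OF add(3)] fgmodD[OF T(1)] fgmodD[OF add.prems(1)]
  have "eff R (x + y) T" by (rule add.IH[OF T(1) mod_iso_sym[OF T(2)]]) (simp_all add: l left_module_dsum)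
  moreover have "mod_iso R S' (dsum M T)"
  proof -
    have i1: "mod_iso R (dsum S B) (dsum (dsum M A) B)"
      by (rule dsum_cong[OF add(4) mod_iso_refl]) (simp_all add: l left_module_dsum)
    have i2: "mod_iso R (dsum (dsum M A) B) (dsum M (dsum A B))"
      by (rule dsum_assoc) (simp_all add: l)
    have i3: "mod_iso R (dsum M (dsum A B)) (dsum M T)"
      by (rule dsum_cong[OF mod_iso_refl T(2)]) (simp_all add: l left_module_dsum)
    show ?thesis
      by (rule mod_iso_trans[OF add.prems(2) mod_iso_trans[OF i1 mod_iso_trans[OF i2 i3]]]) (simp_all add: l left_module_dsum)
  qed
  ultimately have "eff R (frag_of M + (x + y)) S'" by (rule eff.add[OF _ add(2) add.prems(1)])
  then show ?case by (simp add: add.assoc)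
qed

text \<open>The identity of a projective module is null.\<close>

lemma stab_zero_projective:
  fixes Q Z :: "('a, 'm) module"
  assumes Q: "projective R Q" and Z: "left_module R Z" "zero_module Z"
  shows "stab R Q Z"
proof -
  have lQ: "left_module R Q" by (rule fgmodD[OF projective_fgmod[OF Q]])
  interpret Q: left_module R Q by (rule lQ)
  interpret Z: left_module R Z by (rule Z)
  have "pnull R Q Q (\<lambda>x. x)" by (rule pnullI[OF Q lhom_id lhom_id]) simp
  moreover have "y = \<zero>\<^bsub>Z\<^esub>" if "y \<in> carrier Z" for y using that Z(2) by (simp add: zero_module_def)
  ultimately show ?thesis
    unfolding stab_def using lhom_zero[OF lQ, of Z] lhom_zero[OF Z(1), of Q] pnull_zero[OF Z(1), of Z]
    by (intro exI[of _ "\<lambda>x. \<zero>\<^bsub>Z\<^esub>"] exI[of _ "\<lambda>x. \<zero>\<^bsub>Q\<^esub>"] exI[of _ "\<lambda>x. x"]) auto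
qed

text \<open>Each relation is a difference of effective combinations with stably equivalent sums, and
  this property survives the group operations because of \<open>stab_dsum\<close>.\<close>

lemma K0_kernel_eff:
  fixes x :: "('a, 'm) module \<Rightarrow>\<^sub>0 int"
  assumes "x \<in> K0_kernel R"
  shows "\<exists>a b A B. x = a - b \<and> eff R a A \<and> eff R b B \<and> stab R A B"
proof -
  let ?Z = "zero_mod undefined :: ('a, 'm) module"
  have Z: "?Z \<in> fgmod R" "zero_module ?Z" 
    by (rule zero_mod(1)[OF ring_R], rule zero_mod(2)[OF ring_R])
  have rel: "\<exists>a b A B. x = a - b \<and> eff R a A \<and> eff R b B \<and> stab R A B" if "x \<in> K0_relations R"
    for x :: "('a, 'm) module \<Rightarrow>\<^sub>0 int"
  proof -
    from that consider A B C where "x = frag_of C - (frag_of A + frag_of B)" "A \<in> fgmod R" "B \<in> fgmod R" "C \<in> fgmod R"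
        "mod_iso R C (dsum A B)"
      | Q where "x = frag_of Q" "projective R Q"
      unfolding K0_relations_def by blast
    then show ?thesis
    proof cases
      case 1
      have "eff R (frag_of A + frag_of B) C"
        by (rule eff.add[OF eff_frag_of[OF 1(3)] 1(2,4,5)])
      then show ?thesis
        using 1(1) eff_frag_of[OF 1(4)] iso_stab[OF mod_iso_refl[OF fgmodD[OF 1(4)]] fgmodD[OF 1(4)] fgmodD[OF 1(4)]] by blast
    next
      case 2
      then show ?thesis
        using eff_frag_of[OF projective_fgmod[OF 2(2)]] eff.zero[OF Z] stab_zero_projective[OF 2(2) fgmodD[OF Z(1)] Z(2)]
        by (intro exI[of _ x] exI[of _ 0] exI[of _ Q] exI[of _ ?Z]) simp
    qed
  qed
  show ?thesis using assms unfolding K0_kernel_def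
  proof (induction rule: generate.induct)
    case one
    then show ?case
      using eff.zero[OF Z] iso_stab[OF mod_iso_refl[OF fgmodD[OF Z(1)]] fgmodD[OF Z(1)] fgmodD[OF Z(1)]]
      by (intro exI[of _ 0] exI[of _ 0] exI[of _ ?Z]) simp
  next
    case (incl h) then show ?case by (rule rel)
  next
    case (inv h)
    obtain a b A B where ab: "h = a - b" "eff R a A" "eff R b B" "stab R A B" using rel[OF inv] by blast
    have "h \<in> K0_kernel R" unfolding K0_kernel_def by (rule generate.incl[OF inv])
    then have "inv\<^bsub>free_Abelian_group (fgmod R)\<^esub> h = b - a" using K0_kernel_carrier[of h R] ab(1) by simp
    then show ?case using ab(2-4) stab_sym by blast
  next
    case (eng h1 h2)
    obtain a b A B where ab: "h1 = a - b" "eff R a A" "eff R b B" "stab R A B" using eng(3) by blast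
    obtain c d C D where cd: "h2 = c - d" "eff R c C" "eff R d D" "stab R C D" using eng(4) by blast
    note f = eff_fgmod[OF ab(2)] eff_fgmod[OF ab(3)] eff_fgmod[OF cd(2)] eff_fgmod[OF cd(3)]
    obtain S :: "('a, 'm) module" where S: "S \<in> fgmod R" "mod_iso R (dsum A C) S" using fg_copy[OF fgmod_dsum[OF f(1,3)]] by blast
    obtain T :: "('a, 'm) module" where T: "T \<in> fgmod R" "mod_iso R (dsum B D) T" using fg_copy[OF fgmod_dsum[OF f(2,4)]] by blast
    note l = fgmodD[OF f(1)] fgmodD[OF f(2)] fgmodD[OF f(3)] fgmodD[OF f(4)] fgmodD[OF S(1)] fgmodD[OF T(1)]
    have S': "mod_iso R S (dsum A C)" by (rule mod_iso_sym[OF S(2)]) (simp_all add: l left_module_dsum)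
    have T': "mod_iso R T (dsum B D)" by (rule mod_iso_sym[OF T(2)]) (simp_all add: l left_module_dsum)
    have e: "h1 \<otimes>\<^bsub>free_Abelian_group (fgmod R)\<^esub> h2 = (a + c) - (b + d)" using ab(1) cd(1) by (simp add: algebra_simps)
    have e1: "eff R (a + c) S" by (rule eff_add[OF ab(2) cd(2) S(1) S'])
    have e2: "eff R (b + d) T" by (rule eff_add[OF ab(3) cd(3) T(1) T'])
    have "stab R S T" by (rule stab_dsum[OF f(1,2,3,4) S(1) T(1) S' T' ab(4) cd(4)])
    then show ?case using e e1 e2 by blast
  qed
qed

text \<open>An equation \<open>A - B = a - b\<close> in the free group makes \<open>A + B'\<close>
  isomorphic to \<open>B + A'\<close> by \<open>eff_unique\<close>; since \<open>A'\<close> and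
  \<open>B'\<close> are stably equivalent, \<open>B'\<close> can be cancelled stably. Conversely,
  projective summands have class zero.\<close>

lemma K0_kernel_stab:
  fixes A B :: "('a, 'm) module"
  assumes AB: "A \<in> fgmod R" "B \<in> fgmod R"
  shows "frag_of A - frag_of B \<in> K0_kernel R \<longleftrightarrow> stab R A B"
proof
  assume "frag_of A - frag_of B \<in> K0_kernel R"
  then obtain a b A' B' where ab: "frag_of A - frag_of B = a - b" "eff R a A'" "eff R b B'" "stab R A' B'"
    using K0_kernel_eff by blast
  note f = eff_fgmod[OF ab(2)] eff_fgmod[OF ab(3)]
  obtain S :: "('a, 'm) module" where S: "S \<in> fgmod R" "mod_iso R (dsum A B') S" using fg_copy[OF fgmod_dsum[OF AB(1) f(2)]] by blast
  obtain T :: "('a, 'm) module" where T: "T \<in> fgmod R" "mod_iso R (dsum B A') T" using fg_copy[OF fgmod_dsum[OF AB(2) f(1)]] by blast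
  obtain W :: "('a, 'm) module" where W: "W \<in> fgmod R" "mod_iso R (dsum B' B) W" using fg_copy[OF fgmod_dsum[OF f(2) AB(2)]] by blast
  note l = fgmodD[OF f(1)] fgmodD[OF f(2)] fgmodD[OF AB(1)] fgmodD[OF AB(2)] fgmodD[OF S(1)] fgmodD[OF T(1)] fgmodD[OF W(1)]
  have S': "mod_iso R S (dsum A B')" by (rule mod_iso_sym[OF S(2)]) (simp_all add: l left_module_dsum)
  have T': "mod_iso R T (dsum B A')" by (rule mod_iso_sym[OF T(2)]) (simp_all add: l left_module_dsum)
  have W': "mod_iso R W (dsum B' B)" by (rule mod_iso_sym[OF W(2)]) (simp_all add: l left_module_dsum)
  have e1: "eff R (frag_of A + b) S" by (rule eff_add[OF eff_frag_of[OF AB(1)] ab(3) S(1) S'])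
  have e2: "eff R (frag_of B + a) T" by (rule eff_add[OF eff_frag_of[OF AB(2)] ab(2) T(1) T'])
  have "frag_of A + b = frag_of B + a" using ab(1) by (simp add: algebra_simps)
  then have "mod_iso R S T" using eff_unique[OF e1] e2 by simp
  then have st1: "stab R S T" using iso_stab l(5,6) by blast
  have T'': "mod_iso R T (dsum A' B)"
    by (rule mod_iso_trans[OF T' dsum_comm]) (simp_all add: l left_module_dsum)
  have "stab R T W"
    by (rule stab_dsum[OF f(1,2) AB(2,2) T(1) W(1) T'' W' ab(4) iso_stab[OF mod_iso_refl]]) (simp_all add: l)
  then have st: "stab R S W" by (rule stab_trans[OF st1 _ S(1) T(1) W(1)])
  have S'': "mod_iso R S (dsum B' A)"
    by (rule mod_iso_trans[OF S' dsum_comm]) (simp_all add: l left_module_dsum)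
  show "stab R A B" by (rule stab_cancel[OF AB f(2) S(1) W(1) S'' W' st])
next
  assume "stab R A B"
  then obtain C P :: "('a, 'm) module" where CP: "projective R C" "projective R P" "mod_iso R (dsum A C) (dsum B P)"
    by (rule stab_dsum_iso[OF AB]) (rule that)
  note f = projective_fgmod[OF CP(1)] projective_fgmod[OF CP(2)]
  obtain S :: "('a, 'm) module" where S: "S \<in> fgmod R" "mod_iso R (dsum A C) S" using fg_copy[OF fgmod_dsum[OF AB(1) f(1)]] by blast
  note l = fgmodD[OF f(1)] fgmodD[OF f(2)] fgmodD[OF AB(1)] fgmodD[OF AB(2)] fgmodD[OF S(1)]
  have S': "mod_iso R S (dsum A C)" by (rule mod_iso_sym[OF S(2)]) (simp_all add: l left_module_dsum)
  have S'': "mod_iso R S (dsum B P)" by (rule mod_iso_trans[OF S' CP(3)]) (simp_all add: l left_module_dsum)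
  have "frag_of A - frag_of B = (frag_of S - (frag_of B + frag_of P)) - (frag_of S - (frag_of A + frag_of C)) + frag_of P - frag_of C"
    by (simp add: algebra_simps)
  also have "\<dots> \<in> K0_kernel R"
    by (intro K0_kernel_diff K0_kernel_add K0_kernel_sum[OF AB(1) f(1) S(1) S'] K0_kernel_sum[OF AB(2) f(2) S(1) S'']
        K0_kernel_projective CP)
  finally show "frag_of A - frag_of B \<in> K0_kernel R" .
qed

section \<open>The syzygy operator on \<open>K0\<close>\<close>

lemma projective_kernel:
  fixes P Q :: "('a, 'm) module"
  assumes P: "projective R P" and Q: "projective R Q" and p: "lhom R P Q p" "p ` carrier P = carrier Q"
  shows "projective R (submod P (hom_ker P Q p))"
proof -
  note f = projective_fgmod[OF P] projective_fgmod[OF Q]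
  note l = fgmodD[OF f(1)] fgmodD[OF f(2)]
  obtain s where s: "lhom R Q P s" "\<And>x. x \<in> carrier Q \<Longrightarrow> p (s x) = x"
    by (rule projective_lift[OF Q f p(1) lhom_id p(2)]) (rule that)
  have ret: "retract R Q P s p" unfolding retract_def using s p(1) by simp
  let ?K = "submod P (hom_ker P Q p)"
  have lK: "left_module R ?K" by (rule left_module_submod[OF l(1) submodule_ker[OF l p(1)]])
  obtain i r where "retract R (dsum Q ?K) P i r"
    using iso_retract[OF retract_dsum_iso[OF l(2,1) ret] l(1) left_module_dsum[OF l(2) lK]] by metis
  then have "retract R ?K P (\<lambda>x. i (\<zero>\<^bsub>Q\<^esub>, x)) (\<lambda>y. snd (r y))"
    by (rule retract_trans[OF retract_dsum(2)[OF l(2) lK]])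
  then show ?thesis by (rule projective_retract[OF lK P])
qed

lemma syzygy_projective:
  fixes Q :: "('a, 'm) module"
  assumes "projective R Q"
  shows "projective R (syzygy R Q)"
proof -
  obtain P p where P: "proj_cover R Q P p" "syzygy R Q = submod P (hom_ker P Q p)"
    using syzygyE[OF projective_fgmod[OF assms]] by metis
  show ?thesis unfolding P(2) by (rule projective_kernel[OF proj_coverD(1)[OF P(1)] assms proj_coverD(4,5)[OF P(1)]])
qed

text \<open>The sum of two presentations, moved to the carrier type \<open>'m\<close>, has the sum
  of the kernels as its kernel. It is applied to projective covers, but the result is treated as a
  mere presentation of \<open>C\<close>, which \<open>stab_kernel\<close> can compare with the cover
  of \<open>C\<close>.\<close>

lemma dsum_presentation:
  fixes A B C QA QB :: "('a, 'm) module"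
  assumes fg: "A \<in> fgmod R" "B \<in> fgmod R" "C \<in> fgmod R" and iso: "mod_iso R C (dsum A B)"
    and A: "projective R QA" "lhom R QA A p" "p ` carrier QA = carrier A"
    and B: "projective R QB" "lhom R QB B q" "q ` carrier QB = carrier B"
  obtains D :: "('a, 'm) module" and d where "projective R D" "lhom R D C d" "d ` carrier D = carrier C" "mod_iso R D (dsum QA QB)"
    "mod_iso R (submod D (hom_ker D C d)) (dsum (submod QA (hom_ker QA A p)) (submod QB (hom_ker QB B q)))"
proof -
  note fQ = projective_fgmod[OF A(1)] projective_fgmod[OF B(1)]
  obtain D :: "('a, 'm) module" where D: "D \<in> fgmod R" "mod_iso R (dsum QA QB) D"
    using fg_copy[OF fgmod_dsum[OF fQ]] by blast
  note l = fgmodD[OF fg(1)] fgmodD[OF fg(2)] fgmodD[OF fg(3)] fgmodD[OF fQ(1)] fgmodD[OF fQ(2)] fgmodD[OF D(1)]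
  note ld = left_module_dsum[OF l(1,2)] left_module_dsum[OF l(4,5)]
  have D': "mod_iso R D (dsum QA QB)" by (rule mod_iso_sym[OF D(2) ld(2) l(6)])
  have pD: "projective R D" by (rule projective_dsum[OF D(1) D' A(1) B(1)])
  obtain u v where uv: "lhom R D (dsum QA QB) u" "lhom R (dsum QA QB) D v"
    "\<And>x. x \<in> carrier D \<Longrightarrow> v (u x) = x" "\<And>x. x \<in> carrier (dsum QA QB) \<Longrightarrow> u (v x) = x"
    by (rule mod_isoE[OF D' l(6) ld(2)]) (rule that)
  obtain c' c where c: "lhom R C (dsum A B) c'" "lhom R (dsum A B) C c"
    "\<And>x. x \<in> carrier C \<Longrightarrow> c (c' x) = x" "\<And>x. x \<in> carrier (dsum A B) \<Longrightarrow> c' (c x) = x"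
    by (rule mod_isoE[OF iso l(3) ld(1)]) (rule that)
  let ?pq = "\<lambda>z. (p (fst z), q (snd z))"
  note m = dsum_maps[OF l(4,5)]
  have pq: "lhom R (dsum QA QB) (dsum A B) ?pq"
    by (rule lhom_pair[OF lhom_comp[OF m(3) A(2)] lhom_comp[OF m(4) B(2)]])
  let ?d = "\<lambda>x. c (?pq (u x))"
  have d: "lhom R D C ?d" by (rule lhom_comp[OF lhom_comp[OF uv(1) pq] c(2)])
  have ds: "?d ` carrier D = carrier C"
  proof
    show "?d ` carrier D \<subseteq> carrier C" using lhomD(1)[OF d] by blast
    show "carrier C \<subseteq> ?d ` carrier D"
    proof
      fix x assume x: "x \<in> carrier C"
      obtain a b where ab: "c' x = (a, b)" by force
      have "a \<in> carrier A" "b \<in> carrier B" using lhomD(1)[OF c(1) x] ab by auto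
      then obtain y z where yz: "y \<in> carrier QA" "a = p y" "z \<in> carrier QB" "b = q z" using A(3) B(3) by (metis imageE)
      have "?d (v (y, z)) = x" using uv(4)[of "(y, z)"] yz ab c(3)[OF x] by simp
      moreover have "v (y, z) \<in> carrier D" using lhomD(1)[OF uv(2), of "(y, z)"] yz by simp
      ultimately show "x \<in> ?d ` carrier D" by (metis (no_types, lifting) imageI)
    qed
  qed
  have cz: "c w = \<zero>\<^bsub>C\<^esub> \<longleftrightarrow> w = (\<zero>\<^bsub>A\<^esub>, \<zero>\<^bsub>B\<^esub>)" if "w \<in> carrier (dsum A B)" for w
    using c(4)[OF that] lhomZ(1)[OF c(1) l(3) ld(1)] lhomZ(1)[OF c(2) ld(1) l(3)] by auto
  let ?K = "hom_ker D C ?d" and ?KA = "hom_ker QA A p" and ?KB = "hom_ker QB B q"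
  have K: "submodule ?K R D" "submodule ?KA R QA" "submodule ?KB R QB"
    using submodule_ker[OF l(6,3) d] submodule_ker[OF l(4,1) A(2)] submodule_ker[OF l(5,2) B(2)] .
  have Kiff: "x \<in> ?K \<longleftrightarrow> x \<in> carrier D \<and> fst (u x) \<in> ?KA \<and> snd (u x) \<in> ?KB" for x
  proof (cases "x \<in> carrier D")
    case True
    then have "u x \<in> carrier (dsum QA QB)" using lhomD(1)[OF uv(1)] by blast
    then show ?thesis using True cz[OF lhomD(1)[OF pq, of "u x"]] by (auto simp: hom_ker_def)
  qed (simp add: hom_ker_def)
  note lK = left_module_submod[OF l(6) K(1)] left_module_submod[OF l(4) K(2)] left_module_submod[OF l(5) K(3)]
  have sub: "?K \<subseteq> carrier D" "?KA \<subseteq> carrier QA" "?KB \<subseteq> carrier QB" by (auto simp: hom_ker_def)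
  have "mod_iso R (submod D ?K) (dsum (submod QA ?KA) (submod QB ?KB))"
  proof (rule mod_isoI[OF lK(1) left_module_dsum[OF lK(2,3)], where f = u and g = v])
    have "lhom R (submod D ?K) (dsum QA QB) u" by (rule lhom_from_submod[OF uv(1) sub(1)])
    then show "lhom R (submod D ?K) (dsum (submod QA ?KA) (submod QB ?KB)) u"
      using Kiff by (auto simp: lhom_def mem_Times_iff)
    have uvz: "u (v z) = z" if "fst z \<in> ?KA" "snd z \<in> ?KB" for z
      using uv(4)[of z] that sub by (cases z) auto
    have vK: "v z \<in> ?K" if "fst z \<in> ?KA" "snd z \<in> ?KB" for z
      unfolding Kiff uvz[OF that] using that lhomD(1)[OF uv(2), of z] sub by (cases z) auto
    show "lhom R (dsum (submod QA ?KA) (submod QB ?KB)) (submod D ?K) v"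
    proof (rule lhomI)
      show "v z \<in> carrier (submod D ?K)" if "z \<in> carrier (dsum (submod QA ?KA) (submod QB ?KB))" for z
        using vK[of z] that by auto
      show "v (y \<oplus>\<^bsub>dsum (submod QA ?KA) (submod QB ?KB)\<^esub> z) = v y \<oplus>\<^bsub>submod D ?K\<^esub> v z"
        if "y \<in> carrier (dsum (submod QA ?KA) (submod QB ?KB))" "z \<in> carrier (dsum (submod QA ?KA) (submod QB ?KB))" for y z
        using lhomD(2)[OF uv(2), of y z] that sub by (cases y, cases z) auto
      show "v (a \<odot>\<^bsub>dsum (submod QA ?KA) (submod QB ?KB)\<^esub> z) = a \<odot>\<^bsub>submod D ?K\<^esub> v z"
        if "a \<in> carrier R" "z \<in> carrier (dsum (submod QA ?KA) (submod QB ?KB))" for a z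
        using lhomD(3)[OF uv(2), of a z] that sub by (cases z) auto
    qed
    show "v (u x) = x" if "x \<in> carrier (submod D ?K)" for x using uv(3)[of x] that sub by auto
    show "u (v z) = z" if "z \<in> carrier (dsum (submod QA ?KA) (submod QB ?KB))" for z
      using uvz[of z] that by auto
  qed
  then show ?thesis by (rule that[OF pD d ds D'])
qed

text \<open>The chosen syzygy of \<open>C\<close> is compared with the kernel of the summed
  presentation by \<open>stab_kernel\<close>, and stably equivalent modules have the same
  class.\<close>

lemma Om_kernel:
  fixes x :: "('a, 'm) module \<Rightarrow>\<^sub>0 int"
  assumes "x \<in> K0_kernel R"
  shows "Om R x \<in> K0_kernel R"
proof -
  have rel: "Om R x \<in> K0_kernel R" if "x \<in> K0_relations R" for x :: "('a, 'm) module \<Rightarrow>\<^sub>0 int"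
  proof -
    from that consider A B C where "x = frag_of C - (frag_of A + frag_of B)" "A \<in> fgmod R" "B \<in> fgmod R" "C \<in> fgmod R"
        "mod_iso R C (dsum A B)"
      | Q where "x = frag_of Q" "projective R Q"
      unfolding K0_relations_def by blast
    then show ?thesis
    proof cases
      case 1
      obtain QA p where QA: "proj_cover R A QA p" "syzygy R A = submod QA (hom_ker QA A p)"
        using syzygyE[OF 1(2)] by metis
      obtain QB q where QB: "proj_cover R B QB q" "syzygy R B = submod QB (hom_ker QB B q)"
        using syzygyE[OF 1(3)] by metis
      obtain QC r where QC: "proj_cover R C QC r" "syzygy R C = submod QC (hom_ker QC C r)"
        using syzygyE[OF 1(4)] by metis
      obtain D :: "('a, 'm) module" and d where D: "projective R D" "lhom R D C d" "d ` carrier D = carrier C" "mod_iso R D (dsum QA QB)"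
        "mod_iso R (submod D (hom_ker D C d)) (dsum (syzygy R A) (syzygy R B))"
        by (rule dsum_presentation[OF 1(2-5) proj_coverD(1,4,5)[OF QA(1)] proj_coverD(1,4,5)[OF QB(1)]])
          (rule that; simp add: QA(2) QB(2))
      let ?K = "submod D (hom_ker D C d)"
      have fK: "?K \<in> fgmod R"
        by (rule fg_submod[OF projective_fgmod[OF D(1)] submodule_ker[OF fgmodD[OF projective_fgmod[OF D(1)]] fgmodD[OF 1(4)] D(2)]])
      have "stab R (syzygy R C) ?K"
        unfolding QC(2)
        by (rule stab_kernel[OF 1(4,4) iso_stab[OF mod_iso_refl] proj_coverD(1,4,5)[OF QC(1)] D(1-3)]) (simp_all add: fgmodD[OF 1(4)])
      then have "frag_of (syzygy R C) - frag_of ?K \<in> K0_kernel R"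
        using K0_kernel_stab[OF syzygy_fgmod[OF 1(4)] fK] by blast
      then have "(frag_of (syzygy R C) - frag_of ?K) + (frag_of ?K - (frag_of (syzygy R A) + frag_of (syzygy R B))) \<in> K0_kernel R"
        by (rule K0_kernel_add[OF _ K0_kernel_sum[OF syzygy_fgmod[OF 1(2)] syzygy_fgmod[OF 1(3)] fK D(5)]])
      then show ?thesis by (simp add: 1(1) Om_simps algebra_simps)
    next
      case 2
      then show ?thesis using K0_kernel_projective[OF syzygy_projective[OF 2(2)]] by (simp add: Om_simps)
    qed
  qed
  show ?thesis using assms unfolding K0_kernel_def
  proof (induction rule: generate.induct)
    case one then show ?case using K0_kernel_zero by (simp add: Om_simps K0_kernel_def)
  next
    case (incl h) then show ?case using rel by (simp add: K0_kernel_def)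
  next
    case (inv h)
    have "h \<in> K0_kernel R" unfolding K0_kernel_def by (rule generate.incl[OF inv])
    then have "inv\<^bsub>free_Abelian_group (fgmod R)\<^esub> h = - h" using K0_kernel_carrier[of h R] by simp
    then show ?case using K0_kernel_minus[OF rel[OF inv]] by (simp add: Om_simps K0_kernel_def)
  next
    case (eng h1 h2)
    then show ?case using K0_kernel_add[of "Om R h1" R "Om R h2"] by (simp add: Om_simps K0_kernel_def)
  qed
qed

lemma Om_pow_kernel:
  fixes x :: "('a, 'm) module \<Rightarrow>\<^sub>0 int"
  shows "x \<in> K0_kernel R \<Longrightarrow> (Om R ^^ s) x \<in> K0_kernel R"
  by (induction s) (simp_all add: Om_kernel)

text \<open>By \<open>Om_kernel\<close> all representatives of a coset give the same value, so the
  set in the definition of \<open>K0_syzygy\<close> is a singleton.\<close>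

lemma K0_syzygy_coset:
  fixes x :: "('a, 'm) module \<Rightarrow>\<^sub>0 int"
  shows "K0_syzygy R (K0_coset R x) = K0_coset R (Om R x)"
proof -
  have "K0_coset R (Om R (h + x)) = K0_coset R (Om R x)" if "h \<in> K0_kernel R" for h
    using Om_kernel[OF that] by (simp add: K0_coset_eq_iff Om_simps)
  then have "(\<lambda>z. K0_coset R (Om R z)) ` K0_coset R x = {K0_coset R (Om R x)}"
    unfolding K0_coset_eq[of R x] image_image using K0_kernel_zero[of R] by force
  then show ?thesis unfolding K0_syzygy_def Om_def[symmetric] by simp
qed

lemma Om_keys:
  fixes x :: "('a, 'm) module \<Rightarrow>\<^sub>0 int"
  assumes "Poly_Mapping.keys x \<subseteq> fgmod R"
  shows "Poly_Mapping.keys ((Om R ^^ s) x) \<subseteq> fgmod R"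
proof (induction s)
  case (Suc s)
  have "Poly_Mapping.keys (Om R ((Om R ^^ s) x)) \<subseteq> (\<Union>M\<in>Poly_Mapping.keys ((Om R ^^ s) x). Poly_Mapping.keys (frag_of (syzygy R M)))"
    unfolding Om_def by (rule keys_frag_extend)
  also have "\<dots> \<subseteq> fgmod R" using Suc.IH syzygy_fgmod by (auto simp: keys_frag_of)
  finally show ?case by simp
qed (simp add: assms)

text \<open>The syzygy operator always maps onto the next group, so only injectivity matters.\<close>

lemma phi_eq:
  fixes M :: "('a, 'm) module"
  shows "phi R M = (LEAST n. \<forall>s\<ge>n. \<forall>x. Poly_Mapping.keys x \<subseteq> ind_summands R M \<longrightarrow>
    (Om R ^^ Suc s) x \<in> K0_kernel R \<longrightarrow> (Om R ^^ s) x \<in> K0_kernel R)"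
proof -
  let ?D = "{x. Poly_Mapping.keys x \<subseteq> ind_summands R M}"
  have fg: "Poly_Mapping.keys x \<subseteq> fgmod R" if "x \<in> ?D" for x using that by (auto simp: ind_summands_def)
  have img: "(K0_syzygy R ^^ s) ` add_span R M = (\<lambda>x. K0_coset R ((Om R ^^ s) x)) ` ?D" for s
  proof (induction s)
    case (Suc s)
    have "(K0_syzygy R ^^ Suc s) ` add_span R M = K0_syzygy R ` (K0_syzygy R ^^ s) ` add_span R M"
      by (simp add: image_comp)
    also have "\<dots> = (\<lambda>x. K0_coset R ((Om R ^^ Suc s) x)) ` ?D"
      unfolding Suc.IH image_image by (simp add: K0_syzygy_coset)
    finally show ?case .
  qed (simp add: add_span_eq)
  have "K0_syzygy R \<in> iso ((K0 R)\<lparr>carrier := (K0_syzygy R ^^ s) ` add_span R M\<rparr>)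
                     ((K0 R)\<lparr>carrier := (K0_syzygy R ^^ Suc s) ` add_span R M\<rparr>) \<longleftrightarrow>
      (\<forall>x. x \<in> ?D \<longrightarrow> (Om R ^^ Suc s) x \<in> K0_kernel R \<longrightarrow> (Om R ^^ s) x \<in> K0_kernel R)" (is "?L \<longleftrightarrow> ?P") for s
  proof -
    let ?A = "(K0_syzygy R ^^ s) ` add_span R M" and ?B = "(K0_syzygy R ^^ Suc s) ` add_span R M"
    have onto: "K0_syzygy R ` ?A = ?B" by (simp add: image_comp)
    have hom: "K0_syzygy R \<in> hom ((K0 R)\<lparr>carrier := ?A\<rparr>) ((K0 R)\<lparr>carrier := ?B\<rparr>)"
    proof (rule homI)
      show "K0_syzygy R c \<in> carrier ((K0 R)\<lparr>carrier := ?B\<rparr>)" if "c \<in> carrier ((K0 R)\<lparr>carrier := ?A\<rparr>)" for c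
        using that onto by auto
      fix c d assume "c \<in> carrier ((K0 R)\<lparr>carrier := ?A\<rparr>)" "d \<in> carrier ((K0 R)\<lparr>carrier := ?A\<rparr>)"
      then have "c \<in> (\<lambda>x. K0_coset R ((Om R ^^ s) x)) ` ?D" "d \<in> (\<lambda>x. K0_coset R ((Om R ^^ s) x)) ` ?D"
        unfolding img by simp_all
      then obtain x y where xy: "x \<in> ?D" "c = K0_coset R ((Om R ^^ s) x)" "y \<in> ?D" "d = K0_coset R ((Om R ^^ s) y)"
        by blast
      note k = Om_keys[OF fg[OF xy(1)]] Om_keys[OF fg[OF xy(3)]]
      have "K0_syzygy R (c \<otimes>\<^bsub>K0 R\<^esub> d) = K0_syzygy R c \<otimes>\<^bsub>K0 R\<^esub> K0_syzygy R d"
        unfolding xy(2,4) K0_mult[OF k(1)[of s] k(2)[of s]] K0_syzygy_coset Om_simps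
        using K0_mult[OF k(1)[of "Suc s"] k(2)[of "Suc s"]] by simp
      then show "K0_syzygy R (c \<otimes>\<^bsub>(K0 R)\<lparr>carrier := ?A\<rparr>\<^esub> d)
          = K0_syzygy R c \<otimes>\<^bsub>(K0 R)\<lparr>carrier := ?B\<rparr>\<^esub> K0_syzygy R d" by simp
    qed
    have "inj_on (K0_syzygy R) ?A \<longleftrightarrow> ?P"
    proof
      assume inj: "inj_on (K0_syzygy R) ?A"
      show ?P
      proof (intro allI impI)
        fix x assume x: "x \<in> ?D" "(Om R ^^ Suc s) x \<in> K0_kernel R"
        have 0: "(Om R ^^ m) (0 :: ('a, 'm) module \<Rightarrow>\<^sub>0 int) = 0" for m :: nat by (induction m) (simp_all add: Om_simps)
        have "K0_syzygy R (K0_coset R ((Om R ^^ s) x)) = K0_syzygy R (K0_coset R ((Om R ^^ s) 0))"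
          unfolding K0_syzygy_coset K0_coset_eq_iff 0 using x(2) by (simp add: Om_simps)
        moreover have "K0_coset R ((Om R ^^ s) x) \<in> ?A" "K0_coset R ((Om R ^^ s) 0) \<in> ?A"
          unfolding img using x(1) by (auto intro!: image_eqI[of _ _ 0])
        ultimately have "K0_coset R ((Om R ^^ s) x) = K0_coset R ((Om R ^^ s) 0)" using inj_onD[OF inj] by blast
        then show "(Om R ^^ s) x \<in> K0_kernel R" unfolding K0_coset_eq_iff using 0[of s] by simp
      qed
    next
      assume P: ?P
      show "inj_on (K0_syzygy R) ?A"
      proof (rule inj_onI)
        fix c d assume cd: "c \<in> ?A" "d \<in> ?A" "K0_syzygy R c = K0_syzygy R d"
        obtain x y where xy: "x \<in> ?D" "c = K0_coset R ((Om R ^^ s) x)" "y \<in> ?D" "d = K0_coset R ((Om R ^^ s) y)"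
          using cd(1,2) unfolding img by blast
        have "x - y \<in> ?D" using xy(1,3) keys_diff[of x y] by blast
        moreover have "(Om R ^^ Suc s) (x - y) \<in> K0_kernel R"
          using cd(3) unfolding xy(2,4) K0_syzygy_coset K0_coset_eq_iff by (simp add: Om_pow_diff Om_simps)
        ultimately have "(Om R ^^ s) (x - y) \<in> K0_kernel R" using P by blast
        then show "c = d" unfolding xy(2,4) K0_coset_eq_iff Om_pow_diff .
      qed
    qed
    then show ?thesis unfolding iso_def bij_betw_def using hom onto by simp
  qed
  then show ?thesis unfolding phi_def by simp
qed

end

section \<open>Resolutions and dimension\<close>

text \<open>Universal property of a quotient, with \<open>K\<close> in the role of \<open>F\<close>
  modulo the kernel of \<open>p\<close>.\<close>

lemma lhom_factor:
  assumes lm: "left_module R F" "left_module R K" "left_module R N"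
    and p: "lhom R F K p" "p ` carrier F = carrier K" and f: "lhom R F N f"
    and ker: "\<And>x. \<lbrakk>x \<in> carrier F; p x = \<zero>\<^bsub>K\<^esub>\<rbrakk> \<Longrightarrow> f x = \<zero>\<^bsub>N\<^esub>"
  obtains h where "lhom R K N h" "\<And>x. x \<in> carrier F \<Longrightarrow> h (p x) = f x"
proof -
  interpret F: left_module R F by fact
  interpret K: left_module R K by fact
  interpret N: left_module R N by fact
  define h where "h k = f (inv_into (carrier F) p k)" for k
  have h: "h (p x) = f x" if x: "x \<in> carrier F" for x
  proof -
    let ?y = "inv_into (carrier F) p (p x)"
    have y: "?y \<in> carrier F" "p ?y = p x" using inv_into_into[of "p x" p] f_inv_into_f[of "p x" p] x by blast+
    have "p (?y \<ominus>\<^bsub>F\<^esub> x) = \<zero>\<^bsub>K\<^esub>"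
      using lhomZ(3)[OF p(1) lm(1,2) y(1) x] y(2) K.minus_self[OF lhomD(1)[OF p(1) x]] by simp
    then have "f (?y \<ominus>\<^bsub>F\<^esub> x) = \<zero>\<^bsub>N\<^esub>" using ker y(1) x by simp
    then have "f ?y \<ominus>\<^bsub>N\<^esub> f x = \<zero>\<^bsub>N\<^esub>" using lhomZ(3)[OF f lm(1,3) y(1) x] by simp
    then show ?thesis
      unfolding h_def using N.minus_eq_zero[OF lhomD(1)[OF f y(1)] lhomD(1)[OF f x]] by blast
  qed
  have ex: "\<exists>x\<in>carrier F. k = p x" if "k \<in> carrier K" for k using that p(2) by blast
  have "lhom R K N h"
  proof (rule lhomI)
    show "h k \<in> carrier N" if "k \<in> carrier K" for k
      using ex[OF that] h lhomD(1)[OF f] by metis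
    show "h (k \<oplus>\<^bsub>K\<^esub> l) = h k \<oplus>\<^bsub>N\<^esub> h l" if kl: "k \<in> carrier K" "l \<in> carrier K" for k l
    proof -
      obtain x y where xy: "x \<in> carrier F" "k = p x" "y \<in> carrier F" "l = p y" using ex[OF kl(1)] ex[OF kl(2)] by blast
      have "k \<oplus>\<^bsub>K\<^esub> l = p (x \<oplus>\<^bsub>F\<^esub> y)" using xy lhomD(2)[OF p(1)] by simp
      then show ?thesis using xy h[of "x \<oplus>\<^bsub>F\<^esub> y"] h lhomD(2)[OF f] by simp
    qed
    show "h (a \<odot>\<^bsub>K\<^esub> k) = a \<odot>\<^bsub>N\<^esub> h k" if ak: "a \<in> carrier R" "k \<in> carrier K" for a k
    proof -
      obtain x where x: "x \<in> carrier F" "k = p x" using ex[OF ak(2)] by blast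
      have "a \<odot>\<^bsub>K\<^esub> k = p (a \<odot>\<^bsub>F\<^esub> x)" using x ak lhomD(3)[OF p(1)] by simp
      then show ?thesis using x ak h[of "a \<odot>\<^bsub>F\<^esub> x"] h lhomD(3)[OF f] by simp
    qed
  qed
  then show ?thesis using that h by blast
qed

text \<open>The \<open>n\<close>-th syzygy in the given resolution, with \<open>X\<close> itself as
  the syzygy of order 0; \<open>res_map\<close> is the surjection of \<open>F n\<close> onto it. The
  shift lets the augmentation and the differentials be treated alike.\<close>

definition res_obj :: "('a, 'm) module \<Rightarrow> (nat \<Rightarrow> ('a, 'm) module) \<Rightarrow> (nat \<Rightarrow> 'm \<Rightarrow> 'm) \<Rightarrow> nat \<Rightarrow> ('a, 'm) module"
  where "res_obj X F D n = (case n of 0 \<Rightarrow> X | Suc m \<Rightarrow> submod (F m) (D m ` carrier (F (Suc m))))"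

definition res_map :: "(nat \<Rightarrow> 'm \<Rightarrow> 'm) \<Rightarrow> ('m \<Rightarrow> 'm) \<Rightarrow> nat \<Rightarrow> 'm \<Rightarrow> 'm"
  where "res_map D p n = (case n of 0 \<Rightarrow> p | Suc m \<Rightarrow> D m)"

lemma res_simps [simp]: "res_obj X F D 0 = X" "res_obj X F D (Suc m) = submod (F m) (D m ` carrier (F (Suc m)))"
  "res_map D p 0 = p" "res_map D p (Suc m) = D m"
  by (simp_all add: res_obj_def res_map_def)

lemma proj_resolutionD:
  assumes X: "X \<in> fgmod R" and r: "proj_resolution R X F D p"
  shows "projective R (F n)" "F n \<in> fgmod R" "left_module R (F n)" "res_obj X F D n \<in> fgmod R" "left_module R (res_obj X F D n)"
    "lhom R (F n) (res_obj X F D n) (res_map D p n)" "res_map D p n ` carrier (F n) = carrier (res_obj X F D n)"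
    "hom_ker (F n) (res_obj X F D n) (res_map D p n) = D n ` carrier (F (Suc n))"
    "lhom R (F (Suc n)) (F n) (D n)" "submodule (D n ` carrier (F (Suc n))) R (F n)"
proof -
  have P: "projective R (F n)" for n using r by (simp add: proj_resolution_def)
  then have fF: "F n \<in> fgmod R" for n using projective_fgmod by blast
  then have lF: "left_module R (F n)" for n using fgmodD by blast
  have D: "lhom R (F (Suc n)) (F n) (D n)" for n using r by (simp add: proj_resolution_def mod_hom_iff)
  have p: "lhom R (F 0) X p" "p ` carrier (F 0) = carrier X" using r by (simp_all add: proj_resolution_def mod_hom_iff)
  have e0: "D 0 ` carrier (F 1) = hom_ker (F 0) X p" using r by (simp add: proj_resolution_def)
  have es: "D (Suc n) ` carrier (F (Suc (Suc n))) = hom_ker (F (Suc n)) (F n) (D n)" for n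
    using r by (simp add: proj_resolution_def)
  have sub: "submodule (D n ` carrier (F (Suc n))) R (F n)" for n
    using submodule_image[OF lF lF D left_module.submodule_carrier[OF lF]] .
  show "projective R (F n)" "F n \<in> fgmod R" "left_module R (F n)" "lhom R (F (Suc n)) (F n) (D n)"
    "submodule (D n ` carrier (F (Suc n))) R (F n)" by (rule P fF lF D sub)+
  show K: "res_obj X F D n \<in> fgmod R"
    using X fgmod_submod_image[OF fF lF D] by (cases n) simp_all
  then show "left_module R (res_obj X F D n)" by (rule fgmodD)
  show "lhom R (F n) (res_obj X F D n) (res_map D p n)"
    using p(1) lhom_submodI[OF D] by (cases n) simp_all
  show "res_map D p n ` carrier (F n) = carrier (res_obj X F D n)"
    using p(2) by (cases n) simp_all
  show "hom_ker (F n) (res_obj X F D n) (res_map D p n) = D n ` carrier (F (Suc n))"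
    using e0 es by (cases n) (simp_all add: hom_ker_def)
qed

text \<open>The short exact sequences with terms \<open>S (n + 1)\<close>, \<open>F n\<close>,
  \<open>S n\<close> are spliced; each differential is \<open>c (n + 1)\<close> followed by the
  inclusion of \<open>S (n + 1)\<close> into \<open>F n\<close>.\<close>

lemma proj_resolutionI:
  assumes "\<And>n. projective R (F n)" "\<And>n. c n \<in> mod_hom R (F n) (S n)" "\<And>n. c n ` carrier (F n) = carrier (S n)"
    "\<And>n. S (Suc n) = submod (F n) (hom_ker (F n) (S n) (c n))"
  shows "proj_resolution R (S 0) F (\<lambda>n. c (Suc n)) (c 0)"
proof -
  have "c (Suc n) \<in> mod_hom R (F (Suc n)) (F n)" for n
    using assms(2)[of "Suc n"] unfolding assms(4)[of n] mod_hom_iff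
    by (auto intro: lhom_submodD simp: hom_ker_def)
  moreover have "c (Suc n) ` carrier (F (Suc n)) = hom_ker (F n) (S n) (c n)" for n
    using assms(3)[of "Suc n"] unfolding assms(4)[of n] by simp
  moreover have "hom_ker (F (Suc n)) (S (Suc n)) (c (Suc n)) = hom_ker (F (Suc n)) (F n) (c (Suc n))" for n
    unfolding assms(4)[of n] by (simp add: hom_ker_def)
  ultimately show ?thesis
    unfolding proj_resolution_def using assms(1) assms(2)[of 0] assms(3)[of 0] by simp
qed

context good_ring
begin

text \<open>Splices the covers behind the choices in \<open>syzygy\<close>, so that the syzygies of
  this resolution are literally the iterates of \<open>syzygy\<close>.\<close>

lemma min_resolution:
  fixes X :: "('a, 'm) module"
  assumes X: "X \<in> fgmod R"
  obtains Q c where "\<And>n. proj_cover R ((syzygy R ^^ n) X) (Q n) (c n)"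
    "\<And>n. (syzygy R ^^ Suc n) X = submod (Q n) (hom_ker (Q n) ((syzygy R ^^ n) X) (c n))"
    "proj_resolution R X Q (\<lambda>n. c (Suc n)) (c 0)"
proof -
  have "\<exists>Qc. proj_cover R ((syzygy R ^^ n) X) (fst Qc) (snd Qc) \<and>
    (syzygy R ^^ Suc n) X = submod (fst Qc) (hom_ker (fst Qc) ((syzygy R ^^ n) X) (snd Qc))" for n
  proof -
    obtain Q p where "proj_cover R ((syzygy R ^^ n) X) Q p"
      "syzygy R ((syzygy R ^^ n) X) = submod Q (hom_ker Q ((syzygy R ^^ n) X) p)"
      using syzygyE[OF syzygy_pow_fgmod[OF X, of n]] by metis
    then show ?thesis by (intro exI[of _ "(Q, p)"]) simp
  qed
  then obtain Qc where Qc: "\<And>n. proj_cover R ((syzygy R ^^ n) X) (fst (Qc n)) (snd (Qc n))"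
    "\<And>n. (syzygy R ^^ Suc n) X = submod (fst (Qc n)) (hom_ker (fst (Qc n)) ((syzygy R ^^ n) X) (snd (Qc n)))"
    by metis
  have "proj_resolution R ((syzygy R ^^ 0) X) (\<lambda>n. fst (Qc n)) (\<lambda>n. snd (Qc (Suc n))) (snd (Qc 0))"
  proof (rule proj_resolutionI[where c = "\<lambda>n. snd (Qc n)" and S = "\<lambda>n. (syzygy R ^^ n) X"])
    show "(syzygy R ^^ Suc n) X = submod (fst (Qc n)) (hom_ker (fst (Qc n)) ((syzygy R ^^ n) X) (snd (Qc n)))" for n
      by (rule Qc(2))
  qed (use Qc(1) in \<open>simp_all add: proj_cover_def\<close>)
  then have "proj_resolution R X (\<lambda>n. fst (Qc n)) (\<lambda>n. snd (Qc (Suc n))) (snd (Qc 0))" by simp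
  then show ?thesis by (rule that[of "\<lambda>n. fst (Qc n)" "\<lambda>n. snd (Qc n)", OF Qc])
qed

text \<open>Induction by \<open>stab_kernel\<close>: kernels of projective presentations of stably
  equivalent modules are stably equivalent.\<close>

lemma res_obj_stab:
  fixes X :: "('a, 'm) module"
  assumes X: "X \<in> fgmod R" and r: "proj_resolution R X F D p"
  shows "stab R (res_obj X F D n) ((syzygy R ^^ n) X)"
proof (induction n)
  case 0
  show ?case using iso_stab[OF mod_iso_refl] fgmodD[OF X] by simp
next
  case (Suc n)
  note P = proj_resolutionD[OF X r]
  note fS = syzygy_pow_fgmod[OF X, of n]
  obtain Q c where Q: "proj_cover R ((syzygy R ^^ n) X) Q c"
    "syzygy R ((syzygy R ^^ n) X) = submod Q (hom_ker Q ((syzygy R ^^ n) X) c)"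
    using syzygyE[OF fS] by metis
  show ?case
    using stab_kernel[OF P(4) fS Suc.IH P(1,6,7) proj_coverD(1,4,5)[OF Q(1)]] Q(2) P(8)[of n] by simp
qed

text \<open>The equation \<open>1 = f g + k\<close> sends the identity of \<open>B\<close> through
  \<open>A\<close> and through a projective.\<close>

lemma stab_projective:
  fixes A B :: "('a, 'm) module"
  assumes AB: "A \<in> fgmod R" "B \<in> fgmod R" "stab R A B" and A: "projective R A"
  shows "projective R B"
proof -
  obtain f g h k where fg: "lhom R A B f" "lhom R B A g" "pnull R A A h" "pnull R B B k"
    "\<forall>x\<in>carrier A. x = g (f x) \<oplus>\<^bsub>A\<^esub> h x" "\<forall>y\<in>carrier B. y = f (g y) \<oplus>\<^bsub>B\<^esub> k y"
    using AB(3) unfolding stab_def by (elim exE conjE) (rule that)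
  obtain Q :: "('a, 'm) module" and s t where Q: "projective R Q" "lhom R B Q s" "lhom R Q B t" "\<forall>x\<in>carrier B. k x = t (s x)"
    by (rule pnullE[OF fg(4)]) (rule that)
  show ?thesis
    by (rule projective_thruI[OF AB(2) A Q(1) fg(2,1) Q(2,3)]) (use fg(6) Q(4) in simp)
qed

text \<open>If \<open>F (n + 1)\<close> vanishes, then \<open>F n\<close> maps isomorphically onto
  the \<open>n\<close>-th syzygy of the resolution, which is stably equivalent to the iterated
  \<open>syzygy\<close>; conversely the minimal resolution can be stopped at a projective
  syzygy.\<close>

lemma res_length_iff:
  fixes X :: "('a, 'm) module"
  assumes X: "X \<in> fgmod R"
  shows "(\<exists>F D p. proj_resolution R X F D p \<and> (\<forall>i>n. zero_module (F i))) \<longleftrightarrow> projective R ((syzygy R ^^ n) X)"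
proof
  assume "\<exists>F D p. proj_resolution R X F D p \<and> (\<forall>i>n. zero_module (F i))"
  then obtain F D p where r: "proj_resolution R X F D p" and z: "zero_module (F (Suc n))" by blast
  note P = proj_resolutionD[OF X r]
  have "hom_ker (F n) (res_obj X F D n) (res_map D p n) = {\<zero>\<^bsub>F n\<^esub>}"
    unfolding P(8) using z lhomZ(1)[OF P(9)[of n] P(3,3)] by (simp add: zero_module_def)
  then have "x = \<zero>\<^bsub>F n\<^esub>" if "x \<in> carrier (F n)" "res_map D p n x = \<zero>\<^bsub>res_obj X F D n\<^esub>" for x
    using that by (auto simp: hom_ker_def)
  then obtain g where g: "lhom R (res_obj X F D n) (F n) g" "\<And>x. x \<in> carrier (F n) \<Longrightarrow> g (res_map D p n x) = x"
    "\<And>y. y \<in> carrier (res_obj X F D n) \<Longrightarrow> res_map D p n (g y) = y"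
    by (rule lhom_inj_iso[OF P(3,5,6,7)]) (assumption | rule that)+
  then have "retract R (res_obj X F D n) (F n) g (res_map D p n)" unfolding retract_def using P(6) by blast
  then have "projective R (res_obj X F D n)" by (rule projective_retract[OF P(5,1)])
  then show "projective R ((syzygy R ^^ n) X)"
    by (rule stab_projective[OF P(4) syzygy_pow_fgmod[OF X] res_obj_stab[OF X r]])
next
  assume proj: "projective R ((syzygy R ^^ n) X)"
  obtain Q c where Qc: "\<And>n. proj_cover R ((syzygy R ^^ n) X) (Q n) (c n)"
    "\<And>n. (syzygy R ^^ Suc n) X = submod (Q n) (hom_ker (Q n) ((syzygy R ^^ n) X) (c n))"
    using min_resolution[OF X] by metis
  let ?S = "(syzygy R ^^ n) X"
  have lS: "left_module R ?S" by (rule fgmodD[OF projective_fgmod[OF proj]])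
  interpret S: left_module R ?S by (rule lS)
  \<comment> \<open>The zero tail is taken inside \<open>?S\<close>, because
    \<open>proj_resolutionI\<close> asks for equality of modules: the kernel of the identity of
    \<open>?S\<close> is then \<open>?O\<close> itself.\<close>
  let ?O = "submod ?S {\<zero>\<^bsub>?S\<^esub>}"
  have lO: "left_module R ?O" by (rule left_module_submod[OF lS S.submodule_zero])
  have fO: "?O \<in> fgmod R" by (rule fg_submod[OF projective_fgmod[OF proj] S.submodule_zero])
  have zO: "zero_module ?O" by (simp add: zero_module_def)
  \<comment> \<open>The minimal resolution is cut at \<open>n\<close>: there the term is the syzygy
    itself with its identity as augmentation, followed by zero modules.\<close>
  define T where "T i = (if i \<le> n then (syzygy R ^^ i) X else ?O)" for i
  define F where "F i = (if i < n then Q i else T i)" for i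
  define d where "d i = (if i < n then c i else (\<lambda>x\<in>carrier (T i). x))" for i
  have "proj_resolution R (T 0) F (\<lambda>i. d (Suc i)) (d 0)"
  proof (rule proj_resolutionI)
    fix i
    show "projective R (F i)"
      using proj_coverD(1)[OF Qc(1)] proj projective_zero[OF fO zO] by (simp add: F_def T_def)
    show "d i \<in> mod_hom R (F i) (T i)"
    proof (cases "i < n")
      case True
      then show ?thesis using Qc(1)[of i] by (simp add: F_def T_def d_def proj_cover_def)
    next
      case False
      have "left_module R (T i)" using lS lO False by (cases "i = n") (simp_all add: T_def)
      then show ?thesis using False restrict_mod_hom[of R "T i" "\<lambda>x. x" "T i"] lhom_id by (simp add: F_def d_def)
    qed
    show "d i ` carrier (F i) = carrier (T i)"
      using proj_coverD(5)[OF Qc(1)[of i]] by (simp add: F_def T_def d_def)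
    show "T (Suc i) = submod (F i) (hom_ker (F i) (T i) (d i))"
    proof (cases "i < n")
      case True
      then show ?thesis using Qc(2)[of i] by (simp add: F_def T_def d_def)
    next
      case False
      have "hom_ker (T i) (T i) (\<lambda>x\<in>carrier (T i). x) = {\<zero>\<^bsub>?S\<^esub>}"
        using False by (cases "i = n") (auto simp: T_def hom_ker_def)
      then show ?thesis using False by (cases "i = n") (simp_all add: F_def T_def d_def)
    qed
  qed
  moreover have "T 0 = X" by (simp add: T_def)
  moreover have "zero_module (F i)" if "i > n" for i using that zO by (simp add: F_def T_def)
  ultimately show "\<exists>F D p. proj_resolution R X F D p \<and> (\<forall>i>n. zero_module (F i))" by metis
qed

lemma proj_dim_eq:
  fixes X :: "('a, 'm) module"
  assumes X: "X \<in> fgmod R"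
  shows "proj_dim R X = Inf {enat n | n. projective R ((syzygy R ^^ n) X)}"
  unfolding proj_dim_def res_length_iff[OF X] ..

end

section \<open>The functors Ext\<close>

text \<open>Every \<open>n\<close>-cocycle factors through a universal one \<open>\<pi>\<close>, and it is a coboundary if and only if the factor
  extends along \<open>\<iota>\<close>.\<close>

definition ext_data ::
  "('a, 'r) ring_scheme \<Rightarrow> nat \<Rightarrow> ('a, 'm) module \<Rightarrow> ('a, 'm) module \<Rightarrow> ('a, 'm) module \<Rightarrow> ('m \<Rightarrow> 'm) \<Rightarrow> ('m \<Rightarrow> 'm) \<Rightarrow> bool"
  where "ext_data R n X K G \<pi> \<iota> \<longleftrightarrow>
    res_term R X n \<in> fgmod R \<and> K \<in> fgmod R \<and> G \<in> fgmod R \<and> lhom R (res_term R X n) K \<pi> \<and>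
    \<pi> ` carrier (res_term R X n) = carrier K \<and> lhom R K G \<iota> \<and>
    (\<forall>N\<in>fgmod R. cocycles R n X N = {restrict (\<lambda>x. f (\<pi> x)) (carrier (res_term R X n)) | f. lhom R K N f}) \<and>
    (\<forall>N\<in>fgmod R. coboundaries R n X N =
      {restrict (\<lambda>x. g (\<iota> (\<pi> x))) (carrier (res_term R X n)) | g. lhom R G N g})"

definition ext_cls ::
  "('a, 'r) ring_scheme \<Rightarrow> nat \<Rightarrow> ('a, 'm) module \<Rightarrow> ('m \<Rightarrow> 'm) \<Rightarrow> ('a, 'm) module \<Rightarrow> ('m \<Rightarrow> 'm) \<Rightarrow> ('m \<Rightarrow> 'm) set"
  where "ext_cls R n X \<pi> N f = coboundaries R n X N #>\<^bsub>hom_group R (res_term R X n) N\<^esub>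
    restrict (\<lambda>x. f (\<pi> x)) (carrier (res_term R X n))"

section \<open>Classes of cocycles\<close>

context
  fixes R :: "('a, 'r) ring_scheme" and n and X K G :: "('a, 'm) module" and \<pi> \<iota>
  assumes E: "ext_data R n X K G \<pi> \<iota>"
begin

abbreviation (input) resn :: "'m set" where "resn \<equiv> carrier (res_term R X n)"

abbreviation (input) cls :: "('a, 'm) module \<Rightarrow> ('m \<Rightarrow> 'm) \<Rightarrow> ('m \<Rightarrow> 'm) set" where "cls \<equiv> ext_cls R n X \<pi>"

lemma ext_dataD:
  "res_term R X n \<in> fgmod R" "K \<in> fgmod R" "G \<in> fgmod R" "lhom R (res_term R X n) K \<pi>"
  "\<pi> ` resn = carrier K" "lhom R K G \<iota>"
  "N \<in> fgmod R \<Longrightarrow> cocycles R n X N = {restrict (\<lambda>x. f (\<pi> x)) resn | f. lhom R K N f}"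
  "N \<in> fgmod R \<Longrightarrow> coboundaries R n X N =
      {restrict (\<lambda>x. g (\<iota> (\<pi> x))) resn | g. lhom R G N g}"
  using E unfolding ext_data_def by blast+

lemma ext_lm: "left_module R (res_term R X n)" "left_module R K" "left_module R G"
  using ext_dataD(1-3) fgmodD by blast+

lemma ext_cls_eq:
  assumes N: "N \<in> fgmod R"
  shows "cls N f = {restrict (\<lambda>x. g (\<iota> (\<pi> x)) \<oplus>\<^bsub>N\<^esub> f (\<pi> x)) resn | g. lhom R G N g}"
proof -
  have 1: "cls N f = (\<lambda>b. \<lambda>x\<in>resn. b x \<oplus>\<^bsub>N\<^esub> (restrict (\<lambda>x. f (\<pi> x)) resn) x) ` coboundaries R n X N"
    by (auto simp: ext_cls_def r_coset_def hom_group_def)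
  have 2: "(\<lambda>x\<in>resn. restrict (\<lambda>x. g (\<iota> (\<pi> x))) resn x \<oplus>\<^bsub>N\<^esub> (restrict (\<lambda>x. f (\<pi> x)) resn) x)
      = restrict (\<lambda>x. g (\<iota> (\<pi> x)) \<oplus>\<^bsub>N\<^esub> f (\<pi> x)) resn" for g
    by (auto simp: restrict_def)
  show ?thesis
    unfolding 1 ext_dataD(8)[OF N] setcompr_eq_image image_image 2 ..
qed

lemma ext_clsI:
  assumes "N \<in> fgmod R" "lhom R G N g" "z = restrict (\<lambda>x. g (\<iota> (\<pi> x)) \<oplus>\<^bsub>N\<^esub> f (\<pi> x)) resn"
  shows "z \<in> cls N f"
  unfolding ext_cls_eq[OF assms(1)] assms(3) by (intro CollectI exI[of _ g] conjI refl assms(2))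

lemma ext_clsE:
  assumes "N \<in> fgmod R" "z \<in> cls N f"
  obtains g where "lhom R G N g" "z = restrict (\<lambda>x. g (\<iota> (\<pi> x)) \<oplus>\<^bsub>N\<^esub> f (\<pi> x)) resn"
  using assms(2) unfolding ext_cls_eq[OF assms(1)] by (elim CollectE exE conjE) (rule that)

lemma ext_surj:
  assumes "k \<in> carrier K"
  obtains x where "x \<in> resn" "k = \<pi> x"
  using assms ext_dataD(5) by blast

lemma ext_pi: "x \<in> resn \<Longrightarrow> \<pi> x \<in> carrier K"
  by (rule lhomD(1)[OF ext_dataD(4)])

lemma ext_restrict_eq:
  "restrict (\<lambda>x. f (\<pi> x)) resn = restrict (\<lambda>x. g (\<pi> x)) resn
    \<longleftrightarrow> (\<forall>k\<in>carrier K. f k = g k)"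
proof
  assume eq: "restrict (\<lambda>x. f (\<pi> x)) resn = restrict (\<lambda>x. g (\<pi> x)) resn"
  show "\<forall>k\<in>carrier K. f k = g k"
  proof
    fix k assume "k \<in> carrier K"
    then obtain x where x: "x \<in> resn" "k = \<pi> x" by (rule ext_surj)
    then show "f k = g k" using fun_cong[OF eq, of x] by simp
  qed
qed (use ext_pi in \<open>auto simp: restrict_def\<close>)

text \<open>The map \<open>c \<iota> \<pi>\<close> is a coboundary. One inclusion is shown and then
  applied a second time with \<open>-c\<close>.\<close>

lemma ext_cls_shift:
  assumes N: "N \<in> fgmod R" and f: "lhom R K N f" and c: "lhom R G N c" and eq: "\<And>k. k \<in> carrier K \<Longrightarrow> f' k = c (\<iota> k) \<oplus>\<^bsub>N\<^esub> f k"
  shows "cls N f' = cls N f"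
proof -
  interpret N: left_module R N by (rule fgmodD[OF N])
  have lN: "left_module R N" by (rule fgmodD[OF N])
  have \<iota>: "\<iota> k \<in> carrier G" if "k \<in> carrier K" for k using lhomD(1)[OF ext_dataD(6) that] .
  have sub: "cls N f' \<subseteq> cls N f"
    if f: "lhom R K N f" and c: "lhom R G N c" and eq: "\<And>k. k \<in> carrier K \<Longrightarrow> f' k = c (\<iota> k) \<oplus>\<^bsub>N\<^esub> f k" for f f' c
  proof
    fix z assume "z \<in> cls N f'"
    then obtain g where g: "lhom R G N g" "z = restrict (\<lambda>x. g (\<iota> (\<pi> x)) \<oplus>\<^bsub>N\<^esub> f' (\<pi> x)) resn"
      by (rule ext_clsE[OF N]) (rule that)
    have "z = restrict (\<lambda>x. (g (\<iota> (\<pi> x)) \<oplus>\<^bsub>N\<^esub> c (\<iota> (\<pi> x))) \<oplus>\<^bsub>N\<^esub> f (\<pi> x)) resn"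
      unfolding g(2)
    proof (rule restrict_ext)
      fix x assume "x \<in> resn"
      then have k: "\<pi> x \<in> carrier K" by (rule ext_pi)
      show "g (\<iota> (\<pi> x)) \<oplus>\<^bsub>N\<^esub> f' (\<pi> x) = (g (\<iota> (\<pi> x)) \<oplus>\<^bsub>N\<^esub> c (\<iota> (\<pi> x))) \<oplus>\<^bsub>N\<^esub> f (\<pi> x)"
        unfolding eq[OF k] using lhomD(1)[OF g(1) \<iota>[OF k]] lhomD(1)[OF c \<iota>[OF k]] lhomD(1)[OF f k]
        by (simp add: N.M.a_assoc)
    qed
    then show "z \<in> cls N f" by (rule ext_clsI[OF N lhom_add[OF lN g(1) c]])
  qed
  have f': "lhom R K N f'"
    using lhom_cong[OF ext_lm(2), of f' "\<lambda>k. c (\<iota> k) \<oplus>\<^bsub>N\<^esub> f k" N] eq lhom_add[OF lN lhom_comp[OF ext_dataD(6) c] f] by simp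
  have "f k = \<ominus>\<^bsub>N\<^esub> c (\<iota> k) \<oplus>\<^bsub>N\<^esub> f' k" if k: "k \<in> carrier K" for k
    unfolding eq[OF k] using lhomD(1)[OF c \<iota>[OF k]] lhomD(1)[OF f k] by (simp add: N.M.r_neg1)
  then have "cls N f \<subseteq> cls N f'"
    using sub[OF f' lhom_neg[OF lN c]] by blast
  then show ?thesis using sub[OF f c eq] by blast
qed

lemma ext_cls_iff:
  assumes N: "N \<in> fgmod R" and f: "lhom R K N f" "lhom R K N f'"
  shows "cls N f' = cls N f \<longleftrightarrow> (\<exists>c. lhom R G N c \<and> (\<forall>k\<in>carrier K. f' k = c (\<iota> k) \<oplus>\<^bsub>N\<^esub> f k))"
proof
  have lN: "left_module R N" by (rule fgmodD[OF N])
  interpret N: left_module R N by (rule lN)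
  assume eq: "cls N f' = cls N f"
  have "restrict (\<lambda>x. f' (\<pi> x)) resn = restrict (\<lambda>x. \<zero>\<^bsub>N\<^esub> \<oplus>\<^bsub>N\<^esub> f' (\<pi> x)) resn"
    using lhomD(1)[OF f(2) ext_pi] by (auto simp: restrict_def)
  then have "restrict (\<lambda>x. f' (\<pi> x)) resn \<in> cls N f'"
    by (rule ext_clsI[OF N lhom_zero[OF lN]])
  then obtain c where c: "lhom R G N c" "restrict (\<lambda>x. f' (\<pi> x)) resn
      = restrict (\<lambda>x. c (\<iota> (\<pi> x)) \<oplus>\<^bsub>N\<^esub> f (\<pi> x)) resn"
    unfolding eq by (rule ext_clsE[OF N]) (rule that)
  then have "\<forall>k\<in>carrier K. f' k = c (\<iota> k) \<oplus>\<^bsub>N\<^esub> f k"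
    using ext_restrict_eq[of f' "\<lambda>k. c (\<iota> k) \<oplus>\<^bsub>N\<^esub> f k"] by simp
  then show "\<exists>c. lhom R G N c \<and> (\<forall>k\<in>carrier K. f' k = c (\<iota> k) \<oplus>\<^bsub>N\<^esub> f k)" using c(1) by blast
qed (use ext_cls_shift[OF N f(1)] in blast)

lemma ext_cls_cong:
  assumes "\<And>k. k \<in> carrier K \<Longrightarrow> f k = f' k"
  shows "cls N f = cls N f'"
  unfolding ext_cls_def using ext_restrict_eq[of f f'] assms by simp

lemma Ext_carrier:
  assumes N: "N \<in> fgmod R"
  shows "carrier (Ext R n X N) = {cls N f | f. lhom R K N f}"
proof -
  have "carrier (Ext R n X N) = (\<lambda>z. coboundaries R n X N #>\<^bsub>hom_group R (res_term R X n) N\<^esub> z) ` cocycles R n X N"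
    by (auto simp: Ext_def FactGroup_def RCOSETS_def r_coset_def)
  then show ?thesis unfolding ext_dataD(7)[OF N] setcompr_eq_image image_image ext_cls_def .
qed

lemma Ext_mult:
  assumes N: "N \<in> fgmod R" and f: "lhom R K N f" "lhom R K N f'"
  shows "cls N f \<otimes>\<^bsub>Ext R n X N\<^esub> cls N f' = cls N (\<lambda>k. f k \<oplus>\<^bsub>N\<^esub> f' k)"
proof -
  have lN: "left_module R N" by (rule fgmodD[OF N])
  interpret N: left_module R N by (rule lN)
  have \<iota>: "\<iota> k \<in> carrier G" if "k \<in> carrier K" for k using lhomD(1)[OF ext_dataD(6) that] .
  have m: "cls N f \<otimes>\<^bsub>Ext R n X N\<^esub> cls N f' =
      {(\<lambda>x\<in>resn. y x \<oplus>\<^bsub>N\<^esub> z x) | y z. y \<in> cls N f \<and> z \<in> cls N f'}"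
    by (auto simp: Ext_def FactGroup_def set_mult_def hom_group_def)
  have comb: "(\<lambda>x\<in>resn. restrict (\<lambda>x. g (\<iota> (\<pi> x)) \<oplus>\<^bsub>N\<^esub> f (\<pi> x)) resn x \<oplus>\<^bsub>N\<^esub> restrict (\<lambda>x. g' (\<iota> (\<pi> x)) \<oplus>\<^bsub>N\<^esub> f' (\<pi> x)) resn x)
      = restrict (\<lambda>x. (g (\<iota> (\<pi> x)) \<oplus>\<^bsub>N\<^esub> g' (\<iota> (\<pi> x))) \<oplus>\<^bsub>N\<^esub> (f (\<pi> x) \<oplus>\<^bsub>N\<^esub> f' (\<pi> x))) resn"
    if g: "lhom R G N g" "lhom R G N g'" for g g'
  proof (rule restrict_ext)
    fix x assume x: "x \<in> resn"
    note k = ext_pi[OF x]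
    show "restrict (\<lambda>x. g (\<iota> (\<pi> x)) \<oplus>\<^bsub>N\<^esub> f (\<pi> x)) resn x \<oplus>\<^bsub>N\<^esub> restrict (\<lambda>x. g' (\<iota> (\<pi> x)) \<oplus>\<^bsub>N\<^esub> f' (\<pi> x)) resn x
        = (g (\<iota> (\<pi> x)) \<oplus>\<^bsub>N\<^esub> g' (\<iota> (\<pi> x))) \<oplus>\<^bsub>N\<^esub> (f (\<pi> x) \<oplus>\<^bsub>N\<^esub> f' (\<pi> x))"
      using x lhomD(1)[OF g(1) \<iota>[OF k]] lhomD(1)[OF g(2) \<iota>[OF k]] lhomD(1)[OF f(1) k] lhomD(1)[OF f(2) k]
      by (simp add: N.M.a_ac)
  qed
  show ?thesis
  proof (rule subset_antisym)
    show "cls N f \<otimes>\<^bsub>Ext R n X N\<^esub> cls N f' \<subseteq> cls N (\<lambda>k. f k \<oplus>\<^bsub>N\<^esub> f' k)"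
    proof
      fix w assume "w \<in> cls N f \<otimes>\<^bsub>Ext R n X N\<^esub> cls N f'"
      then obtain y z where yz: "y \<in> cls N f" "z \<in> cls N f'" "w = (\<lambda>x\<in>resn. y x \<oplus>\<^bsub>N\<^esub> z x)"
        unfolding m by blast
      obtain g where g: "lhom R G N g" "y = restrict (\<lambda>x. g (\<iota> (\<pi> x)) \<oplus>\<^bsub>N\<^esub> f (\<pi> x)) resn"
        by (rule ext_clsE[OF N yz(1)]) (rule that)
      obtain g' where g': "lhom R G N g'" "z = restrict (\<lambda>x. g' (\<iota> (\<pi> x)) \<oplus>\<^bsub>N\<^esub> f' (\<pi> x)) resn"
        by (rule ext_clsE[OF N yz(2)]) (rule that)
      show "w \<in> cls N (\<lambda>k. f k \<oplus>\<^bsub>N\<^esub> f' k)"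
        unfolding yz(3) g(2) g'(2) comb[OF g(1) g'(1)] by (rule ext_clsI[OF N lhom_add[OF lN g(1) g'(1)] refl])
    qed
    show "cls N (\<lambda>k. f k \<oplus>\<^bsub>N\<^esub> f' k) \<subseteq> cls N f \<otimes>\<^bsub>Ext R n X N\<^esub> cls N f'"
    proof
      fix w assume "w \<in> cls N (\<lambda>k. f k \<oplus>\<^bsub>N\<^esub> f' k)"
      then obtain g where g: "lhom R G N g" "w = restrict (\<lambda>x. g (\<iota> (\<pi> x)) \<oplus>\<^bsub>N\<^esub> (f (\<pi> x) \<oplus>\<^bsub>N\<^esub> f' (\<pi> x))) resn"
        by (rule ext_clsE[OF N]) (rule that)
      note z = lhom_zero[OF lN, of G]
      have "w = restrict (\<lambda>x. (g (\<iota> (\<pi> x)) \<oplus>\<^bsub>N\<^esub> \<zero>\<^bsub>N\<^esub>) \<oplus>\<^bsub>N\<^esub> (f (\<pi> x) \<oplus>\<^bsub>N\<^esub> f' (\<pi> x))) resn"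
        unfolding g(2) using lhomD(1)[OF g(1) \<iota>[OF ext_pi]] by (intro restrict_ext) simp
      then have "w = (\<lambda>x\<in>resn. restrict (\<lambda>x. g (\<iota> (\<pi> x)) \<oplus>\<^bsub>N\<^esub> f (\<pi> x)) resn x \<oplus>\<^bsub>N\<^esub> restrict (\<lambda>x. \<zero>\<^bsub>N\<^esub> \<oplus>\<^bsub>N\<^esub> f' (\<pi> x)) resn x)"
        using comb[OF g(1) z] by simp
      moreover have "restrict (\<lambda>x. g (\<iota> (\<pi> x)) \<oplus>\<^bsub>N\<^esub> f (\<pi> x)) resn \<in> cls N f"
        by (rule ext_clsI[OF N g(1) refl])
      moreover have "restrict (\<lambda>x. \<zero>\<^bsub>N\<^esub> \<oplus>\<^bsub>N\<^esub> f' (\<pi> x)) resn \<in> cls N f'"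
        by (rule ext_clsI[OF N z refl])
      ultimately show "w \<in> cls N f \<otimes>\<^bsub>Ext R n X N\<^esub> cls N f'" unfolding m by blast
    qed
  qed
qed

text \<open>Every representative of the class is sent into the same coset, which is what
  \<open>the_elem\<close> in \<open>Ext_map\<close> requires.\<close>

lemma Ext_map_cls:
  assumes N: "N \<in> fgmod R" "N' \<in> fgmod R" and f: "lhom R K N f" and h: "lhom R N N' h"
  shows "Ext_map R n X N N' h (cls N f) = cls N' (\<lambda>k. h (f k))"
proof -
  have lN: "left_module R N" "left_module R N'" using fgmodD N by blast+
  have \<iota>: "\<iota> k \<in> carrier G" if "k \<in> carrier K" for k using lhomD(1)[OF ext_dataD(6) that] .
  have one: "coboundaries R n X N' #>\<^bsub>hom_group R (res_term R X n) N'\<^esub> compose resn h z = cls N' (\<lambda>k. h (f k))"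
    if zE: "z \<in> cls N f" for z
  proof -
    obtain g where g: "lhom R G N g" "z = restrict (\<lambda>x. g (\<iota> (\<pi> x)) \<oplus>\<^bsub>N\<^esub> f (\<pi> x)) resn"
      by (rule ext_clsE[OF N(1) zE]) (rule that)
    have "compose resn h z = restrict (\<lambda>x. h (g (\<iota> (\<pi> x))) \<oplus>\<^bsub>N'\<^esub> h (f (\<pi> x))) resn"
      unfolding g(2) compose_def
      using lhomD(2)[OF h lhomD(1)[OF g(1) \<iota>[OF ext_pi]] lhomD(1)[OF f ext_pi]] by (intro restrict_ext) simp
    then have "coboundaries R n X N' #>\<^bsub>hom_group R (res_term R X n) N'\<^esub> compose resn h z
        = cls N' (\<lambda>k. h (g (\<iota> k)) \<oplus>\<^bsub>N'\<^esub> h (f k))"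
      by (simp add: ext_cls_def)
    also have "\<dots> = cls N' (\<lambda>k. h (f k))"
      by (rule ext_cls_shift[OF N(2) lhom_comp[OF f h] lhom_comp[OF g(1) h]]) simp
    finally show ?thesis .
  qed
  have "cls N f \<noteq> {}" using ext_clsI[OF N(1) lhom_zero[OF lN(1)] refl] by blast
  then have "(\<lambda>z. coboundaries R n X N' #>\<^bsub>hom_group R (res_term R X n) N'\<^esub> compose resn h z) ` cls N f
      = {cls N' (\<lambda>k. h (f k))}"
    using one by force
  then show ?thesis unfolding Ext_map_def by simp
qed

end

text \<open>Because \<open>\<iota> u = g \<iota>'\<close>, a map that extends along
  \<open>\<iota>\<close> is pulled back by \<open>u\<close> to one that extends along
  \<open>\<iota>'\<close>.\<close>

lemma ext_cls_pull:
  fixes R :: "('a, 'r) ring_scheme" and X Z K G K' G' N :: "('a, 'm) module"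
  assumes E: "ext_data R n X K G \<pi> \<iota>" and E': "ext_data R n Z K' G' \<pi>' \<iota>'"
    and u: "lhom R K' K u" and g: "lhom R G' G g" and gu: "\<forall>y\<in>carrier K'. \<iota> (u y) = g (\<iota>' y)"
    and N: "N \<in> fgmod R" and f: "lhom R K N f" "lhom R K N f'" and eq: "ext_cls R n X \<pi> N f = ext_cls R n X \<pi> N f'"
  shows "ext_cls R n Z \<pi>' N (\<lambda>y. f (u y)) = ext_cls R n Z \<pi>' N (\<lambda>y. f' (u y))"
proof -
  obtain d where d: "lhom R G N d" "\<forall>k\<in>carrier K. f k = d (\<iota> k) \<oplus>\<^bsub>N\<^esub> f' k" using ext_cls_iff[OF E N f(2,1)] eq by blast
  show ?thesis
    by (rule ext_cls_shift[OF E' N lhom_comp[OF u f(2)] lhom_comp[OF g d(1)]]) (use d(2) gu lhomD(1)[OF u] in simp)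
qed

text \<open>\<open>f\<close> and \<open>f u u'\<close> differ by \<open>f c \<iota>\<close>, which
  extends along \<open>\<iota>\<close>.\<close>

lemma ext_cls_homotopic:
  fixes R :: "('a, 'r) ring_scheme" and X K G K' N :: "('a, 'm) module"
  assumes E: "ext_data R n X K G \<pi> \<iota>" and u: "lhom R K' K u" "lhom R K K' u'" and c: "lhom R G K c"
    and uu: "\<forall>x\<in>carrier K. x = u (u' x) \<oplus>\<^bsub>K\<^esub> c (\<iota> x)" and N: "N \<in> fgmod R" and f: "lhom R K N f"
  shows "ext_cls R n X \<pi> N (\<lambda>x. f (u (u' x))) = ext_cls R n X \<pi> N f"
proof (rule sym, rule ext_cls_shift[OF E N lhom_comp[OF lhom_comp[OF u(2,1)] f] lhom_comp[OF c f]])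
  interpret N: left_module R N by (rule fgmodD[OF N])
  fix x assume x: "x \<in> carrier K"
  have a: "u (u' x) \<in> carrier K" "c (\<iota> x) \<in> carrier K"
    using lhomD(1)[OF lhom_comp[OF u(2,1)] x] lhomD(1)[OF c lhomD(1)[OF ext_dataD(6)[OF E] x]] .
  have "f x = f (u (u' x) \<oplus>\<^bsub>K\<^esub> c (\<iota> x))" using uu x by simp
  then show "f x = f (c (\<iota> x)) \<oplus>\<^bsub>N\<^esub> f (u (u' x))"
    using lhomD(2)[OF f a] N.M.a_comm[OF lhomD(1)[OF f a(1)] lhomD(1)[OF f a(2)]] by simp
qed

text \<open>A Yoneda argument: the image under \<eta> of the class of the identity of
  \<open>K\<close> gives \<open>u\<close>, and a preimage of the class of the identity of
  \<open>K'\<close> gives \<open>u'\<close>. That the classes of \<open>\<iota>\<close> and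
  \<open>\<iota>'\<close> vanish at \<open>G\<close> and \<open>G'\<close> yields \<open>g\<close>
  and \<open>g'\<close>.\<close>

lemma ext_iff_pair_eq:
  fixes R :: "('a, 'r) ring_scheme" and X Z K G K' G' :: "('a, 'm) module"
  assumes E: "ext_data R n X K G \<pi> \<iota>" and E': "ext_data R n Z K' G' \<pi>' \<iota>'"
  shows "Ext_nat_iso R n X Z \<longleftrightarrow> pair_eq R K G \<iota> K' G' \<iota>'"
proof
  note D = ext_dataD[OF E] and D' = ext_dataD[OF E'] and l = ext_lm[OF E] and l' = ext_lm[OF E']
  interpret K: left_module R K by (rule l)
  interpret G: left_module R G by (rule l)
  interpret K': left_module R K' by (rule l')
  interpret G': left_module R G' by (rule l')
  let ?E = "ext_cls R n X \<pi>" and ?E' = "ext_cls R n Z \<pi>'"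
  assume "Ext_nat_iso R n X Z"
  then obtain \<eta> where \<eta>: "\<And>N. N \<in> fgmod R \<Longrightarrow> \<eta> N \<in> iso (Ext R n X N) (Ext R n Z N)"
    and nat: "\<And>N N' h c. \<lbrakk>N \<in> fgmod R; N' \<in> fgmod R; h \<in> mod_hom R N N'; c \<in> carrier (Ext R n X N)\<rbrakk>
      \<Longrightarrow> \<eta> N' (Ext_map R n X N N' h c) = Ext_map R n Z N N' h (\<eta> N c)"
    unfolding Ext_nat_iso_def by blast
  have bij: "bij_betw (\<eta> N) (carrier (Ext R n X N)) (carrier (Ext R n Z N))" if "N \<in> fgmod R" for N
    using \<eta>[OF that] by (simp add: iso_def)
  have cid: "?E K (\<lambda>x. x) \<in> carrier (Ext R n X K)" unfolding Ext_carrier[OF E D(2)] using lhom_id by blast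
  have "\<eta> K (?E K (\<lambda>x. x)) \<in> carrier (Ext R n Z K)" using bij_betwE[OF bij[OF D(2)]] cid by blast
  then obtain u where u: "lhom R K' K u" "\<eta> K (?E K (\<lambda>x. x)) = ?E' K u" unfolding Ext_carrier[OF E' D(2)] by blast
  \<comment> \<open>By naturality \<eta> is determined by its value at the class of the identity of
    \<open>K\<close>: it is composition with \<open>u\<close>.\<close>
  have \<eta>E: "\<eta> N (?E N f) = ?E' N (\<lambda>y. f (u y))" if N: "N \<in> fgmod R" and f: "lhom R K N f" for N f
  proof -
    let ?h = "restrict f (carrier K)"
    have h: "?h \<in> mod_hom R K N" "lhom R K N ?h" using restrict_mod_hom[OF l(2)] lhom_restrict_iff[OF l(2)] f by blast+
    have "Ext_map R n X K N ?h (?E K (\<lambda>x. x)) = ?E N ?h" using Ext_map_cls[OF E D(2) N lhom_id h(2)] .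
    also have "\<dots> = ?E N f" by (rule ext_cls_cong[OF E]) simp
    finally have 1: "Ext_map R n X K N ?h (?E K (\<lambda>x. x)) = ?E N f" .
    have "Ext_map R n Z K N ?h (?E' K u) = ?E' N (\<lambda>y. ?h (u y))" using Ext_map_cls[OF E' D(2) N u(1) h(2)] .
    also have "\<dots> = ?E' N (\<lambda>y. f (u y))" by (rule ext_cls_cong[OF E']) (simp add: lhomD(1)[OF u(1)])
    finally show ?thesis using nat[OF D(2) N h(1) cid] 1 u(2) by simp
  qed
  have inj: "?E N f = ?E N f'" if "N \<in> fgmod R" "lhom R K N f" "lhom R K N f'" "?E' N (\<lambda>y. f (u y)) = ?E' N (\<lambda>y. f' (u y))" for N f f'
  proof -
    have "?E N f \<in> carrier (Ext R n X N)" "?E N f' \<in> carrier (Ext R n X N)"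
      unfolding Ext_carrier[OF E that(1)] using that(2,3) by blast+
    then show ?thesis
      using inj_onD[OF bij_betw_imp_inj_on[OF bij[OF that(1)]]] \<eta>E[OF that(1,2)] \<eta>E[OF that(1,3)] that(4) by simp
  qed
  have "?E' K' (\<lambda>y. y) \<in> carrier (Ext R n Z K')" unfolding Ext_carrier[OF E' D'(2)] using lhom_id by blast
  then have "?E' K' (\<lambda>y. y) \<in> \<eta> K' ` carrier (Ext R n X K')" using bij[OF D'(2)] by (simp add: bij_betw_def)
  then obtain u' where u': "lhom R K K' u'" "\<eta> K' (?E K' u') = ?E' K' (\<lambda>y. y)" unfolding Ext_carrier[OF E D'(2)] by force
  have uu: "lhom R K' K' (\<lambda>y. u' (u y))" "lhom R K K (\<lambda>x. u (u' x))"
    by (rule lhom_comp[OF u(1) u'(1)], rule lhom_comp[OF u'(1) u(1)])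
  have "?E' K' (\<lambda>y. y) = ?E' K' (\<lambda>y. u' (u y))" using \<eta>E[OF D'(2) u'(1)] u'(2) by simp
  then obtain c' where c': "lhom R G' K' c'" "\<forall>y\<in>carrier K'. y = c' (\<iota>' y) \<oplus>\<^bsub>K'\<^esub> u' (u y)"
    using ext_cls_iff[OF E' D'(2) uu(1) lhom_id] by blast
  have c'': "y = u' (u y) \<oplus>\<^bsub>K'\<^esub> c' (\<iota>' y)" if y: "y \<in> carrier K'" for y
  proof -
    have "c' (\<iota>' y) \<in> carrier K'" "u' (u y) \<in> carrier K'"
      using lhomD(1)[OF c'(1) lhomD(1)[OF D'(6) y]] lhomD(1)[OF uu(1) y] .
    then show ?thesis using c'(2) y K'.M.a_comm by metis
  qed
  \<comment> \<open>Injectivity of \<eta> turns the homotopy for \<open>u' u\<close> into one for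
    \<open>u u'\<close>.\<close>
  have "?E' K (\<lambda>y. u (u' (u y))) = ?E' K u"
  proof (rule sym, rule ext_cls_shift[OF E' D(2) lhom_comp[OF u(1) uu(2)] lhom_comp[OF c'(1) u(1)]])
    fix y assume y: "y \<in> carrier K'"
    have "u y = u (c' (\<iota>' y) \<oplus>\<^bsub>K'\<^esub> u' (u y))" using c'(2) y by simp
    then show "u y = u (c' (\<iota>' y)) \<oplus>\<^bsub>K\<^esub> u (u' (u y))"
      using lhomD(2)[OF u(1) lhomD(1)[OF c'(1) lhomD(1)[OF D'(6) y]] lhomD(1)[OF uu(1) y]] by simp
  qed
  then have "?E K (\<lambda>x. x) = ?E K (\<lambda>x. u (u' x))" using inj[OF D(2) lhom_id uu(2)] by simp
  then obtain c where c: "lhom R G K c" "\<forall>x\<in>carrier K. x = c (\<iota> x) \<oplus>\<^bsub>K\<^esub> u (u' x)"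
    using ext_cls_iff[OF E D(2) uu(2) lhom_id] by blast
  have cc: "x = u (u' x) \<oplus>\<^bsub>K\<^esub> c (\<iota> x)" if x: "x \<in> carrier K" for x
  proof -
    have "c (\<iota> x) \<in> carrier K" "u (u' x) \<in> carrier K"
      using lhomD(1)[OF c(1) lhomD(1)[OF D(6) x]] lhomD(1)[OF uu(2) x] .
    then show ?thesis using c(2) x K.M.a_comm by metis
  qed
  have z: "lhom R K G (\<lambda>x. \<zero>\<^bsub>G\<^esub>)" "lhom R K G' (\<lambda>x. \<zero>\<^bsub>G'\<^esub>)" by (rule lhom_zero[OF l(3)], rule lhom_zero[OF l'(3)])
  have z': "lhom R K' G (\<lambda>x. \<zero>\<^bsub>G\<^esub>)" "lhom R K' G' (\<lambda>x. \<zero>\<^bsub>G'\<^esub>)" by (rule lhom_zero[OF l(3)], rule lhom_zero[OF l'(3)])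
  \<comment> \<open>The class of \<open>\<iota>\<close> at \<open>G\<close> is zero since
    \<open>\<iota>\<close> extends along itself; hence \<open>\<iota> u\<close> extends along
    \<open>\<iota>'\<close>, which yields \<open>g\<close>.\<close>
  have "?E G \<iota> = ?E G (\<lambda>x. \<zero>\<^bsub>G\<^esub>)"
    by (rule ext_cls_shift[OF E D(3) z(1) lhom_id]) (simp add: lhomD(1)[OF D(6)])
  then have "?E' G (\<lambda>y. \<iota> (u y)) = ?E' G (\<lambda>y. \<zero>\<^bsub>G\<^esub>)" using \<eta>E[OF D(3) D(6)] \<eta>E[OF D(3) z(1)] by simp
  then obtain g where g: "lhom R G' G g" "\<forall>y\<in>carrier K'. \<iota> (u y) = g (\<iota>' y) \<oplus>\<^bsub>G\<^esub> \<zero>\<^bsub>G\<^esub>"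
    using ext_cls_iff[OF E' D(3) z'(1) lhom_comp[OF u(1) D(6)]] by blast
  have gg: "\<iota> (u y) = g (\<iota>' y)" if "y \<in> carrier K'" for y
    using g(2) that lhomD(1)[OF g(1) lhomD(1)[OF D'(6) that]] by simp
  \<comment> \<open>\<open>\<iota>' u' u = \<iota>' - \<iota>' c' \<iota>'\<close> extends along
    \<open>\<iota>'\<close>, so its class is zero; injectivity of \<eta> carries this back to
    \<open>\<iota>' u'\<close> and yields \<open>g'\<close>.\<close>
  have "?E' G' (\<lambda>y. \<iota>' (u' (u y))) = ?E' G' (\<lambda>y. \<zero>\<^bsub>G'\<^esub>)"
  proof (rule ext_cls_shift[OF E' D'(3) z'(2) lhom_diff[OF l'(3) lhom_id lhom_comp[OF c'(1) D'(6)]]])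
    fix y assume y: "y \<in> carrier K'"
    have a: "u' (u y) \<in> carrier K'" "c' (\<iota>' y) \<in> carrier K'"
      using lhomD(1)[OF uu(1) y] lhomD(1)[OF c'(1) lhomD(1)[OF D'(6) y]] .
    have b: "\<iota>' (u' (u y)) \<in> carrier G'" "\<iota>' (c' (\<iota>' y)) \<in> carrier G'" using lhomD(1)[OF D'(6)] a by blast+
    have "\<iota>' y = \<iota>' (u' (u y)) \<oplus>\<^bsub>G'\<^esub> \<iota>' (c' (\<iota>' y))" using lhomD(2)[OF D'(6) a] c''[OF y] by simp
    then have "\<iota>' y \<ominus>\<^bsub>G'\<^esub> \<iota>' (c' (\<iota>' y)) = \<iota>' (u' (u y))" using G'.add_minus_self[OF b] by simp
    then show "\<iota>' (u' (u y)) = (\<iota>' y \<ominus>\<^bsub>G'\<^esub> \<iota>' (c' (\<iota>' y))) \<oplus>\<^bsub>G'\<^esub> \<zero>\<^bsub>G'\<^esub>" using b by simp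
  qed
  then have "?E G' (\<lambda>x. \<iota>' (u' x)) = ?E G' (\<lambda>x. \<zero>\<^bsub>G'\<^esub>)" using inj[OF D'(3) lhom_comp[OF u'(1) D'(6)] z(2)] by simp
  then obtain g' where g': "lhom R G G' g'" "\<forall>x\<in>carrier K. \<iota>' (u' x) = g' (\<iota> x) \<oplus>\<^bsub>G'\<^esub> \<zero>\<^bsub>G'\<^esub>"
    using ext_cls_iff[OF E D'(3) z(2) lhom_comp[OF u'(1) D'(6)]] by blast
  have gg': "\<iota>' (u' x) = g' (\<iota> x)" if "x \<in> carrier K" for x
    using g'(2) that lhomD(1)[OF g'(1) lhomD(1)[OF D(6) that]] by simp
  show "pair_eq R K G \<iota> K' G' \<iota>'"
    unfolding pair_eq_def using u(1) u'(1) g(1) g'(1) c(1) c'(1) gg gg' cc c'' by blast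
next
  note D = ext_dataD[OF E] and D' = ext_dataD[OF E'] and l = ext_lm[OF E] and l' = ext_lm[OF E']
  interpret K: left_module R K by (rule l)
  interpret K': left_module R K' by (rule l')
  let ?E = "ext_cls R n X \<pi>" and ?E' = "ext_cls R n Z \<pi>'"
  assume "pair_eq R K G \<iota> K' G' \<iota>'"
  then obtain u u' g g' c c' where u: "lhom R K' K u" "lhom R K K' u'" and g: "lhom R G' G g" "lhom R G G' g'"
    and c: "lhom R G K c" "lhom R G' K' c'"
    and gu: "\<forall>y\<in>carrier K'. \<iota> (u y) = g (\<iota>' y)" "\<forall>x\<in>carrier K. \<iota>' (u' x) = g' (\<iota> x)"
    and uu: "\<forall>x\<in>carrier K. x = u (u' x) \<oplus>\<^bsub>K\<^esub> c (\<iota> x)" "\<forall>y\<in>carrier K'. y = u' (u y) \<oplus>\<^bsub>K'\<^esub> c' (\<iota>' y)"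
    unfolding pair_eq_def by (elim exE conjE) (rule that)
  note shift = ext_cls_pull[OF E E' u(1) g(1) gu(1)] and shift' = ext_cls_pull[OF E' E u(2) g(2) gu(2)]
  note bk = ext_cls_homotopic[OF E u c(1) uu(1)] and bk' = ext_cls_homotopic[OF E' u(2,1) c(2) uu(2)]
  \<comment> \<open>A representative of the class is chosen; \<open>shift\<close> makes the result
    independent of it, as the next fact records.\<close>
  define \<eta> where "\<eta> N z = ?E' N (\<lambda>y. (SOME f. lhom R K N f \<and> ?E N f = z) (u y))" for N z
  have \<eta>: "\<eta> N (?E N f) = ?E' N (\<lambda>y. f (u y))" if N: "N \<in> fgmod R" and f: "lhom R K N f" for N f
  proof -
    have "lhom R K N (SOME f'. lhom R K N f' \<and> ?E N f' = ?E N f) \<and> ?E N (SOME f'. lhom R K N f' \<and> ?E N f' = ?E N f) = ?E N f"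
      using someI[of "\<lambda>f'. lhom R K N f' \<and> ?E N f' = ?E N f" f] f by blast
    then show ?thesis unfolding \<eta>_def using shift[OF N _ f] by blast
  qed
  have "\<eta> N \<in> iso (Ext R n X N) (Ext R n Z N)" if N: "N \<in> fgmod R" for N
  proof -
    have lN: "left_module R N" by (rule fgmodD[OF N])
    note car = Ext_carrier[OF E N] and car' = Ext_carrier[OF E' N]
    have "\<eta> N \<in> hom (Ext R n X N) (Ext R n Z N)"
    proof (rule homI)
      show "\<eta> N z \<in> carrier (Ext R n Z N)" if z: "z \<in> carrier (Ext R n X N)" for z
      proof -
        obtain f where "lhom R K N f" "z = ?E N f" using z unfolding car by blast
        then show ?thesis unfolding car' using \<eta>[OF N] lhom_comp[OF u(1)] by blast
      qed
      fix z w assume "z \<in> carrier (Ext R n X N)" "w \<in> carrier (Ext R n X N)"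
      then obtain f f' where f: "lhom R K N f" "z = ?E N f" "lhom R K N f'" "w = ?E N f'" unfolding car by blast
      show "\<eta> N (z \<otimes>\<^bsub>Ext R n X N\<^esub> w) = \<eta> N z \<otimes>\<^bsub>Ext R n Z N\<^esub> \<eta> N w"
        unfolding f(2,4) Ext_mult[OF E N f(1,3)] \<eta>[OF N f(1)] \<eta>[OF N f(3)] \<eta>[OF N lhom_add[OF lN f(1,3)]]
          Ext_mult[OF E' N lhom_comp[OF u(1) f(1)] lhom_comp[OF u(1) f(3)]] ..
    qed
    moreover have "bij_betw (\<eta> N) (carrier (Ext R n X N)) (carrier (Ext R n Z N))"
      unfolding bij_betw_def
    proof
      show "inj_on (\<eta> N) (carrier (Ext R n X N))"
      proof (rule inj_onI)
        fix z w assume zw: "z \<in> carrier (Ext R n X N)" "w \<in> carrier (Ext R n X N)" "\<eta> N z = \<eta> N w"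
        then obtain f f' where f: "lhom R K N f" "z = ?E N f" "lhom R K N f'" "w = ?E N f'" unfolding car by blast
        have "?E' N (\<lambda>y. f (u y)) = ?E' N (\<lambda>y. f' (u y))" using zw(3) unfolding f(2,4) \<eta>[OF N f(1)] \<eta>[OF N f(3)] .
        then have "?E N (\<lambda>x. f (u (u' x))) = ?E N (\<lambda>x. f' (u (u' x)))"
          using shift'[OF N lhom_comp[OF u(1) f(1)] lhom_comp[OF u(1) f(3)]] by blast
        then show "z = w" unfolding f(2,4) bk[OF N f(1)] bk[OF N f(3)] .
      qed
      show "\<eta> N ` carrier (Ext R n X N) = carrier (Ext R n Z N)"
      proof
        show "\<eta> N ` carrier (Ext R n X N) \<subseteq> carrier (Ext R n Z N)"
          using hom_carrier[OF calculation] by blast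
        show "carrier (Ext R n Z N) \<subseteq> \<eta> N ` carrier (Ext R n X N)"
        proof
          fix z assume "z \<in> carrier (Ext R n Z N)"
          then obtain f where f: "lhom R K' N f" "z = ?E' N f" unfolding car' by blast
          have "\<eta> N (?E N (\<lambda>x. f (u' x))) = z" using \<eta>[OF N lhom_comp[OF u(2) f(1)]] bk'[OF N f(1)] f(2) by simp
          moreover have "?E N (\<lambda>x. f (u' x)) \<in> carrier (Ext R n X N)" unfolding car using lhom_comp[OF u(2) f(1)] by blast
          ultimately show "z \<in> \<eta> N ` carrier (Ext R n X N)" by blast
        qed
      qed
    qed
    ultimately show ?thesis by (simp add: iso_def)
  qed
  moreover have "\<eta> N' (Ext_map R n X N N' h z) = Ext_map R n Z N N' h (\<eta> N z)"
    if N: "N \<in> fgmod R" "N' \<in> fgmod R" and h: "h \<in> mod_hom R N N'" and z: "z \<in> carrier (Ext R n X N)" for N N' h z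
  proof -
    have h': "lhom R N N' h" using h by (simp add: mod_hom_iff)
    obtain f where f: "lhom R K N f" "z = ?E N f" using z unfolding Ext_carrier[OF E N(1)] by blast
    show ?thesis
      unfolding f(2) Ext_map_cls[OF E N f(1) h'] \<eta>[OF N(1) f(1)] \<eta>[OF N(2) lhom_comp[OF f(1) h']]
        Ext_map_cls[OF E' N lhom_comp[OF u(1) f(1)] h'] ..
  qed
  ultimately show "Ext_nat_iso R n X Z" unfolding Ext_nat_iso_def by (intro exI[of _ \<eta>]) blast
qed

text \<open>The map \<open>e = 1 - g g' - c\<close> vanishes on \<open>K\<close>, so it factors as
  \<open>s q\<close>. Since \<open>q c = 0\<close>, this gives \<open>q s = 1 - f' f\<close> on
  \<open>A\<close>: the defect passes through \<open>Q\<close>.\<close>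

lemma pair_eq_stab_half:
  fixes A B Q Q' :: "('a, 'm) module"
  assumes AB: "A \<in> fgmod R" "B \<in> fgmod R"
    and Q: "projective R Q" "lhom R Q A q" "q ` carrier Q = carrier A"
    and Q': "projective R Q'" "lhom R Q' B q'" "q' ` carrier Q' = carrier B"
    and K: "K = hom_ker Q A q" "K' = hom_ker Q' B q'"
    and u: "lhom R (submod Q K) (submod Q' K') u'" and c: "lhom R Q (submod Q K) c" and g: "lhom R Q Q' g'" "lhom R Q' Q g"
    and gu: "\<forall>x\<in>K. u' x = g' x" "\<forall>y\<in>K'. u y = g y"
    and uu: "\<forall>x\<in>K. x = u (u' x) \<oplus>\<^bsub>Q\<^esub> c x"
    and f: "lhom R A B f" "\<And>x. x \<in> carrier Q \<Longrightarrow> f (q x) = q' (g' x)"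
    and f': "lhom R B A f'" "\<And>y. y \<in> carrier Q' \<Longrightarrow> f' (q' y) = q (g y)"
  obtains h where "pnull R A A h" "\<forall>a\<in>carrier A. a = f' (f a) \<oplus>\<^bsub>A\<^esub> h a"
proof -
  note fQ = projective_fgmod[OF Q(1)] projective_fgmod[OF Q'(1)]
  note l = fgmodD[OF fQ(1)] fgmodD[OF fQ(2)] fgmodD[OF AB(1)] fgmodD[OF AB(2)]
  interpret Q: left_module R Q by (rule l)
  interpret A: left_module R A by (rule l)
  have KQ: "K \<subseteq> carrier Q" by (auto simp: K hom_ker_def)
  have cQ: "lhom R Q Q c" by (rule lhom_submodD[OF c KQ])
  have gg: "lhom R Q Q (\<lambda>x. g (g' x))" by (rule lhom_comp[OF g])
  have s0: "lhom R Q Q (\<lambda>x. g (g' x) \<oplus>\<^bsub>Q\<^esub> c x)" by (rule lhom_add[OF l(1) gg cQ])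
  define e where "e x = x \<ominus>\<^bsub>Q\<^esub> (g (g' x) \<oplus>\<^bsub>Q\<^esub> c x)" for x
  have e: "lhom R Q Q e" unfolding e_def by (rule lhom_diff[OF l(1) lhom_id s0])
  have "e x = \<zero>\<^bsub>Q\<^esub>" if x: "x \<in> carrier Q" "q x = \<zero>\<^bsub>A\<^esub>" for x
  proof -
    have xK: "x \<in> K" using x by (simp add: K hom_ker_def)
    have "u' x \<in> K'" using lhomD(1)[OF u, of x] xK by simp
    then have "g (g' x) \<oplus>\<^bsub>Q\<^esub> c x = x" using gu uu xK by metis
    then show ?thesis unfolding e_def using Q.minus_self[OF x(1)] by simp
  qed
  then obtain s where s: "lhom R A Q s" "\<And>x. x \<in> carrier Q \<Longrightarrow> s (q x) = e x"
    by (rule lhom_factor[OF l(1,3,1) Q(2,3) e]) (assumption | rule that)+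
  have "a = f' (f a) \<oplus>\<^bsub>A\<^esub> q (s a)" if a: "a \<in> carrier A" for a
  proof -
    obtain x where x: "x \<in> carrier Q" "a = q x" using a Q(3) by blast
    have fa: "f' (f a) = q (g (g' x))" using x f(2) f'(2)[OF lhomD(1)[OF g(1) x(1)]] by simp
    have "q (c x) = \<zero>\<^bsub>A\<^esub>" using lhomD(1)[OF c x(1)] by (simp add: K hom_ker_def)
    then have "q (g (g' x) \<oplus>\<^bsub>Q\<^esub> c x) = f' (f a)"
      using lhomD(2)[OF Q(2) lhomD(1)[OF gg x(1)] lhomD(1)[OF cQ x(1)]] fa lhomD(1)[OF Q(2) lhomD(1)[OF gg x(1)]] by simp
    then have "q (s a) = a \<ominus>\<^bsub>A\<^esub> f' (f a)"
      unfolding x(2) s(2)[OF x(1)] e_def using lhomZ(3)[OF Q(2) l(1,3) x(1) lhomD(1)[OF s0 x(1)]] by simp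
    moreover have "f' (f a) \<in> carrier A" using lhomD(1)[OF lhom_comp[OF f(1) f'(1)] a] .
    ultimately show ?thesis using A.add_minus_cancel[OF a] by simp
  qed
  moreover have "pnull R A A (\<lambda>a. q (s a))" by (rule pnullI[OF Q(1) s(1) Q(2)]) (rule refl)
  ultimately show ?thesis using that by blast
qed

text \<open>The maps \<open>g\<close>, \<open>g'\<close> carry kernels into kernels because they
  restrict to \<open>u\<close>, \<open>u'\<close>, so they induce maps between the cokernels
  \<open>A\<close> and \<open>B\<close>.\<close>

lemma pair_eq_stab:
  fixes A B Q Q' :: "('a, 'm) module"
  assumes AB: "A \<in> fgmod R" "B \<in> fgmod R"
    and Q: "projective R Q" "lhom R Q A q" "q ` carrier Q = carrier A"
    and Q': "projective R Q'" "lhom R Q' B q'" "q' ` carrier Q' = carrier B"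
  shows "pair_eq R (submod Q (hom_ker Q A q)) Q (\<lambda>x. x) (submod Q' (hom_ker Q' B q')) Q' (\<lambda>x. x) \<longleftrightarrow> stab R A B"
proof
  let ?K = "hom_ker Q A q" and ?K' = "hom_ker Q' B q'"
  assume "pair_eq R (submod Q ?K) Q (\<lambda>x. x) (submod Q' ?K') Q' (\<lambda>x. x)"
  then obtain u u' g g' c c' where u: "lhom R (submod Q' ?K') (submod Q ?K) u" "lhom R (submod Q ?K) (submod Q' ?K') u'"
    and g: "lhom R Q' Q g" "lhom R Q Q' g'" and c: "lhom R Q (submod Q ?K) c" "lhom R Q' (submod Q' ?K') c'"
    and gu: "\<forall>y\<in>carrier (submod Q' ?K'). u y = g y" "\<forall>x\<in>carrier (submod Q ?K). u' x = g' x"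
    and uu: "\<forall>x\<in>carrier (submod Q ?K). x = u (u' x) \<oplus>\<^bsub>submod Q ?K\<^esub> c x"
      "\<forall>y\<in>carrier (submod Q' ?K'). y = u' (u y) \<oplus>\<^bsub>submod Q' ?K'\<^esub> c' y"
    unfolding pair_eq_def by (elim exE conjE) (rule that)
  note gu = gu[unfolded submod_simps] and uu = uu[unfolded submod_simps]
  note fQ = projective_fgmod[OF Q(1)] projective_fgmod[OF Q'(1)]
  note l = fgmodD[OF fQ(1)] fgmodD[OF fQ(2)] fgmodD[OF AB(1)] fgmodD[OF AB(2)]
  have "q' (g' x) = \<zero>\<^bsub>B\<^esub>" if "x \<in> carrier Q" "q x = \<zero>\<^bsub>A\<^esub>" for x
  proof -
    have "x \<in> ?K" using that by (simp add: hom_ker_def)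
    then have "g' x \<in> ?K'" using lhomD(1)[OF u(2), of x] gu(2) by simp
    then show ?thesis by (simp add: hom_ker_def)
  qed
  then obtain f where f: "lhom R A B f" "\<And>x. x \<in> carrier Q \<Longrightarrow> f (q x) = q' (g' x)"
    by (rule lhom_factor[OF l(1,3,4) Q(2,3) lhom_comp[OF g(2) Q'(2)]]) (assumption | rule that)+
  have "q (g y) = \<zero>\<^bsub>A\<^esub>" if "y \<in> carrier Q'" "q' y = \<zero>\<^bsub>B\<^esub>" for y
  proof -
    have "y \<in> ?K'" using that by (simp add: hom_ker_def)
    then have "g y \<in> ?K" using lhomD(1)[OF u(1), of y] gu(1) by simp
    then show ?thesis by (simp add: hom_ker_def)
  qed
  then obtain f' where f': "lhom R B A f'" "\<And>x. x \<in> carrier Q' \<Longrightarrow> f' (q' x) = q (g x)"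
    by (rule lhom_factor[OF l(2,4,3) Q'(2,3) lhom_comp[OF g(1) Q(2)]]) (assumption | rule that)+
  obtain h where h: "pnull R A A h" "\<forall>a\<in>carrier A. a = f' (f a) \<oplus>\<^bsub>A\<^esub> h a"
    by (rule pair_eq_stab_half[OF AB Q Q' refl refl u(2) c(1) g(2,1) gu(2,1) uu(1) f f']) (assumption | rule that)+
  obtain k where k: "pnull R B B k" "\<forall>b\<in>carrier B. b = f (f' b) \<oplus>\<^bsub>B\<^esub> k b"
    by (rule pair_eq_stab_half[OF AB(2,1) Q' Q refl refl u(1) c(2) g(1,2) gu(1,2) uu(2) f' f]) (assumption | rule that)+
  show "stab R A B" unfolding stab_def using f(1) f'(1) h k by blast
qed (rule stab_pair_eq[OF AB _ Q Q'])

section \<open>Ext in terms of syzygies\<close>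

context good_ring
begin

lemma some_resolution:
  fixes X :: "('a, 'm) module"
  assumes X: "X \<in> fgmod R"
  obtains p where "proj_resolution R X (res_term R X) (res_diff R X) p"
proof -
  obtain Q c where "proj_resolution R X Q (\<lambda>n. c (Suc n)) (c 0)" using min_resolution[OF X] by metis
  then have "\<exists>z. case z of (F, D, p) \<Rightarrow> proj_resolution R X F D p"
    by (intro exI[of _ "(Q, \<lambda>n. c (Suc n), c 0)"]) simp
  from someI_ex[OF this] have "case some_resolution R X of (F, D, p) \<Rightarrow> proj_resolution R X F D p"
    unfolding some_resolution_def .
  then show ?thesis using that by (auto simp: res_term_def res_diff_def split: prod.splits)
qed

text \<open>A cocycle vanishes on the image of the differential, which is the kernel of the
  surjection onto the \<open>n\<close>-th syzygy, so it factors through that syzygy.\<close>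

lemma cocycles_eq:
  fixes X N :: "('a, 'm) module"
  assumes X: "X \<in> fgmod R" and N: "N \<in> fgmod R"
    and r: "proj_resolution R X (res_term R X) (res_diff R X) p"
  shows "cocycles R n X N = {restrict (\<lambda>x. f (res_map (res_diff R X) p n x)) (carrier (res_term R X n)) | f.
    lhom R (res_obj X (res_term R X) (res_diff R X) n) N f}"
proof -
  let ?F = "res_term R X" and ?D = "res_diff R X"
  let ?K = "res_obj X ?F ?D n" and ?\<pi> = "res_map ?D p n"
  note P = proj_resolutionD[OF X r]
  have lN: "left_module R N" by (rule fgmodD[OF N])
  interpret N: left_module R N by (rule lN)
  show ?thesis
  proof (rule subset_antisym)
    show "cocycles R n X N \<subseteq> {restrict (\<lambda>x. f (?\<pi> x)) (carrier (?F n)) | f. lhom R ?K N f}"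
    proof
      fix z assume "z \<in> cocycles R n X N"
      then have z: "lhom R (?F n) N z" "z \<in> extensional (carrier (?F n))"
        and zD: "compose (carrier (?F (Suc n))) z (?D n) = (\<lambda>x\<in>carrier (?F (Suc n)). \<zero>\<^bsub>N\<^esub>)"
        by (auto simp: cocycles_def mod_hom_iff)
      have "z x = \<zero>\<^bsub>N\<^esub>" if "x \<in> carrier (?F n)" "?\<pi> x = \<zero>\<^bsub>?K\<^esub>" for x
      proof -
        have "x \<in> ?D n ` carrier (?F (Suc n))" unfolding P(8)[symmetric] using that by (simp add: hom_ker_def)
        then obtain y where y: "y \<in> carrier (?F (Suc n))" "x = ?D n y" by blast
        then show ?thesis using fun_cong[OF zD, of y] by (simp add: compose_def)
      qed
      then obtain f where f: "lhom R ?K N f" "\<And>x. x \<in> carrier (?F n) \<Longrightarrow> f (?\<pi> x) = z x"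
        by (rule lhom_factor[OF P(3) P(5) lN P(6) P(7) z(1)]) (assumption | rule that)+
      have "z = restrict (\<lambda>x. f (?\<pi> x)) (carrier (?F n))"
        using z(2) f(2) by (auto simp: extensional_def fun_eq_iff)
      then show "z \<in> {restrict (\<lambda>x. f (?\<pi> x)) (carrier (?F n)) | f. lhom R ?K N f}" using f(1) by blast
    qed
    show "{restrict (\<lambda>x. f (?\<pi> x)) (carrier (?F n)) | f. lhom R ?K N f} \<subseteq> cocycles R n X N"
    proof
      fix z assume "z \<in> {restrict (\<lambda>x. f (?\<pi> x)) (carrier (?F n)) | f. lhom R ?K N f}"
      then obtain f where f: "lhom R ?K N f" "z = restrict (\<lambda>x. f (?\<pi> x)) (carrier (?F n))" by blast
      have "z \<in> mod_hom R (?F n) N"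
        unfolding f(2) using restrict_mod_hom[OF P(3)] lhom_comp[OF P(6) f(1)] by blast
      moreover have "z (?D n x) = \<zero>\<^bsub>N\<^esub>" if x: "x \<in> carrier (?F (Suc n))" for x
      proof -
        have "?D n x \<in> hom_ker (?F n) ?K ?\<pi>" unfolding P(8) using x by blast
        then have "?D n x \<in> carrier (?F n)" "?\<pi> (?D n x) = \<zero>\<^bsub>?K\<^esub>" by (simp_all add: hom_ker_def)
        then show ?thesis unfolding f(2) using lhomZ(1)[OF f(1) P(5) lN] by simp
      qed
      ultimately show "z \<in> cocycles R n X N"
        by (auto simp: cocycles_def compose_def intro: restrict_ext)
    qed
  qed
qed

text \<open>In degree 0 the only coboundary is zero, which the choice of the zero map as
  \<open>\<iota>\<close> expresses; the functor described is Hom(X, -).\<close>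

lemma ext_data_0:
  fixes X :: "('a, 'm) module"
  assumes X: "X \<in> fgmod R"
  shows "\<exists>\<pi>. ext_data R 0 X X X \<pi> (\<lambda>x. \<zero>\<^bsub>X\<^esub>)"
proof -
  have lX: "left_module R X" by (rule fgmodD[OF X])
  obtain p where r: "proj_resolution R X (res_term R X) (res_diff R X) p" by (rule some_resolution[OF X])
  note P = proj_resolutionD[OF X r, of 0, simplified]
  have "coboundaries R 0 X N = {restrict (\<lambda>x. g \<zero>\<^bsub>X\<^esub>) (carrier (res_term R X 0)) | g. lhom R X N g}" if N: "N \<in> fgmod R" for N
  proof (rule subset_antisym)
    show "coboundaries R 0 X N \<subseteq> {restrict (\<lambda>x. g \<zero>\<^bsub>X\<^esub>) (carrier (res_term R X 0)) | g. lhom R X N g}"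
      using lhom_zero[OF fgmodD[OF N], of X] by fastforce
    show "{restrict (\<lambda>x. g \<zero>\<^bsub>X\<^esub>) (carrier (res_term R X 0)) | g. lhom R X N g} \<subseteq> coboundaries R 0 X N"
    proof
      fix z assume "z \<in> {restrict (\<lambda>x. g \<zero>\<^bsub>X\<^esub>) (carrier (res_term R X 0)) | g. lhom R X N g}"
      then obtain g where g: "lhom R X N g" "z = restrict (\<lambda>x. g \<zero>\<^bsub>X\<^esub>) (carrier (res_term R X 0))" by blast
      show "z \<in> coboundaries R 0 X N" unfolding g(2) lhomZ(1)[OF g(1) lX fgmodD[OF N]] by simp
    qed
  qed
  then have "ext_data R 0 X X X p (\<lambda>x. \<zero>\<^bsub>X\<^esub>)"
    unfolding ext_data_def using P X cocycles_eq[OF X _ r, of _ 0] lhom_zero[OF lX, of X] by simp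
  then show ?thesis by blast
qed

text \<open>The universal cocycle is the surjection onto the syzygy of order \<open>n + 1\<close>,
  viewed inside the \<open>n\<close>-th term \<open>Q\<close>, and coboundaries are the maps that
  extend to \<open>Q\<close>. The module \<open>A\<close> presented by \<open>Q\<close> is the
  \<open>n\<close>-th syzygy of the chosen resolution, known up to stable equivalence.\<close>

lemma ext_data_Suc:
  fixes X :: "('a, 'm) module"
  assumes X: "X \<in> fgmod R"
  obtains Q q where "projective R Q" "\<exists>A. A \<in> fgmod R \<and> lhom R Q A q \<and> q ` carrier Q = carrier A \<and> stab R A ((syzygy R ^^ n) X) \<and>
    (\<exists>\<pi>. ext_data R (Suc n) X (submod Q (hom_ker Q A q)) Q \<pi> (\<lambda>x. x))"
proof -
  obtain p where r: "proj_resolution R X (res_term R X) (res_diff R X) p" by (rule some_resolution[OF X])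
  let ?F = "res_term R X" and ?D = "res_diff R X"
  note P = proj_resolutionD[OF X r]
  let ?A = "res_obj X ?F ?D n"
  have K: "submod (?F n) (hom_ker (?F n) ?A (res_map ?D p n)) = res_obj X ?F ?D (Suc n)" unfolding P(8) by simp
  have "coboundaries R (Suc n) X N = {restrict (\<lambda>x. g (?D n x)) (carrier (?F (Suc n))) | g. lhom R (?F n) N g}" if N: "N \<in> fgmod R" for N
  proof (rule subset_antisym)
    show "coboundaries R (Suc n) X N \<subseteq> {restrict (\<lambda>x. g (?D n x)) (carrier (?F (Suc n))) | g. lhom R (?F n) N g}"
      by (auto simp: mod_hom_iff compose_def)
    show "{restrict (\<lambda>x. g (?D n x)) (carrier (?F (Suc n))) | g. lhom R (?F n) N g} \<subseteq> coboundaries R (Suc n) X N"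
    proof
      fix z assume "z \<in> {restrict (\<lambda>x. g (?D n x)) (carrier (?F (Suc n))) | g. lhom R (?F n) N g}"
      then obtain g where g: "lhom R (?F n) N g" "z = restrict (\<lambda>x. g (?D n x)) (carrier (?F (Suc n)))" by blast
      have "z = compose (carrier (?F (Suc n))) (restrict g (carrier (?F n))) (?D n)"
        unfolding g(2) compose_def using lhomD(1)[OF P(9)[of n]] by (intro restrict_ext) simp
      then show "z \<in> coboundaries R (Suc n) X N" using restrict_mod_hom[OF P(3), of g n N] g(1) by simp
    qed
  qed
  then have "ext_data R (Suc n) X (res_obj X ?F ?D (Suc n)) (?F n) (?D n) (\<lambda>x. x)"
    unfolding ext_data_def
    using P(2)[of "Suc n"] P(4)[of "Suc n"] P(2)[of n] P(6)[of "Suc n"] P(7)[of "Suc n"] lhom_incl[OF P(3) P(10), of n]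
      cocycles_eq[OF X _ r, of _ "Suc n"] by simp
  then show ?thesis
    using that[OF P(1)[of n], of "res_map ?D p n"] P(4,6,7)[of n] res_obj_stab[OF X r, of n] unfolding K[symmetric] by blast
qed

text \<open>With zero maps as \<open>\<iota>\<close> and \<open>\<iota>'\<close> the homotopies in
  \<open>pair_eq\<close> vanish, which leaves mutually inverse maps.\<close>

lemma Ext_nat_iso_0:
  fixes X Z :: "('a, 'm) module"
  assumes X: "X \<in> fgmod R" "Z \<in> fgmod R"
  shows "Ext_nat_iso R 0 X Z \<longleftrightarrow> mod_iso R X Z"
proof -
  have l: "left_module R X" "left_module R Z" using X fgmodD by blast+
  interpret X: left_module R X by (rule l)
  interpret Z: left_module R Z by (rule l)
  obtain \<pi> \<pi>' where "ext_data R 0 X X X \<pi> (\<lambda>x. \<zero>\<^bsub>X\<^esub>)" "ext_data R 0 Z Z Z \<pi>' (\<lambda>x. \<zero>\<^bsub>Z\<^esub>)"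
    using ext_data_0[OF X(1)] ext_data_0[OF X(2)] by blast
  then have "Ext_nat_iso R 0 X Z \<longleftrightarrow> pair_eq R X X (\<lambda>x. \<zero>\<^bsub>X\<^esub>) Z Z (\<lambda>x. \<zero>\<^bsub>Z\<^esub>)" by (rule ext_iff_pair_eq)
  also have "\<dots> \<longleftrightarrow> mod_iso R X Z"
  proof
    assume "pair_eq R X X (\<lambda>x. \<zero>\<^bsub>X\<^esub>) Z Z (\<lambda>x. \<zero>\<^bsub>Z\<^esub>)"
    then obtain u u' c c' where u: "lhom R Z X u" "lhom R X Z u'" and c: "lhom R X X c" "lhom R Z Z c'"
      and uu: "\<forall>x\<in>carrier X. x = u (u' x) \<oplus>\<^bsub>X\<^esub> c \<zero>\<^bsub>X\<^esub>" "\<forall>y\<in>carrier Z. y = u' (u y) \<oplus>\<^bsub>Z\<^esub> c' \<zero>\<^bsub>Z\<^esub>"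
      unfolding pair_eq_def by (elim exE conjE) (rule that)
    show "mod_iso R X Z"
      by (rule mod_isoI[OF l u(2,1)])
        (use uu lhomZ(1)[OF c(1) l(1,1)] lhomZ(1)[OF c(2) l(2,2)] lhomD(1)[OF lhom_comp[OF u(2,1)]] lhomD(1)[OF lhom_comp[OF u]] in simp_all)
  next
    assume "mod_iso R X Z"
    then obtain f g where fg: "lhom R X Z f" "lhom R Z X g" "\<And>x. x \<in> carrier X \<Longrightarrow> g (f x) = x" "\<And>y. y \<in> carrier Z \<Longrightarrow> f (g y) = y"
      by (rule mod_isoE[OF _ l]) (rule that)
    show "pair_eq R X X (\<lambda>x. \<zero>\<^bsub>X\<^esub>) Z Z (\<lambda>x. \<zero>\<^bsub>Z\<^esub>)"
      unfolding pair_eq_def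
      using fg lhom_zero[OF l(1), of X] lhom_zero[OF l(1), of Z] lhom_zero[OF l(2), of X] lhom_zero[OF l(2), of Z]
      by (intro exI[of _ g] exI[of _ f] exI[of _ "\<lambda>x. \<zero>\<^bsub>X\<^esub>"] exI[of _ "\<lambda>x. \<zero>\<^bsub>Z\<^esub>"]) simp
  qed
  finally show ?thesis .
qed

lemma Ext_nat_iso_Suc:
  fixes X Z :: "('a, 'm) module"
  assumes X: "X \<in> fgmod R" "Z \<in> fgmod R"
  shows "Ext_nat_iso R (Suc n) X Z \<longleftrightarrow> stab R ((syzygy R ^^ n) X) ((syzygy R ^^ n) Z)"
proof -
  obtain Q q A \<pi> where Q: "projective R Q" "A \<in> fgmod R" "lhom R Q A q" "q ` carrier Q = carrier A" "stab R A ((syzygy R ^^ n) X)"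
    "ext_data R (Suc n) X (submod Q (hom_ker Q A q)) Q \<pi> (\<lambda>x. x)"
    using ext_data_Suc[OF X(1), of n] by metis
  obtain Q' q' A' \<pi>' where Q': "projective R Q'" "A' \<in> fgmod R" "lhom R Q' A' q'" "q' ` carrier Q' = carrier A'" "stab R A' ((syzygy R ^^ n) Z)"
    "ext_data R (Suc n) Z (submod Q' (hom_ker Q' A' q')) Q' \<pi>' (\<lambda>x. x)"
    using ext_data_Suc[OF X(2), of n] by metis
  note fS = syzygy_pow_fgmod[OF X(1), of n] syzygy_pow_fgmod[OF X(2), of n]
  have "Ext_nat_iso R (Suc n) X Z \<longleftrightarrow> stab R A A'"
    using ext_iff_pair_eq[OF Q(6) Q'(6)] pair_eq_stab[OF Q(2) Q'(2) Q(1,3,4) Q'(1,3,4)] by simp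
  also have "\<dots> \<longleftrightarrow> stab R ((syzygy R ^^ n) X) ((syzygy R ^^ n) Z)"
  proof
    assume "stab R A A'"
    then show "stab R ((syzygy R ^^ n) X) ((syzygy R ^^ n) Z)"
      using stab_trans[OF stab_sym[OF Q(5)] stab_trans[OF _ Q'(5) Q(2) Q'(2) fS(2)] fS(1) Q(2) fS(2)] by blast
  next
    assume "stab R ((syzygy R ^^ n) X) ((syzygy R ^^ n) Z)"
    then show "stab R A A'"
      using stab_trans[OF Q(5) stab_trans[OF _ stab_sym[OF Q'(5)] fS Q'(2)] Q(2) fS(1) Q'(2)] by blast
  qed
  finally show ?thesis .
qed

end

section \<open>Igusa--Todorov functions via stable equivalence\<close>

lemma add_cat_retract:
  fixes X :: "('a, 'm) module"
  assumes ir: "retract R X M i r" and X: "X \<in> fgmod R" and M: "left_module R M"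
  shows "X \<in> add_cat R M"
proof -
  have "thru R M X X (\<lambda>x. r (i x))" by (rule thru_comp1[OF _ _ fgmodD[OF X]]) (use ir in \<open>simp_all add: retract_def\<close>)
  then have "thru R M X X (\<lambda>x. x)" by (rule thru_cong) (use ir in \<open>simp add: retract_def\<close>)
  then show ?thesis using X by (simp add: add_cat_iff[OF M])
qed

context good_ring
begin

text \<open>Locality of the endomorphism ring: in \<open>1 = k + l\<close> with \<open>k\<close> a
  sum of composites through \<open>M\<close>, either some composite is invertible and splits
  \<open>X\<close> off \<open>M\<close>, or \<open>l\<close> is invertible. The induction moves
  composites from \<open>k\<close> to \<open>l\<close> one by one.\<close>

lemma thru_indecomposable:
  fixes X :: "('a, 'm) module" and M :: "('a, 'n) module"
  assumes X: "X \<in> fgmod R" "indecomposable R X" and M: "left_module R M" and th: "thru R M X X k"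
    and l: "lhom R X X l" "\<And>x. x \<in> carrier X \<Longrightarrow> k x \<oplus>\<^bsub>X\<^esub> l x = x"
  shows "(\<exists>i r. retract R X M i r) \<or> (l ` carrier X = carrier X \<and> (\<forall>x\<in>carrier X. l x = \<zero>\<^bsub>X\<^esub> \<longrightarrow> x = \<zero>\<^bsub>X\<^esub>))"
  using th l
proof (induction arbitrary: l rule: thru.induct)
  case (zero h)
  interpret X: left_module R X by (rule fgmodD[OF X(1)])
  have "l x = x" if "x \<in> carrier X" for x using zero(1)[OF that] zero(3)[OF that] lhomD(1)[OF zero(2) that] by simp
  then show ?case by simp
next
  case (step h g f k)
  have lX: "left_module R X" by (rule fgmodD[OF X(1)])
  interpret X: left_module R X by (rule lX)
  let ?l = "\<lambda>x. f (g x) \<oplus>\<^bsub>X\<^esub> l x"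
  have fg: "lhom R X X (\<lambda>x. f (g x))" by (rule lhom_comp[OF step.hyps(2,3)])
  have l': "lhom R X X ?l" by (rule lhom_add[OF lX fg step.prems(1)])
  have h: "lhom R X X h" by (rule thru_lhom[OF step.hyps(1) lX lX])
  have "h x \<oplus>\<^bsub>X\<^esub> ?l x = x" if x: "x \<in> carrier X" for x
    using step.prems(2)[OF x] step.hyps(4)[OF x] lhomD(1)[OF h x] lhomD(1)[OF fg x] lhomD(1)[OF step.prems(1) x]
    by (simp add: X.M.a_assoc)
  from step.IH[OF l' this] consider "\<exists>i r. retract R X M i r"
    | "?l ` carrier X = carrier X" "\<forall>x\<in>carrier X. ?l x = \<zero>\<^bsub>X\<^esub> \<longrightarrow> x = \<zero>\<^bsub>X\<^esub>" by blast
  then show ?case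
  proof cases
    case 1 then show ?thesis by blast
  next
    case 2
    \<comment> \<open>Dividing by the automorphism \<open>?l\<close> makes the two remaining maps
      add up to the identity, as \<open>local_endo\<close> requires.\<close>
    obtain w where w: "lhom R X X w" "\<And>x. x \<in> carrier X \<Longrightarrow> w (?l x) = x" "\<And>y. y \<in> carrier X \<Longrightarrow> ?l (w y) = y"
      by (rule lhom_inj_iso[OF lX lX l' 2(1)]) (use 2(2) in blast)+
    have a: "lhom R X X (\<lambda>x. w (f (g x)))" and b: "lhom R X X (\<lambda>x. w (l x))"
      using lhom_comp[OF fg w(1)] lhom_comp[OF step.prems(1) w(1)] .
    have s: "w (f (g x)) \<oplus>\<^bsub>X\<^esub> w (l x) = x" if x: "x \<in> carrier X" for x
      using w(2)[OF x] lhomD(2)[OF w(1) lhomD(1)[OF fg x] lhomD(1)[OF step.prems(1) x]] by simp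
    from local_endo[OF lX fg_art[OF X(1)] fg_noe[OF X(1)] a b s X(2)]
    consider (A) "(\<lambda>x. w (f (g x))) ` carrier X = carrier X" "\<forall>x\<in>carrier X. w (f (g x)) = \<zero>\<^bsub>X\<^esub> \<longrightarrow> x = \<zero>\<^bsub>X\<^esub>"
      | (B) "(\<lambda>x. w (l x)) ` carrier X = carrier X" "\<forall>x\<in>carrier X. w (l x) = \<zero>\<^bsub>X\<^esub> \<longrightarrow> x = \<zero>\<^bsub>X\<^esub>" by blast
    then show ?thesis
    proof cases
      case A
      obtain v where v: "lhom R X X v" "\<And>x. x \<in> carrier X \<Longrightarrow> v (w (f (g x))) = x"
        by (rule lhom_inj_iso[OF lX lX a A(1)]) (use A(2) in blast)+
      have "retract R X M g (\<lambda>m. v (w (f m)))"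
        unfolding retract_def using step.hyps(2) lhom_comp[OF lhom_comp[OF step.hyps(3) w(1)] v(1)] v(2) by blast
      then show ?thesis by blast
    next
      case B
      have "y \<in> l ` carrier X" if y: "y \<in> carrier X" for y
      proof -
        have "w y \<in> (\<lambda>x. w (l x)) ` carrier X" unfolding B(1) by (rule lhomD(1)[OF w(1) y])
        then obtain x where x: "x \<in> carrier X" "w y = w (l x)" by blast
        have "y = ?l (w (l x))" using w(3)[OF y] x(2) by simp
        also have "\<dots> = l x" by (rule w(3)[OF lhomD(1)[OF step.prems(1) x(1)]])
        finally show ?thesis using x(1) by blast
      qed
      then have "l ` carrier X = carrier X" using lhomD(1)[OF step.prems(1)] by blast
      moreover have "x = \<zero>\<^bsub>X\<^esub>" if "x \<in> carrier X" "l x = \<zero>\<^bsub>X\<^esub>" for x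
        using B(2) that lhomZ(1)[OF w(1) lX lX] by simp
      ultimately show ?thesis by blast
    qed
  qed
qed

text \<open>For \<open>l = 0\<close> the second alternative of \<open>thru_indecomposable\<close>
  contradicts that \<open>X\<close> is nonzero. This leads back from add \<open>M\<close> to the
  summands that generate \<open>add_span\<close>.\<close>

lemma indecomposable_summand:
  fixes X :: "('a, 'm) module" and M :: "('a, 'n) module"
  assumes X: "X \<in> fgmod R" "indecomposable R X" and M: "left_module R M" and th: "thru R M X X (\<lambda>x. x)"
  shows "summand R X M"
proof -
  interpret X: left_module R X by (rule fgmodD[OF X(1)])
  have "(\<exists>i r. retract R X M i r) \<or> ((\<lambda>x. \<zero>\<^bsub>X\<^esub>) ` carrier X = carrier X \<and> (\<forall>x\<in>carrier X. \<zero>\<^bsub>X\<^esub> = \<zero>\<^bsub>X\<^esub> \<longrightarrow> x = \<zero>\<^bsub>X\<^esub>))"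
    by (rule thru_indecomposable[OF X M th lhom_zero[OF X.left_module_axioms]]) simp
  moreover have "\<exists>x\<in>carrier X. x \<noteq> \<zero>\<^bsub>X\<^esub>" using X(2) unfolding indecomposable_def zero_module_def by blast
  ultimately show ?thesis using summand_iff_retract[OF X.left_module_axioms M] by blast
qed

lemma thru_iso:
  assumes "mod_iso R X Y" "left_module R X" "left_module R Y" "thru R M X X (\<lambda>x. x)"
  shows "thru R M Y Y (\<lambda>x. x)"
  by (rule iso_retract[OF assms(1-3)]) (rule thru_retract[OF assms(4) _ assms(3,2)])

lemma zero_mod_add_cat: "left_module R M \<Longrightarrow> zero_mod z \<in> add_cat R M"
  using zero_mod[OF ring_R, of z] by (auto simp: add_cat_iff zero_module_def intro: thru.zero)

lemma add_cat_dsum: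
  fixes A B :: "('a, 'm) module" and M :: "('a, 'n) module"
  assumes AB: "A \<in> add_cat R M" "B \<in> add_cat R M" and M: "left_module R M"
  obtains C :: "('a, 'm) module" where "C \<in> add_cat R M" "mod_iso R C (dsum A B)"
proof -
  have f: "A \<in> fgmod R" "B \<in> fgmod R" "thru R M A A (\<lambda>x. x)" "thru R M B B (\<lambda>x. x)"
    using AB by (auto simp: add_cat_iff[OF M])
  note l = fgmodD[OF f(1)] fgmodD[OF f(2)]
  obtain C :: "('a, 'm) module" where C: "C \<in> fgmod R" "mod_iso R (dsum A B) C" by (rule fg_copy[OF fgmod_dsum[OF f(1,2)]])
  note i = C(2) left_module_dsum[OF l] fgmodD[OF C(1)]
  have "C \<in> add_cat R M" using C(1) thru_iso[OF i thru_dsum[OF f(3,4) l]] by (simp add: add_cat_iff[OF M])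
  then show ?thesis by (rule that) (rule mod_iso_sym[OF i])
qed

text \<open>Positive and negative parts are collected in \<open>A\<close> and \<open>B\<close>, with
  a zero module where a part is empty.\<close>

lemma frag_add_cat:
  fixes M :: "('a, 'n) module" and x :: "('a, 'm) module \<Rightarrow>\<^sub>0 int"
  assumes M: "left_module R M" and x: "Poly_Mapping.keys x \<subseteq> add_cat R M"
  shows "\<exists>(A :: ('a, 'm) module) (B :: ('a, 'm) module). A \<in> add_cat R M \<and> B \<in> add_cat R M \<and> x - (frag_of A - frag_of B) \<in> K0_kernel R"
  using x
proof (induction rule: frag_induction)
  case zero
  let ?z = "zero_mod undefined :: ('a, 'm) module"
  show ?case by (rule exI[of _ ?z], rule exI[of _ ?z]) (simp add: zero_mod_add_cat[OF M] K0_kernel_zero)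
next
  case (one X)
  let ?z = "zero_mod undefined :: ('a, 'm) module"
  have "frag_of ?z \<in> K0_kernel R" by (rule K0_kernel_projective[OF projective_zero[OF zero_mod[OF ring_R]]])
  then show ?case by (intro exI[of _ X] exI[of _ ?z]) (simp add: one zero_mod_add_cat[OF M])
next
  case (diff a b)
  obtain A B :: "('a, 'm) module" where A: "A \<in> add_cat R M" "B \<in> add_cat R M" "a - (frag_of A - frag_of B) \<in> K0_kernel R"
    using diff(1) by (elim exE conjE)
  obtain A' B' :: "('a, 'm) module" where B: "A' \<in> add_cat R M" "B' \<in> add_cat R M" "b - (frag_of A' - frag_of B') \<in> K0_kernel R"
    using diff(2) by (elim exE conjE)
  obtain C :: "('a, 'm) module" where C: "C \<in> add_cat R M" "mod_iso R C (dsum A B')" by (rule add_cat_dsum[OF A(1) B(2) M])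
  obtain D :: "('a, 'm) module" where D: "D \<in> add_cat R M" "mod_iso R D (dsum B A')" by (rule add_cat_dsum[OF A(2) B(1) M])
  have f: "A \<in> fgmod R" "B \<in> fgmod R" "A' \<in> fgmod R" "B' \<in> fgmod R" "C \<in> fgmod R" "D \<in> fgmod R"
    using A B C D by (auto simp: add_cat_def)
  note k = K0_kernel_sum[OF f(1,4,5) C(2)] K0_kernel_sum[OF f(2,3,6) D(2)]
  have "a - b - (frag_of C - frag_of D) = (a - (frag_of A - frag_of B)) - (b - (frag_of A' - frag_of B'))
      - (frag_of C - (frag_of A + frag_of B')) + (frag_of D - (frag_of B + frag_of A'))"
    by simp
  also have "\<dots> \<in> K0_kernel R" by (intro K0_kernel_add K0_kernel_diff k A(3) B(3))
  finally show ?case using C(1) D(1) by blast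
qed

text \<open>Descent over the submodules of \<open>A\<close>: a decomposable one splits into two
  smaller ones, which stay in add \<open>M\<close> as retracts, and an indecomposable one in add
  \<open>M\<close> is a summand of \<open>M\<close>.\<close>

lemma ind_decomposition:
  fixes A :: "('a, 'm) module" and M :: "('a, 'm) module"
  assumes M: "left_module R M" and A: "A \<in> add_cat R M"
  shows "\<exists>a. Poly_Mapping.keys a \<subseteq> ind_summands R M \<and> frag_of A - a \<in> K0_kernel R"
proof -
  have fA: "A \<in> fgmod R" and thA: "thru R M A A (\<lambda>x. x)" using A by (auto simp: add_cat_iff[OF M])
  have lA: "left_module R A" by (rule fgmodD[OF fA])
  interpret A: left_module R A by (rule lA)
  have "submodule N R A \<longrightarrow> thru R M (submod A N) (submod A N) (\<lambda>x. x) \<longrightarrow>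
      (\<exists>a. Poly_Mapping.keys a \<subseteq> ind_summands R M \<and> frag_of (submod A N) - a \<in> K0_kernel R)" for N
  proof (induction N rule: wf_induct_rule[OF fg_art[OF fA, unfolded art_def]])
    case (1 N)
    show ?case
    proof (intro impI)
      assume N: "submodule N R A" and th: "thru R M (submod A N) (submod A N) (\<lambda>x. x)"
      let ?N = "submod A N"
      have fN: "?N \<in> fgmod R" by (rule fg_submod[OF fA N])
      have lN: "left_module R ?N" by (rule fgmodD[OF fN])
      show "\<exists>a. Poly_Mapping.keys a \<subseteq> ind_summands R M \<and> frag_of ?N - a \<in> K0_kernel R"
      proof (cases "zero_module ?N")
        case True
        then show ?thesis using K0_kernel_projective[OF projective_zero[OF fN True]] by (intro exI[of _ 0]) simp
      next
        case nz: False
        show ?thesis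
        proof (cases "indecomposable R ?N")
          case True
          have "?N \<in> ind_summands R M"
            using fN True indecomposable_summand[OF fN True M th] by (simp add: ind_summands_def)
          then show ?thesis by (intro exI[of _ "frag_of ?N"]) (simp add: K0_kernel_zero)
        next
          case False
          then obtain N1 N2 where NN: "internal_sum R ?N N1 N2" "N1 \<noteq> {\<zero>\<^bsub>A\<^esub>}" "N2 \<noteq> {\<zero>\<^bsub>A\<^esub>}"
            using nz unfolding indecomposable_def by auto
          have s: "submodule N1 R A" "submodule N2 R A" "N1 \<subseteq> N" "N2 \<subseteq> N" "N1 \<inter> N2 = {\<zero>\<^bsub>A\<^esub>}"
            using NN(1) unfolding internal_sum_def submodule_submod[OF lA N] by auto
          have p: "N1 \<subset> N" "N2 \<subset> N" using s NN(2,3) by blast+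
          let ?N1 = "submod A N1" and ?N2 = "submod A N2"
          have f12: "?N1 \<in> fgmod R" "?N2 \<in> fgmod R" using fg_submod[OF fA] s by blast+
          note l12 = fgmodD[OF f12(1)] fgmodD[OF f12(2)]
          have iso: "mod_iso R ?N (dsum ?N1 ?N2)" using internal_sum_iso[OF lN NN(1)] by simp
          have thd: "thru R M (dsum ?N1 ?N2) (dsum ?N1 ?N2) (\<lambda>x. x)"
            by (rule thru_iso[OF iso lN left_module_dsum[OF l12] th])
          have th12: "thru R M ?N1 ?N1 (\<lambda>x. x)" "thru R M ?N2 ?N2 (\<lambda>x. x)"
            using thru_retract[OF thd _ _ left_module_dsum[OF l12]] retract_dsum[OF l12] l12 by blast+
          have r: "(N1, N) \<in> sub_rel R A" "(N2, N) \<in> sub_rel R A" using s p N by (simp_all add: sub_rel_def)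
          obtain a where a: "Poly_Mapping.keys a \<subseteq> ind_summands R M" "frag_of ?N1 - a \<in> K0_kernel R"
            using 1[OF r(1)] s(1) th12(1) by blast
          obtain b where b: "Poly_Mapping.keys b \<subseteq> ind_summands R M" "frag_of ?N2 - b \<in> K0_kernel R"
            using 1[OF r(2)] s(2) th12(2) by blast
          have "frag_of ?N - (a + b) = (frag_of ?N - (frag_of ?N1 + frag_of ?N2)) + ((frag_of ?N1 - a) + (frag_of ?N2 - b))" by simp
          also have "\<dots> \<in> K0_kernel R" by (intro K0_kernel_add a(2) b(2) K0_kernel_sum[OF f12 fN iso])
          finally have "frag_of ?N - (a + b) \<in> K0_kernel R" .
          moreover have "Poly_Mapping.keys (a + b) \<subseteq> ind_summands R M" using a(1) b(1) keys_add[of a b] by blast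
          ultimately show ?thesis by blast
        qed
      qed
    qed
  qed
  from this[of "carrier A"] show ?thesis using A.submodule_carrier thA by simp
qed

lemma Om_pow_frag: "(Om R ^^ s) (frag_of A) = frag_of ((syzygy R ^^ s) A)"
  by (induction s) (simp_all add: Om_simps)

text \<open>\<open>x\<close> and the difference of \<open>A\<close> and \<open>B\<close> have the
  same class, and the iterates of \<open>Om\<close> respect classes.\<close>

lemma Om_pow_stab:
  fixes A B :: "('a, 'm) module"
  assumes AB: "A \<in> fgmod R" "B \<in> fgmod R" and x: "x - (frag_of A - frag_of B) \<in> K0_kernel R"
  shows "(Om R ^^ s) x \<in> K0_kernel R \<longleftrightarrow> stab R ((syzygy R ^^ s) A) ((syzygy R ^^ s) B)"
proof -
  let ?y = "frag_of ((syzygy R ^^ s) A) - frag_of ((syzygy R ^^ s) B)"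
  have "(Om R ^^ s) x - ?y \<in> K0_kernel R"
    using Om_pow_kernel[OF x, of s] by (simp add: Om_pow_diff Om_pow_frag)
  then have "(Om R ^^ s) x \<in> K0_kernel R \<longleftrightarrow> ?y \<in> K0_kernel R"
    using K0_kernel_add[of "(Om R ^^ s) x - ?y" R ?y] K0_kernel_diff[of "(Om R ^^ s) x" R "(Om R ^^ s) x - ?y"] by auto
  then show ?thesis using K0_kernel_stab syzygy_pow_fgmod AB by blast
qed

text \<open>Combinations of indecomposable summands of \<open>M\<close> and differences of modules
  in add \<open>M\<close> represent the same classes, and a difference is zero in \<open>K0\<close>
  exactly under stable equivalence. In this form \<open>K0\<close> has disappeared.\<close>

lemma phi_stab:
  fixes M :: "('a, 'm) module"
  assumes M: "M \<in> fgmod R"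
  shows "phi R M = (LEAST n. \<forall>s\<ge>n. \<forall>(A :: ('a, 'm) module) \<in> add_cat R M. \<forall>(B :: ('a, 'm) module) \<in> add_cat R M.
    stab R ((syzygy R ^^ Suc s) A) ((syzygy R ^^ Suc s) B) \<longrightarrow> stab R ((syzygy R ^^ s) A) ((syzygy R ^^ s) B))"
proof -
  have lM: "left_module R M" by (rule fgmodD[OF M])
  have sub: "ind_summands R M \<subseteq> add_cat R M"
  proof
    fix X assume "X \<in> ind_summands R M"
    then have X: "X \<in> fgmod R" "summand R X M" by (auto simp: ind_summands_def)
    obtain i r where "retract R X M i r" using X(2) summand_iff_retract[OF fgmodD[OF X(1)] lM] by blast
    then show "X \<in> add_cat R M" by (rule add_cat_retract[OF _ X(1) lM])
  qed
  have "(\<forall>x. Poly_Mapping.keys x \<subseteq> ind_summands R M \<longrightarrow> (Om R ^^ Suc s) x \<in> K0_kernel R \<longrightarrow> (Om R ^^ s) x \<in> K0_kernel R)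
    \<longleftrightarrow> (\<forall>(A :: ('a, 'm) module) \<in> add_cat R M. \<forall>(B :: ('a, 'm) module) \<in> add_cat R M.
    stab R ((syzygy R ^^ Suc s) A) ((syzygy R ^^ Suc s) B) \<longrightarrow> stab R ((syzygy R ^^ s) A) ((syzygy R ^^ s) B))"
    (is "?l \<longleftrightarrow> ?r") for s
  proof
    assume L: ?l
    show ?r
    proof (intro ballI impI)
      fix A B :: "('a, 'm) module"
      assume AB: "A \<in> add_cat R M" "B \<in> add_cat R M" and st: "stab R ((syzygy R ^^ Suc s) A) ((syzygy R ^^ Suc s) B)"
      have f: "A \<in> fgmod R" "B \<in> fgmod R" using AB by (auto simp: add_cat_def)
      obtain a where a: "Poly_Mapping.keys a \<subseteq> ind_summands R M" "frag_of A - a \<in> K0_kernel R"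
        using ind_decomposition[OF lM AB(1)] by blast
      obtain b where b: "Poly_Mapping.keys b \<subseteq> ind_summands R M" "frag_of B - b \<in> K0_kernel R"
        using ind_decomposition[OF lM AB(2)] by blast
      have "(a - b) - (frag_of A - frag_of B) = (frag_of B - b) - (frag_of A - a)" by simp
      also have "\<dots> \<in> K0_kernel R" by (rule K0_kernel_diff[OF b(2) a(2)])
      finally have k: "(a - b) - (frag_of A - frag_of B) \<in> K0_kernel R" .
      have "Poly_Mapping.keys (a - b) \<subseteq> ind_summands R M" using a(1) b(1) keys_diff[of a b] by blast
      then show "stab R ((syzygy R ^^ s) A) ((syzygy R ^^ s) B)"
        using L[rule_format, of "a - b"] st unfolding Om_pow_stab[OF f k] by blast
    qed
  next
    assume r: ?r
    show ?l
    proof (intro allI impI)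
      fix x :: "('a, 'm) module \<Rightarrow>\<^sub>0 int"
      assume x: "Poly_Mapping.keys x \<subseteq> ind_summands R M" "(Om R ^^ Suc s) x \<in> K0_kernel R"
      obtain A B :: "('a, 'm) module" where AB: "A \<in> add_cat R M" "B \<in> add_cat R M" and k: "x - (frag_of A - frag_of B) \<in> K0_kernel R"
        using frag_add_cat[OF lM subset_trans[OF x(1) sub]] by (elim exE conjE)
      have f: "A \<in> fgmod R" "B \<in> fgmod R" using AB by (auto simp: add_cat_def)
      show "(Om R ^^ s) x \<in> K0_kernel R" using x(2) r AB unfolding Om_pow_stab[OF f k] by blast
    qed
  qed
  then show ?thesis unfolding phi_eq by presburger
qed

lemma stab_cong:
  fixes A B A' B' :: "('a, 'm) module"
  assumes f: "A \<in> fgmod R" "B \<in> fgmod R" "A' \<in> fgmod R" "B' \<in> fgmod R" and iso: "mod_iso R A A'" "mod_iso R B B'"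
  shows "stab R A B \<longleftrightarrow> stab R A' B'"
proof -
  note s = iso_stab[OF iso(1) fgmodD[OF f(1)] fgmodD[OF f(3)]] iso_stab[OF iso(2) fgmodD[OF f(2)] fgmodD[OF f(4)]]
  show ?thesis
    using stab_trans[OF stab_trans[OF s(1) _ f(1,3,4)] stab_sym[OF s(2)] f(1,4,2)]
      stab_trans[OF stab_trans[OF stab_sym[OF s(1)] _ f(3,1,2)] s(2) f(3,2,4)] by blast
qed

lemma stab_syzygy_pow_cong:
  fixes A B A' B' :: "('a, 'm) module"
  assumes f: "A \<in> fgmod R" "B \<in> fgmod R" "A' \<in> fgmod R" "B' \<in> fgmod R" and iso: "mod_iso R A A'" "mod_iso R B B'"
  shows "stab R ((syzygy R ^^ n) A) ((syzygy R ^^ n) B) \<longleftrightarrow> stab R ((syzygy R ^^ n) A') ((syzygy R ^^ n) B')"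
  by (intro stab_cong syzygy_pow_fgmod syzygy_pow_iso f iso)

end

section \<open>The functor \<open>Hom(P, -)\<close>\<close>

locale corner = good_ring R U
  for R :: "('a, 'r) ring_scheme" and U :: "'m itself" +
  fixes e :: 'a
  assumes e_closed: "e \<in> carrier R" and e_idem: "e \<otimes>\<^bsub>R\<^esub> e = e"
begin

abbreviation P :: "('a, 'a) module" where "P \<equiv> left_ideal_module R e"

abbreviation HP :: "('a, 'n) module \<Rightarrow> ('a \<Rightarrow> 'a, 'a \<Rightarrow> 'n) module" where "HP X \<equiv> hom_module R P X"

definition Hm :: "('n \<Rightarrow> 'p) \<Rightarrow> ('a \<Rightarrow> 'n) \<Rightarrow> ('a \<Rightarrow> 'p)" where "Hm h f = compose (carrier P) h f"

definition Gm :: "('a \<Rightarrow> 'a) ring" where "Gm = opposite_ring (End_ring R P)"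

text \<open>The inverse of evaluation at \<open>e\<close>, which identifies Hom(P, X) with
  \<open>e X\<close>; see \<open>HP_val\<close>.\<close>

definition kap :: "('a, 'n) module \<Rightarrow> 'n \<Rightarrow> 'a \<Rightarrow> 'n" where "kap X y = (\<lambda>a\<in>carrier P. a \<odot>\<^bsub>X\<^esub> y)"

section \<open>The module \<open>P\<close>, its endomorphism ring and Hom(P, X)\<close>

lemma P_simps [simp]: "\<zero>\<^bsub>P\<^esub> = \<zero>\<^bsub>R\<^esub>" "x \<oplus>\<^bsub>P\<^esub> y = x \<oplus>\<^bsub>R\<^esub> y" "a \<odot>\<^bsub>P\<^esub> x = a \<otimes>\<^bsub>R\<^esub> x"
  by (simp_all add: left_ideal_module_def)

lemma P_carrier: "carrier P = {x \<in> carrier R. x \<otimes>\<^bsub>R\<^esub> e = x}"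
proof -
  interpret ring R by (rule ring_R)
  have "\<exists>y. x = y \<otimes>\<^bsub>R\<^esub> e \<and> y \<in> carrier R" if "x \<in> carrier R" "x \<otimes>\<^bsub>R\<^esub> e = x" for x using that by force
  then show ?thesis using e_closed e_idem by (auto simp: left_ideal_module_def m_assoc)
qed

lemma P_lm: "left_module R P"
proof -
  interpret ring R by (rule ring_R)
  interpret reg: left_module R "reg R" by (rule left_module_reg[OF ring_R])
  have "submodule (carrier P) R (reg R)"
    unfolding P_carrier by (rule reg.submoduleI) (auto simp: e_closed l_distr m_assoc)
  then have "left_module R (submod (reg R) (carrier P))" by (rule left_module_submod[OF reg.left_module_axioms])
  moreover have "submod (reg R) (carrier P) = P"
    by (simp add: submod_def reg_def left_ideal_module_def mk_module_def)
  ultimately show ?thesis by simp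
qed

lemma e_P: "e \<in> carrier P"
  by (simp add: P_carrier e_closed e_idem)

lemma P_R: "a \<in> carrier P \<Longrightarrow> a \<in> carrier R"
  by (simp add: P_carrier)

lemma P_fgmod: "P \<in> fgmod R"
proof (rule fgmod_image[OF fgmod_reg[OF ring_R] P_lm lhom_smult[OF P_lm e_P]])
  show "(\<lambda>a. a \<odot>\<^bsub>P\<^esub> e) ` carrier (reg R) = carrier P"
    by (auto simp: left_ideal_module_def)
qed

lemma HP_simps [simp]: "carrier (HP X) = mod_hom R P X" "\<zero>\<^bsub>HP X\<^esub> = (\<lambda>x\<in>carrier P. \<zero>\<^bsub>X\<^esub>)"
  "f \<oplus>\<^bsub>HP X\<^esub> g = (\<lambda>x\<in>carrier P. f x \<oplus>\<^bsub>X\<^esub> g x)" "\<gamma> \<odot>\<^bsub>HP X\<^esub> f = compose (carrier P) f \<gamma>"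
  by (simp_all add: hom_module_def)

lemma Gm_simps [simp]: "carrier Gm = mod_hom R P P" "\<zero>\<^bsub>Gm\<^esub> = (\<lambda>x\<in>carrier P. \<zero>\<^bsub>R\<^esub>)"
  "f \<oplus>\<^bsub>Gm\<^esub> g = (\<lambda>x\<in>carrier P. f x \<oplus>\<^bsub>R\<^esub> g x)" "f \<otimes>\<^bsub>Gm\<^esub> g = compose (carrier P) g f"
  "\<one>\<^bsub>Gm\<^esub> = (\<lambda>x\<in>carrier P. x)"
  by (simp_all add: Gm_def opposite_ring_def End_ring_def)

lemma HP_lhom: "f \<in> mod_hom R P X \<Longrightarrow> lhom R P X f"
  by (simp add: mod_hom_iff)

lemma HP_val: "\<lbrakk>f \<in> mod_hom R P X; a \<in> carrier P\<rbrakk> \<Longrightarrow> f a = a \<odot>\<^bsub>X\<^esub> f e"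
  using lhomD(3)[OF HP_lhom P_R e_P, of f X a] by (simp add: P_carrier)

lemma HP_e: "f \<in> mod_hom R P X \<Longrightarrow> f e \<in> carrier X" "f \<in> mod_hom R P X \<Longrightarrow> e \<odot>\<^bsub>X\<^esub> f e = f e"
  using lhomD(1)[OF HP_lhom e_P] HP_val[OF _ e_P, symmetric] by blast+

text \<open>A map out of \<open>P\<close> is determined by its value at the generator
  \<open>e\<close>. Most identities between elements of Hom modules below are checked at this single
  point.\<close>

lemma HP_eqI:
  assumes "f \<in> mod_hom R P X" "g \<in> mod_hom R P X" "f e = g e"
  shows "f = g"
proof (rule extensionalityI)
  show "f \<in> extensional (carrier P)" "g \<in> extensional (carrier P)" using assms by (simp_all add: mod_hom_iff)
  show "f a = g a" if "a \<in> carrier P" for a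
    using HP_val[OF assms(1) that] HP_val[OF assms(2) that] assms(3) by simp
qed

lemma HP_add: "\<lbrakk>left_module R X; f \<in> mod_hom R P X; g \<in> mod_hom R P X\<rbrakk> \<Longrightarrow> (\<lambda>x\<in>carrier P. f x \<oplus>\<^bsub>X\<^esub> g x) \<in> mod_hom R P X"
  using restrict_mod_hom[OF P_lm] lhom_add HP_lhom by blast

lemma HP_zero: "left_module R X \<Longrightarrow> (\<lambda>x\<in>carrier P. \<zero>\<^bsub>X\<^esub>) \<in> mod_hom R P X"
  using restrict_mod_hom[OF P_lm] lhom_zero by blast

lemma HP_neg: "\<lbrakk>left_module R X; f \<in> mod_hom R P X\<rbrakk> \<Longrightarrow> (\<lambda>x\<in>carrier P. \<ominus>\<^bsub>X\<^esub> f x) \<in> mod_hom R P X"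
  using restrict_mod_hom[OF P_lm] lhom_neg HP_lhom by blast

lemma HP_comp: "\<lbrakk>f \<in> mod_hom R P X; lhom R X Y h\<rbrakk> \<Longrightarrow> compose (carrier P) h f \<in> mod_hom R P Y"
  unfolding compose_def using restrict_mod_hom[OF P_lm] lhom_comp HP_lhom by blast

lemma HP_smult: "\<lbrakk>f \<in> mod_hom R P X; \<gamma> \<in> mod_hom R P P\<rbrakk> \<Longrightarrow> compose (carrier P) f \<gamma> \<in> mod_hom R P X"
  using HP_comp HP_lhom by blast

lemma HP_id: "(\<lambda>x\<in>carrier P. x) \<in> mod_hom R P P"
  using restrict_mod_hom[OF P_lm] lhom_id by blast

lemma comp_e: "compose (carrier P) f g e = f (g e)"
  using e_P by (simp add: compose_def)

lemma smult_e: "\<lbrakk>f \<in> mod_hom R P X; \<gamma> \<in> mod_hom R P P\<rbrakk> \<Longrightarrow> compose (carrier P) f \<gamma> e = \<gamma> e \<odot>\<^bsub>X\<^esub> f e"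
  using HP_val[of f X "\<gamma> e"] HP_e(1)[of \<gamma> P] by (simp add: comp_e)

lemma kap:
  assumes "left_module R X" "y \<in> carrier X"
  shows "kap X y \<in> mod_hom R P X" "kap X y e = e \<odot>\<^bsub>X\<^esub> y"
proof -
  interpret left_module R X by fact
  have "lhom R P X (\<lambda>a. a \<odot>\<^bsub>X\<^esub> y)"
    using assms(2) by (intro lhomI) (auto simp: P_R smult_l_distr smult_assoc1)
  then show "kap X y \<in> mod_hom R P X" unfolding kap_def using restrict_mod_hom[OF P_lm] by blast
  show "kap X y e = e \<odot>\<^bsub>X\<^esub> y" by (simp add: kap_def e_P)
qed

lemma HP_group:
  fixes X :: "('a, 'n) module"
  assumes X: "left_module R X"
  shows "abelian_group (HP X)"
proof -
  interpret X: left_module R X by fact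
  have c: "f e \<in> carrier X" if "f \<in> mod_hom R P X" for f using HP_e(1)[OF that] .
  note cl = HP_add[OF X] HP_zero[OF X] HP_smult
  show ?thesis
  proof (rule abelian_groupI)
    show "f \<oplus>\<^bsub>HP X\<^esub> g \<oplus>\<^bsub>HP X\<^esub> h = f \<oplus>\<^bsub>HP X\<^esub> (g \<oplus>\<^bsub>HP X\<^esub> h)" if "f \<in> carrier (HP X)" "g \<in> carrier (HP X)" "h \<in> carrier (HP X)" for f g h
      by (rule HP_eqI[of _ X], (use that in \<open>simp_all add: cl del: restrict_apply\<close>)[2], use that c in \<open>simp add: e_P X.M.a_assoc\<close>)
    show "f \<oplus>\<^bsub>HP X\<^esub> g = g \<oplus>\<^bsub>HP X\<^esub> f" if "f \<in> carrier (HP X)" "g \<in> carrier (HP X)" for f g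
      by (rule HP_eqI[of _ X]) (use that c in \<open>simp_all add: cl e_P X.M.a_comm\<close>)
    show "\<zero>\<^bsub>HP X\<^esub> \<oplus>\<^bsub>HP X\<^esub> f = f" if "f \<in> carrier (HP X)" for f
      by (rule HP_eqI[of _ X], (use that in \<open>simp_all add: cl del: restrict_apply\<close>)[2], use that c in \<open>simp add: e_P\<close>)
    show "\<exists>g\<in>carrier (HP X). g \<oplus>\<^bsub>HP X\<^esub> f = \<zero>\<^bsub>HP X\<^esub>" if f: "f \<in> carrier (HP X)" for f
    proof (rule bexI)
      let ?g = "\<lambda>x\<in>carrier P. \<ominus>\<^bsub>X\<^esub> f x"
      show g: "?g \<in> carrier (HP X)" using HP_neg[OF X] f by (simp del: restrict_apply)
      show "?g \<oplus>\<^bsub>HP X\<^esub> f = \<zero>\<^bsub>HP X\<^esub>"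
        by (rule HP_eqI[of _ X], (use f g in \<open>simp_all add: cl del: restrict_apply\<close>)[2], use f c[of f] X.M.l_neg[of "f e"] in \<open>simp add: e_P\<close>)
    qed
  qed (simp_all add: cl del: restrict_apply)
qed

lemma ring_Gm: "ring Gm"
proof -
  interpret ring R by (rule ring_R)
  interpret P: left_module R P by (rule P_lm)
  have c: "f e \<in> carrier R" if "f \<in> mod_hom R P P" for f using HP_e(1)[OF that] P_R by blast
  note cl = HP_add[OF P_lm, simplified] HP_zero[OF P_lm, simplified] HP_smult HP_id
  \<comment> \<open>\<open>Gm\<close> has the additive group of \<open>HP P\<close>, so the additive
    laws are borrowed and the remaining ones are verified at \<open>e\<close>.\<close>
  interpret H: abelian_group "HP P" by (rule HP_group[OF P_lm])
  have "abelian_group Gm"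
  proof (rule abelian_groupI)
    fix f g h assume f: "f \<in> carrier Gm"
    show "\<zero>\<^bsub>Gm\<^esub> \<oplus>\<^bsub>Gm\<^esub> f = f" using H.l_zero[of f] f by simp
    show "\<exists>g\<in>carrier Gm. g \<oplus>\<^bsub>Gm\<^esub> f = \<zero>\<^bsub>Gm\<^esub>"
      using H.l_neg[of f] H.a_inv_closed[of f] f by (intro bexI[of _ "\<ominus>\<^bsub>HP P\<^esub> f"]) simp_all
    assume g: "g \<in> carrier Gm"
    show "f \<oplus>\<^bsub>Gm\<^esub> g \<in> carrier Gm" using H.a_closed[of f g] f g by simp
    show "f \<oplus>\<^bsub>Gm\<^esub> g = g \<oplus>\<^bsub>Gm\<^esub> f" using H.a_comm[of f g] f g by simp
    assume "h \<in> carrier Gm"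
    then show "f \<oplus>\<^bsub>Gm\<^esub> g \<oplus>\<^bsub>Gm\<^esub> h = f \<oplus>\<^bsub>Gm\<^esub> (g \<oplus>\<^bsub>Gm\<^esub> h)" using H.a_assoc[of f g h] f g by simp
  qed (use cl in simp_all)
  moreover have "monoid Gm"
  proof (rule monoidI)
    show "f \<otimes>\<^bsub>Gm\<^esub> g \<otimes>\<^bsub>Gm\<^esub> h = f \<otimes>\<^bsub>Gm\<^esub> (g \<otimes>\<^bsub>Gm\<^esub> h)" if "f \<in> carrier Gm" "g \<in> carrier Gm" "h \<in> carrier Gm" for f g h
      by (rule HP_eqI[of _ P], (use that in \<open>simp_all add: cl\<close>)[2], use that HP_e(1)[of f P] in \<open>simp add: comp_e compose_eq\<close>)
    show "\<one>\<^bsub>Gm\<^esub> \<otimes>\<^bsub>Gm\<^esub> f = f" "f \<otimes>\<^bsub>Gm\<^esub> \<one>\<^bsub>Gm\<^esub> = f" if "f \<in> carrier Gm" for f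
      by (rule HP_eqI[of _ P], (use that in \<open>simp_all add: cl del: restrict_apply\<close>)[2], use that HP_e(1)[of f P] in \<open>simp add: comp_e e_P\<close>)+
  qed (simp_all add: cl del: restrict_apply)
  moreover have "(f \<oplus>\<^bsub>Gm\<^esub> g) \<otimes>\<^bsub>Gm\<^esub> h = f \<otimes>\<^bsub>Gm\<^esub> h \<oplus>\<^bsub>Gm\<^esub> g \<otimes>\<^bsub>Gm\<^esub> h"
    if "f \<in> carrier Gm" "g \<in> carrier Gm" "h \<in> carrier Gm" for f g h
  proof (rule HP_eqI[of _ P])
    show "(f \<oplus>\<^bsub>Gm\<^esub> g) \<otimes>\<^bsub>Gm\<^esub> h \<in> mod_hom R P P" "f \<otimes>\<^bsub>Gm\<^esub> h \<oplus>\<^bsub>Gm\<^esub> g \<otimes>\<^bsub>Gm\<^esub> h \<in> mod_hom R P P"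
      using that by (simp_all add: cl del: restrict_apply)
    show "((f \<oplus>\<^bsub>Gm\<^esub> g) \<otimes>\<^bsub>Gm\<^esub> h) e = (f \<otimes>\<^bsub>Gm\<^esub> h \<oplus>\<^bsub>Gm\<^esub> g \<otimes>\<^bsub>Gm\<^esub> h) e"
      using that lhomD(2)[OF HP_lhom[of h P], of "f e" "g e"] HP_e(1)[of f P] HP_e(1)[of g P] by (simp add: comp_e e_P)
  qed
  moreover have "h \<otimes>\<^bsub>Gm\<^esub> (f \<oplus>\<^bsub>Gm\<^esub> g) = h \<otimes>\<^bsub>Gm\<^esub> f \<oplus>\<^bsub>Gm\<^esub> h \<otimes>\<^bsub>Gm\<^esub> g"
    if "f \<in> carrier Gm" "g \<in> carrier Gm" "h \<in> carrier Gm" for f g h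
  proof (rule HP_eqI[of _ P])
    show "h \<otimes>\<^bsub>Gm\<^esub> (f \<oplus>\<^bsub>Gm\<^esub> g) \<in> mod_hom R P P" "h \<otimes>\<^bsub>Gm\<^esub> f \<oplus>\<^bsub>Gm\<^esub> h \<otimes>\<^bsub>Gm\<^esub> g \<in> mod_hom R P P"
      using that by (simp_all add: cl del: restrict_apply)
    show "(h \<otimes>\<^bsub>Gm\<^esub> (f \<oplus>\<^bsub>Gm\<^esub> g)) e = (h \<otimes>\<^bsub>Gm\<^esub> f \<oplus>\<^bsub>Gm\<^esub> h \<otimes>\<^bsub>Gm\<^esub> g) e"
      using that HP_e(1)[of h P] by (simp add: comp_e e_P)
  qed
  ultimately show ?thesis by (rule ringI)
qed

lemma HP_lm:
  fixes X :: "('a, 'n) module"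
  assumes X: "left_module R X"
  shows "left_module Gm (HP X)"
proof -
  interpret X: left_module R X by fact
  have c: "f e \<in> carrier X" if "f \<in> mod_hom R P X" for f using HP_e(1)[OF that] .
  note cl = HP_add[OF X] HP_zero[OF X] HP_smult
  note clP = HP_add[OF P_lm, simplified]
  show ?thesis
  proof (rule left_moduleI[OF ring_Gm HP_group[OF X]])
    fix \<gamma> \<delta> f g
    show "\<gamma> \<odot>\<^bsub>HP X\<^esub> f \<in> carrier (HP X)" if "\<gamma> \<in> carrier Gm" "f \<in> carrier (HP X)" using that by (simp add: cl)
    show "(\<gamma> \<oplus>\<^bsub>Gm\<^esub> \<delta>) \<odot>\<^bsub>HP X\<^esub> f = \<gamma> \<odot>\<^bsub>HP X\<^esub> f \<oplus>\<^bsub>HP X\<^esub> \<delta> \<odot>\<^bsub>HP X\<^esub> f"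
      if "\<gamma> \<in> carrier Gm" "\<delta> \<in> carrier Gm" "f \<in> carrier (HP X)"
    proof (rule HP_eqI[of _ X])
      show "(\<gamma> \<oplus>\<^bsub>Gm\<^esub> \<delta>) \<odot>\<^bsub>HP X\<^esub> f \<in> mod_hom R P X" "\<gamma> \<odot>\<^bsub>HP X\<^esub> f \<oplus>\<^bsub>HP X\<^esub> \<delta> \<odot>\<^bsub>HP X\<^esub> f \<in> mod_hom R P X"
        using that by (simp_all add: cl clP del: restrict_apply)
      show "((\<gamma> \<oplus>\<^bsub>Gm\<^esub> \<delta>) \<odot>\<^bsub>HP X\<^esub> f) e = (\<gamma> \<odot>\<^bsub>HP X\<^esub> f \<oplus>\<^bsub>HP X\<^esub> \<delta> \<odot>\<^bsub>HP X\<^esub> f) e"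
        using that lhomD(2)[OF HP_lhom[of f X], of "\<gamma> e" "\<delta> e"] HP_e(1)[of \<gamma> P] HP_e(1)[of \<delta> P] by (simp add: comp_e e_P)
    qed
    show "\<gamma> \<odot>\<^bsub>HP X\<^esub> (f \<oplus>\<^bsub>HP X\<^esub> g) = \<gamma> \<odot>\<^bsub>HP X\<^esub> f \<oplus>\<^bsub>HP X\<^esub> \<gamma> \<odot>\<^bsub>HP X\<^esub> g"
      if "\<gamma> \<in> carrier Gm" "f \<in> carrier (HP X)" "g \<in> carrier (HP X)"
    proof (rule HP_eqI[of _ X])
      show "\<gamma> \<odot>\<^bsub>HP X\<^esub> (f \<oplus>\<^bsub>HP X\<^esub> g) \<in> mod_hom R P X" "\<gamma> \<odot>\<^bsub>HP X\<^esub> f \<oplus>\<^bsub>HP X\<^esub> \<gamma> \<odot>\<^bsub>HP X\<^esub> g \<in> mod_hom R P X"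
        using that by (simp_all add: cl del: restrict_apply)
      show "(\<gamma> \<odot>\<^bsub>HP X\<^esub> (f \<oplus>\<^bsub>HP X\<^esub> g)) e = (\<gamma> \<odot>\<^bsub>HP X\<^esub> f \<oplus>\<^bsub>HP X\<^esub> \<gamma> \<odot>\<^bsub>HP X\<^esub> g) e"
        using that HP_e(1)[of \<gamma> P] by (simp add: comp_e e_P)
    qed
    show "(\<gamma> \<otimes>\<^bsub>Gm\<^esub> \<delta>) \<odot>\<^bsub>HP X\<^esub> f = \<gamma> \<odot>\<^bsub>HP X\<^esub> (\<delta> \<odot>\<^bsub>HP X\<^esub> f)"
      if "\<gamma> \<in> carrier Gm" "\<delta> \<in> carrier Gm" "f \<in> carrier (HP X)"
    proof (rule HP_eqI[of _ X])
      show "(\<gamma> \<otimes>\<^bsub>Gm\<^esub> \<delta>) \<odot>\<^bsub>HP X\<^esub> f \<in> mod_hom R P X" "\<gamma> \<odot>\<^bsub>HP X\<^esub> (\<delta> \<odot>\<^bsub>HP X\<^esub> f) \<in> mod_hom R P X"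
        using that by (simp_all add: cl)
      show "((\<gamma> \<otimes>\<^bsub>Gm\<^esub> \<delta>) \<odot>\<^bsub>HP X\<^esub> f) e = (\<gamma> \<odot>\<^bsub>HP X\<^esub> (\<delta> \<odot>\<^bsub>HP X\<^esub> f)) e"
        using that HP_e(1)[of \<gamma> P] by (simp add: comp_e compose_eq)
    qed
    show "\<one>\<^bsub>Gm\<^esub> \<odot>\<^bsub>HP X\<^esub> f = f" if "f \<in> carrier (HP X)"
      by (rule HP_eqI[of _ X], (use that in \<open>simp_all add: cl HP_id del: restrict_apply\<close>)[2], use that in \<open>simp add: comp_e e_P\<close>)
  qed
qed

text \<open>The \<open>\<Gamma>\<close>-submodules \<open>L\<close> of \<open>Hom(P, X)\<close> embed into the \<open>\<Lambda>\<close>-submodules of \<open>X\<close>.\<close>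

definition Up :: "('a, 'n) module \<Rightarrow> ('a \<Rightarrow> 'n) set \<Rightarrow> 'n set"
  where "Up X L = {x \<in> carrier X. \<forall>r\<in>carrier R. kap X (r \<odot>\<^bsub>X\<^esub> x) \<in> L}"

lemma Up:
  fixes X :: "('a, 'n) module"
  assumes X: "left_module R X" and L: "submodule L Gm (HP X)"
  shows "submodule (Up X L) R X" "f \<in> mod_hom R P X \<Longrightarrow> f e \<in> Up X L \<longleftrightarrow> f \<in> L"
proof -
  interpret X: left_module R X by fact
  interpret H: left_module Gm "HP X" by (rule HP_lm[OF X])
  note L' = H.submoduleD[OF L]
  show "submodule (Up X L) R X"
  proof (rule X.submoduleI)
    show "Up X L \<subseteq> carrier X" by (auto simp: Up_def)
    have "kap X \<zero>\<^bsub>X\<^esub> = \<zero>\<^bsub>HP X\<^esub>"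
      by (rule HP_eqI[OF kap(1)[OF X]]) (simp_all add: HP_zero[OF X] kap(2)[OF X] e_P e_closed)
    then show "\<zero>\<^bsub>X\<^esub> \<in> Up X L" using L'(2) by (simp add: Up_def)
    show "x \<oplus>\<^bsub>X\<^esub> y \<in> Up X L" if xy: "x \<in> Up X L" "y \<in> Up X L" for x y
    proof -
      have c: "x \<in> carrier X" "y \<in> carrier X" using xy by (auto simp: Up_def)
      have "kap X (r \<odot>\<^bsub>X\<^esub> (x \<oplus>\<^bsub>X\<^esub> y)) = kap X (r \<odot>\<^bsub>X\<^esub> x) \<oplus>\<^bsub>HP X\<^esub> kap X (r \<odot>\<^bsub>X\<^esub> y)" if r: "r \<in> carrier R" for r
      proof (rule HP_eqI[of _ X])
        show "kap X (r \<odot>\<^bsub>X\<^esub> (x \<oplus>\<^bsub>X\<^esub> y)) \<in> mod_hom R P X" using kap(1)[OF X] r c by simp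
        show "kap X (r \<odot>\<^bsub>X\<^esub> x) \<oplus>\<^bsub>HP X\<^esub> kap X (r \<odot>\<^bsub>X\<^esub> y) \<in> mod_hom R P X" using kap(1)[OF X] r c by (simp add: HP_add[OF X])
        show "kap X (r \<odot>\<^bsub>X\<^esub> (x \<oplus>\<^bsub>X\<^esub> y)) e = (kap X (r \<odot>\<^bsub>X\<^esub> x) \<oplus>\<^bsub>HP X\<^esub> kap X (r \<odot>\<^bsub>X\<^esub> y)) e"
          using kap(2)[OF X] r c by (simp add: e_P e_closed X.smult_r_distr)
      qed
      then show ?thesis using xy c L'(3) by (simp add: Up_def del: HP_simps)
    qed
    show "a \<odot>\<^bsub>X\<^esub> x \<in> Up X L" if "a \<in> carrier R" "x \<in> Up X L" for a x
      using that by (simp add: Up_def flip: X.smult_assoc1)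
  qed
  assume f: "f \<in> mod_hom R P X"
  have fe: "f e \<in> carrier X" "e \<odot>\<^bsub>X\<^esub> f e = f e" using HP_e[OF f] .
  show "f e \<in> Up X L \<longleftrightarrow> f \<in> L"
  proof
    assume "f e \<in> Up X L"
    then have "kap X (\<one>\<^bsub>R\<^esub> \<odot>\<^bsub>X\<^esub> f e) \<in> L" unfolding Up_def using X.R.one_closed by blast
    moreover have "kap X (\<one>\<^bsub>R\<^esub> \<odot>\<^bsub>X\<^esub> f e) = f"
      by (rule HP_eqI[OF kap(1)[OF X] f]) (use fe kap(2)[OF X] in simp_all)
    ultimately show "f \<in> L" by simp
  next
    assume fL: "f \<in> L"
    have "kap X (r \<odot>\<^bsub>X\<^esub> f e) \<in> L" if r: "r \<in> carrier R" for r
    proof -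
      have re: "r \<otimes>\<^bsub>R\<^esub> e \<in> carrier P" using r e_closed e_idem by (simp add: P_carrier X.R.m_assoc)
      \<comment> \<open>The endomorphism of \<open>P\<close> with value \<open>e r e\<close> at
        \<open>e\<close>: its action on \<open>f\<close> is \<open>kap\<close> of the multiple of
        \<open>f e\<close> by \<open>r\<close>.\<close>
      let ?g = "kap P (r \<otimes>\<^bsub>R\<^esub> e)"
      have g: "?g \<in> mod_hom R P P" "?g e = e \<otimes>\<^bsub>R\<^esub> (r \<otimes>\<^bsub>R\<^esub> e)" using kap[OF P_lm re] by simp_all
      have "compose (carrier P) f ?g = kap X (r \<odot>\<^bsub>X\<^esub> f e)"
      proof (rule HP_eqI[OF HP_smult[OF f g(1)] kap(1)[OF X]])
        show "r \<odot>\<^bsub>X\<^esub> f e \<in> carrier X" using r fe by simp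
        show "compose (carrier P) f ?g e = kap X (r \<odot>\<^bsub>X\<^esub> f e) e"
          unfolding smult_e[OF f g(1)] g(2) using kap(2)[OF X] r fe e_closed by (simp add: X.smult_assoc1)
      qed
      moreover have "?g \<odot>\<^bsub>HP X\<^esub> f \<in> L" using L'(4)[OF _ fL] g(1) by simp
      ultimately show ?thesis by simp
    qed
    then show "f e \<in> Up X L" using fe by (simp add: Up_def)
  qed
qed

text \<open>\<open>Up\<close> is strictly monotone, since a submodule is recovered from the values
  of its elements at \<open>e\<close>.\<close>

lemma flen_HP:
  fixes X :: "('a, 'n) module"
  assumes X: "left_module R X" "flen R X"
  shows "flen Gm (HP X)"
proof (rule flen_transport[OF X(2), of _ _ "Up X"])
  interpret H: left_module Gm "HP X" by (rule HP_lm[OF X(1)])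
  fix A B assume "(A, B) \<in> sub_rel Gm (HP X)"
  then have AB: "submodule A Gm (HP X)" "submodule B Gm (HP X)" "A \<subset> B" by (auto simp: sub_rel_def)
  then obtain f where f: "f \<in> B" "f \<notin> A" by blast
  have "f \<in> mod_hom R P X" using H.submoduleD(7)[OF AB(2) f(1)] by simp
  then have "f e \<in> Up X B" "f e \<notin> Up X A" using Up(2)[OF X(1)] AB f by blast+
  moreover have "Up X A \<subseteq> Up X B" using AB(3) by (auto simp: Up_def)
  ultimately show "(Up X A, Up X B) \<in> sub_rel R X" using Up(1)[OF X(1)] AB by (auto simp: sub_rel_def)
qed

text \<open>Left ideals of \<open>Gm\<close> are submodules of \<open>HP P\<close>, so finite length
  passes from \<open>P\<close> to \<open>Gm\<close>. The carrier type is that of the Hom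
  modules.\<close>

lemma good_Gm: "good_ring TYPE('a \<Rightarrow> 'm) Gm"
proof (rule good_ring.intro)
  show "ring Gm" by (rule ring_Gm)
  show "module_universe Gm TYPE('a \<Rightarrow> 'm)"
    unfolding Gm_def by (rule module_universe_End[OF ring_R e_closed e_idem universe])
  show "flen Gm (reg Gm)"
  proof (rule flen_transport[OF flen_HP[OF P_lm flen_fgmod[OF P_fgmod flen_reg]], of _ _ "\<lambda>A. A"])
    interpret H: left_module Gm "HP P" by (rule HP_lm[OF P_lm])
    interpret G: left_module Gm "reg Gm" by (rule left_module_reg[OF ring_Gm])
    have "submodule A Gm (HP P)" if "submodule A Gm (reg Gm)" for A
      using G.submoduleD[OF that] by (intro H.submoduleI) simp_all
    then show "(A, B) \<in> sub_rel Gm (HP P)" if "(A, B) \<in> sub_rel Gm (reg Gm)" for A B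
      using that by (simp add: sub_rel_def)
  qed
qed

sublocale G: good_ring Gm "TYPE('a \<Rightarrow> 'm)"
  by (rule good_Gm)

lemma HP_fgmod:
  fixes X :: "('a, 'n) module"
  assumes "X \<in> fgmod R"
  shows "HP X \<in> fgmod Gm"
  using noe_fgmod[OF HP_lm[OF fgmodD[OF assms]]] flen_HP[OF fgmodD[OF assms] flen_fgmod[OF assms flen_reg]]
  by (simp add: flen_def)

section \<open>Hom(P, -) on maps\<close>

lemma Hm_e: "Hm h f e = h (f e)"
  by (simp add: Hm_def comp_e)

lemma Hm_closed: "\<lbrakk>lhom R X Y h; f \<in> mod_hom R P X\<rbrakk> \<Longrightarrow> Hm h f \<in> mod_hom R P Y"
  unfolding Hm_def by (rule HP_comp)

lemma Hm_lhom:
  fixes X :: "('a, 'n) module" and Y :: "('a, 'p) module"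
  assumes XY: "left_module R X" "left_module R Y" and h: "lhom R X Y h"
  shows "lhom Gm (HP X) (HP Y) (Hm h)"
proof (rule lhomI)
  fix f g assume f: "f \<in> carrier (HP X)"
  then have f': "f \<in> mod_hom R P X" by simp
  show "Hm h f \<in> carrier (HP Y)" using Hm_closed[OF h f'] by simp
  { assume "g \<in> carrier (HP X)"
    then have g': "g \<in> mod_hom R P X" by simp
    show "Hm h (f \<oplus>\<^bsub>HP X\<^esub> g) = Hm h f \<oplus>\<^bsub>HP Y\<^esub> Hm h g"
    proof (rule HP_eqI[of _ Y])
      show "Hm h (f \<oplus>\<^bsub>HP X\<^esub> g) \<in> mod_hom R P Y" using Hm_closed[OF h HP_add[OF XY(1) f' g']] by simp
      show "Hm h f \<oplus>\<^bsub>HP Y\<^esub> Hm h g \<in> mod_hom R P Y" using HP_add[OF XY(2) Hm_closed[OF h f'] Hm_closed[OF h g']] by simp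
      show "Hm h (f \<oplus>\<^bsub>HP X\<^esub> g) e = (Hm h f \<oplus>\<^bsub>HP Y\<^esub> Hm h g) e"
        using lhomD(2)[OF h HP_e(1)[OF f'] HP_e(1)[OF g']] by (simp add: Hm_e e_P)
    qed }
  fix \<gamma> assume "\<gamma> \<in> carrier Gm"
  then have \<gamma>: "\<gamma> \<in> mod_hom R P P" by simp
  show "Hm h (\<gamma> \<odot>\<^bsub>HP X\<^esub> f) = \<gamma> \<odot>\<^bsub>HP Y\<^esub> Hm h f"
  proof (rule HP_eqI[of _ Y])
    show "Hm h (\<gamma> \<odot>\<^bsub>HP X\<^esub> f) \<in> mod_hom R P Y" using Hm_closed[OF h HP_smult[OF f' \<gamma>]] by simp
    show "\<gamma> \<odot>\<^bsub>HP Y\<^esub> Hm h f \<in> mod_hom R P Y" using HP_smult[OF Hm_closed[OF h f'] \<gamma>] by simp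
    show "Hm h (\<gamma> \<odot>\<^bsub>HP X\<^esub> f) e = (\<gamma> \<odot>\<^bsub>HP Y\<^esub> Hm h f) e"
      using HP_e(1)[OF \<gamma>] by (simp add: Hm_e comp_e) (simp add: Hm_def compose_def)
  qed
qed

lemma Hm_comp:
  assumes "f \<in> mod_hom R P X" "lhom R X Y h" "lhom R Y Z k"
  shows "Hm k (Hm h f) = Hm (\<lambda>x. k (h x)) f"
  by (rule HP_eqI[OF Hm_closed[OF assms(3) Hm_closed[OF assms(2,1)]] Hm_closed[OF lhom_comp[OF assms(2,3)] assms(1)]])
    (simp add: Hm_e)

lemma Hm_cong:
  assumes "f \<in> mod_hom R P X" "\<And>x. x \<in> carrier X \<Longrightarrow> h x = k x"
  shows "Hm h f = Hm k f"
  unfolding Hm_def compose_def using lhomD(1)[OF HP_lhom[OF assms(1)]] assms(2) by (intro restrict_ext) simp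

lemma Hm_id: "f \<in> mod_hom R P X \<Longrightarrow> Hm (\<lambda>x. x) f = f"
  by (rule HP_eqI[OF Hm_closed[OF lhom_id]]) (simp_all add: Hm_e)

lemma HP_retract:
  fixes X :: "('a, 'n) module" and Y :: "('a, 'p) module"
  assumes XY: "left_module R X" "left_module R Y" and ir: "retract R X Y i r"
  shows "retract Gm (HP X) (HP Y) (Hm i) (Hm r)"
proof -
  have i: "lhom R X Y i" and r: "lhom R Y X r" and ri: "\<And>x. x \<in> carrier X \<Longrightarrow> r (i x) = x"
    using ir by (auto simp: retract_def)
  have "Hm r (Hm i f) = f" if "f \<in> mod_hom R P X" for f
    by (rule HP_eqI[OF Hm_closed[OF r Hm_closed[OF i that]] that]) (simp add: Hm_e ri[OF HP_e(1)[OF that]])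
  then show ?thesis unfolding retract_def using Hm_lhom[OF XY i] Hm_lhom[OF XY(2,1) r] by simp
qed

lemma HP_iso:
  fixes X :: "('a, 'n) module" and Y :: "('a, 'p) module"
  assumes XY: "left_module R X" "left_module R Y" and iso: "mod_iso R X Y"
  shows "mod_iso Gm (HP X) (HP Y)"
proof -
  obtain i r where "retract R X Y i r" "retract R Y X r i" using iso_retract[OF iso XY] by metis
  then have "retract Gm (HP X) (HP Y) (Hm i) (Hm r)" "retract Gm (HP Y) (HP X) (Hm r) (Hm i)"
    using HP_retract XY by blast+
  then show ?thesis
    unfolding retract_def by (intro mod_isoI[OF HP_lm[OF XY(1)] HP_lm[OF XY(2)], of "Hm i" "Hm r"]) auto
qed

text \<open>Left exactness as an equality of modules, not only an isomorphism: a map into the kernel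
  is literally a map into \<open>Q\<close>.\<close>

lemma HP_kernel:
  fixes Q :: "('a, 'n) module" and X :: "('a, 'p) module"
  assumes QX: "left_module R Q" "left_module R X" and p: "lhom R Q X p"
  shows "HP (submod Q (hom_ker Q X p)) = submod (HP Q) (hom_ker (HP Q) (HP X) (Hm p))"
proof -
  interpret X: left_module R X by fact
  let ?K = "hom_ker Q X p"
  have "mod_hom R P (submod Q ?K) = hom_ker (HP Q) (HP X) (Hm p)"
  proof (rule subset_antisym)
    show "mod_hom R P (submod Q ?K) \<subseteq> hom_ker (HP Q) (HP X) (Hm p)"
    proof
      fix f assume f: "f \<in> mod_hom R P (submod Q ?K)"
      have fQ: "f \<in> mod_hom R P Q" using f by (auto simp: mod_hom_iff hom_ker_def intro: lhom_submodD)
      have "f e \<in> ?K" using HP_e(1)[OF f] by simp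
      then have "Hm p f = \<zero>\<^bsub>HP X\<^esub>"
        by (intro HP_eqI[of _ X]) (simp_all add: Hm_closed[OF p fQ] HP_zero[OF QX(2)] Hm_e e_P hom_ker_def)
      then show "f \<in> hom_ker (HP Q) (HP X) (Hm p)" using fQ by (simp add: hom_ker_def)
    qed
    show "hom_ker (HP Q) (HP X) (Hm p) \<subseteq> mod_hom R P (submod Q ?K)"
    proof
      fix f assume "f \<in> hom_ker (HP Q) (HP X) (Hm p)"
      then have f: "f \<in> mod_hom R P Q" "Hm p f = \<zero>\<^bsub>HP X\<^esub>" by (simp_all add: hom_ker_def)
      have "f a \<in> ?K" if a: "a \<in> carrier P" for a
        using fun_cong[OF f(2), of a] lhomD(1)[OF HP_lhom[OF f(1)] a] a by (simp add: Hm_def compose_def hom_ker_def)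
      then show "f \<in> mod_hom R P (submod Q ?K)" using f(1) by (simp add: mod_hom_iff lhom_submodI)
    qed
  qed
  then show ?thesis by (simp add: hom_module_def submod_def mk_module_def)
qed

text \<open>A preimage \<open>y\<close> of \<open>f e\<close> gives the lift \<open>kap Q y\<close>:
  its value \<open>e y\<close> at \<open>e\<close> is mapped to \<open>e\<close> times
  \<open>f e\<close>, which is \<open>f e\<close>.\<close>

lemma HP_surj:
  fixes Q :: "('a, 'n) module" and X :: "('a, 'p) module"
  assumes QX: "left_module R Q" "left_module R X" and p: "lhom R Q X p" "p ` carrier Q = carrier X"
  shows "Hm p ` carrier (HP Q) = carrier (HP X)"
proof
  interpret Q: left_module R Q by fact
  interpret X: left_module R X by fact
  show "Hm p ` carrier (HP Q) \<subseteq> carrier (HP X)" using Hm_closed[OF p(1)] by auto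
  show "carrier (HP X) \<subseteq> Hm p ` carrier (HP Q)"
  proof
    fix f assume "f \<in> carrier (HP X)"
    then have f: "f \<in> mod_hom R P X" by simp
    then have "f e \<in> p ` carrier Q" using HP_e(1)[OF f] p(2) by simp
    then obtain y where y: "y \<in> carrier Q" "f e = p y" by blast
    have "Hm p (kap Q y) = f"
    proof (rule HP_eqI[OF Hm_closed[OF p(1) kap(1)[OF QX(1) y(1)]] f])
      have "p (e \<odot>\<^bsub>Q\<^esub> y) = e \<odot>\<^bsub>X\<^esub> f e" using lhomD(3)[OF p(1) e_closed y(1)] y(2) by simp
      then show "Hm p (kap Q y) e = f e" using HP_e(2)[OF f] by (simp add: Hm_e kap(2)[OF QX(1) y(1)])
    qed
    then show "f \<in> Hm p ` carrier (HP Q)" using kap(1)[OF QX(1) y(1)] by (metis HP_simps(1) imageI)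
  qed
qed

lemma HP_zero_module: "zero_module X \<Longrightarrow> left_module R X \<Longrightarrow> zero_module (HP X)"
proof -
  assume Z: "zero_module X" "left_module R X"
  have "f = (\<lambda>x\<in>carrier P. \<zero>\<^bsub>X\<^esub>)" if f: "f \<in> mod_hom R P X" for f
    by (rule HP_eqI[OF f HP_zero[OF Z(2)]]) (use HP_e(1)[OF f] Z(1) in \<open>simp add: zero_module_def e_P\<close>)
  then have "mod_hom R P X = {\<lambda>x\<in>carrier P. \<zero>\<^bsub>X\<^esub>}" using HP_zero[OF Z(2)] by blast
  then show "zero_module (HP X)" unfolding zero_module_def HP_simps .
qed

lemma thru_HP:
  fixes X :: "('a, 'n) module" and Y :: "('a, 'p) module" and M :: "('a, 'q) module"
  assumes th: "thru R M X Y h" and XY: "left_module R X" "left_module R Y" "left_module R M"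
  shows "thru Gm (HP M) (HP X) (HP Y) (Hm h)"
  using th
proof (induction rule: thru.induct)
  case (zero h)
  have h: "lhom R X Y h" using lhom_cong[OF XY(1), of h "\<lambda>x. \<zero>\<^bsub>Y\<^esub>" Y] zero lhom_zero[OF XY(2)] by simp
  show ?case
  proof (rule thru.zero)
    fix f assume "f \<in> carrier (HP X)"
    then have f: "f \<in> mod_hom R P X" by simp
    show "Hm h f = \<zero>\<^bsub>HP Y\<^esub>"
      by (rule HP_eqI[OF Hm_closed[OF h f]]) (simp_all add: HP_zero[OF XY(2)] Hm_e e_P zero[OF HP_e(1)[OF f]])
  qed
next
  case (step h g f k)
  have h: "lhom R X Y h" by (rule thru_lhom[OF step.hyps(1) XY(1,2)])
  have fg: "lhom R X Y (\<lambda>x. f (g x))" by (rule lhom_comp[OF step.hyps(2,3)])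
  have k: "lhom R X Y k"
    using lhom_cong[OF XY(1), of k "\<lambda>x. h x \<oplus>\<^bsub>Y\<^esub> f (g x)" Y] step.hyps(4) lhom_add[OF XY(2) h fg] by simp
  show ?case
  proof (rule thru.step[OF step.IH Hm_lhom[OF XY(1,3) step.hyps(2)] Hm_lhom[OF XY(3,2) step.hyps(3)]])
    fix u assume "u \<in> carrier (HP X)"
    then have u: "u \<in> mod_hom R P X" by simp
    have v: "Hm f (Hm g u) \<in> mod_hom R P Y" by (rule Hm_closed[OF step.hyps(3) Hm_closed[OF step.hyps(2) u]])
    show "Hm k u = Hm h u \<oplus>\<^bsub>HP Y\<^esub> Hm f (Hm g u)"
    proof (rule HP_eqI[OF Hm_closed[OF k u]])
      show "Hm h u \<oplus>\<^bsub>HP Y\<^esub> Hm f (Hm g u) \<in> mod_hom R P Y" using HP_add[OF XY(2) Hm_closed[OF h u] v] by simp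
      show "Hm k u e = (Hm h u \<oplus>\<^bsub>HP Y\<^esub> Hm f (Hm g u)) e" by (simp add: Hm_e e_P step.hyps(4)[OF HP_e(1)[OF u]])
    qed
  qed
qed

text \<open>A composite \<open>f g\<close> with \<open>g x\<close> in \<open>P\<close> takes the
  value \<open>g x\<close> times \<open>f e\<close>. For the identity this shows that a module in
  add \<open>P\<close> is generated by the values at \<open>e\<close> of the maps from
  \<open>P\<close>.\<close>

lemma thru_generated:
  fixes X :: "('a, 'n) module" and Y :: "('a, 'p) module"
  assumes th: "thru R P X Y k" and Y: "left_module R Y" and H: "submodule H R Y" "\<And>f. f \<in> mod_hom R P Y \<Longrightarrow> f e \<in> H"
    and x: "x \<in> carrier X"
  shows "k x \<in> H"
  using th
proof (induction rule: thru.induct)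
  case (zero h) then show ?case using left_module.submoduleD(2)[OF Y H(1)] x by simp
next
  case (step h g f k)
  have f: "restrict f (carrier P) \<in> mod_hom R P Y" using restrict_mod_hom[OF P_lm] step.hyps(3) by blast
  have gx: "g x \<in> carrier P" using lhomD(1)[OF step.hyps(2) x] .
  have "f (g x) = g x \<odot>\<^bsub>Y\<^esub> f e" using HP_val[OF f gx] gx e_P by simp
  moreover have "f e \<in> H" using H(2)[OF f] e_P by simp
  ultimately have "f (g x) \<in> H" using left_module.submoduleD(4)[OF Y H(1) P_R[OF gx]] by simp
  then show ?case using left_module.submoduleD(3)[OF Y H(1) step.IH] step.hyps(4)[OF x] by simp
qed

text \<open>Yoneda at \<open>P\<close>: on a composite through \<open>f : P -> Y\<close>, the map
  \<open>\<phi>\<close> is determined by \<open>\<phi> f\<close>, which is itself a map from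
  \<open>P\<close> to \<open>N\<close> and can be composed with \<open>g\<close>.\<close>

lemma thru_full:
  fixes X :: "('a, 'n) module" and Y :: "('a, 'p) module" and N :: "('a, 'q) module"
  assumes th: "thru R P X Y k" and l: "left_module R X" "left_module R Y" "left_module R N"
    and \<phi>: "lhom Gm (HP Y) (HP N) \<phi>"
  shows "\<exists>m. lhom R X N m \<and> (\<forall>u\<in>mod_hom R P X. \<phi> (Hm k u) = Hm m u)"
  using th
proof (induction rule: thru.induct)
  case (zero h)
  have h: "lhom R X Y h" using lhom_cong[OF l(1), of h "\<lambda>x. \<zero>\<^bsub>Y\<^esub>" Y] zero lhom_zero[OF l(2)] by simp
  have "\<phi> (Hm h u) = Hm (\<lambda>x. \<zero>\<^bsub>N\<^esub>) u" if u: "u \<in> mod_hom R P X" for u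
  proof -
    have "Hm h u = \<zero>\<^bsub>HP Y\<^esub>"
      by (rule HP_eqI[OF Hm_closed[OF h u]]) (simp_all add: HP_zero[OF l(2)] Hm_e e_P zero[OF HP_e(1)[OF u]])
    then have "\<phi> (Hm h u) = \<zero>\<^bsub>HP N\<^esub>" using lhomZ(1)[OF \<phi> HP_lm[OF l(2)] HP_lm[OF l(3)]] by simp
    then show ?thesis by (simp add: Hm_def compose_def)
  qed
  then show ?case using lhom_zero[OF l(3), of X] by blast
next
  case (step h g f k)
  obtain m where m: "lhom R X N m" "\<forall>u\<in>mod_hom R P X. \<phi> (Hm h u) = Hm m u" using step.IH by blast
  have h: "lhom R X Y h" by (rule thru_lhom[OF step.hyps(1) l(1,2)])
  have fg: "lhom R X Y (\<lambda>x. f (g x))" by (rule lhom_comp[OF step.hyps(2,3)])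
  have k: "lhom R X Y k"
    using lhom_cong[OF l(1), of k "\<lambda>x. h x \<oplus>\<^bsub>Y\<^esub> f (g x)" Y] step.hyps(4) lhom_add[OF l(2) h fg] by simp
  let ?f = "restrict f (carrier P)"
  have f: "?f \<in> mod_hom R P Y" using restrict_mod_hom[OF P_lm] step.hyps(3) by blast
  have \<phi>f: "\<phi> ?f \<in> mod_hom R P N" using lhomD(1)[OF \<phi>, of ?f] f by simp
  let ?m = "\<lambda>x. m x \<oplus>\<^bsub>N\<^esub> \<phi> ?f (g x)"
  have m': "lhom R X N ?m" by (rule lhom_add[OF l(3) m(1) lhom_comp[OF step.hyps(2) HP_lhom[OF \<phi>f]]])
  have "\<phi> (Hm k u) = Hm ?m u" if u: "u \<in> mod_hom R P X" for u
  proof -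
    have gu: "Hm g u \<in> mod_hom R P P" by (rule Hm_closed[OF step.hyps(2) u])
    have fgu: "Hm g u \<odot>\<^bsub>HP Y\<^esub> ?f \<in> mod_hom R P Y" using HP_smult[OF f gu] by simp
    \<comment> \<open>The composite applied to \<open>u\<close> is the action of the endomorphism
      \<open>Hm g u\<close> of \<open>P\<close> on \<open>f\<close>, so linearity of
      \<open>\<phi>\<close> over \<open>Gm\<close> applies.\<close>
    have "Hm k u = Hm h u \<oplus>\<^bsub>HP Y\<^esub> Hm g u \<odot>\<^bsub>HP Y\<^esub> ?f"
    proof (rule HP_eqI[OF Hm_closed[OF k u]])
      show "Hm h u \<oplus>\<^bsub>HP Y\<^esub> Hm g u \<odot>\<^bsub>HP Y\<^esub> ?f \<in> mod_hom R P Y" using HP_add[OF l(2) Hm_closed[OF h u] fgu] by simp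
      show "Hm k u e = (Hm h u \<oplus>\<^bsub>HP Y\<^esub> Hm g u \<odot>\<^bsub>HP Y\<^esub> ?f) e"
        using lhomD(1)[OF step.hyps(2) HP_e(1)[OF u]] by (simp add: Hm_e comp_e e_P step.hyps(4)[OF HP_e(1)[OF u]])
    qed
    then have "\<phi> (Hm k u) = \<phi> (Hm h u) \<oplus>\<^bsub>HP N\<^esub> Hm g u \<odot>\<^bsub>HP N\<^esub> \<phi> ?f"
      using lhomD(2)[OF \<phi>, of "Hm h u" "Hm g u \<odot>\<^bsub>HP Y\<^esub> ?f"] Hm_closed[OF h u] fgu lhomD(3)[OF \<phi>, of "Hm g u" ?f] gu f
      by (simp del: HP_simps(3,4))
    also have "\<dots> = Hm ?m u"
    proof (rule HP_eqI[OF _ Hm_closed[OF m' u]])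
      have "\<phi> (Hm h u) \<in> mod_hom R P N" using Hm_closed[OF m(1) u] m(2) u by simp
      then show "\<phi> (Hm h u) \<oplus>\<^bsub>HP N\<^esub> Hm g u \<odot>\<^bsub>HP N\<^esub> \<phi> ?f \<in> mod_hom R P N"
        using HP_add[OF l(3) _ HP_smult[OF \<phi>f gu]] by simp
      show "(\<phi> (Hm h u) \<oplus>\<^bsub>HP N\<^esub> Hm g u \<odot>\<^bsub>HP N\<^esub> \<phi> ?f) e = Hm ?m u e"
        using m(2) u by (simp add: Hm_e comp_e e_P)
    qed
    finally show ?thesis .
  qed
  then show ?case using m' by blast
qed

section \<open>The category add \<open>P\<close> and projective modules over \<Gamma>\<close>

definition addP :: "('a, 'm) module \<Rightarrow> bool"
  where "addP Q \<longleftrightarrow> Q \<in> fgmod R \<and> thru R P Q Q (\<lambda>x. x)"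

lemma addP_iff: "addP Q \<longleftrightarrow> Q \<in> add_cat R P"
  by (simp add: addP_def add_cat_iff[OF P_lm])

text \<open>\<open>HP P\<close> is free on the identity of \<open>P\<close>, so maps out of it lift;
  the lifts along the composites in \<open>thru\<close> add up.\<close>

lemma addP_projective:
  assumes Q: "addP Q"
  shows "projective Gm (HP Q)"
proof (rule projectiveI)
  have fQ: "Q \<in> fgmod R" and th: "thru R P Q Q (\<lambda>x. x)" using Q by (auto simp: addP_def)
  note lQ = fgmodD[OF fQ]
  show "HP Q \<in> fgmod Gm" by (rule HP_fgmod[OF fQ])
  fix A B :: "('a \<Rightarrow> 'a, 'a \<Rightarrow> 'm) module" and g f
  assume AB: "A \<in> fgmod Gm" "B \<in> fgmod Gm" "lhom Gm A B g" "lhom Gm (HP Q) B f" "g ` carrier A = carrier B"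
  have lA: "left_module Gm A" and lB: "left_module Gm B" using AB fgmodD by blast+
  have lift: "\<exists>h. lhom Gm (HP P) A h \<and> (\<forall>x\<in>carrier (HP P). g (h x) = f' x)" if f': "lhom Gm (HP P) B f'" for f'
  proof -
    let ?i = "\<lambda>x\<in>carrier P. x"
    have "f' ?i \<in> g ` carrier A" unfolding AB(5) using lhomD(1)[OF f', of ?i] HP_id by simp
    then obtain a where a: "a \<in> carrier A" "f' ?i = g a" by blast
    have "lhom Gm (HP P) A (\<lambda>\<gamma>. \<gamma> \<odot>\<^bsub>A\<^esub> a)"
      using lhom_smult[OF lA a(1)] by (simp add: lhom_def)
    moreover have "g (\<gamma> \<odot>\<^bsub>A\<^esub> a) = f' \<gamma>" if \<gamma>: "\<gamma> \<in> carrier (HP P)" for \<gamma>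
    proof -
      have "\<gamma> \<odot>\<^bsub>HP P\<^esub> ?i = \<gamma>"
        by (rule HP_eqI[of _ P]) (use \<gamma> HP_smult[OF HP_id, of \<gamma>] HP_e(1)[of \<gamma> P] in \<open>simp_all add: comp_e\<close>)
      then have "f' \<gamma> = \<gamma> \<odot>\<^bsub>B\<^esub> f' ?i" using lhomD(3)[OF f', of \<gamma> ?i] \<gamma> HP_id by simp
      then show ?thesis using lhomD(3)[OF AB(3), of \<gamma> a] a \<gamma> by simp
    qed
    ultimately show ?thesis by blast
  qed
  \<comment> \<open>Stated for any source \<open>X\<close> and any sum \<open>k\<close> of
    composites through \<open>HP P\<close>, as induction on \<open>thru\<close> demands; in the end
    \<open>k\<close> is the identity.\<close>
  have "\<exists>h. lhom Gm X A h \<and> (\<forall>x\<in>carrier X. g (h x) = f (k x))" if thk: "thru Gm (HP P) X (HP Q) k" and lX: "left_module Gm X" for X :: "('a \<Rightarrow> 'a, 'a \<Rightarrow> 'm) module" and k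
    using thk
  proof (induction rule: thru.induct)
    case (zero k)
    then show ?case
      using lhom_zero[OF lA, of X] lhomZ(1)[OF AB(3) lA lB] lhomZ(1)[OF AB(4) HP_lm[OF lQ] lB]
      by (intro exI[of _ "\<lambda>x. \<zero>\<^bsub>A\<^esub>"]) (simp del: HP_simps)
  next
    case (step k i j l)
    obtain h where h: "lhom Gm X A h" "\<forall>x\<in>carrier X. g (h x) = f (k x)" using step.IH by blast
    obtain h' where h': "lhom Gm (HP P) A h'" "\<forall>x\<in>carrier (HP P). g (h' x) = f (j x)"
      using lift[OF lhom_comp[OF step.hyps(3) AB(4)]] by blast
    have "lhom Gm X A (\<lambda>x. h x \<oplus>\<^bsub>A\<^esub> h' (i x))" by (rule lhom_add[OF lA h(1) lhom_comp[OF step.hyps(2) h'(1)]])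
    moreover have "g (h x \<oplus>\<^bsub>A\<^esub> h' (i x)) = f (l x)" if x: "x \<in> carrier X" for x
    proof -
      note ix = lhomD(1)[OF step.hyps(2) x]
      have kx: "k x \<in> carrier (HP Q)" by (rule lhomD(1)[OF thru_lhom[OF step.hyps(1) lX HP_lm[OF lQ]] x])
      show ?thesis
        using lhomD(2)[OF AB(3) lhomD(1)[OF h(1) x] lhomD(1)[OF h'(1) ix]] h(2) h'(2) x ix
          lhomD(2)[OF AB(4) kx lhomD(1)[OF step.hyps(3) ix]] step.hyps(4)[OF x] by (simp del: HP_simps)
    qed
    ultimately show ?case by blast
  qed
  note lift2 = this
  have "thru Gm (HP P) (HP Q) (HP Q) (Hm (\<lambda>x. x))" by (rule thru_HP[OF th lQ lQ P_lm])
  then have "thru Gm (HP P) (HP Q) (HP Q) (\<lambda>x. x)" by (rule thru_cong) (simp add: Hm_id)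
  then show "\<exists>h. lhom Gm (HP Q) A h \<and> (\<forall>x\<in>carrier (HP Q). g (h x) = f x)"
    by (rule lift2[OF _ HP_lm[OF lQ]])
qed

lemma addP_generated:
  assumes Q: "addP Q" and H: "submodule H R Q" "\<And>f. f \<in> mod_hom R P Q \<Longrightarrow> f e \<in> H"
  shows "H = carrier Q"
proof -
  have fQ: "left_module R Q" and th: "thru R P Q Q (\<lambda>x. x)" using Q by (auto simp: addP_def fgmodD)
  show ?thesis using thru_generated[OF th fQ H(1)] H(2) left_module.submoduleD(1)[OF fQ H(1)] by blast
qed

text \<open>If \<open>L\<close> supplements the kernel of \<open>Hm p\<close>, then the kernel of
  \<open>p\<close> plus \<open>Up Q L\<close> contains all values \<open>f e\<close>, hence is
  \<open>Q\<close> by \<open>addP_generated\<close>. Minimality of the cover makes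
  \<open>Up Q L\<close> all of \<open>Q\<close>, and so \<open>L\<close> is everything.\<close>

lemma HP_cover:
  fixes X Q :: "('a, 'm) module"
  assumes X: "X \<in> fgmod R" and c: "proj_cover R X Q p" and Q: "addP Q"
  shows "proj_cover Gm (HP X) (HP Q) (restrict (Hm p) (carrier (HP Q)))"
proof -
  note c' = proj_coverD[OF c]
  have lX: "left_module R X" by (rule fgmodD[OF X])
  interpret Q: left_module R Q by (rule c')
  interpret H: left_module Gm "HP Q" by (rule HP_lm[OF c'(3)])
  have hp: "lhom Gm (HP Q) (HP X) (Hm p)" by (rule Hm_lhom[OF c'(3) lX c'(4)])
  have "L = carrier (HP Q)" if L: "submodule L Gm (HP Q)" "hom_ker (HP Q) (HP X) (Hm p) <+>\<^bsub>HP Q\<^esub> L = carrier (HP Q)" for L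
  proof -
    note U = Up[OF c'(3) L(1)]
    have K: "submodule (hom_ker Q X p) R Q" by (rule submodule_ker[OF c'(3) lX c'(4)])
    note s = submodule_sum[OF c'(3) K U(1)]
    have "f e \<in> hom_ker Q X p <+>\<^bsub>Q\<^esub> Up Q L" if f: "f \<in> mod_hom R P Q" for f
    proof -
      have "f \<in> hom_ker (HP Q) (HP X) (Hm p) <+>\<^bsub>HP Q\<^esub> L" unfolding L(2) using f by simp
      then obtain k l where kl: "k \<in> hom_ker (HP Q) (HP X) (Hm p)" "l \<in> L" "f = k \<oplus>\<^bsub>HP Q\<^esub> l" unfolding set_add_iff by blast
      have k: "k \<in> mod_hom R P Q" "Hm p k = \<zero>\<^bsub>HP X\<^esub>" using kl(1) by (simp_all add: hom_ker_def)
      have l: "l \<in> mod_hom R P Q" using H.submoduleD(7)[OF L(1) kl(2)] by simp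
      have "p (k e) = \<zero>\<^bsub>X\<^esub>" using fun_cong[OF k(2), of e] by (simp add: Hm_e e_P)
      then have "k e \<in> hom_ker Q X p" using HP_e(1)[OF k(1)] by (simp add: hom_ker_def)
      moreover have "l e \<in> Up Q L" using U(2)[OF l] kl(2) by simp
      moreover have "f e = k e \<oplus>\<^bsub>Q\<^esub> l e" unfolding kl(3) by (simp add: e_P)
      ultimately show ?thesis unfolding set_add_iff by blast
    qed
    then have "hom_ker Q X p <+>\<^bsub>Q\<^esub> Up Q L = carrier Q" by (rule addP_generated[OF Q s(1)])
    then have eq: "Up Q L = carrier Q" by (rule c'(6)[OF U(1)])
    have "f \<in> L" if f: "f \<in> mod_hom R P Q" for f using U(2)[OF f] eq HP_e(1)[OF f] by simp
    then show ?thesis using H.submoduleD(1)[OF L(1)] by auto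
  qed
  moreover have "hom_ker (HP Q) (HP X) (restrict (Hm p) (carrier (HP Q))) = hom_ker (HP Q) (HP X) (Hm p)"
    by (auto simp: hom_ker_def)
  ultimately show ?thesis
    unfolding proj_cover_def
    using addP_projective[OF Q] restrict_mod_hom[OF HP_lm[OF c'(3)], of "Hm p" "HP X"] hp HP_surj[OF c'(3) lX c'(4,5)]
    by simp
qed

lemma HP_syzygy:
  fixes X Q :: "('a, 'm) module"
  assumes X: "X \<in> fgmod R" and c: "proj_cover R X Q p" "syzygy R X = submod Q (hom_ker Q X p)" and Q: "addP Q"
  shows "mod_iso Gm (HP (syzygy R X)) (syzygy Gm (HP X))"
proof -
  note fH = HP_fgmod[OF X]
  obtain Q' p' where Q': "proj_cover Gm (HP X) Q' p'" "syzygy Gm (HP X) = submod Q' (hom_ker Q' (HP X) p')"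
    using G.syzygyE[OF fH] by metis
  have "hom_ker (HP Q) (HP X) (restrict (Hm p) (carrier (HP Q))) = hom_ker (HP Q) (HP X) (Hm p)"
    by (auto simp: hom_ker_def)
  then show ?thesis
    using G.cover_kernel_iso[OF fH fH mod_iso_refl[OF fgmodD[OF fH]] HP_cover[OF X c(1) Q] Q'(1)]
      HP_kernel[OF proj_coverD(3)[OF c(1)] fgmodD[OF X] proj_coverD(4)[OF c(1)]] c(2) Q'(2) by simp
qed

end

section \<open>Modules with a resolution in \<open>add P\<close>\<close>

context corner
begin

abbreviation Pinf :: "('a, 'm) module set" where "Pinf \<equiv> P_inf R P"

lemma P_infD: "Y \<in> Pinf \<Longrightarrow> Y \<in> fgmod R" "Y \<in> Pinf \<Longrightarrow> left_module R Y"
  by (auto simp: P_inf_def fgmodD)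

text \<open>Dropping the first term of the resolution leaves a resolution of the kernel, with terms
  still in add \<open>P\<close>.\<close>

lemma P_inf_presentation:
  assumes Y: "Y \<in> Pinf"
  obtains F p where "addP F" "projective R F" "lhom R F Y p" "p ` carrier F = carrier Y" "submod F (hom_ker F Y p) \<in> Pinf"
proof -
  obtain F D p where r: "proj_resolution R Y F D p" and F: "\<And>n. F n \<in> add_cat R P" using Y unfolding P_inf_def by blast
  note d = proj_resolutionD[OF P_infD(1)[OF Y] r]
  let ?K = "submod (F 0) (D 0 ` carrier (F 1))"
  have "D 0 \<in> mod_hom R (F (Suc 0)) (F 0)" "D (Suc 0) ` carrier (F (Suc (Suc 0))) = hom_ker (F (Suc 0)) (F 0) (D 0)"
    using r unfolding proj_resolution_def by blast+
  then have D0: "D 0 \<in> mod_hom R (F (Suc 0)) ?K" "D (Suc 0) ` carrier (F (Suc (Suc 0))) = hom_ker (F (Suc 0)) ?K (D 0)"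
    by (auto simp: mod_hom_iff hom_ker_def intro: lhom_submodI)
  have "proj_resolution R ?K (\<lambda>n. F (Suc n)) (\<lambda>n. D (Suc n)) (D 0)"
    using r D0 unfolding proj_resolution_def by simp
  moreover have "?K \<in> fgmod R" using d(4)[of "Suc 0"] by simp
  ultimately have "?K \<in> Pinf" using F unfolding P_inf_def by blast
  then show ?thesis
    using that[of "F 0" p] F d(1)[of 0] d(6-8)[of 0] by (simp add: addP_iff)
qed

text \<open>Lift \<open>id\<^sub>X = \<Sum> f\<^sub>j g\<^sub>j\<close>, with \<open>g\<^sub>j : X \<rightarrow> Y\<close> and \<open>f\<^sub>j : Y \<rightarrow> X\<close>, to projective covers: the lift is
  an automorphism of the cover of \<open>X\<close> that factors through the cover of \<open>Y\<close>, and likewise on the kernels.\<close>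

lemma thru_cover:
  fixes X :: "('a, 'm) module"
  assumes X: "X \<in> fgmod R" and Y: "Y \<in> Pinf" and th: "thru R Y X X (\<lambda>x. x)" and c: "proj_cover R X Q q"
  shows "addP Q" "\<exists>K\<in>Pinf. thru R K (submod Q (hom_ker Q X q)) (submod Q (hom_ker Q X q)) (\<lambda>x. x)"
proof -
  obtain F p where F: "addP F" "projective R F" "lhom R F Y p" "p ` carrier F = carrier Y" "submod F (hom_ker F Y p) \<in> Pinf"
    by (rule P_inf_presentation[OF Y])
  note q = proj_coverD[OF c]
  have lX: "left_module R X" by (rule fgmodD[OF X])
  note lY = P_infD[OF Y]
  have fF: "F \<in> fgmod R" and thF: "thru R P F F (\<lambda>x. x)" using F(1) by (simp_all add: addP_def)
  note lF = fgmodD[OF fF]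
  let ?K = "submod F (hom_ker F Y p)" and ?L = "submod Q (hom_ker Q X q)"
  interpret X: left_module R X by (rule lX)
  interpret Q: left_module R Q by (rule q(3))
  have lL: "left_module R ?L" by (rule left_module_submod[OF q(3) submodule_ker[OF q(3) lX q(4)]])
  \<comment> \<open>For an arbitrary \<open>k\<close>, since the induction treats one composite at a
    time; the same \<open>\<theta>\<close> has to serve for the cover and for the kernel.\<close>
  have "\<exists>\<theta>. thru R F Q Q \<theta> \<and> thru R ?K ?L ?L \<theta> \<and> (\<forall>x\<in>carrier Q. q (\<theta> x) = k (q x))" if "thru R Y X X k" for k
    using that
  proof (induction rule: thru.induct)
    case (zero h)
    have "q \<zero>\<^bsub>Q\<^esub> = \<zero>\<^bsub>X\<^esub>" by (rule lhomZ(1)[OF q(4,3) lX])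
    then show ?case using zero[OF lhomD(1)[OF q(4)]] by (intro exI[of _ "\<lambda>x. \<zero>\<^bsub>Q\<^esub>"] conjI thru.zero) simp_all
  next
    case (step h g f k)
    obtain \<theta> where \<theta>: "thru R F Q Q \<theta>" "thru R ?K ?L ?L \<theta>" "\<forall>x\<in>carrier Q. q (\<theta> x) = h (q x)" using step.IH by blast
    obtain g' where g': "lhom R Q F g'" "\<And>x. x \<in> carrier Q \<Longrightarrow> p (g' x) = g (q x)"
      by (rule projective_lift[OF q(1) fF lY(1) F(3) lhom_comp[OF q(4) step.hyps(2)] F(4)]) (rule that)
    obtain f' where f': "lhom R F Q f'" "\<And>x. x \<in> carrier F \<Longrightarrow> q (f' x) = f (p x)"
      by (rule projective_lift[OF F(2) q(2) X q(4) lhom_comp[OF F(3) step.hyps(3)] q(5)]) (rule that)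
    have gk: "lhom R ?L ?K g'" by (rule lhom_ker_restrict[OF g'(1), where f = g]) (simp_all add: g'(2) lhomZ(1)[OF step.hyps(2) lX lY(2)])
    have fk: "lhom R ?K ?L f'" by (rule lhom_ker_restrict[OF f'(1), where f = f]) (simp_all add: f'(2) lhomZ(1)[OF step.hyps(3) lY(2) lX])
    let ?\<theta> = "\<lambda>x. \<theta> x \<oplus>\<^bsub>Q\<^esub> f' (g' x)"
    have "thru R F Q Q ?\<theta>" by (rule thru.step[OF \<theta>(1) g'(1) f'(1)]) simp
    moreover have "thru R ?K ?L ?L ?\<theta>" by (rule thru.step[OF \<theta>(2) gk fk]) simp
    moreover have "q (?\<theta> x) = k (q x)" if x: "x \<in> carrier Q" for x
    proof -
      note gx = lhomD(1)[OF g'(1) x]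
      have "q (?\<theta> x) = q (\<theta> x) \<oplus>\<^bsub>X\<^esub> q (f' (g' x))"
        by (rule lhomD(2)[OF q(4) lhomD(1)[OF thru_lhom[OF \<theta>(1) q(3,3)] x] lhomD(1)[OF f'(1) gx]])
      then show ?thesis using \<theta>(3) f'(2)[OF gx] g'(2)[OF x] step.hyps(4)[OF lhomD(1)[OF q(4) x]] x by simp
    qed
    ultimately show ?case by blast
  qed
  then obtain \<theta> where \<theta>: "thru R F Q Q \<theta>" "thru R ?K ?L ?L \<theta>" "\<And>x. x \<in> carrier Q \<Longrightarrow> q (\<theta> x) = q x" using th by blast
  have l\<theta>: "lhom R Q Q \<theta>" by (rule thru_lhom[OF \<theta>(1) q(3,3)])
  have "(\<lambda>x. q (\<theta> x)) ` carrier Q = carrier X" unfolding q(5)[symmetric] by (rule image_cong) (simp_all add: \<theta>(3))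
  then have s: "\<theta> ` carrier Q = carrier Q" by (rule cover_surj[OF c lX q(3) l\<theta>])
  obtain w where w: "lhom R Q Q w" "\<And>x. x \<in> carrier Q \<Longrightarrow> w (\<theta> x) = x" "\<And>x. x \<in> carrier Q \<Longrightarrow> \<theta> (w x) = x"
    by (rule lhom_inj_iso[OF q(3,3) l\<theta> s]) (erule (1) surj_endo_inj[OF q(3) fg_noe[OF q(2)] l\<theta> s], rule that)
  have "thru R F Q Q (\<lambda>x. w (\<theta> x))" by (rule thru_comp[OF \<theta>(1) w(1) lhom_id q(3,3,3)])
  then have "thru R F Q Q (\<lambda>x. x)" by (rule thru_cong) (simp add: w(2))
  then show "addP Q" unfolding addP_def using thru_trans[OF _ thF q(3,3) lF] q(2) by blast
  have qw: "q (w x) = q x" if "x \<in> carrier Q" for x using \<theta>(3)[OF lhomD(1)[OF w(1) that]] w(3)[OF that] by simp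
  have "lhom R ?L ?L w" by (rule lhom_ker_restrict[OF w(1), where f = "\<lambda>x. x"]) (simp_all add: qw)
  then have "thru R ?K ?L ?L (\<lambda>x. w (\<theta> x))" using thru_comp[OF \<theta>(2) _ lhom_id lL lL lL] by blast
  then have "thru R ?K ?L ?L (\<lambda>x. x)" by (rule thru_cong) (simp add: w(2) hom_ker_def)
  then show "\<exists>K\<in>Pinf. thru R K ?L ?L (\<lambda>x. x)" using F(5) by blast
qed

text \<open>The minimal resolution of \<open>X\<close> works: each of its syzygies lies in the
  additive closure of some module in \<open>Pinf\<close>, which varies with the degree, and
  \<open>thru_cover\<close> passes this on while placing the covers in add \<open>P\<close>.\<close>

lemma add_P_inf:
  fixes X :: "('a, 'm) module"
  assumes X: "X \<in> add_cat R Y" and Y: "Y \<in> Pinf"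
  shows "X \<in> Pinf"
proof -
  have fX: "X \<in> fgmod R" and th: "thru R Y X X (\<lambda>x. x)" using X by (auto simp: add_cat_iff[OF P_infD(2)[OF Y]])
  obtain Q c where Q: "\<And>n. proj_cover R ((syzygy R ^^ n) X) (Q n) (c n)"
    "\<And>n. (syzygy R ^^ Suc n) X = submod (Q n) (hom_ker (Q n) ((syzygy R ^^ n) X) (c n))"
    "proj_resolution R X Q (\<lambda>n. c (Suc n)) (c 0)" by (rule min_resolution[OF fX]) (rule that)
  have T: "\<exists>Z\<in>Pinf. thru R Z ((syzygy R ^^ n) X) ((syzygy R ^^ n) X) (\<lambda>x. x)" for n
  proof (induction n)
    case 0 then show ?case using th Y by auto
  next
    case (Suc n)
    then obtain Z where "Z \<in> Pinf" "thru R Z ((syzygy R ^^ n) X) ((syzygy R ^^ n) X) (\<lambda>x. x)" by blast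
    from thru_cover(2)[OF syzygy_pow_fgmod[OF fX] this Q(1)] show ?case unfolding Q(2) .
  qed
  have "Q n \<in> add_cat R P" for n
  proof -
    obtain Z where "Z \<in> Pinf" "thru R Z ((syzygy R ^^ n) X) ((syzygy R ^^ n) X) (\<lambda>x. x)" using T by blast
    from thru_cover(1)[OF syzygy_pow_fgmod[OF fX] this Q(1)] show ?thesis by (simp add: addP_iff)
  qed
  then show ?thesis using fX Q(3) unfolding P_inf_def by blast
qed

lemma add_cat_refl: "Y \<in> fgmod R \<Longrightarrow> Y \<in> add_cat R Y" for Y :: "('a, 'm) module"
  using thru_comp1[OF lhom_id lhom_id fgmodD] by (simp add: add_cat_iff fgmodD)

lemma P_inf_cover:
  assumes X: "X \<in> Pinf" and c: "proj_cover R X Q q"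
  shows "addP Q" "submod Q (hom_ker Q X q) \<in> Pinf"
proof -
  note l = P_infD[OF X]
  note q = proj_coverD[OF c]
  have th: "thru R X X X (\<lambda>x. x)" by (rule thru_comp1[OF lhom_id lhom_id l(2)])
  show "addP Q" by (rule thru_cover(1)[OF l(1) X th c])
  obtain K where K: "K \<in> Pinf" "thru R K (submod Q (hom_ker Q X q)) (submod Q (hom_ker Q X q)) (\<lambda>x. x)"
    using thru_cover(2)[OF l(1) X th c] by blast
  have "submod Q (hom_ker Q X q) \<in> add_cat R K"
    using fg_submod[OF q(2) submodule_ker[OF q(3) l(2) q(4)]] K(2) by (simp add: add_cat_iff[OF P_infD(2)[OF K(1)]])
  then show "submod Q (hom_ker Q X q) \<in> Pinf" by (rule add_P_inf[OF _ K(1)])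
qed

lemma syzygy_P_inf: "X \<in> Pinf \<Longrightarrow> syzygy R X \<in> Pinf"
  by (rule syzygyE[OF P_infD(1)]) (use P_inf_cover(2) in auto)

lemma syzygy_pow_P_inf: "X \<in> Pinf \<Longrightarrow> (syzygy R ^^ n) X \<in> Pinf"
  by (induction n) (simp_all add: syzygy_P_inf)

text \<open>An isomorphism rather than an equality, as the covers over the two rings are chosen
  independently.\<close>

lemma HP_syzygy_pow:
  assumes X: "X \<in> Pinf"
  shows "mod_iso Gm (HP ((syzygy R ^^ n) X)) ((syzygy Gm ^^ n) (HP X))"
proof (induction n)
  case 0 show ?case using mod_iso_refl[OF HP_lm[OF P_infD(2)[OF X]]] by simp
next
  case (Suc n)
  let ?X = "(syzygy R ^^ n) X"
  have P: "?X \<in> Pinf" by (rule syzygy_pow_P_inf[OF X])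
  note f = HP_fgmod[OF P_infD(1)[OF P]] G.syzygy_pow_fgmod[OF HP_fgmod[OF P_infD(1)[OF X]], of n]
  obtain Q q where Q: "proj_cover R ?X Q q" "syzygy R ?X = submod Q (hom_ker Q ?X q)" by (rule syzygyE[OF P_infD(1)[OF P]])
  have 1: "mod_iso Gm (HP (syzygy R ?X)) (syzygy Gm (HP ?X))" by (rule HP_syzygy[OF P_infD(1)[OF P] Q P_inf_cover(1)[OF P Q(1)]])
  have 2: "mod_iso Gm (syzygy Gm (HP ?X)) (syzygy Gm ((syzygy Gm ^^ n) (HP X)))" by (rule G.syzygy_iso[OF f Suc])
  show ?case
    using mod_iso_trans[OF 1 2 HP_lm[OF P_infD(2)[OF syzygy_P_inf[OF P]]] fgmodD[OF G.syzygy_fgmod[OF f(1)]] fgmodD[OF G.syzygy_fgmod[OF f(2)]]]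
    by simp
qed

subsection \<open>Full faithfulness\<close>

text \<open>After composition with a presentation \<open>F -> X\<close>, the kernel of the
  difference contains all values \<open>f e\<close>, which generate \<open>F\<close>.\<close>

lemma Hm_faithful:
  fixes N :: "('a, 'n) module"
  assumes X: "X \<in> Pinf" and N: "left_module R N" and hk: "lhom R X N h" "lhom R X N k"
    and eq: "\<And>u. u \<in> mod_hom R P X \<Longrightarrow> Hm h u = Hm k u" and x: "x \<in> carrier X"
  shows "h x = k x"
proof -
  obtain F p where F: "addP F" "projective R F" "lhom R F X p" "p ` carrier F = carrier X" by (rule P_inf_presentation[OF X])
  have lF: "left_module R F" by (rule fgmodD[OF projective_fgmod[OF F(2)]])
  interpret N: left_module R N by (rule N)
  let ?d = "\<lambda>y. h (p y) \<ominus>\<^bsub>N\<^esub> k (p y)"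
  note hp = lhom_comp[OF F(3) hk(1)] lhom_comp[OF F(3) hk(2)]
  have d: "lhom R F N ?d" by (rule lhom_diff[OF N hp])
  have "f e \<in> hom_ker F N ?d" if f: "f \<in> mod_hom R P F" for f
  proof -
    have "h (p (f e)) = k (p (f e))" using fun_cong[OF eq[OF Hm_closed[OF F(3) f]], of e] by (simp add: Hm_e)
    then show ?thesis using HP_e(1)[OF f] lhomD(1)[OF hp(2) HP_e(1)[OF f]] by (simp add: hom_ker_def N.minus_self)
  qed
  then have ker: "hom_ker F N ?d = carrier F" by (rule addP_generated[OF F(1) submodule_ker[OF lF N d]])
  obtain y where y: "y \<in> carrier F" "x = p y" using x F(4) by blast
  have "?d y = \<zero>\<^bsub>N\<^esub>" using ker y(1) unfolding hom_ker_def by blast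
  then show ?thesis using N.minus_eq_zero lhomD(1)[OF hp(1) y(1)] lhomD(1)[OF hp(2) y(1)] y(2) by simp
qed

text \<open>On the presentation \<open>F\<close> the map is given by some \<open>m\<close>, by
  \<open>thru_full\<close>. The kernel of \<open>p\<close> lies in \<open>Pinf\<close> again, so
  \<open>Hm_faithful\<close> applies there and shows that \<open>m\<close> vanishes on it; hence
  \<open>m\<close> descends to \<open>X\<close>.\<close>

lemma Hm_full:
  fixes N :: "('a, 'n) module"
  assumes X: "X \<in> Pinf" and N: "left_module R N" and \<phi>: "lhom Gm (HP X) (HP N) \<phi>"
  obtains h where "lhom R X N h" "\<And>u. u \<in> mod_hom R P X \<Longrightarrow> \<phi> u = Hm h u"
proof -
  obtain F p where F: "addP F" "projective R F" "lhom R F X p" "p ` carrier F = carrier X" "submod F (hom_ker F X p) \<in> Pinf"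
    by (rule P_inf_presentation[OF X])
  have lF: "left_module R F" by (rule fgmodD[OF projective_fgmod[OF F(2)]])
  note lX = P_infD(2)[OF X]
  have th: "thru R P F F (\<lambda>x. x)" using F(1) by (simp add: addP_def)
  have \<phi>p: "lhom Gm (HP F) (HP N) (\<lambda>u. \<phi> (Hm p u))" by (rule lhom_comp[OF Hm_lhom[OF lF lX F(3)] \<phi>])
  obtain m where m: "lhom R F N m" "\<forall>u\<in>mod_hom R P F. \<phi> (Hm p (Hm (\<lambda>x. x) u)) = Hm m u"
    using thru_full[OF th lF lF N \<phi>p] by blast
  have m': "\<phi> (Hm p u) = Hm m u" if "u \<in> mod_hom R P F" for u using m(2) that by (simp add: Hm_id)
  let ?K = "submod F (hom_ker F X p)"
  have K: "mod_hom R P ?K = hom_ker (HP F) (HP X) (Hm p)" using HP_kernel[OF lF lX F(3)] HP_simps(1)[of ?K] by simp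
  have sK: "hom_ker F X p \<subseteq> carrier F" by (auto simp: hom_ker_def)
  have m0: "m x = \<zero>\<^bsub>N\<^esub>" if "x \<in> carrier ?K" for x
  proof (rule Hm_faithful[OF F(5) N lhom_from_submod[OF m(1) sK] lhom_zero[OF N] _ that])
    fix u assume "u \<in> mod_hom R P ?K"
    then have u: "u \<in> mod_hom R P F" "Hm p u = \<zero>\<^bsub>HP X\<^esub>" unfolding K by (simp_all add: hom_ker_def)
    have "Hm m u = \<zero>\<^bsub>HP N\<^esub>" using m'[OF u(1)] u(2) lhomZ(1)[OF \<phi> HP_lm[OF lX] HP_lm[OF N]] by simp
    then show "Hm m u = Hm (\<lambda>x. \<zero>\<^bsub>N\<^esub>) u" by (simp add: Hm_def compose_def)
  qed
  obtain h where h: "lhom R X N h" "\<And>x. x \<in> carrier F \<Longrightarrow> h (p x) = m x"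
    by (rule lhom_factor[OF lF lX N F(3,4) m(1)]) (use m0 in \<open>simp add: hom_ker_def\<close>, rule that)
  have "\<phi> u = Hm h u" if u: "u \<in> mod_hom R P X" for u
  proof -
    have "u \<in> Hm p ` carrier (HP F)" unfolding HP_surj[OF lF lX F(3,4)] using u by simp
    then obtain v where v: "v \<in> mod_hom R P F" "u = Hm p v" by auto
    then have "\<phi> u = Hm m v" using m' by simp
    also have "\<dots> = Hm h u" unfolding v(2) Hm_comp[OF v(1) F(3) h(1)] by (rule Hm_cong[OF v(1)]) (simp add: h(2))
    finally show ?thesis .
  qed
  then show ?thesis using that[OF h(1)] by blast
qed

lemma Hm_add: "Hm (\<lambda>x. h x \<oplus>\<^bsub>N\<^esub> k x) u = Hm h u \<oplus>\<^bsub>HP N\<^esub> Hm k u"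
  by (simp add: Hm_def compose_def cong: restrict_cong)

text \<open>By fullness each of the two factors of a composite over \<open>Gm\<close> comes from a
  map over \<open>R\<close>.\<close>

lemma thru_HP_back:
  fixes Z :: "('a, 'n) module"
  assumes X: "X \<in> Pinf" and Y: "Y \<in> Pinf" and Z: "left_module R Z" and th: "thru Gm (HP Y) (HP X) (HP Z) \<kappa>"
  shows "\<exists>k. thru R Y X Z k \<and> (\<forall>u\<in>mod_hom R P X. \<kappa> u = Hm k u)"
  using th
proof (induction rule: thru.induct)
  case (zero h)
  then show ?case by (intro exI[of _ "\<lambda>x. \<zero>\<^bsub>Z\<^esub>"]) (simp add: thru.zero Hm_def compose_def)
next
  case (step h g f k)
  obtain h' where h': "thru R Y X Z h'" "\<forall>u\<in>mod_hom R P X. h u = Hm h' u" using step.IH by blast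
  obtain g' where g': "lhom R X Y g'" "\<And>u. u \<in> mod_hom R P X \<Longrightarrow> g u = Hm g' u" by (rule Hm_full[OF X P_infD(2)[OF Y] step.hyps(2)]) (rule that)
  obtain f' where f': "lhom R Y Z f'" "\<And>u. u \<in> mod_hom R P Y \<Longrightarrow> f u = Hm f' u" by (rule Hm_full[OF Y Z step.hyps(3)]) (rule that)
  have "k u = Hm (\<lambda>x. h' x \<oplus>\<^bsub>Z\<^esub> f' (g' x)) u" if u: "u \<in> mod_hom R P X" for u
    using step.hyps(4)[of u] u h'(2) g'(2)[OF u] f'(2)[OF Hm_closed[OF g'(1) u]] Hm_comp[OF u g'(1) f'(1)]
    by (simp add: Hm_add[where h = h'] del: HP_simps(3))
  moreover have "thru R Y X Z (\<lambda>x. h' x \<oplus>\<^bsub>Z\<^esub> f' (g' x))" by (rule thru.step[OF h'(1) g'(1) f'(1)]) simp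
  ultimately show ?case by blast
qed

lemma HP_add_cat_iff:
  assumes X: "X \<in> Pinf" and Y: "Y \<in> Pinf"
  shows "HP X \<in> add_cat Gm (HP Y) \<longleftrightarrow> X \<in> add_cat R Y"
proof -
  note l = P_infD(2)[OF X] P_infD(2)[OF Y]
  have "thru Gm (HP Y) (HP X) (HP X) (\<lambda>u. u)" if "thru R Y X X (\<lambda>x. x)"
    by (rule thru_cong[OF thru_HP[OF that l(1,1,2)]]) (simp add: Hm_id)
  moreover have "thru R Y X X (\<lambda>x. x)" if th: "thru Gm (HP Y) (HP X) (HP X) (\<lambda>u. u)"
  proof -
    obtain k where k: "thru R Y X X k" "\<forall>u\<in>mod_hom R P X. u = Hm k u" using thru_HP_back[OF X Y l(1) th] by blast
    show ?thesis
    proof (rule thru_cong[OF k(1)])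
      show "x = k x" if "x \<in> carrier X" for x
        by (rule Hm_faithful[OF X l(1) lhom_id thru_lhom[OF k(1) l(1,1)] _ that]) (use k(2) Hm_id in simp)
    qed
  qed
  ultimately show ?thesis
    using P_infD(1)[OF X] HP_fgmod[OF P_infD(1)[OF X]] by (auto simp: add_cat_iff[OF l(2)] add_cat_iff[OF HP_lm[OF l(2)]])
qed

lemma HP_iso_back:
  assumes X: "X \<in> Pinf" and Y: "Y \<in> Pinf" and iso: "mod_iso Gm (HP X) (HP Y)"
  shows "mod_iso R X Y"
proof -
  note l = P_infD(2)[OF X] P_infD(2)[OF Y]
  obtain \<phi> \<psi> where \<phi>: "lhom Gm (HP X) (HP Y) \<phi>" "lhom Gm (HP Y) (HP X) \<psi>" 
    "\<And>x. x \<in> carrier (HP X) \<Longrightarrow> \<psi> (\<phi> x) = x" "\<And>y. y \<in> carrier (HP Y) \<Longrightarrow> \<phi> (\<psi> y) = y"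
    by (rule mod_isoE[OF iso HP_lm[OF l(1)] HP_lm[OF l(2)]]) (rule that)
  obtain f where f: "lhom R X Y f" "\<And>u. u \<in> mod_hom R P X \<Longrightarrow> \<phi> u = Hm f u" by (rule Hm_full[OF X l(2) \<phi>(1)]) (rule that)
  obtain g where g: "lhom R Y X g" "\<And>u. u \<in> mod_hom R P Y \<Longrightarrow> \<psi> u = Hm g u" by (rule Hm_full[OF Y l(1) \<phi>(2)]) (rule that)
  show ?thesis
  proof (rule mod_isoI[OF l f(1) g(1)])
    show "g (f x) = x" if "x \<in> carrier X" for x
    proof (rule Hm_faithful[OF X l(1) lhom_comp[OF f(1) g(1)] lhom_id _ that])
      fix u assume u: "u \<in> mod_hom R P X"
      show "Hm (\<lambda>x. g (f x)) u = Hm (\<lambda>x. x) u"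
        using \<phi>(3)[of u] u f(2)[OF u] g(2)[OF Hm_closed[OF f(1) u]] by (simp add: Hm_id Hm_comp[OF u f(1) g(1)])
    qed
    show "f (g y) = y" if "y \<in> carrier Y" for y
    proof (rule Hm_faithful[OF Y l(2) lhom_comp[OF g(1) f(1)] lhom_id _ that])
      fix u assume u: "u \<in> mod_hom R P Y"
      show "Hm (\<lambda>x. f (g x)) u = Hm (\<lambda>x. x) u"
        using \<phi>(4)[of u] u g(2)[OF u] f(2)[OF Hm_closed[OF g(1) u]] by (simp add: Hm_id Hm_comp[OF u g(1) f(1)])
    qed
  qed
qed

text \<open>If Hom(P, X) vanishes, the functor does not separate the identity of \<open>X\<close>
  from zero, so the two agree by faithfulness.\<close>

lemma HP_zero_module_iff:
  assumes X: "X \<in> Pinf"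
  shows "zero_module (HP X) \<longleftrightarrow> zero_module X"
proof
  note l = P_infD(2)[OF X]
  interpret X: left_module R X by (rule l)
  assume "zero_module (HP X)"
  then have z: "mod_hom R P X = {\<lambda>x\<in>carrier P. \<zero>\<^bsub>X\<^esub>}" unfolding zero_module_def HP_simps .
  have "x = \<zero>\<^bsub>X\<^esub>" if "x \<in> carrier X" for x
  proof (rule Hm_faithful[OF X l lhom_id lhom_zero[OF l] _ that])
    fix u assume "u \<in> mod_hom R P X"
    then have "u = (\<lambda>x\<in>carrier P. \<zero>\<^bsub>X\<^esub>)" unfolding z by blast
    then show "Hm (\<lambda>x. x) u = Hm (\<lambda>x. \<zero>\<^bsub>X\<^esub>) u" by (simp add: Hm_def compose_def cong: restrict_cong)
  qed
  then show "zero_module X" unfolding zero_module_def by blast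
qed (rule HP_zero_module[OF _ P_infD(2)[OF X]])

text \<open>The composites through \<open>HP Y\<close> are collected in the image of a single
  \<open>Z\<close> in add \<open>Y\<close>: each step enlarges \<open>Z\<close> to a copy
  \<open>C\<close> of \<open>Z + Y\<close>, and additivity of the functor gives the maps into and
  out of \<open>HP C\<close>.\<close>

lemma HP_factor:
  fixes N :: "('a \<Rightarrow> 'a, 'n) module"
  assumes Y: "Y \<in> Pinf" and N: "left_module Gm N" and th: "thru Gm (HP Y) N N \<kappa>"
  shows "\<exists>(Z :: ('a, 'm) module) a b. Z \<in> add_cat R Y \<and> lhom Gm N (HP Z) a \<and> lhom Gm (HP Z) N b \<and> (\<forall>x\<in>carrier N. \<kappa> x = b (a x))"
  using th
proof (induction rule: thru.induct)
  case (zero h)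
  let ?z = "zero_mod undefined :: ('a, 'm) module"
  have z: "?z \<in> add_cat R Y" by (rule zero_mod_add_cat[OF P_infD(2)[OF Y]])
  have "left_module R ?z" by (rule fgmodD[OF zero_mod(1)[OF ring_R]])
  then show ?case
    using z lhom_zero[OF N, of "HP ?z"] lhom_zero[OF HP_lm, of ?z N] zero
    by (intro exI[of _ ?z] exI[of _ "\<lambda>x. \<zero>\<^bsub>HP ?z\<^esub>"] exI[of _ "\<lambda>x. \<zero>\<^bsub>N\<^esub>"]) (simp del: HP_simps)
next
  case (step h g f k)
  obtain Z :: "('a, 'm) module" and a b where Z: "Z \<in> add_cat R Y" "lhom Gm N (HP Z) a" "lhom Gm (HP Z) N b" "\<forall>x\<in>carrier N. h x = b (a x)"
    using step.IH by blast
  have lY: "left_module R Y" by (rule P_infD(2)[OF Y])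
  obtain C :: "('a, 'm) module" where C: "C \<in> add_cat R Y" "mod_iso R C (dsum Z Y)"
    by (rule add_cat_dsum[OF Z(1) add_cat_refl[OF P_infD(1)[OF Y]] lY])
  have lZ: "left_module R Z" and lC: "left_module R C" using Z(1) C(1) by (auto simp: add_cat_def fgmodD)
  interpret Z: left_module R Z by (rule lZ)
  interpret Y: left_module R Y by (rule lY)
  obtain s t where st: "lhom R C (dsum Z Y) s" "lhom R (dsum Z Y) C t" "\<And>y. y \<in> carrier (dsum Z Y) \<Longrightarrow> s (t y) = y"
    by (rule mod_isoE[OF C(2) lC left_module_dsum[OF lZ lY]]) (rule that)
  note dm = dsum_maps[OF lZ lY]
  let ?i = "\<lambda>x. t (x, \<zero>\<^bsub>Y\<^esub>)" and ?j = "\<lambda>y. t (\<zero>\<^bsub>Z\<^esub>, y)" and ?p = "\<lambda>z. fst (s z)" and ?q = "\<lambda>z. snd (s z)"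
  have ij: "lhom R Z C ?i" "lhom R Y C ?j" "lhom R C Z ?p" "lhom R C Y ?q"
    using lhom_comp[OF dm(1) st(2)] lhom_comp[OF dm(2) st(2)] lhom_comp[OF st(1) dm(3)] lhom_comp[OF st(1) dm(4)] by auto
  have pq: "s (?i x \<oplus>\<^bsub>C\<^esub> ?j y) = (x, y)" if xy: "x \<in> carrier Z" "y \<in> carrier Y" for x y
    using lhomD(2)[OF st(2), of "(x, \<zero>\<^bsub>Y\<^esub>)" "(\<zero>\<^bsub>Z\<^esub>, y)", symmetric] st(3)[of "(x, y)"] xy by simp
  note H = Hm_lhom[OF lZ lC ij(1)] Hm_lhom[OF lY lC ij(2)] Hm_lhom[OF lC lZ ij(3)] Hm_lhom[OF lC lY ij(4)]
  let ?a = "\<lambda>x. Hm ?i (a x) \<oplus>\<^bsub>HP C\<^esub> Hm ?j (g x)" and ?b = "\<lambda>u. b (Hm ?p u) \<oplus>\<^bsub>N\<^esub> f (Hm ?q u)"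
  have a: "lhom Gm N (HP C) ?a" by (rule lhom_add[OF HP_lm[OF lC] lhom_comp[OF Z(2) H(1)] lhom_comp[OF step.hyps(2) H(2)]])
  have b: "lhom Gm (HP C) N ?b" by (rule lhom_add[OF N lhom_comp[OF H(3) Z(3)] lhom_comp[OF H(4) step.hyps(3)]])
  have "k x = ?b (?a x)" if x: "x \<in> carrier N" for x
  proof -
    have u: "a x \<in> mod_hom R P Z" "g x \<in> mod_hom R P Y" "?a x \<in> mod_hom R P C"
      using lhomD(1)[OF Z(2) x] lhomD(1)[OF step.hyps(2) x] lhomD(1)[OF a x] by (simp_all only: HP_simps)
    have v: "?a x e = ?i (a x e) \<oplus>\<^bsub>C\<^esub> ?j (g x e)" by (simp add: e_P Hm_e)
    have "Hm ?p (?a x) = a x" "Hm ?q (?a x) = g x"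
      using pq[OF HP_e(1)[OF u(1)] HP_e(1)[OF u(2)]] 
      by (intro HP_eqI[OF Hm_closed[OF ij(3) u(3)] u(1)] HP_eqI[OF Hm_closed[OF ij(4) u(3)] u(2)]; simp add: Hm_e v del: HP_simps)+
    then show ?thesis using step.hyps(4)[OF x] Z(4) x by simp
  qed
  then show ?case using C(1) a b by blast
qed

text \<open>Over \<open>Gm\<close> the module \<open>N\<close> is a retract of some
  \<open>HP Z\<close>. The idempotent \<open>a b\<close> is \<open>Hm h\<close> by fullness, and
  \<open>h\<close> is idempotent by faithfulness; its image is the wanted summand of
  \<open>Z\<close>.\<close>

lemma HP_dense:
  fixes N :: "('a \<Rightarrow> 'a, 'a \<Rightarrow> 'm) module"
  assumes Y: "Y \<in> Pinf" and N: "N \<in> add_cat Gm (HP Y)"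
  obtains X :: "('a, 'm) module" where "X \<in> add_cat R Y" "mod_iso Gm N (HP X)"
proof -
  note lY = P_infD(2)[OF Y]
  have fN: "N \<in> fgmod Gm" and th: "thru Gm (HP Y) N N (\<lambda>x. x)" using N by (auto simp: add_cat_iff[OF HP_lm[OF lY]])
  have lN: "left_module Gm N" by (rule fgmodD[OF fN])
  obtain Z :: "('a, 'm) module" and a b where Z: "Z \<in> add_cat R Y" "lhom Gm N (HP Z) a" "lhom Gm (HP Z) N b" "\<forall>x\<in>carrier N. x = b (a x)"
    using HP_factor[OF Y lN th] by blast
  have ba: "b (a x) = x" if "x \<in> carrier N" for x using bspec[OF Z(4) that] by (rule sym)
  have PZ: "Z \<in> Pinf" by (rule add_P_inf[OF Z(1) Y])
  note lZ = P_infD[OF PZ]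
  obtain h where h: "lhom R Z Z h" "\<And>u. u \<in> mod_hom R P Z \<Longrightarrow> a (b u) = Hm h u"
    by (rule Hm_full[OF PZ lZ(2) lhom_comp[OF Z(3,2)]]) (rule that)
  have hh: "h (h x) = h x" if "x \<in> carrier Z" for x
  proof (rule Hm_faithful[OF PZ lZ(2) lhom_comp[OF h(1,1)] h(1) _ that])
    fix u assume u: "u \<in> mod_hom R P Z"
    have bu: "b u \<in> carrier N" using lhomD(1)[OF Z(3)] u by simp
    have "Hm (\<lambda>x. h (h x)) u = a (b (a (b u)))"
      using h(2)[OF u] h(2)[OF Hm_closed[OF h(1) u]] Hm_comp[OF u h(1,1)] by simp
    then show "Hm (\<lambda>x. h (h x)) u = Hm h u" using ba[OF bu] h(2)[OF u] by simp
  qed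
  have sW: "submodule (h ` carrier Z) R Z"
    by (rule submodule_image[OF lZ(2,2) h(1) left_module.submodule_carrier[OF lZ(2)]])
  let ?W = "submod Z (h ` carrier Z)"
  have W: "?W \<in> fgmod R" by (rule fg_submod[OF lZ(1) sW])
  note lW = fgmodD[OF W]
  have r: "lhom R Z ?W h" by (rule lhom_submodI[OF h(1)]) simp
  have i: "lhom R ?W Z (\<lambda>x. x)" by (rule lhom_incl[OF lZ(2) sW])
  have ir: "retract R ?W Z (\<lambda>x. x) h" unfolding retract_def using r i hh by auto
  have "thru R Y ?W ?W (\<lambda>x. x)"
    by (rule thru_retract[OF _ ir lW lZ(2)]) (use Z(1) in \<open>simp add: add_cat_iff[OF lY]\<close>)
  then have "?W \<in> add_cat R Y" using W by (simp add: add_cat_iff[OF lY])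
  moreover have "mod_iso Gm N (HP ?W)"
  proof (rule mod_isoI[OF lN HP_lm[OF lW] lhom_comp[OF Z(2) Hm_lhom[OF lZ(2) lW r]] lhom_comp[OF Hm_lhom[OF lW lZ(2) i] Z(3)]])
    fix x assume x: "x \<in> carrier N"
    have u: "a x \<in> mod_hom R P Z" using lhomD(1)[OF Z(2) x] by simp
    have "Hm (\<lambda>x. x) (Hm h (a x)) = Hm h (a x)" unfolding Hm_comp[OF u r i] ..
    also have "\<dots> = a x" using h(2)[OF u] ba[OF x] by simp
    finally show "b (Hm (\<lambda>x. x) (Hm h (a x))) = x" using ba[OF x] by simp
  next
    fix u assume "u \<in> carrier (HP ?W)"
    then have u: "u \<in> mod_hom R P ?W" by simp
    then have uZ: "u \<in> mod_hom R P Z" using Hm_closed[OF i u] by (simp add: Hm_id)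
    have bu: "b u \<in> carrier N" using lhomD(1)[OF Z(3)] uZ by simp
    have "Hm h u = u" using Hm_cong[OF u, of h "\<lambda>x. x"] hh Hm_id[OF u] by auto
    then show "Hm h (a (b (Hm (\<lambda>x. x) u))) = u" using h(2)[OF uZ] Hm_id[OF uZ] by simp
  qed
  ultimately show ?thesis by (rule that)
qed

subsection \<open>Stable equivalence\<close>

text \<open>The projective through which \<open>h\<close> factors may lie outside add
  \<open>P\<close>, so it is first exchanged for a presentation of \<open>B\<close> in add
  \<open>P\<close>, which the functor sends to a projective.\<close>

lemma pnull_HP:
  assumes A: "A \<in> Pinf" and B: "B \<in> Pinf" and n: "pnull R A B h"
  shows "pnull Gm (HP A) (HP B) (Hm h)"
proof -
  note l = P_infD[OF A] P_infD[OF B]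
  obtain F p where F: "addP F" "projective R F" "lhom R F B p" "p ` carrier F = carrier B" by (rule P_inf_presentation[OF B])
  have fF: "F \<in> fgmod R" by (rule projective_fgmod[OF F(2)])
  obtain s where s: "lhom R A F s" "\<And>x. x \<in> carrier A \<Longrightarrow> h x = p (s x)" by (rule pnull_cover[OF n l(3) fF F(3,4)]) (rule that)
  show ?thesis
  proof (rule pnullI[OF addP_projective[OF F(1)] Hm_lhom[OF l(2) fgmodD[OF fF] s(1)] Hm_lhom[OF fgmodD[OF fF] l(4) F(3)]])
    fix u assume "u \<in> carrier (HP A)"
    then have u: "u \<in> mod_hom R P A" by simp
    show "Hm h u = Hm p (Hm s u)" unfolding Hm_comp[OF u s(1) F(3)] by (rule Hm_cong[OF u s(2)])
  qed
qed

text \<open>The presentation \<open>F\<close> of \<open>B\<close> stays surjective under the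
  functor, so the null map factors through \<open>HP F\<close>; fullness brings the first factor
  back to \<open>R\<close>.\<close>

lemma pnull_HP_back:
  assumes A: "A \<in> Pinf" and B: "B \<in> Pinf" and n: "pnull Gm (HP A) (HP B) \<kappa>"
  obtains h where "pnull R A B h" "\<And>u. u \<in> mod_hom R P A \<Longrightarrow> \<kappa> u = Hm h u"
proof -
  note l = P_infD[OF A] P_infD[OF B]
  obtain F p where F: "addP F" "projective R F" "lhom R F B p" "p ` carrier F = carrier B" by (rule P_inf_presentation[OF B])
  note lF = fgmodD[OF projective_fgmod[OF F(2)]]
  obtain s where s: "lhom Gm (HP A) (HP F) s" "\<And>x. x \<in> carrier (HP A) \<Longrightarrow> \<kappa> x = Hm p (s x)"
    by (rule pnull_cover[OF n HP_fgmod[OF l(3)] HP_fgmod[OF projective_fgmod[OF F(2)]] Hm_lhom[OF lF l(4) F(3)] HP_surj[OF lF l(4) F(3,4)]]) (rule that)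
  obtain t where t: "lhom R A F t" "\<And>u. u \<in> mod_hom R P A \<Longrightarrow> s u = Hm t u" by (rule Hm_full[OF A lF s(1)]) (rule that)
  have "\<kappa> u = Hm (\<lambda>x. p (t x)) u" if u: "u \<in> mod_hom R P A" for u
    using s(2)[of u] t(2)[OF u] Hm_comp[OF u t(1) F(3)] u by simp
  then show ?thesis by (rule that[OF pnullI[OF F(2) t(1) F(3) refl]])
qed

lemma stab_HP_iff:
  assumes A: "A \<in> Pinf" and B: "B \<in> Pinf"
  shows "stab Gm (HP A) (HP B) \<longleftrightarrow> stab R A B"
proof
  note l = P_infD(2)[OF A] P_infD(2)[OF B]
  assume "stab Gm (HP A) (HP B)"
  then obtain \<phi> \<psi> \<eta> \<kappa> where s: "lhom Gm (HP A) (HP B) \<phi>" "lhom Gm (HP B) (HP A) \<psi>" "pnull Gm (HP A) (HP A) \<eta>" "pnull Gm (HP B) (HP B) \<kappa>"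
    "\<forall>x\<in>carrier (HP A). x = \<psi> (\<phi> x) \<oplus>\<^bsub>HP A\<^esub> \<eta> x" "\<forall>y\<in>carrier (HP B). y = \<phi> (\<psi> y) \<oplus>\<^bsub>HP B\<^esub> \<kappa> y"
    unfolding stab_def by (elim exE conjE)
  obtain f where f: "lhom R A B f" "\<And>u. u \<in> mod_hom R P A \<Longrightarrow> \<phi> u = Hm f u" by (rule Hm_full[OF A l(2) s(1)]) (rule that)
  obtain g where g: "lhom R B A g" "\<And>u. u \<in> mod_hom R P B \<Longrightarrow> \<psi> u = Hm g u" by (rule Hm_full[OF B l(1) s(2)]) (rule that)
  obtain h where h: "pnull R A A h" "\<And>u. u \<in> mod_hom R P A \<Longrightarrow> \<eta> u = Hm h u" by (rule pnull_HP_back[OF A A s(3)]) (rule that)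
  obtain k where k: "pnull R B B k" "\<And>u. u \<in> mod_hom R P B \<Longrightarrow> \<kappa> u = Hm k u" by (rule pnull_HP_back[OF B B s(4)]) (rule that)
  have "x = g (f x) \<oplus>\<^bsub>A\<^esub> h x" if "x \<in> carrier A" for x
  proof (rule Hm_faithful[OF A l(1) lhom_id lhom_add[OF l(1) lhom_comp[OF f(1) g(1)] pnull_lhom[OF h(1) l(1)]] _ that])
    fix u assume u: "u \<in> mod_hom R P A"
    have "u = \<psi> (\<phi> u) \<oplus>\<^bsub>HP A\<^esub> \<eta> u" using s(5) u by (simp del: HP_simps add: HP_simps(1))
    also have "\<dots> = Hm (\<lambda>x. g (f x) \<oplus>\<^bsub>A\<^esub> h x) u"
      unfolding Hm_add[where h = "\<lambda>x. g (f x)"] f(2)[OF u] g(2)[OF Hm_closed[OF f(1) u]] h(2)[OF u] Hm_comp[OF u f(1) g(1)] ..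
    finally show "Hm (\<lambda>x. x) u = Hm (\<lambda>x. g (f x) \<oplus>\<^bsub>A\<^esub> h x) u" unfolding Hm_id[OF u] .
  qed
  moreover have "y = f (g y) \<oplus>\<^bsub>B\<^esub> k y" if "y \<in> carrier B" for y
  proof (rule Hm_faithful[OF B l(2) lhom_id lhom_add[OF l(2) lhom_comp[OF g(1) f(1)] pnull_lhom[OF k(1) l(2)]] _ that])
    fix u assume u: "u \<in> mod_hom R P B"
    have "u = \<phi> (\<psi> u) \<oplus>\<^bsub>HP B\<^esub> \<kappa> u" using s(6) u by (simp del: HP_simps add: HP_simps(1))
    also have "\<dots> = Hm (\<lambda>y. f (g y) \<oplus>\<^bsub>B\<^esub> k y) u"
      unfolding Hm_add[where h = "\<lambda>y. f (g y)"] g(2)[OF u] f(2)[OF Hm_closed[OF g(1) u]] k(2)[OF u] Hm_comp[OF u g(1) f(1)] ..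
    finally show "Hm (\<lambda>y. y) u = Hm (\<lambda>y. f (g y) \<oplus>\<^bsub>B\<^esub> k y) u" unfolding Hm_id[OF u] .
  qed
  ultimately show "stab R A B" unfolding stab_def using f(1) g(1) h(1) k(1) by blast
next
  note l = P_infD(2)[OF A] P_infD(2)[OF B]
  assume "stab R A B"
  then obtain f g h k where s: "lhom R A B f" "lhom R B A g" "pnull R A A h" "pnull R B B k"
    "\<forall>x\<in>carrier A. x = g (f x) \<oplus>\<^bsub>A\<^esub> h x" "\<forall>y\<in>carrier B. y = f (g y) \<oplus>\<^bsub>B\<^esub> k y"
    unfolding stab_def by (elim exE conjE)
  have "u = Hm g (Hm f u) \<oplus>\<^bsub>HP A\<^esub> Hm h u" if u: "u \<in> mod_hom R P A" for u
  proof -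
    have "u = Hm (\<lambda>x. x) u" by (rule Hm_id[OF u, symmetric])
    also have "\<dots> = Hm (\<lambda>x. g (f x) \<oplus>\<^bsub>A\<^esub> h x) u" using s(5) by (intro Hm_cong[OF u]) blast
    finally show ?thesis unfolding Hm_add[where h = "\<lambda>x. g (f x)"] Hm_comp[OF u s(1,2)] .
  qed
  moreover have "u = Hm f (Hm g u) \<oplus>\<^bsub>HP B\<^esub> Hm k u" if u: "u \<in> mod_hom R P B" for u
  proof -
    have "u = Hm (\<lambda>x. x) u" by (rule Hm_id[OF u, symmetric])
    also have "\<dots> = Hm (\<lambda>y. f (g y) \<oplus>\<^bsub>B\<^esub> k y) u" using s(6) by (intro Hm_cong[OF u]) blast
    finally show ?thesis unfolding Hm_add[where h = "\<lambda>y. f (g y)"] Hm_comp[OF u s(2,1)] .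
  qed
  ultimately show "stab Gm (HP A) (HP B)"
    unfolding stab_def HP_simps(1) using Hm_lhom[OF l s(1)] Hm_lhom[OF l(2,1) s(2)] pnull_HP[OF A A s(3)] pnull_HP[OF B B s(4)] by blast
qed

text \<open>Projective means stably equivalent to a zero module, a condition to which
  \<open>stab_HP_iff\<close> applies.\<close>

lemma projective_HP_iff:
  assumes X: "X \<in> Pinf"
  shows "projective Gm (HP X) \<longleftrightarrow> projective R X"
proof -
  let ?z = "zero_mod undefined :: ('a, 'm) module"
  note z = zero_mod[OF ring_R, of "undefined :: 'm"]
  have Z: "?z \<in> Pinf" by (rule add_P_inf[OF zero_mod_add_cat[OF P_infD(2)[OF X]] X])
  note f = P_infD(1)[OF X] HP_fgmod[OF P_infD(1)[OF X]] HP_fgmod[OF z(1)]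
  have hz: "zero_module (HP ?z)" by (rule HP_zero_module[OF z(2) fgmodD[OF z(1)]])
  have "projective R X \<longleftrightarrow> stab R X ?z"
    using stab_zero_projective[OF _ fgmodD[OF z(1)] z(2)] stab_projective[OF z(1) f(1) _ projective_zero[OF z]] stab_sym by blast
  moreover have "projective Gm (HP X) \<longleftrightarrow> stab Gm (HP X) (HP ?z)"
    using G.stab_zero_projective[OF _ fgmodD[OF f(3)] hz] G.stab_projective[OF f(3,2) _ projective_zero[OF f(3) hz]] stab_sym by blast
  ultimately show ?thesis using stab_HP_iff[OF X Z] by simp
qed

lemma stab_syzygy_pow_HP:
  assumes A: "A \<in> Pinf" and B: "B \<in> Pinf"
  shows "stab Gm ((syzygy Gm ^^ n) (HP A)) ((syzygy Gm ^^ n) (HP B)) \<longleftrightarrow> stab R ((syzygy R ^^ n) A) ((syzygy R ^^ n) B)"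
proof -
  note P = syzygy_pow_P_inf[OF A, of n] syzygy_pow_P_inf[OF B, of n]
  have f: "HP X \<in> fgmod Gm" if "X \<in> Pinf" for X by (rule HP_fgmod[OF P_infD(1)[OF that]])
  show ?thesis
    using G.stab_cong[OF f[OF P(1)] f[OF P(2)] G.syzygy_pow_fgmod[OF f[OF A]] G.syzygy_pow_fgmod[OF f[OF B]]
      HP_syzygy_pow[OF A] HP_syzygy_pow[OF B]] stab_HP_iff[OF P] by simp
qed

end

section \<open>The comparison\<close>

lemma add_cat_base_iso:
  fixes M :: "('a, 'm) module" and N :: "('a, 'n) module"
  assumes iso: "mod_iso R M N" and l: "left_module R M" "left_module R N"
  shows "add_cat R M \<subseteq> (add_cat R N :: ('a, 'q) module set)"
proof -
  obtain i r where "retract R M N i r" by (rule iso_retract[OF iso l])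
  then have "thru R N M M (\<lambda>x. x)" by (rule thru_retract_base[OF _ l(1)])
  then have "thru R N X X (\<lambda>x. x)" if "X \<in> fgmod R" "thru R M X X (\<lambda>x. x)" for X :: "('a, 'q) module"
    using thru_trans[OF that(2) _ fgmodD[OF that(1)] fgmodD[OF that(1)] l(1)] by blast
  then show ?thesis by (auto simp: add_cat_iff[OF l(1)] add_cat_iff[OF l(2)])
qed

lemma projective_iso:
  fixes A B :: "('a, 'm) module"
  assumes iso: "mod_iso R A B" and l: "left_module R A" "left_module R B"
  shows "projective R A \<longleftrightarrow> projective R B"
proof -
  obtain i r where ir: "retract R A B i r" "retract R B A r i" by (rule iso_retract[OF iso l])
  show ?thesis using projective_retract[OF l(1) _ ir(1)] projective_retract[OF l(2) _ ir(2)] by blast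
qed

context good_ring
begin

lemma add_cat_iso:
  fixes X Y :: "('a, 'm) module"
  assumes iso: "mod_iso R X Y" and l: "left_module R Y" "left_module R M" and X: "X \<in> add_cat R M"
  shows "Y \<in> add_cat R M"
  using X thru_iso[OF iso _ l(1)] fgmod_iso[OF iso _ l(1)] by (auto simp: add_cat_iff[OF l(2)] dest: fgmodD)

lemma Ext_nat_iso_cong:
  fixes A B A' B' :: "('a, 'm) module"
  assumes f: "A \<in> fgmod R" "B \<in> fgmod R" "A' \<in> fgmod R" "B' \<in> fgmod R" and iso: "mod_iso R A A'" "mod_iso R B B'"
  shows "Ext_nat_iso R d A B \<longleftrightarrow> Ext_nat_iso R d A' B'"
proof (cases d)
  case 0
  note l = fgmodD[OF f(1)] fgmodD[OF f(2)] fgmodD[OF f(3)] fgmodD[OF f(4)]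
  show ?thesis
    unfolding 0 Ext_nat_iso_0[OF f(1,2)] Ext_nat_iso_0[OF f(3,4)]
    using mod_iso_trans[OF mod_iso_trans[OF iso(1) _ l(1,3,4)] mod_iso_sym[OF iso(2) l(2,4)] l(1,4,2)]
      mod_iso_trans[OF mod_iso_trans[OF mod_iso_sym[OF iso(1) l(1,3)] _ l(3,1,2)] iso(2) l(3,2,4)] by blast
next
  case (Suc n)
  show ?thesis unfolding Suc Ext_nat_iso_Suc[OF f(1,2)] Ext_nat_iso_Suc[OF f(3,4)] by (rule stab_syzygy_pow_cong[OF f iso])
qed

lemma proj_dim_iso:
  fixes A B :: "('a, 'm) module"
  assumes f: "A \<in> fgmod R" "B \<in> fgmod R" and iso: "mod_iso R A B"
  shows "proj_dim R A = proj_dim R B"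
  unfolding proj_dim_eq[OF f(1)] proj_dim_eq[OF f(2)]
  using projective_iso[OF syzygy_pow_iso[OF f iso] fgmodD[OF syzygy_pow_fgmod[OF f(1)]] fgmodD[OF syzygy_pow_fgmod[OF f(2)]]]
  by simp

end

context corner
begin

lemma Ext_nat_iso_HP:
  assumes S: "S \<in> Pinf" and T: "T \<in> Pinf"
  shows "Ext_nat_iso Gm d (HP S) (HP T) \<longleftrightarrow> Ext_nat_iso R d S T"
proof -
  note f = P_infD(1)[OF S] P_infD(1)[OF T]
  note g = HP_fgmod[OF f(1)] HP_fgmod[OF f(2)]
  show ?thesis
  proof (cases d)
    case 0
    show ?thesis
      unfolding 0 Ext_nat_iso_0[OF f] G.Ext_nat_iso_0[OF g]
      using HP_iso[OF fgmodD[OF f(1)] fgmodD[OF f(2)]] HP_iso_back[OF S T] by blast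
  next
    case (Suc n)
    show ?thesis unfolding Suc Ext_nat_iso_Suc[OF f] G.Ext_nat_iso_Suc[OF g] by (rule stab_syzygy_pow_HP[OF S T])
  qed
qed

text \<open>For the intersection of the additive closures, a common object over \<open>Gm\<close> is
  isomorphic to some \<open>HP X\<close> by \<open>HP_dense\<close>, and then \<open>X\<close> is a
  common object over \<open>R\<close>.\<close>

lemma d_division_HP:
  assumes Y: "Y \<in> Pinf" and UV: "S \<in> add_cat R Y" "T \<in> add_cat R Y"
  shows "d_division Gm d (HP Y) (HP S) (HP T) \<longleftrightarrow> d_division R d Y S T"
proof -
  have P: "S \<in> Pinf" "T \<in> Pinf" using add_P_inf[OF _ Y] UV by blast+
  have 1: "HP S \<in> add_cat Gm (HP Y)" "HP T \<in> add_cat Gm (HP Y)" using HP_add_cat_iff[OF _ Y] P UV by blast+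
  have "(\<forall>(W :: ('a \<Rightarrow> 'a, 'a \<Rightarrow> 'm) module) \<in> add_cat Gm (HP S) \<inter> add_cat Gm (HP T). zero_module W) \<longleftrightarrow>
    (\<forall>(W :: ('a, 'm) module) \<in> add_cat R S \<inter> add_cat R T. zero_module W)" (is "?l \<longleftrightarrow> ?r")
  proof
    assume L: ?l
    show ?r
    proof
      fix W :: "('a, 'm) module" assume W: "W \<in> add_cat R S \<inter> add_cat R T"
      then have PW: "W \<in> Pinf" using add_P_inf[OF _ P(1)] by blast
      then have "HP W \<in> add_cat Gm (HP S) \<inter> add_cat Gm (HP T)" using HP_add_cat_iff[OF PW] P W by blast
      then show "zero_module W" using L HP_zero_module_iff[OF PW] by blast
    qed
  next
    assume r: ?r
    show ?l
    proof
      fix W :: "('a \<Rightarrow> 'a, 'a \<Rightarrow> 'm) module" assume W: "W \<in> add_cat Gm (HP S) \<inter> add_cat Gm (HP T)"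
      then have lW: "left_module Gm W" by (auto simp: add_cat_def fgmodD)
      obtain X :: "('a, 'm) module" where X: "X \<in> add_cat R S" "mod_iso Gm W (HP X)" using HP_dense[OF P(1)] W by blast
      have PX: "X \<in> Pinf" by (rule add_P_inf[OF X(1) P(1)])
      have lX: "left_module Gm (HP X)" by (rule HP_lm[OF P_infD(2)[OF PX]])
      have "HP X \<in> add_cat Gm (HP T)" using G.add_cat_iso[OF X(2) lX HP_lm[OF P_infD(2)[OF P(2)]]] W by blast
      then have "zero_module (HP X)" using r X(1) HP_add_cat_iff[OF PX P(2)] HP_zero_module_iff[OF PX] by blast
      then show "zero_module W" by (rule zero_module_iso[OF mod_iso_sym[OF X(2) lW lX] lX lW])
    qed
  qed
  then show ?thesis unfolding d_division_def Ext_nat_iso_HP[OF P] using 1 UV by blast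
qed

text \<open>A given division over \<open>Gm\<close> consists of modules that are only isomorphic to
  some \<open>HP S\<close> and \<open>HP T\<close>.\<close>

lemma d_division_iso:
  fixes S T S' T' M :: "('a \<Rightarrow> 'a, 'a \<Rightarrow> 'm) module"
  assumes d: "d_division Gm d M S T" and M: "left_module Gm M" and f: "S' \<in> fgmod Gm" "T' \<in> fgmod Gm"
    and iso: "mod_iso Gm S S'" "mod_iso Gm T T'"
  shows "d_division Gm d M S' T'"
proof -
  have a: "S \<in> add_cat Gm M" "T \<in> add_cat Gm M" using d by (auto simp: d_division_def)
  then have g: "S \<in> fgmod Gm" "T \<in> fgmod Gm" by (auto simp: add_cat_def)
  note l = fgmodD[OF f(1)] fgmodD[OF f(2)] fgmodD[OF g(1)] fgmodD[OF g(2)]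
  have "add_cat Gm S' \<subseteq> add_cat Gm S" "add_cat Gm T' \<subseteq> add_cat Gm T"
    using add_cat_base_iso[OF mod_iso_sym[OF iso(1)]] add_cat_base_iso[OF mod_iso_sym[OF iso(2)]] l by blast+
  moreover have "S' \<in> add_cat Gm M" "T' \<in> add_cat Gm M"
    using G.add_cat_iso[OF iso(1) l(1) M a(1)] G.add_cat_iso[OF iso(2) l(2) M a(2)] .
  ultimately show ?thesis
    using d unfolding d_division_def G.Ext_nat_iso_cong[OF g f iso] by blast
qed

theorem d_division_iff:
  assumes Y: "Y \<in> Pinf"
  shows "(\<exists>S T. d_division R d Y S T) \<longleftrightarrow> (\<exists>S T. d_division Gm d (HP Y) S T)"
proof
  assume "\<exists>S T. d_division R d Y S T"
  then obtain S T where d: "d_division R d Y S T" by blast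
  then have "S \<in> add_cat R Y" "T \<in> add_cat R Y" by (auto simp: d_division_def)
  from d_division_HP[OF Y this] d show "\<exists>S T. d_division Gm d (HP Y) S T" by blast
next
  assume "\<exists>S T. d_division Gm d (HP Y) S T"
  then obtain S' T' where d: "d_division Gm d (HP Y) S' T'" by blast
  then have a: "S' \<in> add_cat Gm (HP Y)" "T' \<in> add_cat Gm (HP Y)" by (auto simp: d_division_def)
  obtain S :: "('a, 'm) module" where S: "S \<in> add_cat R Y" "mod_iso Gm S' (HP S)" by (rule HP_dense[OF Y a(1)])
  obtain T :: "('a, 'm) module" where T: "T \<in> add_cat R Y" "mod_iso Gm T' (HP T)" by (rule HP_dense[OF Y a(2)])
  have "HP S \<in> fgmod Gm" "HP T \<in> fgmod Gm" using S T HP_fgmod by (auto simp: add_cat_def)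
  from d_division_iso[OF d HP_lm[OF P_infD(2)[OF Y]] this S(2) T(2)]
  show "\<exists>S T. d_division R d Y S T" unfolding d_division_HP[OF Y S(1) T(1)] by blast
qed

text \<open>The conditions under the two minima agree for each \<open>s\<close> separately: by
  \<open>HP_dense\<close> pairs over \<open>Gm\<close> can be taken of the form \<open>HP A\<close>,
  \<open>HP B\<close>.\<close>

theorem phi_HP:
  assumes Y: "Y \<in> Pinf"
  shows "phi Gm (HP Y) = phi R Y"
proof -
  note fY = P_infD(1)[OF Y]
  let ?S = "\<lambda>s. \<forall>(A :: ('a, 'm) module) \<in> add_cat R Y. \<forall>(B :: ('a, 'm) module) \<in> add_cat R Y.
    stab R ((syzygy R ^^ Suc s) A) ((syzygy R ^^ Suc s) B) \<longrightarrow> stab R ((syzygy R ^^ s) A) ((syzygy R ^^ s) B)"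
  let ?T = "\<lambda>s. \<forall>(A :: ('a \<Rightarrow> 'a, 'a \<Rightarrow> 'm) module) \<in> add_cat Gm (HP Y). \<forall>(B :: ('a \<Rightarrow> 'a, 'a \<Rightarrow> 'm) module) \<in> add_cat Gm (HP Y).
    stab Gm ((syzygy Gm ^^ Suc s) A) ((syzygy Gm ^^ Suc s) B) \<longrightarrow> stab Gm ((syzygy Gm ^^ s) A) ((syzygy Gm ^^ s) B)"
  have "?T s \<longleftrightarrow> ?S s" for s
  proof
    assume T: "?T s"
    show "?S s"
    proof (intro ballI impI)
      fix A B :: "('a, 'm) module"
      assume AB: "A \<in> add_cat R Y" "B \<in> add_cat R Y" and st: "stab R ((syzygy R ^^ Suc s) A) ((syzygy R ^^ Suc s) B)"
      have P: "A \<in> Pinf" "B \<in> Pinf" using AB add_P_inf[OF _ Y] by blast+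
      have "HP A \<in> add_cat Gm (HP Y)" "HP B \<in> add_cat Gm (HP Y)" using HP_add_cat_iff[OF _ Y] P AB by blast+
      then show "stab R ((syzygy R ^^ s) A) ((syzygy R ^^ s) B)"
        using T st unfolding stab_syzygy_pow_HP[OF P, symmetric] by blast
    qed
  next
    assume S: "?S s"
    show "?T s"
    proof (intro ballI impI)
      fix A' B' :: "('a \<Rightarrow> 'a, 'a \<Rightarrow> 'm) module"
      assume AB': "A' \<in> add_cat Gm (HP Y)" "B' \<in> add_cat Gm (HP Y)"
        and st: "stab Gm ((syzygy Gm ^^ Suc s) A') ((syzygy Gm ^^ Suc s) B')"
      obtain A :: "('a, 'm) module" where A: "A \<in> add_cat R Y" "mod_iso Gm A' (HP A)" by (rule HP_dense[OF Y AB'(1)])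
      obtain B :: "('a, 'm) module" where B: "B \<in> add_cat R Y" "mod_iso Gm B' (HP B)" by (rule HP_dense[OF Y AB'(2)])
      have P: "A \<in> Pinf" "B \<in> Pinf" using A(1) B(1) add_P_inf[OF _ Y] by blast+
      have f: "A' \<in> fgmod Gm" "B' \<in> fgmod Gm" using AB' by (auto simp: add_cat_def)
      note c = G.stab_syzygy_pow_cong[OF f HP_fgmod[OF P_infD(1)[OF P(1)]] HP_fgmod[OF P_infD(1)[OF P(2)]] A(2) B(2)]
      show "stab Gm ((syzygy Gm ^^ s) A') ((syzygy Gm ^^ s) B')"
        using st S A(1) B(1) unfolding c stab_syzygy_pow_HP[OF P] by blast
    qed
  qed
  then show ?thesis unfolding phi_stab[OF fY] G.phi_stab[OF HP_fgmod[OF fY]] by presburger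
qed

lemma summand_HP:
  assumes X: "X \<in> Pinf" and Z: "Z \<in> Pinf"
  shows "summand Gm (HP X) (HP Z) \<longleftrightarrow> summand R X Z"
proof -
  note l = P_infD(2)[OF X] P_infD(2)[OF Z]
  note h = HP_lm[OF l(1)] HP_lm[OF l(2)]
  have "\<exists>i r. retract R X Z i r" if ir: "retract Gm (HP X) (HP Z) \<iota> \<rho>" for \<iota> \<rho>
  proof -
    have \<iota>: "lhom Gm (HP X) (HP Z) \<iota>" "lhom Gm (HP Z) (HP X) \<rho>" "\<And>u. u \<in> mod_hom R P X \<Longrightarrow> \<rho> (\<iota> u) = u"
      using ir by (auto simp: retract_def)
    obtain i where i: "lhom R X Z i" "\<And>u. u \<in> mod_hom R P X \<Longrightarrow> \<iota> u = Hm i u" by (rule Hm_full[OF X l(2) \<iota>(1)]) (rule that)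
    obtain r where r: "lhom R Z X r" "\<And>u. u \<in> mod_hom R P Z \<Longrightarrow> \<rho> u = Hm r u" by (rule Hm_full[OF Z l(1) \<iota>(2)]) (rule that)
    have "r (i x) = x" if "x \<in> carrier X" for x
    proof (rule Hm_faithful[OF X l(1) lhom_comp[OF i(1) r(1)] lhom_id _ that])
      fix u assume u: "u \<in> mod_hom R P X"
      show "Hm (\<lambda>x. r (i x)) u = Hm (\<lambda>x. x) u"
        using \<iota>(3)[OF u] i(2)[OF u] r(2)[OF Hm_closed[OF i(1) u]] by (simp add: Hm_id[OF u] Hm_comp[OF u i(1) r(1)])
    qed
    then show ?thesis using i(1) r(1) unfolding retract_def by blast
  qed
  then show ?thesis
    using HP_retract[OF l] unfolding summand_iff_retract[OF l] summand_iff_retract[OF h] by blast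
qed

lemma proj_dim_HP:
  assumes X: "X \<in> Pinf"
  shows "proj_dim Gm (HP X) = proj_dim R X"
proof -
  note f = P_infD(1)[OF X] HP_fgmod[OF P_infD(1)[OF X]]
  have "projective Gm ((syzygy Gm ^^ n) (HP X)) \<longleftrightarrow> projective R ((syzygy R ^^ n) X)" for n
    using projective_iso[OF HP_syzygy_pow[OF X, of n] HP_lm[OF P_infD(2)[OF syzygy_pow_P_inf[OF X]]]
      fgmodD[OF G.syzygy_pow_fgmod[OF f(2)]]] projective_HP_iff[OF syzygy_pow_P_inf[OF X, of n]] by simp
  then show ?thesis unfolding proj_dim_eq[OF f(1)] G.proj_dim_eq[OF f(2)] by simp
qed

text \<open>\<open>M\<close> stands for a syzygy chosen over \<open>Gm\<close>, which is only
  isomorphic to \<open>HP Z\<close>. Its summands are, up to isomorphism, the images of the summands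
  of \<open>Z\<close>, and projective dimension is preserved; so the suprema in \<open>psi\<close>
  are taken over equal sets.\<close>

lemma summand_proj_dims:
  assumes Z: "Z \<in> Pinf" and M: "left_module Gm M" "mod_iso Gm (HP Z) M"
  shows "{proj_dim Gm X | X :: ('a \<Rightarrow> 'a, 'a \<Rightarrow> 'm) module. X \<in> fgmod Gm \<and> summand Gm X M \<and> proj_dim Gm X < \<infinity>} =
    {proj_dim R X | X :: ('a, 'm) module. X \<in> fgmod R \<and> summand R X Z \<and> proj_dim R X < \<infinity>}" (is "?A = ?B")
proof -
  note lZ = P_infD(2)[OF Z]
  note hZ = HP_lm[OF lZ]
  obtain i r where ir: "retract Gm (HP Z) M i r" "retract Gm M (HP Z) r i" by (rule iso_retract[OF M(2) hZ M(1)])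
  have sM: "summand Gm X M \<longleftrightarrow> summand Gm X (HP Z)" if "left_module Gm X" for X :: "('a \<Rightarrow> 'a, 'a \<Rightarrow> 'm) module"
    unfolding summand_iff_retract[OF that M(1)] summand_iff_retract[OF that hZ]
    using retract_trans[OF _ ir(1)] retract_trans[OF _ ir(2)] by blast
  show ?thesis
  proof
    show "?A \<subseteq> ?B"
    proof
      fix n assume "n \<in> ?A"
      then obtain N :: "('a \<Rightarrow> 'a, 'a \<Rightarrow> 'm) module" where N: "n = proj_dim Gm N" "N \<in> fgmod Gm" "summand Gm N M" "proj_dim Gm N < \<infinity>"
        unfolding mem_Collect_eq by (elim exE conjE)
      note lN = fgmodD[OF N(2)]
      obtain j s where js: "retract Gm N (HP Z) j s" using N(3) unfolding sM[OF lN] summand_iff_retract[OF lN hZ] by blast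
      obtain X :: "('a, 'm) module" where X: "X \<in> add_cat R Z" "mod_iso Gm N (HP X)"
        by (rule HP_dense[OF Z add_cat_retract[OF js N(2) hZ]])
      have PX: "X \<in> Pinf" by (rule add_P_inf[OF X(1) Z])
      note f = P_infD(1)[OF PX] HP_fgmod[OF P_infD(1)[OF PX]]
      obtain j' s' where "retract Gm (HP X) N j' s'" by (rule iso_retract[OF X(2) lN fgmodD[OF f(2)]])
      then have "summand Gm (HP X) (HP Z)" using retract_trans[OF _ js] summand_iff_retract[OF fgmodD[OF f(2)] hZ] by blast
      moreover have "proj_dim R X = n" using G.proj_dim_iso[OF N(2) f(2) X(2)] proj_dim_HP[OF PX] N(1) by simp
      ultimately have "n = proj_dim R X \<and> X \<in> fgmod R \<and> summand R X Z \<and> proj_dim R X < \<infinity>"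
        using N(1,4) f(1) summand_HP[OF PX Z] by simp
      then show "n \<in> ?B" by (intro CollectI exI[of _ X])
    qed
    show "?B \<subseteq> ?A"
    proof
      fix n assume "n \<in> ?B"
      then obtain X :: "('a, 'm) module" where X: "n = proj_dim R X" "X \<in> fgmod R" "summand R X Z" "proj_dim R X < \<infinity>"
        unfolding mem_Collect_eq by (elim exE conjE)
      obtain j s where "retract R X Z j s" using X(3) unfolding summand_iff_retract[OF fgmodD[OF X(2)] lZ] by blast
      then have PX: "X \<in> Pinf" by (rule add_P_inf[OF add_cat_retract[OF _ X(2) lZ] Z])
      have "summand Gm (HP X) M" using X(3) summand_HP[OF PX Z] sM[OF HP_lm[OF fgmodD[OF X(2)]]] by blast
      moreover have "proj_dim Gm (HP X) = n" using proj_dim_HP[OF PX] X(1) by simp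
      ultimately have "n = proj_dim Gm (HP X) \<and> HP X \<in> fgmod Gm \<and> summand Gm (HP X) M \<and> proj_dim Gm (HP X) < \<infinity>"
        using X(1,4) HP_fgmod[OF X(2)] by simp
      then show "n \<in> ?A" by (intro CollectI exI[of _ "HP X"])
    qed
  qed
qed

theorem psi_HP:
  assumes Y: "Y \<in> Pinf"
  shows "psi Gm (HP Y) = psi R Y"
  unfolding psi_def phi_HP[OF Y]
    summand_proj_dims[OF syzygy_pow_P_inf[OF Y] fgmodD[OF G.syzygy_pow_fgmod[OF HP_fgmod[OF P_infD(1)[OF Y]]]] HP_syzygy_pow[OF Y]] ..

end

theorem proposition4p5:
  fixes k :: "('k, 'x) ring_scheme"
    and \<Lambda> :: "('k, 'a) module"
    and e :: 'a
    and P :: "('a, 'a) module"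
    and \<Gamma> :: "('a \<Rightarrow> 'a) ring"
    and Y :: "('a, 'm) module"
  assumes "artin_algebra k \<Lambda>"
    and "module_universe \<Lambda> TYPE('m)"
    and "e \<in> carrier \<Lambda>" and "e \<otimes>\<^bsub>\<Lambda>\<^esub> e = e"
    and "P = left_ideal_module \<Lambda> e"
    and "\<Gamma> = opposite_ring (End_ring \<Lambda> P)"
    and "Y \<in> P_inf \<Lambda> P"
  shows "(\<forall>d::nat. (\<exists>U V. d_division \<Lambda> d Y U V)
            \<longleftrightarrow> (\<exists>U V. d_division \<Gamma> d (hom_module \<Lambda> P Y) U V))
       \<and> phi \<Lambda> Y = phi \<Gamma> (hom_module \<Lambda> P Y)
       \<and> psi \<Lambda> Y = psi \<Gamma> (hom_module \<Lambda> P Y)"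
proof -
  interpret corner \<Lambda> "TYPE('m)" e
    using assms(2-4) artin_algebra_flen[OF assms(1)] by (intro corner.intro good_ring.intro corner_axioms.intro)
  have P: "P = left_ideal_module \<Lambda> e" and \<Gamma>: "\<Gamma> = Gm"
    using assms(5,6) by (simp_all add: Gm_def)
  have Y: "Y \<in> P_inf \<Lambda> (left_ideal_module \<Lambda> e)" using assms(7) P by simp
  show ?thesis unfolding \<Gamma> P using d_division_iff[OF Y] phi_HP[OF Y] psi_HP[OF Y] by simp
qed

end
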